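(* Let $\mu_0$ be a probability distribution on $\mathbb{R}_+=[0,\infty)$, and let $(\bar\mu_t)_{t\ge 0}$ be the family of laws obtained from the tree-painting scheme with initial law $\mu_0$. (i) There exists a unique strong solution $(X_t)_{t\ge 0}$, with $X_0$ of law $\mu_0$, to the McKean--Vlasov type equation $$X_t = X_0 - \int_0^t \mathbf 1_{\{X_s>0\}}\,ds + \int_0^t\int_{[0,1]} F_s^{-1}(u)\,N(ds,du),\qquad F_t(x)=\mathbb{P}(X_t\le x)\quad (x\ge 0,\ t\ge 0).$$ Moreover, for all $t\ge 0$, $X_t$ has law $\bar\mu_t$. (ii) The family $(\bar\mu_t)_{t\ge0}$ is the unique weak solution, with initial condition $\mu_0$, of the partial differential equation $$\partial_t\mu_t=\partial_x(\mathbf 1_{\{x>0\}}\mu_t)+\mu_t*\mu_t-\mu_t .$$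
   Context: SDE. $N$ is a Poisson point process on $\mathbb{R}_+\times[0,1]$ with intensity $ds\,du$, independent of $X_0$, and $F_s^{-1}(u)=\inf\{x\ge 0: F_s(x)>u\}$ is the right-continuous inverse of $F_s$. Weak solution. A weak solution of the PDE is a weakly continuous family $(\mu_t)_{t\ge0}$ of probability distributions on $\mathbb{R}$ such that for every bounded $\mathcal C^1$ function $f$ with bounded derivative and every $t>0$, $$\int_{\mathbb{R}} f\,d\mu_t-\int_{\mathbb{R}} f\,d\mu_0=\int_0^t\Big(-\int_{\mathbb{R}}\big(f'(x)\mathbf 1_{\{x>0\}}+f(x)\big)\mu_s(dx)+\int_{\mathbb{R}^2}f(x+y)\mu_s(dx)\mu_s(dy)\Big)ds .$$ Tree-painting scheme. Let $\mathbb{T}=\bigcup_{n\ge0}\{1,2\}^n$ be the set of finite words on $\{1,2\}$, with $\varnothing$ the empty word, $|u|$ the length of $u$, and $u_k$ the prefix of $u$ of length $k$; $u1,u2$ are the children of $u$. Let $(e_u)_{u\in\mathbb{T}}$ be i.i.d. exponential variables of parameter $1$, $b_u=\sum_{k<|u|}e_{u_k}$ (so $b_\varnothing=0$), $d_u=b_u+e_u$, and $\mathcal N_s=\{u\in\mathbb{T}: b_u\le s<d_u\}$ (Yule tree). Fix $t>0$. Conditionally on the Yule tree, let $(X^t_t(u))_{u\in\mathcal N_t}$ be i.i.d. of law $\mu_0$. For $u\in\mathcal N_t$ and $s\in[b_u,t]$ put $X^t_s(u)=(X^t_t(u)-(t-s))_+$. Recursively from the leaves to the root, for $v\in\mathbb{T}$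 with $d_v\le t$ and $s\in[b_v,d_v)$, put $X^t_s(v)=\big(X^t_{d_v}(v1)+X^t_{d_v}(v2)-(d_v-s)\big)_+$ (recall $b_{v1}=b_{v2}=d_v$). Then $\bar\mu_t$ denotes the law of $X^t_0(\varnothing)$, and $\bar\mu_0=\mu_0$. *)

theory Defs
  imports "HOL-Probability.Probability"
begin

section \<open>Tree-painting scheme\<close>

text \<open>A word on the alphabet {1,2} is a list of booleans: the letter 1 is \<^const>\<open>False\<close>, the
  letter 2 is \<^const>\<open>True\<close>, and the prefix of length k of u is \<^term>\<open>take k u\<close>.\<close>

type_synonym word = "bool list"

definition birth :: "(word \<Rightarrow> real) \<Rightarrow> word \<Rightarrow> real" where
  "birth e u = (\<Sum>k<length u. e (take k u))"

definition death :: "(word \<Rightarrow> real) \<Rightarrow> word \<Rightarrow> real" where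
  "death e u = birth e u + e u"

definition alive :: "(word \<Rightarrow> real) \<Rightarrow> real \<Rightarrow> word set" where
  "alive e s = {u. birth e u \<le> s \<and> s < death e u}"

text \<open>\<^term>\<open>painted e \<xi> t u s x\<close> says that the recursion from the leaves to the root, with
  lifetimes \<open>e\<close> and colour \<open>\<xi> u\<close> at time \<open>t\<close> on each \<open>u \<in> alive e t\<close>, assigns to the individual
  \<open>u\<close> at time \<open>s\<close> the value \<open>x\<close>. It is a relation because the recursion is well-founded only
  when the tree of individuals born before \<open>t\<close> is finite, which holds almost surely.\<close>

inductive painted ::
  "(word \<Rightarrow> real) \<Rightarrow> (word \<Rightarrow> real) \<Rightarrow> real \<Rightarrow> word \<Rightarrow> real \<Rightarrow> real \<Rightarrow> bool"
  for e \<xi> :: "word \<Rightarrow> real" and t :: real where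
  leaf: "\<lbrakk>u \<in> alive e t; birth e u \<le> s; s \<le> t\<rbrakk> \<Longrightarrow> painted e \<xi> t u s (max 0 (\<xi> u - (t - s)))"
| node: "\<lbrakk>death e v \<le> t; birth e v \<le> s; s < death e v;
          painted e \<xi> t (v @ [False]) (death e v) x; painted e \<xi> t (v @ [True]) (death e v) y\<rbrakk>
         \<Longrightarrow> painted e \<xi> t v s (max 0 (x + y - (death e v - s)))"

definition root_value :: "(word \<Rightarrow> real) \<Rightarrow> (word \<Rightarrow> real) \<Rightarrow> real \<Rightarrow> real" where
  "root_value e \<xi> t = (THE x. painted e \<xi> t [] 0 x)"

text \<open>The colours of the leaves, i.i.d. of law \<open>\<mu>\<^sub>0\<close> given the tree, are realised by attaching to
  all words i.i.d. variables of law \<open>\<mu>\<^sub>0\<close> independent of the lifetimes.\<close>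

definition painting_space :: "real measure \<Rightarrow> ((word \<Rightarrow> real) \<times> (word \<Rightarrow> real)) measure" where
  "painting_space \<mu>\<^sub>0 =
     (\<Pi>\<^sub>M u\<in>UNIV. density lborel (exponential_density 1)) \<Otimes>\<^sub>M (\<Pi>\<^sub>M u\<in>UNIV. \<mu>\<^sub>0)"

definition painting_law :: "real measure \<Rightarrow> real \<Rightarrow> real measure" where
  "painting_law \<mu>\<^sub>0 t =
     (if t = 0 then \<mu>\<^sub>0
      else distr (painting_space \<mu>\<^sub>0) borel (\<lambda>(e, \<xi>). root_value e \<xi> t))"

section \<open>Poisson point processes\<close>

text \<open>A point process on the measurable space of \<open>\<nu>\<close> is a random measure with values in
  the natural numbers and \<open>\<infinity>\<close>.\<close>

definition point_process :: "'a measure \<Rightarrow> 'b measure \<Rightarrow> ('a \<Rightarrow> 'b measure) \<Rightarrow> bool" where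
  "point_process M \<nu> N \<longleftrightarrow>
     (\<forall>\<omega>\<in>space M. sets (N \<omega>) = sets \<nu> \<and>
        (\<forall>A\<in>sets \<nu>. emeasure (N \<omega>) A \<in> insert \<infinity> (range of_nat))) \<and>
     (\<forall>A\<in>sets \<nu>. (\<lambda>\<omega>. emeasure (N \<omega>) A) \<in> borel_measurable M)"

definition poisson_point_process :: "'a measure \<Rightarrow> 'b measure \<Rightarrow> ('a \<Rightarrow> 'b measure) \<Rightarrow> bool" where
  "poisson_point_process M \<nu> N \<longleftrightarrow>
     point_process M \<nu> N \<and>
     (\<forall>A\<in>sets \<nu>. emeasure \<nu> A < \<infinity> \<longrightarrow>
        (\<forall>k::nat. measure M {\<omega>\<in>space M. emeasure (N \<omega>) A = of_nat k} =
           exp (- measure \<nu> A) * measure \<nu> A ^ k / fact k)) \<and>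
     (\<forall>(A :: nat \<Rightarrow> 'b set) n. A ` {..<n} \<subseteq> sets \<nu> \<longrightarrow> disjoint_family_on A {..<n} \<longrightarrow>
        prob_space.indep_vars M (\<lambda>_. borel) (\<lambda>i \<omega>. emeasure (N \<omega>) (A i)) {..<n})"

definition counting_events ::
  "'a measure \<Rightarrow> 'b measure \<Rightarrow> ('a \<Rightarrow> 'b measure) \<Rightarrow> 'b set \<Rightarrow> 'a set set" where
  "counting_events M \<nu> N S =
     {{\<omega>\<in>space M. emeasure (N \<omega>) A \<in> B} | A B. A \<in> sets \<nu> \<and> A \<subseteq> S \<and> B \<in> sets borel}"

section \<open>The McKean--Vlasov equation\<close>

definition strip_intensity :: "(real \<times> real) measure" where
  "strip_intensity = restrict_space lborel ({0..} \<times> {0..1})"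

definition driving_data ::
  "real measure \<Rightarrow> 'a measure \<Rightarrow> ('a \<Rightarrow> real) \<Rightarrow> ('a \<Rightarrow> (real \<times> real) measure) \<Rightarrow> bool" where
  "driving_data \<mu>\<^sub>0 M X\<^sub>0 N \<longleftrightarrow>
     prob_space M \<and> X\<^sub>0 \<in> borel_measurable M \<and> distr M borel X\<^sub>0 = \<mu>\<^sub>0 \<and>
     poisson_point_process M strip_intensity N \<and>
     prob_space.indep_set M {X\<^sub>0 -` B \<inter> space M | B. B \<in> sets borel}
       (sigma_sets (space M) (counting_events M strip_intensity N UNIV))"

text \<open>The filtration generated by \<open>X\<^sub>0\<close> and \<open>N\<close>, augmented by the null sets.\<close>

definition driving_filtration ::
  "'a measure \<Rightarrow> ('a \<Rightarrow> real) \<Rightarrow> ('a \<Rightarrow> (real \<times> real) measure) \<Rightarrow> real \<Rightarrow> 'a measure" where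
  "driving_filtration M X\<^sub>0 N t =
     sigma (space M)
       ({X\<^sub>0 -` B \<inter> space M | B. B \<in> sets borel} \<union>
        counting_events M strip_intensity N ({0..t} \<times> {0..1}) \<union> null_sets M)"

text \<open>The inverse is \<open>\<infinity>\<close> when the set is empty, which is why it is extended-valued.\<close>

definition right_inverse :: "(real \<Rightarrow> real) \<Rightarrow> real \<Rightarrow> ennreal" where
  "right_inverse F u = (INF x\<in>{x. 0 \<le> x \<and> F x > u}. ennreal x)"

definition cadlag :: "(real \<Rightarrow> real) \<Rightarrow> bool" where
  "cadlag x \<longleftrightarrow>
     (\<forall>t\<ge>0. (x \<longlongrightarrow> x t) (at_right t)) \<and> (\<forall>t>0. \<exists>l. (x \<longlongrightarrow> l) (at_left t))"

text \<open>The equation is stated in the extended reals, so that it includes the finiteness of the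
  integral against \<open>N\<close>. Only the times \<open>t \<ge> 0\<close> matter.\<close>

definition strong_solution ::
  "'a measure \<Rightarrow> ('a \<Rightarrow> real) \<Rightarrow> ('a \<Rightarrow> (real \<times> real) measure) \<Rightarrow> (real \<Rightarrow> 'a \<Rightarrow> real) \<Rightarrow> bool"
  where
  "strong_solution M X\<^sub>0 N X \<longleftrightarrow>
     (\<forall>t\<ge>0. X t \<in> borel_measurable (driving_filtration M X\<^sub>0 N t)) \<and>
     (AE \<omega> in M. cadlag (\<lambda>t. X t \<omega>)) \<and>
     (AE \<omega> in M. \<forall>t\<ge>0.
        ereal (X t \<omega>) =
          ereal (X\<^sub>0 \<omega> - (LBINT s:{0..t}. indicator {0<..} (X s \<omega>))) +
          enn2ereal (\<integral>\<^sup>+(s, u)\<in>{0..t} \<times> {0..1}.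
            right_inverse (cdf (distr M borel (X s))) u \<partial>N \<omega>))"

definition indistinguishable ::
  "'a measure \<Rightarrow> (real \<Rightarrow> 'a \<Rightarrow> real) \<Rightarrow> (real \<Rightarrow> 'a \<Rightarrow> real) \<Rightarrow> bool" where
  "indistinguishable M X Y \<longleftrightarrow> (AE \<omega> in M. \<forall>t\<ge>0. X t \<omega> = Y t \<omega>)"

section \<open>Weak solutions of the partial differential equation\<close>

text \<open>Families are indexed by all reals, but only the indices \<open>t \<ge> 0\<close> matter.\<close>

definition weakly_continuous :: "(real \<Rightarrow> real measure) \<Rightarrow> bool" where
  "weakly_continuous \<mu> \<longleftrightarrow>
     (\<forall>f :: real \<Rightarrow> real. continuous_on UNIV f \<longrightarrow> bounded (range f) \<longrightarrow>
        continuous_on {0..} (\<lambda>t. \<integral>x. f x \<partial>\<mu> t))"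

definition weak_solution :: "(real \<Rightarrow> real measure) \<Rightarrow> bool" where
  "weak_solution \<mu> \<longleftrightarrow>
     (\<forall>t\<ge>0. real_distribution (\<mu> t)) \<and> weakly_continuous \<mu> \<and>
     (\<forall>f f' :: real \<Rightarrow> real.
        (\<forall>x. (f has_real_derivative f' x) (at x)) \<longrightarrow> continuous_on UNIV f' \<longrightarrow>
        bounded (range f) \<longrightarrow> bounded (range f') \<longrightarrow>
        (\<forall>t>0. (\<integral>x. f x \<partial>\<mu> t) - (\<integral>x. f x \<partial>\<mu> 0) =
           (LBINT s:{0..t}.
              - (\<integral>x. f' x * indicator {0<..} x + f x \<partial>\<mu> s)
              + (\<integral>(x, y). f (x + y) \<partial>(\<mu> s \<Otimes>\<^sub>M \<mu> s)))))"

end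

theory Submission
  imports Defs
begin

text \<open>Decomposing the Yule tree at its first branching shows that the painting law solves the
  equation in Duhamel form, hence weakly. Conversely a weak solution, tested against smooth
  approximations of indicators of half-lines moving along the characteristics of the drift, satisfies
  a mild equation for its distribution functions; the mild equation is Lipschitz in the uniform norm,
  so Gronwall's argument gives uniqueness.

  For fixed jump laws the stochastic equation is solved pathwise by Skorokhod reflection, uniquely
  because the drift is nonincreasing in the state. The indicator that the path lies below a
  characteristic changes only at jumps; the compensation formula for the Poisson process thus turns
  the equation into the mild equation for the law of the solution. Taking the painting law as jump
  law, the law of the solution must be the painting law, which gives existence, and the same equation
  identifies the law of any other solution, which gives pathwise uniqueness.\<close>

section \<open>The painting recursion\<close>

text \<open>The equation is nonlinear, but linear once the jump laws are frozen; the mild equation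
  is therefore kept for a pair of families, and no fixed point on path space is needed. Distribution
  functions are convenient unknowns: along a characteristic the drift merely shifts the barrier, and
  convolution with a probability law does not expand the uniform distance. Iterating the weak form
  directly fails, since f' 1_{x>0} is in general discontinuous and so no admissible test function.
  On the analytic side a weak solution may charge the negative half-line, where the drift vanishes;
  barriers below 0 thus obey a different rule than barriers above it. On the probabilistic side the
  path jumps exactly at the points of \<open>N\<close>, so a compensated integrand must look at the
  path strictly before the jump. This is why a predictable sigma-algebra is built: the state after a
  jump is the left limit plus a deterministic function of time and mark.\<close>

definition subtree :: "word \<Rightarrow> (word \<Rightarrow> real) \<Rightarrow> word \<Rightarrow> real" where
  "subtree v e w = e (v @ w)"

text \<open>Fuel \<open>n\<close> bounds the number of generations born up to time \<open>t\<close>;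
  this makes an a priori ill-founded recursion primitive. Time is counted from the birth of the
  root, so a subtree is examined with the remaining time \<open>t - e []\<close>. The conditions
  \<open>0 \<le> t\<close> and \<open>0 < e []\<close> are what the rules of \<open>painted\<close>
  demand when read at the time of birth.\<close>

primrec shallow :: "nat \<Rightarrow> (word \<Rightarrow> real) \<Rightarrow> real \<Rightarrow> bool" where
  "shallow 0 e t \<longleftrightarrow> False"
| "shallow (Suc n) e t \<longleftrightarrow> 0 \<le> t \<and> t < e [] \<or>
     0 < e [] \<and> e [] \<le> t \<and> shallow n (subtree [False] e) (t - e []) \<and>
     shallow n (subtree [True] e) (t - e [])"

text \<open>The value at fuel 0 is a placeholder, never reached where \<open>shallow\<close> holds
  with the same fuel.\<close>

primrec depth_value :: "nat \<Rightarrow> (word \<Rightarrow> real) \<Rightarrow> (word \<Rightarrow> real) \<Rightarrow> real \<Rightarrow> real" where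
  "depth_value 0 e \<xi> t = 0"
| "depth_value (Suc n) e \<xi> t =
     (if t < e [] then max 0 (\<xi> [] - t)
      else max 0 (depth_value n (subtree [False] e) (subtree [False] \<xi>) (t - e []) +
                  depth_value n (subtree [True] e) (subtree [True] \<xi>) (t - e []) - e []))"

definition finite_tree :: "(word \<Rightarrow> real) \<Rightarrow> real \<Rightarrow> bool" where
  "finite_tree e t \<longleftrightarrow> (\<exists>n. shallow n e t)"

lemma shallow_Suc:
  "shallow n e t \<Longrightarrow> shallow (Suc n) e t \<and> depth_value (Suc n) e \<xi> t = depth_value n e \<xi> t"
proof (induction n arbitrary: e \<xi> t)
  case (Suc n)
  show ?case
    using Suc.prems Suc.IH[of "subtree [False] e" "t - e []" "subtree [False] \<xi>"]
      Suc.IH[of "subtree [True] e" "t - e []" "subtree [True] \<xi>"]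
    by (simp only: shallow.simps(2) depth_value.simps(2)) auto
qed simp

lemma shallow_mono:
  assumes "shallow m e t" "m \<le> n"
  shows "shallow n e t" "depth_value n e \<xi> t = depth_value m e \<xi> t"
proof -
  have "shallow n e t \<and> depth_value n e \<xi> t = depth_value m e \<xi> t"
    using assms(2) by (induction n rule: dec_induct) (use assms(1) shallow_Suc in auto)
  then show "shallow n e t" "depth_value n e \<xi> t = depth_value m e \<xi> t" by auto
qed

lemma subtree_simps [simp]:
  "subtree [] e = e" "subtree w (subtree v e) = subtree (v @ w) e" "subtree v e [] = e v"
  by (auto simp: subtree_def fun_eq_iff)

lemma birth_snoc: "birth e (v @ [b]) = death e v"
  by (simp add: birth_def death_def)

text \<open>A node reads its children only at \<open>death e v\<close>, their common birth time, so
  the values at births form a closed recursion. Cutting off the prefix \<open>v\<close> and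
  subtracting \<open>birth e v\<close> turns it into the recursion of \<open>depth_value\<close> on
  the shifted tree.\<close>

lemma painted_at_birth_iff:
  "painted e \<xi> t v (birth e v) x \<longleftrightarrow>
     (\<exists>n. shallow n (subtree v e) (t - birth e v) \<and>
          x = depth_value n (subtree v e) (subtree v \<xi>) (t - birth e v))"
proof
  \<comment> \<open>The rules read an individual at any time of its life, so \<open>s\<close> stays
    free in the rule induction and the equation with the birth time is carried as a premise.\<close>
  have "s = birth e v \<Longrightarrow> \<exists>n. shallow n (subtree v e) (t - birth e v) \<and>
          x = depth_value n (subtree v e) (subtree v \<xi>) (t - birth e v)"
    if "painted e \<xi> t v s x" for s
    using that
  proof (induction rule: painted.induct)
    case (leaf u s)
    then show ?case
      by (intro exI[of _ 1]) (auto simp: alive_def death_def)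
  next
    case (node v s x y)
    from node obtain m n
      where m: "shallow m (subtree (v @ [False]) e) (t - death e v)"
          "x = depth_value m (subtree (v @ [False]) e) (subtree (v @ [False]) \<xi>) (t - death e v)"
        and n: "shallow n (subtree (v @ [True]) e) (t - death e v)"
          "y = depth_value n (subtree (v @ [True]) e) (subtree (v @ [True]) \<xi>) (t - death e v)"
      by (auto simp: birth_snoc)
    have *: "death e v - birth e v = e v" by (simp add: death_def)
    from node have "0 < e v" by (simp add: death_def)
    with node m n shallow_mono(1)[OF m(1), of "max m n"] shallow_mono(1)[OF n(1), of "max m n"]
      shallow_mono(2)[OF m(1), of "max m n"] shallow_mono(2)[OF n(1), of "max m n"]
    show ?case
      by (intro exI[of _ "Suc (max m n)"]) (auto simp: death_def algebra_simps)
  qed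
  then show "painted e \<xi> t v (birth e v) x \<Longrightarrow> \<exists>n. shallow n (subtree v e) (t - birth e v) \<and>
          x = depth_value n (subtree v e) (subtree v \<xi>) (t - birth e v)"
    by blast
next
  have "painted e \<xi> t v (birth e v) (depth_value n (subtree v e) (subtree v \<xi>) (t - birth e v))"
    if "shallow n (subtree v e) (t - birth e v)" for n
    using that
  proof (induction n arbitrary: v)
    case (Suc n)
    show ?case
    proof (cases "t - birth e v < e v")
      case True
      with Suc.prems have "v \<in> alive e t" "birth e v \<le> t"
        by (auto simp: alive_def death_def)
      from painted.leaf[OF this(1) order_refl this(2), of \<xi>] True show ?thesis by simp
    next
      case False
      have d: "t - birth e v - e v = t - death e v" by (simp add: death_def)
      from Suc.prems False have sh: "0 < e v" "e v \<le> t - birth e v"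
        "shallow n (subtree (v @ [False]) e) (t - death e v)"
        "shallow n (subtree (v @ [True]) e) (t - death e v)"
        by (auto simp: d)
      have "painted e \<xi> t v (birth e v)
         (max 0 (depth_value n (subtree (v @ [False]) e) (subtree (v @ [False]) \<xi>) (t - death e v) +
           depth_value n (subtree (v @ [True]) e) (subtree (v @ [True]) \<xi>) (t - death e v)
           - (death e v - birth e v)))"
        using Suc.IH[of "v @ [False]"] Suc.IH[of "v @ [True]"] sh
        by (intro painted.node) (auto simp: birth_snoc death_def)
      with False show ?thesis by (simp add: death_def algebra_simps)
    qed
  qed simp
  then show "\<exists>n. shallow n (subtree v e) (t - birth e v) \<and>
      x = depth_value n (subtree v e) (subtree v \<xi>) (t - birth e v) \<Longrightarrow>
    painted e \<xi> t v (birth e v) x" by blast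
qed

lemma painted_root_iff:
  "painted e \<xi> t [] 0 x \<longleftrightarrow> (\<exists>n. shallow n e t \<and> x = depth_value n e \<xi> t)"
  using painted_at_birth_iff[of e \<xi> t "[]" x] by (simp add: birth_def)

lemma root_value_shallow:
  assumes "shallow n e t" shows "root_value e \<xi> t = depth_value n e \<xi> t"
  unfolding root_value_def painted_root_iff
proof (rule the_equality)
  fix x assume "\<exists>n. shallow n e t \<and> x = depth_value n e \<xi> t"
  then obtain m where "shallow m e t" "x = depth_value m e \<xi> t" by blast
  with assms shallow_mono(2)[of m e t "max m n" \<xi>] shallow_mono(2)[of n e t "max m n" \<xi>]
  show "x = depth_value n e \<xi> t" by simp
qed (use assms in blast)

lemma root_value_not_finite_tree:
  "\<not> finite_tree e t \<Longrightarrow> root_value e \<xi> t = (THE x. False)"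
  by (simp add: root_value_def painted_root_iff finite_tree_def)

text \<open>The least sufficient fuel replaces the definite description by a choice among countably
  many measurable functions. On infinite trees the value is unspecified but constant, hence
  measurable as well.\<close>

lemma root_value_eq:
  "root_value e \<xi> t =
    (if \<exists>n. shallow n e t then depth_value (LEAST n. shallow n e t) e \<xi> t else (THE x. False))"
proof (cases "\<exists>n. shallow n e t")
  case True
  with root_value_shallow[OF LeastI_ex[OF this], of \<xi>] show ?thesis by simp
next
  case False
  with root_value_not_finite_tree[of e t \<xi>] show ?thesis by (simp add: finite_tree_def)
qed

lemma finite_tree_unfold:
  "finite_tree e t \<longleftrightarrow> 0 \<le> t \<and> t < e [] \<or>
     0 < e [] \<and> e [] \<le> t \<and> finite_tree (subtree [False] e) (t - e []) \<and>
     finite_tree (subtree [True] e) (t - e [])" (is "?L \<longleftrightarrow> ?R")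
proof
  assume ?L then obtain n where "shallow n e t" by (auto simp: finite_tree_def)
  then show ?R by (cases n) (auto simp: finite_tree_def)
next
  assume ?R
  moreover have ?L if "0 \<le> t" "t < e []"
    unfolding finite_tree_def by (rule exI[of _ 1]) (use that in simp)
  moreover have ?L if "0 < e []" "e [] \<le> t" "shallow m (subtree [False] e) (t - e [])"
      "shallow n (subtree [True] e) (t - e [])" for m n
    unfolding finite_tree_def
    by (rule exI[of _ "Suc (max m n)"])
       (use that shallow_mono(1)[of m _ _ "max m n"] shallow_mono(1)[of n _ _ "max m n"] in auto)
  ultimately show ?L by (auto simp: finite_tree_def)
qed

lemma root_value_unfold:
  assumes "finite_tree e t"
  shows "root_value e \<xi> t =
    (if t < e [] then max 0 (\<xi> [] - t)
     else max 0 (root_value (subtree [False] e) (subtree [False] \<xi>) (t - e []) +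
                 root_value (subtree [True] e) (subtree [True] \<xi>) (t - e []) - e []))"
proof -
  from assms obtain n where "shallow n e t" by (auto simp: finite_tree_def)
  then obtain m where m: "shallow (Suc m) e t" by (cases n) auto
  from m show ?thesis
    unfolding root_value_shallow[OF m, of \<xi>] by (auto simp: root_value_shallow)
qed

section \<open>Measurability of the painting recursion\<close>

abbreviation word_borel :: "(word \<Rightarrow> real) measure" where
  "word_borel \<equiv> \<Pi>\<^sub>M u\<in>UNIV. borel"

lemma measurable_word_component [measurable (raw)]:
  assumes "f \<in> M \<rightarrow>\<^sub>M word_borel" shows "(\<lambda>x. f x v) \<in> borel_measurable M"
  by (rule measurable_compose[OF assms]) (rule measurable_component_singleton, simp)

lemma measurable_word_const [measurable]: "(\<lambda>_. a) \<in> M \<rightarrow>\<^sub>M word_borel"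
  by (simp add: space_PiM)

lemma measurable_subtree [measurable (raw)]:
  assumes "f \<in> M \<rightarrow>\<^sub>M word_borel" shows "(\<lambda>x. subtree v (f x)) \<in> M \<rightarrow>\<^sub>M word_borel"
  by (rule measurable_PiM_single') (use assms in \<open>auto simp: subtree_def\<close>)

lemma measurable_shallow [measurable (raw)]:
  assumes "f \<in> M \<rightarrow>\<^sub>M word_borel" "h \<in> borel_measurable M"
  shows "Measurable.pred M (\<lambda>x. shallow n (f x) (h x))"
  using assms
proof (induction n arbitrary: f h)
  case (Suc n)
  note Suc.prems [measurable]
  have [measurable]: "Measurable.pred M (\<lambda>x. shallow n (subtree [b] (f x)) (h x - f x []))" for b
    by (rule Suc.IH) measurable
  show ?case by simp
qed simp

lemma measurable_depth_value [measurable (raw)]: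
  assumes "f \<in> M \<rightarrow>\<^sub>M word_borel" "g \<in> M \<rightarrow>\<^sub>M word_borel" "h \<in> borel_measurable M"
  shows "(\<lambda>x. depth_value n (f x) (g x) (h x)) \<in> borel_measurable M"
  using assms
proof (induction n arbitrary: f g h)
  case (Suc n)
  note Suc.prems [measurable]
  have [measurable]: "(\<lambda>x. depth_value n (subtree [b] (f x)) (subtree [b] (g x)) (h x - f x []))
      \<in> borel_measurable M" for b
    by (rule Suc.IH) measurable
  show ?case by simp
qed simp

lemma measurable_finite_tree [measurable (raw)]:
  assumes [measurable]: "f \<in> M \<rightarrow>\<^sub>M word_borel" "h \<in> borel_measurable M"
  shows "Measurable.pred M (\<lambda>x. finite_tree (f x) (h x))"
  unfolding finite_tree_def by measurable

lemma measurable_root_value [measurable (raw)]: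
  assumes [measurable]: "f \<in> M \<rightarrow>\<^sub>M word_borel" "g \<in> M \<rightarrow>\<^sub>M word_borel" "h \<in> borel_measurable M"
  shows "(\<lambda>x. root_value (f x) (g x) (h x)) \<in> borel_measurable M"
  unfolding root_value_eq
proof (rule measurable_If)
  show "(\<lambda>x. depth_value (LEAST n. shallow n (f x) (h x)) (f x) (g x) (h x)) \<in> borel_measurable M"
    by (rule measurable_compose_countable[of "\<lambda>n x. depth_value n (f x) (g x) (h x)"
          _ _ "\<lambda>x. LEAST n. shallow n (f x) (h x)"]) measurable
qed measurable

section \<open>Splitting a labelled tree at its root\<close>

definition graft :: "real \<Rightarrow> (word \<Rightarrow> real) \<Rightarrow> (word \<Rightarrow> real) \<Rightarrow> word \<Rightarrow> real" where
  "graft x a b w = (case w of [] \<Rightarrow> x | c # w' \<Rightarrow> if c then b w' else a w')"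

lemma graft_simps [simp]:
  "graft x a b [] = x" "graft x a b (False # w) = a w" "graft x a b (True # w) = b w"
  "subtree [False] (graft x a b) = a" "subtree [True] (graft x a b) = b"
  by (auto simp: graft_def subtree_def fun_eq_iff)

lemma measurable_graft [measurable (raw)]:
  assumes [measurable]: "f \<in> borel_measurable M" "g \<in> M \<rightarrow>\<^sub>M word_borel" "h \<in> M \<rightarrow>\<^sub>M word_borel"
  shows "(\<lambda>x. graft (f x) (g x) (h x)) \<in> M \<rightarrow>\<^sub>M word_borel"
proof (rule measurable_PiM_single')
  show "(\<lambda>x. graft (f x) (g x) (h x) w) \<in> borel_measurable M" for w
    by (cases w) (auto simp: graft_def)
qed auto

text \<open>By their first letter, the words split into the empty word and two copies of the set of
  all words. Independent identically distributed labels therefore split into a root label and two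
  independent labellings of the same law. The product measure is recognised by its values on
  cylinders, whose finite base splits in the same way.\<close>

lemma PiM_words_eq_distr_graft:
  fixes m :: "real measure"
  assumes "prob_space m" and s: "sets m = sets borel"
  defines "P \<equiv> \<Pi>\<^sub>M u\<in>(UNIV :: word set). m"
  shows "P = distr (m \<Otimes>\<^sub>M (P \<Otimes>\<^sub>M P)) P (\<lambda>(x, a, b). graft x a b)"
proof -
  interpret m: prob_space m by fact
  have pps: "product_prob_space (\<lambda>_::word. m)" by standard
  have sP [measurable_cong]: "sets P = sets word_borel" unfolding P_def
    by (intro sets_PiM_cong) (auto simp: s)
  note s [measurable_cong]
  have spm [simp]: "space m = UNIV" using sets_eq_imp_space_eq[OF s] by simp
  have spP [simp]: "space P = UNIV" by (simp add: P_def space_PiM)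
  interpret P: prob_space P unfolding P_def by (intro prob_space_PiM assms)
  interpret PP: pair_prob_space P P ..
  interpret PPP: pair_prob_space m "P \<Otimes>\<^sub>M P" ..
  have meas: "(\<lambda>(x, a, b). graft x a b) \<in> (m \<Otimes>\<^sub>M (P \<Otimes>\<^sub>M P)) \<rightarrow>\<^sub>M P"
    by measurable
  show ?thesis unfolding P_def
  proof (rule product_prob_space.PiM_eq[OF pps, symmetric], unfold P_def[symmetric])
    show "sets (distr (m \<Otimes>\<^sub>M (P \<Otimes>\<^sub>M P)) P (\<lambda>(x, a, b). graft x a b)) = sets P" by simp
  next
    fix J :: "word set" and F
    assume J: "finite J" "J \<subseteq> UNIV" and F: "\<And>j. j \<in> J \<Longrightarrow> F j \<in> sets m"
    define K where "K b = {w. b # w \<in> J}" for b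
    \<comment> \<open>A cylinder that leaves the root unconstrained corresponds to the whole
      line.\<close>
    define F0 where "F0 = (if [] \<in> J then F [] else UNIV)"
    have K: "finite (K b)" for b
      by (rule finite_subset[of _ "tl ` J"]) (force simp: K_def J image_iff)+
    have Pcol: "emeasure P {a. \<forall>w\<in>K b. a w \<in> F (b # w)} = (\<Prod>w\<in>K b. emeasure m (F (b # w)))" for b
      using product_prob_space.emeasure_PiM_Collect[OF pps, where J = "K b" and X = "\<lambda>w. F (b # w)" and I = UNIV] K F by (simp add: P_def K_def space_PiM)
    have mK: "{a. \<forall>w\<in>K b. a w \<in> F (b # w)} \<in> sets P" for b
    proof -
      have "{a \<in> space P. \<forall>w\<in>K b. a w \<in> F (b # w)} \<in> sets P"
        using K F by (intro sets.sets_Collect_finite_All) (auto simp: K_def P_def intro!: sets_Collect_single')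
      then show ?thesis by simp
    qed
    have F0: "F0 \<in> sets m" using F sets.top[of m] by (auto simp: F0_def)
    have J_split: "J = (J \<inter> {[]}) \<union> ((#) False ` K False \<union> (#) True ` K True)"
    proof (intro set_eqI iffI)
      fix w assume "w \<in> J"
      then show "w \<in> (J \<inter> {[]}) \<union> ((#) False ` K False \<union> (#) True ` K True)"
        by (cases w; cases "hd w") (auto simp: K_def)
    qed (auto simp: K_def)
    have "emeasure (distr (m \<Otimes>\<^sub>M (P \<Otimes>\<^sub>M P)) P (\<lambda>(x, a, b). graft x a b)) (prod_emb UNIV (\<lambda>_. m) J (Pi\<^sub>E J F))
      = emeasure (m \<Otimes>\<^sub>M (P \<Otimes>\<^sub>M P)) ((\<lambda>(x, a, b). graft x a b) -` prod_emb UNIV (\<lambda>_. m) J (Pi\<^sub>E J F))"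
      using J F by (subst emeasure_distr[OF meas]) (auto simp: P_def space_pair_measure space_PiM intro!: sets_PiM_I)
    also have "(\<lambda>(x, a, b). graft x a b) -` prod_emb UNIV (\<lambda>_. m) J (Pi\<^sub>E J F) =
      F0 \<times> ({a. \<forall>w\<in>K False. a w \<in> F (False # w)} \<times> {a. \<forall>w\<in>K True. a w \<in> F (True # w)})"
      (is "?A = ?B")
    proof (intro set_eqI)
      fix z :: "real \<times> (word \<Rightarrow> real) \<times> (word \<Rightarrow> real)"
      obtain x a b where z: "z = (x, a, b)" by (cases z)
      have "z \<in> ?A \<longleftrightarrow> (\<forall>j\<in>J. graft x a b j \<in> F j)"
        by (auto simp: z prod_emb_def PiE_def Pi_def)
      also have "\<dots> \<longleftrightarrow> z \<in> ?B"
        by (subst J_split) (auto simp: z F0_def ball_Un)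
      finally show "z \<in> ?A \<longleftrightarrow> z \<in> ?B" .
    qed
    also have "emeasure (m \<Otimes>\<^sub>M (P \<Otimes>\<^sub>M P)) \<dots> =
       emeasure m F0 * ((\<Prod>w\<in>K False. emeasure m (F (False # w))) * (\<Prod>w\<in>K True. emeasure m (F (True # w))))"
      by (subst PP.emeasure_pair_measure_Times, simp add: F0, intro pair_measureI mK,
          subst P.emeasure_pair_measure_Times) (simp_all add: mK Pcol)
    also have "emeasure m F0 = (\<Prod>j\<in>J \<inter> {[]}. emeasure m (F j))"
      using m.emeasure_space_1 by (auto simp: F0_def)
    also have "\<dots> * ((\<Prod>w\<in>K False. emeasure m (F (False # w))) * (\<Prod>w\<in>K True. emeasure m (F (True # w))))
       = (\<Prod>j\<in>J. emeasure m (F j))"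
      using K J by (subst (2) J_split) (subst prod.union_disjoint | auto simp: prod.reindex)+
    finally show "emeasure (distr (m \<Otimes>\<^sub>M (P \<Otimes>\<^sub>M P)) P (\<lambda>(x, a, b). graft x a b)) (prod_emb UNIV (\<lambda>_. m) J (Pi\<^sub>E J F))
      = (\<Prod>j\<in>J. emeasure m (F j))" .
  qed
qed

lemma sets_PiM_words: "sets m = sets borel \<Longrightarrow> sets (\<Pi>\<^sub>M u\<in>(UNIV :: word set). m) = sets word_borel"
  by (intro sets_PiM_cong) auto

lemma nn_integral_PiM_words:
  fixes m :: "real measure"
  assumes m: "prob_space m" and s: "sets m = sets borel"
    and [measurable]: "g \<in> borel_measurable word_borel"
  defines "P \<equiv> \<Pi>\<^sub>M u\<in>(UNIV :: word set). m"
  shows "(\<integral>\<^sup>+e. g e \<partial>P) = (\<integral>\<^sup>+x. \<integral>\<^sup>+a. \<integral>\<^sup>+b. g (graft x a b) \<partial>P \<partial>P \<partial>m)"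
proof -
  have [measurable_cong]: "sets P = sets word_borel"
    using sets_PiM_words[OF s] by (simp add: P_def)
  note s [measurable_cong]
  interpret P: prob_space P unfolding P_def by (intro prob_space_PiM m)
  interpret PP: pair_prob_space P P ..
  have "(\<integral>\<^sup>+e. g e \<partial>P) = (\<integral>\<^sup>+z. (case z of (x, a, b) \<Rightarrow> g (graft x a b)) \<partial>(m \<Otimes>\<^sub>M (P \<Otimes>\<^sub>M P)))"
    by (subst PiM_words_eq_distr_graft[OF m s, folded P_def])
       (subst nn_integral_distr, auto simp: case_prod_beta')
  also have "\<dots> = (\<integral>\<^sup>+x. \<integral>\<^sup>+z. (case z of (a, b) \<Rightarrow> g (graft x a b)) \<partial>(P \<Otimes>\<^sub>M P) \<partial>m)"
    by (subst PP.nn_integral_fst[symmetric]) auto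
  also have "\<dots> = (\<integral>\<^sup>+x. \<integral>\<^sup>+a. \<integral>\<^sup>+b. g (graft x a b) \<partial>P \<partial>P \<partial>m)"
    by (subst P.nn_integral_fst[symmetric]) auto
  finally show ?thesis .
qed

section \<open>Almost sure finiteness of the Yule tree\<close>

abbreviation clock :: "real measure" where
  "clock \<equiv> density lborel (exponential_density 1)"

abbreviation clocks :: "(word \<Rightarrow> real) measure" where
  "clocks \<equiv> \<Pi>\<^sub>M u\<in>UNIV. clock"

lemma prob_space_clock: "prob_space clock"
  by (rule prob_space_exponential_density) simp

lemma prob_space_clocks: "prob_space clocks"
  by (intro prob_space_PiM prob_space_clock)

lemma sets_clocks [measurable_cong]: "sets clocks = sets word_borel"
  by (rule sets_PiM_words) simp

lemma AE_clock_pos: "AE x in clock. 0 < x"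
  by (subst AE_density) (auto simp: exponential_density_def intro: AE_I[of _ _ "{0}"])

lemma nn_integral_clock:
  assumes [measurable]: "g \<in> borel_measurable borel"
  shows "(\<integral>\<^sup>+x. g x \<partial>clock) = (\<integral>\<^sup>+x. ennreal (exp (- x)) * g x * indicator {0..} x \<partial>lborel)"
  by (subst nn_integral_density)
     (auto intro!: nn_integral_cong simp: exponential_density_def split: split_indicator)

text \<open>One iteration of a Gronwall inequality with constant \<open>c\<close>: the n-th term of
  the exponential series is integrated to the next one.\<close>

lemma nn_integral_iterate:
  fixes c t :: real
  assumes "0 \<le> c" "0 \<le> t"
  shows "(\<integral>\<^sup>+x. ennreal (c * ((c * (t - x)) ^ n / fact n)) * indicator {0..t} x \<partial>lborel) =
    ennreal ((c * t) ^ Suc n / fact (Suc n))"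
proof -
  have "(\<integral>\<^sup>+x. ennreal (c * ((c * (t - x)) ^ n / fact n)) * indicator {0..t} x \<partial>lborel) =
    ennreal (- ((c * (t - t)) ^ Suc n / fact (Suc n)) - - ((c * (t - 0)) ^ Suc n / fact (Suc n)))"
  proof (rule nn_integral_FTC_Icc)
    fix x :: real
    have "((\<lambda>x. - ((c * (t - x)) ^ Suc n / fact (Suc n))) has_real_derivative
        - (real (Suc n) * (c * (t - x)) ^ n * (c * (- 1)) / fact (Suc n))) (at x)"
      by (auto intro!: derivative_eq_intros simp del: power_Suc fact_Suc)
    moreover have "- (real (Suc n) * y * (c * (- 1)) / fact (Suc n)) = c * (y / fact n)" for y
      by (simp add: divide_simps)
    ultimately show "((\<lambda>x. - ((c * (t - x)) ^ Suc n / fact (Suc n))) has_real_derivative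
        c * ((c * (t - x)) ^ n / fact n)) (at x)" by (simp only:)
  qed (use assms in auto)
  then show ?thesis by (simp del: fact_Suc)
qed

lemma power_over_fact_tendsto_0: "(\<lambda>n. x ^ n / fact n) \<longlonglongrightarrow> (0::real)"
  using summable_LIMSEQ_zero[OF summable_exp_generic[of x]] by (simp add: divide_inverse mult.commute)

text \<open>Let \<open>q t\<close> be the probability that the tree up to time \<open>t\<close> is
  infinite. If the root branches at \<open>x \<le> t\<close>, one of the two subtrees must be
  infinite up to \<open>t - x\<close>; the union bound and the estimate exp(-x) \<open>\<le>\<close>
  1 for the density give q(t) \<open>\<le>\<close> 2 times the integral of q(t - x) over [0, t].
  Iteration from q \<open>\<le>\<close> 1 bounds q(t) by (2t)^n / n!, which tends to 0.\<close>

lemma AE_finite_tree: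
  assumes "0 \<le> t"
  shows "AE e in clocks. finite_tree e t"
proof -
  interpret C: prob_space clocks by (rule prob_space_clocks)
  define B where "B e t = (indicator {e. \<not> finite_tree e t} e :: ennreal)" for e t
  have [measurable (raw)]: "(\<lambda>x. B (f x) (h x)) \<in> borel_measurable M"
    if [measurable]: "f \<in> M \<rightarrow>\<^sub>M word_borel" "h \<in> borel_measurable M" for f h and M :: "'b measure"
    unfolding B_def by (simp add: indicator_def of_bool_def) measurable
  define q where "q t = (\<integral>\<^sup>+e. B e t \<partial>clocks)" for t
  have [measurable]: "q \<in> borel_measurable borel"
    unfolding q_def by measurable
  have q_step: "q t \<le> (\<integral>\<^sup>+x. 2 * q (t - x) * indicator {0..t} x \<partial>lborel)" if "0 \<le> t" for t
  proof -
    have "q t = (\<integral>\<^sup>+x. \<integral>\<^sup>+a. \<integral>\<^sup>+b. B (graft x a b) t \<partial>clocks \<partial>clocks \<partial>clock)"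
      unfolding q_def by (rule nn_integral_PiM_words[OF prob_space_clock]) auto
    also have "\<dots> \<le> (\<integral>\<^sup>+x. 2 * q (t - x) * indicator {0..t} x \<partial>clock)"
    proof (rule nn_integral_mono_AE, use AE_clock_pos in eventually_elim)
      fix x :: real assume x: "0 < x"
      show "(\<integral>\<^sup>+a. \<integral>\<^sup>+b. B (graft x a b) t \<partial>clocks \<partial>clocks) \<le> 2 * q (t - x) * indicator {0..t} x"
      proof (cases "x \<le> t")
        case True
        have "(\<integral>\<^sup>+a. \<integral>\<^sup>+b. B (graft x a b) t \<partial>clocks \<partial>clocks) \<le>
            (\<integral>\<^sup>+a. \<integral>\<^sup>+b. B a (t - x) + B b (t - x) \<partial>clocks \<partial>clocks)"
          using x True by (intro nn_integral_mono)
            (auto simp: B_def finite_tree_unfold[of "graft _ _ _"] split: split_indicator)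
        also have "\<dots> = q (t - x) + q (t - x)"
          by (simp add: nn_integral_add q_def[symmetric] C.emeasure_space_1)
        finally show ?thesis using True x by (simp add: mult_2)
      next
        case False
        then have "B (graft x a b) t = 0" for a b
          using that by (simp add: B_def finite_tree_unfold[of "graft _ _ _"])
        then show ?thesis by simp
      qed
    qed
    also have "\<dots> = (\<integral>\<^sup>+x. ennreal (exp (- x)) * (2 * q (t - x) * indicator {0..t} x) * indicator {0..} x \<partial>lborel)"
      by (rule nn_integral_clock) measurable
    also have "\<dots> \<le> (\<integral>\<^sup>+x. 2 * q (t - x) * indicator {0..t} x \<partial>lborel)"
    proof (rule nn_integral_mono)
      fix x :: real
      show "ennreal (exp (- x)) * (2 * q (t - x) * indicator {0..t} x) * indicator {0..} x
          \<le> 2 * q (t - x) * indicator {0..t} x"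
      proof (cases "x \<in> {0..t}")
        case True
        then have "ennreal (exp (- x)) * (2 * q (t - x)) \<le> 1 * (2 * q (t - x))"
          by (intro mult_right_mono) auto
        with True show ?thesis by simp
      qed simp
    qed
    finally show ?thesis .
  qed
  have q_le: "q t \<le> ennreal ((2 * t) ^ n / fact n)" if "0 \<le> t" for n t
    using that
  proof (induction n arbitrary: t)
    case 0
    have "q t \<le> (\<integral>\<^sup>+e. 1 \<partial>clocks)" unfolding q_def B_def
      by (intro nn_integral_mono) (auto split: split_indicator)
    then show ?case by (simp add: C.emeasure_space_1)
  next
    case (Suc n)
    have "q t \<le> (\<integral>\<^sup>+x. 2 * q (t - x) * indicator {0..t} x \<partial>lborel)" by (rule q_step) fact
    also have "\<dots> \<le> (\<integral>\<^sup>+x. ennreal (2 * ((2 * (t - x)) ^ n / fact n)) * indicator {0..t} x \<partial>lborel)"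
    proof (rule nn_integral_mono)
      fix x :: real
      have "2 * q (t - x) \<le> ennreal (2 * ((2 * (t - x)) ^ n / fact n))" if "x \<in> {0..t}"
      proof -
        have "2 * q (t - x) \<le> 2 * ennreal ((2 * (t - x)) ^ n / fact n)"
          using that by (intro mult_left_mono Suc.IH) auto
        also have "\<dots> = ennreal (2 * ((2 * (t - x)) ^ n / fact n))"
          using that by (subst ennreal_mult) auto
        finally show ?thesis .
      qed
      then show "2 * q (t - x) * indicator {0..t} x \<le>
          ennreal (2 * ((2 * (t - x)) ^ n / fact n)) * indicator {0..t} x"
        by (auto split: split_indicator)
    qed
    also have "\<dots> = ennreal ((2 * t) ^ Suc n / fact (Suc n))"
      by (rule nn_integral_iterate) (use Suc.prems in auto)
    finally show ?case .
  qed
  have "(\<lambda>n. ennreal ((2 * t) ^ n / fact n)) \<longlonglongrightarrow> ennreal 0"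
    by (intro tendsto_ennrealI power_over_fact_tendsto_0)
  then have "q t \<le> ennreal 0"
    by (rule LIMSEQ_le_const) (use q_le[OF assms] in auto)
  then have "(\<integral>\<^sup>+e. B e t \<partial>clocks) = 0" by (simp add: q_def)
  then have "AE e in clocks. B e t = 0"
    by (subst (asm) nn_integral_0_iff_AE) auto
  then show ?thesis by eventually_elim (auto simp: B_def indicator_def split: if_splits)
qed

text \<open>The two exceptional sets are covered by null sets, whose cylinders are null in the
  product; arbitrary predicates are thus allowed.\<close>

lemma AE_pairI:
  assumes "sigma_finite_measure N" "AE x in M. P x" "AE y in N. Q y"
  shows "AE z in M \<Otimes>\<^sub>M N. P (fst z) \<and> Q (snd z)"
proof -
  interpret N: sigma_finite_measure N by fact
  obtain A where A: "A \<in> null_sets M" "{x \<in> space M. \<not> P x} \<subseteq> A"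
    using assms(2) by (auto simp: eventually_ae_filter)
  obtain B where B: "B \<in> null_sets N" "{x \<in> space N. \<not> Q x} \<subseteq> B"
    using assms(3) by (auto simp: eventually_ae_filter)
  show ?thesis
  proof (rule AE_I')
    show "A \<times> space N \<union> space M \<times> B \<in> null_sets (M \<Otimes>\<^sub>M N)"
      using A B by (intro null_sets.Un) (auto simp: null_sets_def N.emeasure_pair_measure_Times)
    show "{z \<in> space (M \<Otimes>\<^sub>M N). \<not> (P (fst z) \<and> Q (snd z))} \<subseteq> A \<times> space N \<union> space M \<times> B"
      using A B by (auto simp: space_pair_measure)
  qed
qed

lemma distr_pair_snd:
  assumes "prob_space M" "sigma_finite_measure N"
  shows "distr (M \<Otimes>\<^sub>M N) N snd = N"
proof (rule measure_eqI)
  interpret M: prob_space M by fact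
  interpret N: sigma_finite_measure N by fact
  fix A assume "A \<in> sets (distr (M \<Otimes>\<^sub>M N) N snd)"
  then have A: "A \<in> sets N" by simp
  then have "snd -` A \<inter> space (M \<Otimes>\<^sub>M N) = space M \<times> A"
    by (auto simp: space_pair_measure dest: sets.sets_into_space)
  with A show "emeasure (distr (M \<Otimes>\<^sub>M N) N snd) A = emeasure N A"
    by (simp add: emeasure_distr N.emeasure_pair_measure_Times M.emeasure_space_1)
qed simp

section \<open>Branching recursion for the painting law\<close>

locale painting =
  fixes \<mu>\<^sub>0 :: "real measure"
  assumes real_distribution: "real_distribution \<mu>\<^sub>0" and AE_nonneg: "AE x in \<mu>\<^sub>0. 0 \<le> x"
begin

sublocale real_distribution \<mu>\<^sub>0 by (rule real_distribution)

abbreviation colours :: "(word \<Rightarrow> real) measure" where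
  "colours \<equiv> \<Pi>\<^sub>M u\<in>UNIV. \<mu>\<^sub>0"

lemma prob_space_colours: "prob_space colours"
  by (intro prob_space_PiM prob_space_axioms)

lemma sets_colours [measurable_cong]: "sets colours = sets word_borel"
  by (rule sets_PiM_words) simp

lemma sets_painting_space: "sets (painting_space \<mu>\<^sub>0) = sets (word_borel \<Otimes>\<^sub>M word_borel)"
  unfolding painting_space_def by (intro sets_pair_measure_cong sets_clocks sets_colours)

lemma sets_painting_law [measurable_cong, simp]: "sets (painting_law \<mu>\<^sub>0 t) = sets borel"
  by (simp add: painting_law_def)

lemma prob_space_painting_space: "prob_space (painting_space \<mu>\<^sub>0)"
  unfolding painting_space_def by (intro prob_space_pair prob_space_clocks prob_space_colours)

text \<open>At time 0 the root is almost surely alive, since its lifetime is positive, and its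
  colour is nonnegative, so truncation at 0 leaves it unchanged. The special case in
  \<open>painting_law\<close> thus agrees with the general formula, and time 0 needs no separate
  treatment later.\<close>

lemma painting_law_eq_distr:
  assumes "0 \<le> t"
  shows "painting_law \<mu>\<^sub>0 t = distr (painting_space \<mu>\<^sub>0) borel (\<lambda>(e, \<xi>). root_value e \<xi> t)"
proof (cases "t = 0")
  case True
  interpret C: prob_space clocks by (rule prob_space_clocks)
  interpret X: prob_space colours by (rule prob_space_colours)
  interpret CX: pair_prob_space clocks colours ..
  have pX: "product_prob_space (\<lambda>_::word. \<mu>\<^sub>0)" by standard
  interpret c: prob_space clock by (rule prob_space_clock)
  have pC: "product_prob_space (\<lambda>_::word. clock)" by standard
  have "\<mu>\<^sub>0 = distr colours \<mu>\<^sub>0 (\<lambda>\<xi>. \<xi> [])"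
    by (rule product_prob_space.PiM_component[OF pX, symmetric]) simp
  also have "colours = distr (clocks \<Otimes>\<^sub>M colours) colours snd"
    by (rule distr_pair_snd[OF prob_space_clocks X.sigma_finite_measure_axioms, symmetric])
  also have "distr \<dots> \<mu>\<^sub>0 (\<lambda>\<xi>. \<xi> []) = distr (clocks \<Otimes>\<^sub>M colours) \<mu>\<^sub>0 ((\<lambda>\<xi>. \<xi> []) \<circ> snd)"
    by (rule distr_distr) auto
  also have "\<dots> = distr (clocks \<Otimes>\<^sub>M colours) borel (\<lambda>(e, \<xi>). root_value e \<xi> 0)"
  proof (rule distr_cong_AE)
    have "AE e in clocks. 0 < e []"
      by (rule product_prob_space.AE_component[OF pC _ AE_clock_pos]) simp
    moreover have "AE \<xi> in colours. 0 \<le> \<xi> []"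
      by (rule product_prob_space.AE_component[OF pX _ AE_nonneg]) simp
    ultimately have "AE z in clocks \<Otimes>\<^sub>M colours. 0 < fst z [] \<and> 0 \<le> snd z []"
      by (intro AE_pairI[OF X.sigma_finite_measure_axioms]) auto
    then show "AE z in clocks \<Otimes>\<^sub>M colours. ((\<lambda>\<xi>. \<xi> []) \<circ> snd) z = (case z of (e, \<xi>) \<Rightarrow> root_value e \<xi> 0)"
    proof eventually_elim
      case (elim z)
      obtain e \<xi> where z: "z = (e, \<xi>)" by (cases z)
      from elim z have "finite_tree e 0" by (simp add: finite_tree_unfold[of e])
      from root_value_unfold[OF this, of \<xi>] elim show ?case by (simp add: z)
    qed
  qed (auto simp: case_prod_beta')
  finally show ?thesis using True by (simp add: painting_law_def painting_space_def)
qed (simp add: painting_law_def)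

lemma nn_integral_painting_law_space:
  assumes [measurable]: "h \<in> borel_measurable borel" and "0 \<le> t"
  shows "(\<integral>\<^sup>+z. h z \<partial>painting_law \<mu>\<^sub>0 t) = (\<integral>\<^sup>+e. \<integral>\<^sup>+\<xi>. h (root_value e \<xi> t) \<partial>colours \<partial>clocks)"
proof -
  interpret X: prob_space colours by (rule prob_space_colours)
  have "(\<integral>\<^sup>+z. h z \<partial>painting_law \<mu>\<^sub>0 t) =
      (\<integral>\<^sup>+z. h (case z of (e, \<xi>) \<Rightarrow> root_value e \<xi> t) \<partial>(clocks \<Otimes>\<^sub>M colours))"
    unfolding painting_law_eq_distr[OF assms(2)] painting_space_def
    by (rule nn_integral_distr) (auto simp: case_prod_beta')
  also have "\<dots> = (\<integral>\<^sup>+e. \<integral>\<^sup>+\<xi>. h (root_value e \<xi> t) \<partial>colours \<partial>clocks)"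
    by (subst X.nn_integral_fst[symmetric]) (auto simp: case_prod_beta')
  finally show ?thesis .
qed

text \<open>Condition on the lifetime \<open>x\<close> of the root. With probability exp(-t) it
  exceeds \<open>t\<close>, and the root is a leaf. Otherwise the two subtrees are independent
  copies of the whole scheme with remaining time \<open>t - x\<close>, and the root value is the
  truncated difference of their sum and \<open>x\<close>.\<close>

theorem nn_integral_painting_law:
  assumes [measurable]: "h \<in> borel_measurable borel" and t: "0 \<le> t"
  shows "(\<integral>\<^sup>+z. h z \<partial>painting_law \<mu>\<^sub>0 t) =
    ennreal (exp (- t)) * (\<integral>\<^sup>+y. h (max 0 (y - t)) \<partial>\<mu>\<^sub>0) +
    (\<integral>\<^sup>+x. ennreal (exp (- x)) * (\<integral>\<^sup>+z. \<integral>\<^sup>+z'. h (max 0 (z + z' - x))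
      \<partial>painting_law \<mu>\<^sub>0 (t - x) \<partial>painting_law \<mu>\<^sub>0 (t - x)) * indicator {0..t} x \<partial>lborel)"
proof -
  interpret C: prob_space clocks by (rule prob_space_clocks)
  interpret X: prob_space colours by (rule prob_space_colours)
  interpret c: prob_space clock by (rule prob_space_clock)
  interpret XC: pair_sigma_finite colours clocks ..
  define V where "V x = (\<integral>\<^sup>+a. \<integral>\<^sup>+c. \<integral>\<^sup>+b. \<integral>\<^sup>+d.
      h (max 0 (root_value a c (t - x) + root_value b d (t - x) - x)) \<partial>colours \<partial>clocks \<partial>colours \<partial>clocks)" for x
  have [measurable]: "V \<in> borel_measurable borel"
    unfolding V_def by measurable
  define c0 where "c0 = (\<integral>\<^sup>+y. h (max 0 (y - t)) \<partial>\<mu>\<^sub>0)"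
  have V_eq: "V x = (\<integral>\<^sup>+z. \<integral>\<^sup>+z'. h (max 0 (z + z' - x))
      \<partial>painting_law \<mu>\<^sub>0 (t - x) \<partial>painting_law \<mu>\<^sub>0 (t - x))" if "x \<le> t" for x
    unfolding V_def using that by (simp add: nn_integral_painting_law_space)
  have "(\<integral>\<^sup>+z. h z \<partial>painting_law \<mu>\<^sub>0 t) = (\<integral>\<^sup>+e. \<integral>\<^sup>+\<xi>. h (root_value e \<xi> t) \<partial>colours \<partial>clocks)"
    by (rule nn_integral_painting_law_space) (use t in auto)
  also have "\<dots> = (\<integral>\<^sup>+x. \<integral>\<^sup>+a. \<integral>\<^sup>+b. \<integral>\<^sup>+\<xi>. h (root_value (graft x a b) \<xi> t) \<partial>colours \<partial>clocks \<partial>clocks \<partial>clock)"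
    by (rule nn_integral_PiM_words[OF prob_space_clock]) auto
  also have "\<dots> = (\<integral>\<^sup>+x. \<integral>\<^sup>+a. \<integral>\<^sup>+b. \<integral>\<^sup>+y. \<integral>\<^sup>+c. \<integral>\<^sup>+d. h (root_value (graft x a b) (graft y c d) t)
      \<partial>colours \<partial>colours \<partial>\<mu>\<^sub>0 \<partial>clocks \<partial>clocks \<partial>clock)"
    by (intro nn_integral_cong nn_integral_PiM_words[OF prob_space_axioms]) auto
  also have "\<dots> = (\<integral>\<^sup>+x. c0 * indicator {t<..} x + V x * indicator {0..t} x \<partial>clock)"
  proof (rule nn_integral_cong_AE, use AE_clock_pos in eventually_elim)
    fix x :: real assume x: "0 < x"
    show "(\<integral>\<^sup>+a. \<integral>\<^sup>+b. \<integral>\<^sup>+y. \<integral>\<^sup>+c. \<integral>\<^sup>+d. h (root_value (graft x a b) (graft y c d) t)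
        \<partial>colours \<partial>colours \<partial>\<mu>\<^sub>0 \<partial>clocks \<partial>clocks) = c0 * indicator {t<..} x + V x * indicator {0..t} x"
    proof (cases "t < x")
      case True
      have "root_value (graft x a b) (graft y c d) t = max 0 (y - t)" for a b c d y
        using root_value_unfold[of "graft x a b" t] finite_tree_unfold[of "graft x a b"] True t by auto
      then show ?thesis
        using True by (simp add: c0_def C.emeasure_space_1 X.emeasure_space_1)
    next
      case False
      define W where "W a b c d = h (max 0 (root_value a c (t - x) + root_value b d (t - x) - x))" for a b c d
      have ft: "AE a in clocks. finite_tree a (t - x)"
        by (rule AE_finite_tree) (use False in auto)
      have "(\<integral>\<^sup>+a. \<integral>\<^sup>+b. \<integral>\<^sup>+y. \<integral>\<^sup>+c. \<integral>\<^sup>+d. h (root_value (graft x a b) (graft y c d) t)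
        \<partial>colours \<partial>colours \<partial>\<mu>\<^sub>0 \<partial>clocks \<partial>clocks) =
        (\<integral>\<^sup>+a. \<integral>\<^sup>+b. \<integral>\<^sup>+y. \<integral>\<^sup>+c. \<integral>\<^sup>+d. W a b c d \<partial>colours \<partial>colours \<partial>\<mu>\<^sub>0 \<partial>clocks \<partial>clocks)"
      proof (rule nn_integral_cong_AE, use ft in eventually_elim)
        fix a assume a: "finite_tree a (t - x)"
        show "(\<integral>\<^sup>+b. \<integral>\<^sup>+y. \<integral>\<^sup>+c. \<integral>\<^sup>+d. h (root_value (graft x a b) (graft y c d) t)
            \<partial>colours \<partial>colours \<partial>\<mu>\<^sub>0 \<partial>clocks) =
          (\<integral>\<^sup>+b. \<integral>\<^sup>+y. \<integral>\<^sup>+c. \<integral>\<^sup>+d. W a b c d \<partial>colours \<partial>colours \<partial>\<mu>\<^sub>0 \<partial>clocks)"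
        proof (rule nn_integral_cong_AE, use ft in eventually_elim)
          fix b assume b: "finite_tree b (t - x)"
          have "root_value (graft x a b) (graft y c d) t =
              max 0 (root_value a c (t - x) + root_value b d (t - x) - x)" for y c d
            using root_value_unfold[of "graft x a b" t] finite_tree_unfold[of "graft x a b"] False x a b by auto
          then show "(\<integral>\<^sup>+y. \<integral>\<^sup>+c. \<integral>\<^sup>+d. h (root_value (graft x a b) (graft y c d) t)
            \<partial>colours \<partial>colours \<partial>\<mu>\<^sub>0) = (\<integral>\<^sup>+y. \<integral>\<^sup>+c. \<integral>\<^sup>+d. W a b c d \<partial>colours \<partial>colours \<partial>\<mu>\<^sub>0)"
            by (simp add: W_def)
        qed
      qed
      also have "\<dots> = (\<integral>\<^sup>+a. \<integral>\<^sup>+b. \<integral>\<^sup>+c. \<integral>\<^sup>+d. W a b c d \<partial>colours \<partial>colours \<partial>clocks \<partial>clocks)"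
        using emeasure_space_1 by simp
      \<comment> \<open>In \<open>V\<close> the lifetimes and colours of one subtree are adjacent,
        so that each pair of integrals is one painting law; exchanging the integrals over
        \<open>b\<close> and \<open>c\<close> brings the expression into this order.\<close>
      also have "\<dots> = V x" unfolding V_def W_def[symmetric]
      proof (rule nn_integral_cong)
        fix a :: "word \<Rightarrow> real"
        have [measurable]: "(\<lambda>(b, c). \<integral>\<^sup>+d. W a b c d \<partial>colours) \<in> borel_measurable (clocks \<Otimes>\<^sub>M colours)"
            "(\<lambda>(c, b). \<integral>\<^sup>+d. W a b c d \<partial>colours) \<in> borel_measurable (colours \<Otimes>\<^sub>M clocks)"
          unfolding W_def by measurable
        show "(\<integral>\<^sup>+b. \<integral>\<^sup>+c. \<integral>\<^sup>+d. W a b c d \<partial>colours \<partial>colours \<partial>clocks) =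
            (\<integral>\<^sup>+c. \<integral>\<^sup>+b. \<integral>\<^sup>+d. W a b c d \<partial>colours \<partial>clocks \<partial>colours)"
          using XC.Fubini'[of "\<lambda>c b. \<integral>\<^sup>+d. W a b c d \<partial>colours"] by simp
      qed
      finally show ?thesis using False x by simp
    qed
  qed
  also have "\<dots> = c0 * emeasure clock {t<..} + (\<integral>\<^sup>+x. V x * indicator {0..t} x \<partial>clock)"
    by (subst nn_integral_add) (auto simp: nn_integral_cmult_indicator)
  also have "emeasure clock {t<..} = ennreal (exp (- t))"
  proof -
    have "distributed clock lborel (\<lambda>x. x) (exponential_density 1)"
      by (auto simp: distributed_def distr_id2)
    from c.exponential_distributedD_gt[OF this t] show ?thesis
      by (simp add: c.emeasure_eq_measure greaterThan_def)
  qed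
  also have "(\<integral>\<^sup>+x. V x * indicator {0..t} x \<partial>clock) =
     (\<integral>\<^sup>+x. ennreal (exp (- x)) * (V x * indicator {0..t} x) * indicator {0..} x \<partial>lborel)"
    by (rule nn_integral_clock) measurable
  also have "\<dots> = (\<integral>\<^sup>+x. ennreal (exp (- x)) * (\<integral>\<^sup>+z. \<integral>\<^sup>+z'. h (max 0 (z + z' - x))
      \<partial>painting_law \<mu>\<^sub>0 (t - x) \<partial>painting_law \<mu>\<^sub>0 (t - x)) * indicator {0..t} x \<partial>lborel)"
    by (intro nn_integral_cong) (auto simp: V_eq split: split_indicator)
  finally show ?thesis by (simp add: c0_def mult.commute)
qed

end

section \<open>Integrals over intervals and triangles\<close>

lemma set_integrable_bounded_Icc:
  fixes f :: "real \<Rightarrow> real"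
  assumes "f \<in> borel_measurable borel" "\<And>x. x \<in> {a..b} \<Longrightarrow> \<bar>f x\<bar> \<le> C"
  shows "set_integrable lborel {a..b} f"
  unfolding set_integrable_def
proof (rule integrableI_bounded_set_indicator[where B = C])
  show "AE x in lborel. x \<in> {a..b} \<longrightarrow> norm (f x) \<le> C"
    using assms(2) by (intro AE_I2) simp
  show "emeasure lborel {a..b} < \<infinity>"
    by (simp add: emeasure_lborel_Icc_eq)
qed (use assms(1) in simp_all)

lemma set_integral_shift:
  fixes f :: "real \<Rightarrow> real"
  shows "(LBINT x:{a..b}. f x) = (LBINT x:{0..b - a}. f (a + x))"
  unfolding set_lebesgue_integral_def
  by (subst lborel_integral_real_affine[where c = 1 and t = a])
     (auto intro!: Bochner_Integration.integral_cong split: split_indicator)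

lemma set_integral_reflect:
  fixes f :: "real \<Rightarrow> real"
  shows "(LBINT x:{a..b}. f x) = (LBINT x:{0..b - a}. f (b - x))"
  unfolding set_lebesgue_integral_def
  by (subst lborel_integral_real_affine[where c = "-1" and t = b])
     (auto intro!: Bochner_Integration.integral_cong split: split_indicator)

lemma set_integral_triangle:
  fixes L :: "real \<Rightarrow> real \<Rightarrow> real"
  assumes [measurable]: "case_prod L \<in> borel_measurable (borel \<Otimes>\<^sub>M borel)" and C: "\<And>x y. \<bar>L x y\<bar> \<le> C"
  shows "(LBINT y:{0..t}. LBINT x:{0..y}. L x y) = (LBINT x:{0..t}. LBINT y:{x..t}. L x y)"
proof -
  let ?f = "\<lambda>x y. indicator {0..t} y * (indicator {0..y} x * L x y)"
  have f_eq: "?f x y = (if 0 \<le> x \<and> x \<le> y \<and> y \<le> t then L x y else 0)" for x y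
    by (simp add: indicator_def)
  have [measurable]: "case_prod ?f \<in> borel_measurable (lborel \<Otimes>\<^sub>M lborel)"
    unfolding f_eq by measurable
  have "integrable (lborel \<Otimes>\<^sub>M lborel) (case_prod ?f)"
  proof (rule integrableI_bounded_set[where A = "{0..t} \<times> {0..t}" and B = C])
    show "emeasure (lborel \<Otimes>\<^sub>M lborel) ({0..t} \<times> {0..t}) < \<infinity>"
      by (simp add: lborel.emeasure_pair_measure_Times emeasure_lborel_Icc_eq ennreal_mult_less_top)
    have "0 \<le> C" using C[of 0 0] by simp
    then show "AE z in lborel \<Otimes>\<^sub>M lborel. z \<in> {0..t} \<times> {0..t} \<longrightarrow> norm (case_prod ?f z) \<le> C"
      using C by (intro AE_I2) (simp add: f_eq case_prod_beta')
    show "AE z in lborel \<Otimes>\<^sub>M lborel. z \<notin> {0..t} \<times> {0..t} \<longrightarrow> case_prod ?f z = 0"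
      by (intro AE_I2) (auto simp: f_eq split: if_splits)
  qed simp_all
  from lborel_pair.Fubini_integral[OF this]
  have "(LINT y|lborel. LINT x|lborel. ?f x y) = (LINT x|lborel. LINT y|lborel. ?f x y)" .
  moreover have "(LINT y|lborel. LINT x|lborel. ?f x y) = (LBINT y:{0..t}. LBINT x:{0..y}. L x y)"
    by (simp add: set_lebesgue_integral_def)
  moreover have eq: "?f x y = indicator {0..t} x * (indicator {x..t} y * L x y)" for x y
    by (auto simp: indicator_def)
  have "(LINT x|lborel. LINT y|lborel. ?f x y) = (LBINT x:{0..t}. LBINT y:{x..t}. L x y)"
    unfolding eq by (simp add: set_lebesgue_integral_def)
  ultimately show ?thesis by simp
qed

text \<open>On the triangle 0 \<open>\<le>\<close> x \<open>\<le>\<close> y \<open>\<le>\<close> t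
  the second argument is the age \<open>y - x\<close> here and the remaining time
  \<open>t - y\<close> in the next lemma. For fixed \<open>x\<close> both run over [0, t - x], so
  both double integrals agree. The first form serves the painting law, the second the passage from
  weak to mild solutions.\<close>

lemma set_integral_triangle_diff:
  fixes H :: "real \<Rightarrow> real \<Rightarrow> real"
  assumes [measurable]: "case_prod H \<in> borel_measurable (borel \<Otimes>\<^sub>M borel)" and C: "\<And>x y. \<bar>H x y\<bar> \<le> C"
  shows "(LBINT y:{0..t}. LBINT x:{0..y}. H x (y - x)) = (LBINT x:{0..t}. LBINT r:{0..t - x}. H x r)"
proof -
  have "(LBINT y:{0..t}. LBINT x:{0..y}. H x (y - x)) = (LBINT x:{0..t}. LBINT y:{x..t}. H x (y - x))"
    by (rule set_integral_triangle[where C = C])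
       (use C in \<open>auto simp: case_prod_beta'\<close>)
  then show ?thesis by (subst (asm) (4) set_integral_shift) simp
qed

lemma set_integral_triangle_rev:
  fixes H :: "real \<Rightarrow> real \<Rightarrow> real"
  assumes [measurable]: "case_prod H \<in> borel_measurable (borel \<Otimes>\<^sub>M borel)" and C: "\<And>x y. \<bar>H x y\<bar> \<le> C"
  shows "(LBINT y:{0..t}. LBINT x:{0..y}. H x (t - y)) = (LBINT x:{0..t}. LBINT r:{0..t - x}. H x r)"
proof -
  have "(LBINT y:{0..t}. LBINT x:{0..y}. H x (t - y)) = (LBINT x:{0..t}. LBINT y:{x..t}. H x (t - y))"
    by (rule set_integral_triangle[where C = C]) (use C in \<open>auto simp: case_prod_beta'\<close>)
  then show ?thesis by (subst (asm) (4) set_integral_reflect) simp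
qed

section \<open>Kernels\<close>

text \<open>Pushing \<open>K n\<close> forward along \<open>x\<close> to \<open>(n, x)\<close> moves
  the dependence on \<open>n\<close> from the integrand into the measure; the integral of a fixed
  function depends measurably on the measure.\<close>

lemma measurable_kernel_integral [measurable (raw)]:
  fixes f :: "'a \<Rightarrow> 'b \<Rightarrow> real"
  assumes K [measurable]: "K \<in> N \<rightarrow>\<^sub>M prob_algebra M"
    and f [measurable]: "case_prod f \<in> borel_measurable (N \<Otimes>\<^sub>M M)"
  shows "(\<lambda>n. \<integral>x. f n x \<partial>K n) \<in> borel_measurable N"
proof -
  have "(\<lambda>n. distr (K n) (N \<Otimes>\<^sub>M M) (\<lambda>x. (n, x))) \<in> N \<rightarrow>\<^sub>M prob_algebra (N \<Otimes>\<^sub>M M)"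
    by measurable
  from measurable_compose[OF measurable_prob_algebraD[OF this] integral_measurable_subprob_algebra[OF f]]
  have "(\<lambda>n. \<integral>z. case_prod f z \<partial>distr (K n) (N \<Otimes>\<^sub>M M) (\<lambda>x. (n, x))) \<in> borel_measurable N" .
  moreover have "(\<integral>z. case_prod f z \<partial>distr (K n) (N \<Otimes>\<^sub>M M) (\<lambda>x. (n, x))) = (\<integral>x. f n x \<partial>K n)"
    if n: "n \<in> space N" for n
  proof -
    have [measurable_cong]: "sets (K n) = sets M"
      using measurable_space[OF K n] by (simp add: space_prob_algebra)
    have [measurable]: "(\<lambda>x. (n, x)) \<in> K n \<rightarrow>\<^sub>M N \<Otimes>\<^sub>M M"
      using n by (simp add: measurable_cong_sets[OF \<open>sets (K n) = sets M\<close> refl])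
    show ?thesis by (subst integral_distr) auto
  qed
  ultimately show ?thesis by (simp cong: measurable_cong)
qed

lemma measurable_convolution [measurable (raw)]:
  assumes [measurable]: "K \<in> N \<rightarrow>\<^sub>M prob_algebra (borel :: real measure)" "L \<in> N \<rightarrow>\<^sub>M prob_algebra borel"
  shows "(\<lambda>n. K n \<star> L n) \<in> N \<rightarrow>\<^sub>M prob_algebra borel"
  unfolding convolution_def by measurable

lemma real_distribution_convolution:
  assumes "real_distribution M" "real_distribution N"
  shows "real_distribution (M \<star> N)"
proof -
  interpret M: real_distribution M by fact
  interpret N: real_distribution N by fact
  interpret MN: pair_prob_space M N ..
  show ?thesis unfolding convolution_def by (rule MN.real_distribution_distr) auto
qed

lemma integral_convolution:
  fixes f :: "real \<Rightarrow> real"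
  assumes "real_distribution M" "real_distribution N" and [measurable]: "f \<in> borel_measurable borel"
  shows "(\<integral>z. f z \<partial>(M \<star> N)) = (\<integral>(x, y). f (x + y) \<partial>(M \<Otimes>\<^sub>M N))"
proof -
  interpret M: real_distribution M by fact
  interpret N: real_distribution N by fact
  show ?thesis unfolding convolution_def by (subst integral_distr) (auto simp: case_prod_beta')
qed

text \<open>Families of distributions only matter at times \<open>t \<ge> 0\<close>; composing with \<open>max 0\<close> turns
  measurability on the half-line into plain measurability.\<close>

definition half_line_kernel :: "(real \<Rightarrow> real measure) \<Rightarrow> bool" where
  "half_line_kernel \<mu> \<longleftrightarrow> (\<lambda>s. \<mu> (max 0 s)) \<in> borel \<rightarrow>\<^sub>M prob_algebra borel"

lemma half_line_kernel_real_distribution: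
  assumes "half_line_kernel \<mu>" "0 \<le> t" shows "real_distribution (\<mu> t)"
proof -
  have "\<mu> (max 0 t) \<in> space (prob_algebra borel)"
    using assms(1) unfolding half_line_kernel_def by (rule measurable_space) simp
  with assms(2) show ?thesis
    by (auto simp: space_prob_algebra real_distribution_def real_distribution_axioms_def)
qed

lemma (in real_distribution) abs_expectation_le:
  fixes f :: "real \<Rightarrow> real"
  assumes "\<And>x. \<bar>f x\<bar> \<le> C" shows "\<bar>expectation f\<bar> \<le> C"
proof (cases "integrable M f")
  case True
  have "\<bar>expectation f\<bar> \<le> expectation (\<lambda>x. \<bar>f x\<bar>)"
    by (rule integral_abs_bound)
  also have "\<dots> \<le> expectation (\<lambda>x. C)"
    using True assms by (intro integral_mono) auto
  finally show ?thesis using prob_space by simp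
next
  case False
  have "0 \<le> C" using assms[of 0] by simp
  with False show ?thesis by (simp add: not_integrable_integral_eq)
qed

lemma (in real_distribution) integrable_bounded:
  fixes f :: "real \<Rightarrow> real"
  assumes "f \<in> borel_measurable borel" "\<And>x. \<bar>f x\<bar> \<le> C" shows "integrable M f"
  by (rule integrable_const_bound[where B = C]) (use assms in auto)

lemma cts_step_bounds: "a < b \<Longrightarrow> 0 \<le> cts_step a b x \<and> cts_step a b x \<le> 1"
  by (auto simp: cts_step_def divide_simps)

lemma cts_step_tendsto_indicator:
  "(\<lambda>n. cts_step a (a + 1 / Suc n) x) \<longlonglongrightarrow> indicator {..a} x"
proof (cases "x \<le> a")
  case False
  then have "\<forall>\<^sub>F n in sequentially. 1 / Suc n < x - a"
    using order_tendstoD(2)[OF LIMSEQ_inverse_real_of_nat, of "x - a"]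
    by (simp add: inverse_eq_divide del: of_nat_Suc)
  then have "\<forall>\<^sub>F n in sequentially. cts_step a (a + 1 / Suc n) x = 0"
    by eventually_elim (use False in \<open>auto simp: cts_step_def\<close>)
  with False show ?thesis by (simp add: tendsto_eventually)
qed (simp add: cts_step_def)

text \<open>The closed half-lines are an intersection-stable generator, and the indicator of each is
  a pointwise limit of bounded continuous functions; by dominated convergence, integrals of
  continuous functions already determine measurability of the kernel.\<close>

lemma half_line_kernelI:
  assumes d: "\<And>t. 0 \<le> t \<Longrightarrow> real_distribution (\<mu> t)"
    and m: "\<And>f :: real \<Rightarrow> real. continuous_on UNIV f \<Longrightarrow> bounded (range f) \<Longrightarrow>
        (\<lambda>s. \<integral>x. f x \<partial>\<mu> (max 0 s)) \<in> borel_measurable borel"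
  shows "half_line_kernel \<mu>"
  unfolding half_line_kernel_def
proof (rule measurable_prob_algebra_generated)
  have rd: "real_distribution (\<mu> (max 0 s))" for s by (rule d) simp
  show "sets borel = sigma_sets UNIV (range (atMost :: real \<Rightarrow> _))"
    by (subst borel_eq_atMost) (simp add: sets_measure_of)
  show "Int_stable (range (atMost :: real \<Rightarrow> _))"
    by (auto simp: Int_stable_def)
  show "prob_space (\<mu> (max 0 s))" for s
    using rd by (simp add: real_distribution_def)
  show "sets (\<mu> (max 0 s)) = sets borel" for s
    using rd[of s] by (simp add: real_distribution_def real_distribution_axioms_def)
  fix A :: "real set" assume "A \<in> range atMost"
  then obtain a where A: "A = {..a}" by blast
  have b: "a < a + 1 / Suc n" for n by simp
  have "(\<lambda>s. measure (\<mu> (max 0 s)) {..a}) \<in> borel_measurable borel"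
  proof (rule borel_measurable_LIMSEQ_real)
    show "(\<lambda>s. \<integral>x. cts_step a (a + 1 / Suc n) x \<partial>\<mu> (max 0 s)) \<in> borel_measurable borel" for n
    proof (rule m)
      show "continuous_on UNIV (cts_step a (a + 1 / Suc n))"
        by (intro uniformly_continuous_imp_continuous cts_step_uniformly_continuous b)
      show "bounded (range (cts_step a (a + 1 / Suc n)))"
      proof (rule boundedI)
        fix y assume "y \<in> range (cts_step a (a + 1 / Suc n))"
        with cts_step_bounds[OF b[of n]] show "norm y \<le> 1" by fastforce
      qed
    qed
    fix s :: real
    interpret real_distribution "\<mu> (max 0 s)" by (rule rd)
    have "(\<lambda>n. \<integral>x. cts_step a (a + 1 / Suc n) x \<partial>\<mu> (max 0 s)) \<longlonglongrightarrow> (\<integral>x. indicator {..a} x \<partial>\<mu> (max 0 s))"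
    proof (rule integral_dominated_convergence[where w = "\<lambda>_. 1"])
      show "cts_step a (a + 1 / Suc n) \<in> borel_measurable (\<mu> (max 0 s))" for n
        by (intro measurable_finite_borel borel_measurable_continuous_onI
            uniformly_continuous_imp_continuous cts_step_uniformly_continuous b)
      show "AE x in \<mu> (max 0 s). (\<lambda>n. cts_step a (a + 1 / Suc n) x) \<longlonglongrightarrow> indicator {..a} x"
        using cts_step_tendsto_indicator by (intro AE_I2)
      show "AE x in \<mu> (max 0 s). norm (cts_step a (a + 1 / Suc n) x) \<le> 1" for n
        using cts_step_bounds[OF b[of n]] by (intro AE_I2) (simp del: of_nat_Suc)
    qed simp_all
    then show "(\<lambda>n. \<integral>x. cts_step a (a + 1 / Suc n) x \<partial>\<mu> (max 0 s)) \<longlonglongrightarrow> measure (\<mu> (max 0 s)) {..a}"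
      by simp
  qed
  moreover have "emeasure (\<mu> (max 0 s)) A = ennreal (measure (\<mu> (max 0 s)) {..a})" for s
  proof -
    interpret real_distribution "\<mu> (max 0 s)" by (rule rd)
    show ?thesis by (simp add: A emeasure_eq_measure)
  qed
  ultimately show "(\<lambda>s. emeasure (\<mu> (max 0 s)) A) \<in> borel_measurable borel"
    by simp
qed auto

lemma weakly_continuous_half_line_kernel:
  assumes "weakly_continuous \<mu>" and d: "\<And>t. 0 \<le> t \<Longrightarrow> real_distribution (\<mu> t)"
  shows "half_line_kernel \<mu>"
proof (rule half_line_kernelI)
  fix f :: "real \<Rightarrow> real" assume "continuous_on UNIV f" "bounded (range f)"
  with assms(1) have c: "continuous_on {0..} (\<lambda>t. \<integral>x. f x \<partial>\<mu> t)"
    unfolding weakly_continuous_def by blast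
  have "continuous_on UNIV (\<lambda>s. \<integral>x. f x \<partial>\<mu> (max 0 s))"
    by (rule continuous_on_compose2[OF c, where f = "max 0"])
       (simp_all add: continuous_on_max continuous_on_const continuous_on_id image_subset_iff)
  then show "(\<lambda>s. \<integral>x. f x \<partial>\<mu> (max 0 s)) \<in> borel_measurable borel"
    by (rule borel_measurable_continuous_onI)
qed (rule d)

lemma measurable_half_line_kernel [measurable_dest]:
  "half_line_kernel \<mu> \<Longrightarrow> (\<lambda>s. \<mu> (max 0 s)) \<in> borel \<rightarrow>\<^sub>M prob_algebra borel"
  by (simp add: half_line_kernel_def)

lemma half_line_kernel_convolution:
  assumes [measurable]: "half_line_kernel \<mu>" "half_line_kernel \<nu>"
  shows "half_line_kernel (\<lambda>s. \<mu> s \<star> \<nu> s)"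
  unfolding half_line_kernel_def by measurable

section \<open>The painting law solves the equation\<close>

text \<open>The negative of the discounted value, -exp(-p) f((x - p)^+), is a primitive of the
  integrand: the state moves down at unit speed, rests at 0, and is discounted by a clock of rate 1.
  Its only kink is at p = x, which the fundamental theorem with an exceptional set tolerates. The
  function \<open>k\<close> is minus the generator of this drift with killing at rate 1, applied to
  \<open>f\<close>.\<close>

lemma decay_identity:
  fixes f f' :: "real \<Rightarrow> real"
  assumes d: "\<And>x. (f has_real_derivative f' x) (at x)" and c: "continuous_on UNIV f'"
    and b: "\<And>x. \<bar>f x\<bar> \<le> C" "\<And>x. \<bar>f' x\<bar> \<le> C" and x: "0 \<le> x" and r: "0 \<le> r"
  defines "k \<equiv> \<lambda>y. f y + f' y * indicator {0<..} y"
  shows "exp (- r) * f (max 0 (x - r)) = f x - (LBINT p:{0..r}. exp (- p) * k (max 0 (x - p)))"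
proof -
  have contf: "continuous_on UNIV f"
    using d by (intro continuous_at_imp_continuous_on ballI DERIV_isCont)
  note [measurable] = borel_measurable_continuous_onI[OF contf] borel_measurable_continuous_onI[OF c]
  define F where "F p = - (exp (- p) * f (max 0 (x - p)))" for p
  have "((\<lambda>p. exp (- p) * k (max 0 (x - p))) has_integral F r - F 0) {0..r}"
  proof (rule fundamental_theorem_of_calculus_interior_strong[of "{x}"])
    show "continuous_on {0..r} F"
      unfolding F_def by (intro continuous_intros continuous_on_compose2[OF contf]) auto
    fix p assume "p \<in> {0<..<r} - {x}"
    then consider "p < x" | "x < p" by force
    then have "(F has_real_derivative exp (- p) * k (max 0 (x - p))) (at p)"
    proof cases
      case 1
      have "((\<lambda>p. - (exp (- p) * f (x - p))) has_real_derivative exp (- p) * k (x - p)) (at p)"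
        using 1 by (auto simp: k_def algebra_simps intro!: derivative_eq_intros DERIV_chain'[OF _ d])
      then have "(F has_real_derivative exp (- p) * k (x - p)) (at p)"
        by (rule has_field_derivative_transform_within_open[of _ _ _ "{..<x}"])
           (use 1 in \<open>auto simp: F_def\<close>)
      with 1 show ?thesis by simp
    next
      case 2
      have "((\<lambda>p. - (exp (- p) * f 0)) has_real_derivative exp (- p) * k 0) (at p)"
        by (auto simp: k_def intro!: derivative_eq_intros)
      then have "(F has_real_derivative exp (- p) * k 0) (at p)"
        by (rule has_field_derivative_transform_within_open[of _ _ _ "{x<..}"])
           (use 2 in \<open>auto simp: F_def\<close>)
      with 2 show ?thesis by simp
    qed
    then show "(F has_vector_derivative exp (- p) * k (max 0 (x - p))) (at p)"
      by (simp add: has_real_derivative_iff_has_vector_derivative)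
  qed (use r in auto)
  moreover have "set_integrable lborel {0..r} (\<lambda>p. exp (- p) * k (max 0 (x - p)))"
  proof (rule set_integrable_bounded_Icc)
    show "(\<lambda>p. exp (- p) * k (max 0 (x - p))) \<in> borel_measurable borel"
      unfolding k_def by measurable
    fix p :: real assume p: "p \<in> {0..r}"
    have "\<bar>k y\<bar> \<le> C + C" for y
      unfolding k_def using b(1)[of y] b(2)[of y] by (cases "0 < y") auto
    then have "\<bar>exp (- p)\<bar> * \<bar>k (max 0 (x - p))\<bar> \<le> 1 * (C + C)"
      using p by (intro mult_mono) auto
    then show "\<bar>exp (- p) * k (max 0 (x - p))\<bar> \<le> 2 * C" by (simp add: abs_mult)
  qed
  ultimately have "(LBINT p:{0..r}. exp (- p) * k (max 0 (x - p))) = F r - F 0"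
    by (simp add: set_borel_integral_eq_integral integral_unique)
  with x show ?thesis by (simp add: F_def)
qed

context painting
begin

lemma half_line_kernel_painting_law: "half_line_kernel (painting_law \<mu>\<^sub>0)"
proof -
  have "(\<lambda>s::real. distr (painting_space \<mu>\<^sub>0) borel (\<lambda>z. root_value (fst z) (snd z) (max 0 s)))
      \<in> borel \<rightarrow>\<^sub>M prob_algebra borel"
  proof (rule measurable_distr_prob_space2[where M = "word_borel \<Otimes>\<^sub>M word_borel"])
    show "(\<lambda>_. painting_space \<mu>\<^sub>0) \<in> borel \<rightarrow>\<^sub>M prob_algebra (word_borel \<Otimes>\<^sub>M word_borel)"
      by (rule measurable_const) (simp add: space_prob_algebra prob_space_painting_space sets_painting_space)
    have "(\<lambda>p::real \<times> (word \<Rightarrow> real) \<times> (word \<Rightarrow> real). root_value (fst (snd p)) (snd (snd p)) (max 0 (fst p)))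
        \<in> borel_measurable (borel \<Otimes>\<^sub>M (word_borel \<Otimes>\<^sub>M word_borel))"
      by measurable
    then show "(\<lambda>(s::real, z). root_value (fst z) (snd z) (max 0 s))
        \<in> borel_measurable (borel \<Otimes>\<^sub>M (word_borel \<Otimes>\<^sub>M word_borel))"
      by (simp add: case_prod_beta')
  qed
  then show ?thesis
    unfolding half_line_kernel_def by (simp add: painting_law_eq_distr case_prod_beta')
qed

lemma real_distribution_painting_law: "0 \<le> t \<Longrightarrow> real_distribution (painting_law \<mu>\<^sub>0 t)"
  by (rule half_line_kernel_real_distribution[OF half_line_kernel_painting_law])

abbreviation conv2 :: "real \<Rightarrow> real measure" where
  "conv2 s \<equiv> painting_law \<mu>\<^sub>0 s \<star> painting_law \<mu>\<^sub>0 s"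

lemma real_distribution_conv2: "0 \<le> t \<Longrightarrow> real_distribution (conv2 t)"
  by (intro real_distribution_convolution real_distribution_painting_law)

lemma measurable_conv2 [measurable]: "(\<lambda>s. conv2 (max 0 s)) \<in> borel \<rightarrow>\<^sub>M prob_algebra borel"
  using half_line_kernel_convolution[OF half_line_kernel_painting_law half_line_kernel_painting_law]
  by (simp add: half_line_kernel_def)

text \<open>Every value in the recursion is truncated at 0, so for the indicator of the negative
  numbers all terms on the right of the recursion vanish.\<close>

lemma AE_nonneg_painting_law:
  assumes "0 \<le> t" shows "AE x in painting_law \<mu>\<^sub>0 t. 0 \<le> x"
proof -
  interpret P: real_distribution "painting_law \<mu>\<^sub>0 t" by (rule real_distribution_painting_law) fact
  have "(\<integral>\<^sup>+x. indicator {..<0} x \<partial>painting_law \<mu>\<^sub>0 t) = 0"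
    by (subst nn_integral_painting_law) (use assms in auto)
  then have "AE x in painting_law \<mu>\<^sub>0 t. (indicator {..<0::real} x :: ennreal) = 0"
    by (subst (asm) nn_integral_0_iff_AE) auto
  then show ?thesis by eventually_elim (auto split: split_indicator_asm)
qed

lemma AE_nonneg_conv2:
  assumes "0 \<le> t" shows "AE x in conv2 t. 0 \<le> x"
proof -
  interpret P: real_distribution "painting_law \<mu>\<^sub>0 t" by (rule real_distribution_painting_law) fact
  have "AE z in painting_law \<mu>\<^sub>0 t \<Otimes>\<^sub>M painting_law \<mu>\<^sub>0 t. 0 \<le> fst z \<and> 0 \<le> snd z"
    by (rule AE_pairI[OF P.sigma_finite_measure_axioms]) (rule AE_nonneg_painting_law assms)+
  then have "AE z in painting_law \<mu>\<^sub>0 t \<Otimes>\<^sub>M painting_law \<mu>\<^sub>0 t. 0 \<le> (case z of (x, y) \<Rightarrow> x + y)"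
    by eventually_elim auto
  then show ?thesis unfolding convolution_def by (subst AE_distr_iff) auto
qed

lemma integral_painting_law_nonneg:
  assumes [measurable]: "f \<in> borel_measurable borel" and f: "\<And>x. 0 \<le> f x" "\<And>x. f x \<le> C" and t: "0 \<le> t"
  shows "(\<integral>z. f z \<partial>painting_law \<mu>\<^sub>0 t) = exp (- t) * (\<integral>y. f (max 0 (y - t)) \<partial>\<mu>\<^sub>0) +
    (LBINT x:{0..t}. exp (- x) * (\<integral>z. f (max 0 (z - x)) \<partial>conv2 (max 0 (t - x))))"
proof -
  have b: "\<bar>f x\<bar> \<le> C" for x using f[of x] by simp
  interpret P: real_distribution "painting_law \<mu>\<^sub>0 t"
    by (rule real_distribution_painting_law) fact
  define I where "I x = (\<integral>z. f (max 0 (z - x)) \<partial>conv2 (max 0 (t - x)))" for x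
  have [measurable]: "I \<in> borel_measurable borel"
    unfolding I_def by measurable
  have I: "0 \<le> I x" "I x \<le> C" for x
  proof -
    interpret R: real_distribution "conv2 (max 0 (t - x))" by (rule real_distribution_conv2) simp
    show "0 \<le> I x" unfolding I_def using f by (intro Bochner_Integration.integral_nonneg) auto
    show "I x \<le> C" unfolding I_def using R.abs_expectation_le[of "\<lambda>z. f (max 0 (z - x))" C] b by fastforce
  qed
  have bound: "\<bar>exp (- x) * I x\<bar> \<le> C" if "x \<in> {0..t}" for x
  proof -
    have "exp (- x) * I x \<le> 1 * C" using that I by (intro mult_mono) auto
    with I show ?thesis by (simp add: abs_mult)
  qed
  have int: "set_integrable lborel {0..t} (\<lambda>x. exp (- x) * I x)"
    by (rule set_integrable_bounded_Icc[OF _ bound]) auto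
  have nn: "(\<integral>\<^sup>+z. \<integral>\<^sup>+z'. ennreal (f (max 0 (z + z' - x))) \<partial>painting_law \<mu>\<^sub>0 (t - x) \<partial>painting_law \<mu>\<^sub>0 (t - x)) =
      ennreal (I x)" if "x \<in> {0..t}" for x
  proof -
    interpret R: real_distribution "conv2 (t - x)" by (rule real_distribution_conv2) (use that in simp)
    interpret Q: real_distribution "painting_law \<mu>\<^sub>0 (t - x)" by (rule real_distribution_painting_law) (use that in simp)
    have "(\<integral>\<^sup>+z. \<integral>\<^sup>+z'. ennreal (f (max 0 (z + z' - x))) \<partial>painting_law \<mu>\<^sub>0 (t - x) \<partial>painting_law \<mu>\<^sub>0 (t - x)) =
      (\<integral>\<^sup>+z. ennreal (f (max 0 (z - x))) \<partial>conv2 (t - x))"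
      by (rule nn_integral_convolution[symmetric])
         (auto intro: Q.finite_measure_axioms)
    also have "\<dots> = ennreal (I x)"
      unfolding I_def using that f b by (subst nn_integral_eq_integral) (auto intro!: R.integrable_bounded)
    finally show ?thesis .
  qed
  have L: "0 \<le> (LBINT x:{0..t}. exp (- x) * I x)"
    unfolding set_lebesgue_integral_def using I by (intro Bochner_Integration.integral_nonneg) simp
  have "ennreal (\<integral>z. f z \<partial>painting_law \<mu>\<^sub>0 t) = (\<integral>\<^sup>+z. ennreal (f z) \<partial>painting_law \<mu>\<^sub>0 t)"
    using t f b by (subst nn_integral_eq_integral) (auto intro!: P.integrable_bounded)
  also have "\<dots> = ennreal (exp (- t)) * (\<integral>\<^sup>+y. ennreal (f (max 0 (y - t))) \<partial>\<mu>\<^sub>0) +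
    (\<integral>\<^sup>+x. ennreal (exp (- x)) * (\<integral>\<^sup>+z. \<integral>\<^sup>+z'. ennreal (f (max 0 (z + z' - x)))
      \<partial>painting_law \<mu>\<^sub>0 (t - x) \<partial>painting_law \<mu>\<^sub>0 (t - x)) * indicator {0..t} x \<partial>lborel)"
    by (rule nn_integral_painting_law) (use t in auto)
  also have "(\<integral>\<^sup>+y. ennreal (f (max 0 (y - t))) \<partial>\<mu>\<^sub>0) = ennreal (\<integral>y. f (max 0 (y - t)) \<partial>\<mu>\<^sub>0)"
    using f b by (subst nn_integral_eq_integral) (auto intro!: integrable_bounded)
  also have "(\<integral>\<^sup>+x. ennreal (exp (- x)) * (\<integral>\<^sup>+z. \<integral>\<^sup>+z'. ennreal (f (max 0 (z + z' - x)))
      \<partial>painting_law \<mu>\<^sub>0 (t - x) \<partial>painting_law \<mu>\<^sub>0 (t - x)) * indicator {0..t} x \<partial>lborel) =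
      (\<integral>\<^sup>+x. ennreal (indicator {0..t} x *\<^sub>R (exp (- x) * I x)) \<partial>lborel)"
    using I by (intro nn_integral_cong) (auto simp: nn ennreal_mult split: split_indicator)
  also have "\<dots> = ennreal (LBINT x:{0..t}. exp (- x) * I x)"
    unfolding set_lebesgue_integral_def using int I
    by (subst nn_integral_eq_integral) (auto simp: set_integrable_def)
  also have "ennreal (exp (- t)) * ennreal (\<integral>y. f (max 0 (y - t)) \<partial>\<mu>\<^sub>0) + \<dots> =
      ennreal (exp (- t) * (\<integral>y. f (max 0 (y - t)) \<partial>\<mu>\<^sub>0) + (LBINT x:{0..t}. exp (- x) * I x))"
    using f L by (simp add: ennreal_mult[symmetric] Bochner_Integration.integral_nonneg ennreal_plus[symmetric] del: ennreal_plus)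
  finally show ?thesis using f L
    by (subst (asm) ennreal_inj) (simp_all add: I_def Bochner_Integration.integral_nonneg)
qed

text \<open>Adding the constant \<open>C\<close> makes \<open>f\<close> nonnegative, and the
  constant itself satisfies the recursion, so it cancels.\<close>

lemma integral_painting_law:
  assumes [measurable]: "f \<in> borel_measurable borel" and f: "\<And>x. \<bar>f x\<bar> \<le> C" and t: "0 \<le> t"
  shows "(\<integral>z. f z \<partial>painting_law \<mu>\<^sub>0 t) = exp (- t) * (\<integral>y. f (max 0 (y - t)) \<partial>\<mu>\<^sub>0) +
    (LBINT x:{0..t}. exp (- x) * (\<integral>z. f (max 0 (z - x)) \<partial>conv2 (max 0 (t - x))))"
proof -
  have C: "0 \<le> C" using f[of 0] by simp
  interpret P: real_distribution "painting_law \<mu>\<^sub>0 t"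
    by (rule real_distribution_painting_law) fact
  define I where "I x = (\<integral>z. f (max 0 (z - x)) \<partial>conv2 (max 0 (t - x)))" for x
  have [measurable]: "I \<in> borel_measurable borel"
    unfolding I_def by measurable
  have R: "real_distribution (conv2 (max 0 (t - x)))" for x
    by (rule real_distribution_conv2) simp
  have shift: "(\<integral>z. f (max 0 (z - x)) + C \<partial>conv2 (max 0 (t - x))) = I x + C" for x
  proof -
    interpret R: real_distribution "conv2 (max 0 (t - x))" by (rule R)
    have "integrable (conv2 (max 0 (t - x))) (\<lambda>z. f (max 0 (z - x)))"
      using f by (intro R.integrable_bounded) auto
    then show ?thesis using R.prob_space by (simp add: I_def)
  qed
  have I: "\<bar>I x\<bar> \<le> C" for x
  proof -
    interpret R: real_distribution "conv2 (max 0 (t - x))" by (rule R)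
    show ?thesis unfolding I_def using f by (rule R.abs_expectation_le)
  qed
  have int: "set_integrable lborel {0..t} (\<lambda>x. exp (- x) * I x)"
  proof (rule set_integrable_bounded_Icc)
    fix x assume "x \<in> {0..t}"
    then have "exp (- x) * \<bar>I x\<bar> \<le> 1 * C" using I by (intro mult_mono) auto
    then show "\<bar>exp (- x) * I x\<bar> \<le> C" by (simp add: abs_mult)
  qed measurable
  have intC: "set_integrable lborel {0..t} (\<lambda>x. exp (- x) * C)"
  proof (rule set_integrable_bounded_Icc)
    fix x assume "x \<in> {0..t}"
    then have "exp (- x) * C \<le> 1 * C" using C by (intro mult_right_mono) auto
    then show "\<bar>exp (- x) * C\<bar> \<le> C" using C by (simp add: abs_mult)
  qed measurable
  \<comment> \<open>This is the recursion for a constant function, that is, exp(-t) plus the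
    integral of exp(-x) over [0, t] equals 1.\<close>
  have c: "C = exp (- t) * C + (LBINT x:{0..t}. exp (- x) * C)"
  proof -
    have "measure (conv2 (max 0 (t - x))) UNIV = 1" for x
    proof -
      interpret R: real_distribution "conv2 (max 0 (t - x))" by (rule R)
      show ?thesis using R.prob_space by simp
    qed
    with integral_painting_law_nonneg[of "\<lambda>_. C" C t] C t P.prob_space prob_space show ?thesis by simp
  qed
  have "(\<integral>z. f z \<partial>painting_law \<mu>\<^sub>0 t) + C = (\<integral>z. f z + C \<partial>painting_law \<mu>\<^sub>0 t)"
    using f P.prob_space P.integrable_bounded[of f C] by simp
  also have "\<dots> = exp (- t) * (\<integral>y. f (max 0 (y - t)) + C \<partial>\<mu>\<^sub>0) +
    (LBINT x:{0..t}. exp (- x) * (\<integral>z. f (max 0 (z - x)) + C \<partial>conv2 (max 0 (t - x))))"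
  proof (rule integral_painting_law_nonneg)
    show "0 \<le> f x + C" "f x + C \<le> 2 * C" for x using f[of x] by (auto simp: abs_le_iff)
  qed (use t in auto)
  also have "(\<integral>y. f (max 0 (y - t)) + C \<partial>\<mu>\<^sub>0) = (\<integral>y. f (max 0 (y - t)) \<partial>\<mu>\<^sub>0) + C"
    using f prob_space integrable_bounded[of "\<lambda>y. f (max 0 (y - t))" C] by simp
  also have "(LBINT x:{0..t}. exp (- x) * (\<integral>z. f (max 0 (z - x)) + C \<partial>conv2 (max 0 (t - x)))) =
      (LBINT x:{0..t}. exp (- x) * I x) + (LBINT x:{0..t}. exp (- x) * C)"
    using int intC by (simp add: shift ring_distribs)
  finally show ?thesis using c by (simp add: I_def ring_distribs)
qed

end

declare measurable_word_component [measurable del]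

section \<open>Integrating the decay identity against a law\<close>

lemma bounded_range_abs_le:
  fixes f :: "'a \<Rightarrow> real"
  assumes "bounded (range f)" shows "\<exists>C. \<forall>x. \<bar>f x\<bar> \<le> C"
proof -
  from assms obtain C where "\<forall>y\<in>range f. norm y \<le> C"
    unfolding bounded_iff by (elim exE)
  then have "\<bar>f x\<bar> \<le> C" for x by simp
  then show ?thesis by blast
qed

lemma abs_set_integral_Icc_le:
  fixes g :: "real \<Rightarrow> real"
  assumes g: "\<And>x. x \<in> {a..b} \<Longrightarrow> \<bar>g x\<bar> \<le> C" and "0 \<le> C" "a \<le> b"
  shows "\<bar>LBINT x:{a..b}. g x\<bar> \<le> C * (b - a)"
proof (cases "set_integrable lborel {a..b} g")
  case True
  have "\<bar>LBINT x:{a..b}. g x\<bar> \<le> (LBINT x. \<bar>indicator {a..b} x *\<^sub>R g x\<bar>)"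
    unfolding set_lebesgue_integral_def by (rule integral_abs_bound)
  also have "\<dots> \<le> (LBINT x. indicator {a..b} x * C)"
  proof (rule integral_mono)
    show "integrable lborel (\<lambda>x. \<bar>indicator {a..b} x *\<^sub>R g x\<bar>)"
      using True by (intro integrable_abs) (simp add: set_integrable_def)
    show "integrable lborel (\<lambda>x. indicator {a..b} x * C)"
      by (intro integrable_mult_left) (simp add: emeasure_lborel_Icc_eq)
    show "\<bar>indicator {a..b} x *\<^sub>R g x\<bar> \<le> indicator {a..b} x * C" for x
      using g by (simp add: indicator_def)
  qed
  finally show ?thesis using assms by (simp add: mult.commute)
next
  case False
  with assms show ?thesis by (simp add: set_integrable_def set_lebesgue_integral_def not_integrable_integral_eq)
qed

lemma measurable_set_integral_Icc:
  fixes g :: "real \<Rightarrow> real \<Rightarrow> real"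
  assumes [measurable]: "case_prod g \<in> borel_measurable (borel \<Otimes>\<^sub>M borel)"
    "a \<in> borel_measurable borel" "b \<in> borel_measurable borel"
  shows "(\<lambda>s. LBINT x:{a s..b s}. g s x) \<in> borel_measurable borel"
proof -
  have "(LBINT x:{a s..b s}. g s x) = (LBINT x. if a s \<le> x \<and> x \<le> b s then g s x else 0)" for s
    unfolding set_lebesgue_integral_def by (intro Bochner_Integration.integral_cong) (auto simp: indicator_def)
  then show ?thesis by simp
qed

lemma (in real_distribution) integral_set_integral_swap:
  fixes g :: "real \<Rightarrow> real \<Rightarrow> real"
  assumes [measurable]: "case_prod g \<in> borel_measurable (borel \<Otimes>\<^sub>M borel)"
    and g: "\<And>z p. p \<in> {0..r} \<Longrightarrow> \<bar>g z p\<bar> \<le> K"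
  shows "(\<integral>z. (LBINT p:{0..r}. g z p) \<partial>M) = (LBINT p:{0..r}. \<integral>z. g z p \<partial>M)"
proof -
  interpret L: pair_sigma_finite M lborel ..
  let ?f = "\<lambda>z p. indicator {0..r} p * g z p"
  have "integrable (M \<Otimes>\<^sub>M lborel) (case_prod ?f)"
  proof (rule integrableI_bounded_set[where A = "UNIV \<times> {0..r}" and B = K])
    have [measurable]: "UNIV \<in> sets M" by simp
    show "UNIV \<times> {0..r} \<in> sets (M \<Otimes>\<^sub>M lborel)" by (intro pair_measureI) auto
    show "case_prod ?f \<in> borel_measurable (M \<Otimes>\<^sub>M lborel)" by measurable
    show "emeasure (M \<Otimes>\<^sub>M lborel) (UNIV \<times> {0..r}) < \<infinity>"
      using emeasure_space_1
      by (subst lborel.emeasure_pair_measure_Times) (simp_all add: emeasure_lborel_Icc_eq)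
    show "AE x in M \<Otimes>\<^sub>M lborel. x \<in> UNIV \<times> {0..r} \<longrightarrow> norm (case_prod ?f x) \<le> K"
      using g by (intro AE_I2) (simp add: case_prod_beta' mem_Times_iff)
    show "AE x in M \<Otimes>\<^sub>M lborel. x \<notin> UNIV \<times> {0..r} \<longrightarrow> case_prod ?f x = 0"
      by (intro AE_I2) (simp add: case_prod_beta' mem_Times_iff indicator_def)
  qed
  from L.Fubini_integral[OF this] show ?thesis
    by (simp add: set_lebesgue_integral_def)
qed

lemma (in real_distribution) decay_integral:
  fixes f f' :: "real \<Rightarrow> real"
  assumes d: "\<And>x. (f has_real_derivative f' x) (at x)" and c: "continuous_on UNIV f'"
    and b: "\<And>x. \<bar>f x\<bar> \<le> C" "\<And>x. \<bar>f' x\<bar> \<le> C" and r: "0 \<le> r" and AE: "AE x in M. 0 \<le> x"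
  defines "k \<equiv> \<lambda>y. f y + f' y * indicator {0<..} y"
  shows "exp (- r) * (\<integral>z. f (max 0 (z - r)) \<partial>M) =
    (\<integral>z. f z \<partial>M) - (LBINT p:{0..r}. exp (- p) * (\<integral>z. k (max 0 (z - p)) \<partial>M))"
proof -
  have contf: "continuous_on UNIV f"
    using d by (intro continuous_at_imp_continuous_on ballI DERIV_isCont)
  note [measurable] = borel_measurable_continuous_onI[OF contf] borel_measurable_continuous_onI[OF c]
  have [measurable]: "k \<in> borel_measurable borel" unfolding k_def by measurable
  have C: "0 \<le> C" using b(1)[of 0] by simp
  have k: "\<bar>k y\<bar> \<le> 2 * C" for y
    unfolding k_def using b(1)[of y] b(2)[of y] by (cases "0 < y") auto
  have g: "\<bar>exp (- p) * k (max 0 (z - p))\<bar> \<le> 2 * C" if "p \<in> {0..r}" for p z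
  proof -
    have "exp (- p) * \<bar>k (max 0 (z - p))\<bar> \<le> 1 * (2 * C)" using k that by (intro mult_mono) auto
    then show ?thesis by (simp add: abs_mult)
  qed
  have [measurable]: "(\<lambda>z. LBINT p:{0..r}. exp (- p) * k (max 0 (z - p))) \<in> borel_measurable borel"
    by (rule measurable_set_integral_Icc) measurable
  have "exp (- r) * (\<integral>z. f (max 0 (z - r)) \<partial>M) = (\<integral>z. exp (- r) * f (max 0 (z - r)) \<partial>M)"
    by simp
  also have "\<dots> = (\<integral>z. f z - (LBINT p:{0..r}. exp (- p) * k (max 0 (z - p))) \<partial>M)"
  proof (rule integral_cong_AE)
    show "AE z in M. exp (- r) * f (max 0 (z - r)) = f z - (LBINT p:{0..r}. exp (- p) * k (max 0 (z - p)))"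
      using AE
    proof eventually_elim
      case (elim z)
      from decay_identity[OF d c b elim r] show ?case by (simp only: k_def)
    qed
    show "(\<lambda>z. f z - (LBINT p:{0..r}. exp (- p) * k (max 0 (z - p)))) \<in> borel_measurable M"
      by (rule measurable_finite_borel) measurable
    show "(\<lambda>z. exp (- r) * f (max 0 (z - r))) \<in> borel_measurable M"
      by (rule measurable_finite_borel) measurable
  qed
  also have "\<dots> = (\<integral>z. f z \<partial>M) - (\<integral>z. (LBINT p:{0..r}. exp (- p) * k (max 0 (z - p))) \<partial>M)"
  proof (rule Bochner_Integration.integral_diff)
    show "integrable M f" using b by (intro integrable_bounded) auto
    have "\<bar>LBINT p:{0..r}. exp (- p) * k (max 0 (z - p))\<bar> \<le> 2 * C * (r - 0)" for z
      using g C r by (intro abs_set_integral_Icc_le) auto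
    then show "integrable M (\<lambda>z. LBINT p:{0..r}. exp (- p) * k (max 0 (z - p)))"
      by (rule integrable_bounded[rotated]) measurable
  qed
  also have "(\<integral>z. (LBINT p:{0..r}. exp (- p) * k (max 0 (z - p))) \<partial>M) =
      (LBINT p:{0..r}. (\<integral>z. exp (- p) * k (max 0 (z - p)) \<partial>M))"
  proof (rule integral_set_integral_swap[where K = "2 * C"])
    show "(\<lambda>(z, p). exp (- p) * k (max 0 (z - p))) \<in> borel_measurable (borel \<Otimes>\<^sub>M borel)"
      by measurable
  qed (rule g)
  finally show ?thesis by simp
qed

lemma set_integral_cong_Icc:
  fixes f g :: "real \<Rightarrow> real"
  assumes "\<And>x. a \<le> x \<Longrightarrow> x \<le> b \<Longrightarrow> f x = g x"
  shows "(LBINT x:{a..b}. f x) = (LBINT x:{a..b}. g x)"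
  by (rule set_lebesgue_integral_cong) (use assms in auto)

context painting
begin

text \<open>In the Duhamel formula for \<open>f\<close> each discounted term is its undiscounted
  value minus an integral of \<open>k\<close>. The undiscounted values give the initial and the gain
  term. The corrections form \<open>A\<close> and a double integral over a triangle; by the Duhamel
  formula for \<open>k\<close> they add up to the time integral of \<open>n\<close>, which collects
  drift and loss.\<close>

lemma weak_equation_painting_law:
  fixes f f' :: "real \<Rightarrow> real"
  assumes d: "\<And>x. (f has_real_derivative f' x) (at x)" and c: "continuous_on UNIV f'"
    and b: "\<And>x. \<bar>f x\<bar> \<le> C" "\<And>x. \<bar>f' x\<bar> \<le> C" and t: "0 \<le> t"
  shows "(\<integral>x. f x \<partial>painting_law \<mu>\<^sub>0 t) - (\<integral>x. f x \<partial>\<mu>\<^sub>0) =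
    (LBINT s:{0..t}. - (\<integral>x. f' x * indicator {0<..} x + f x \<partial>painting_law \<mu>\<^sub>0 s) +
       (\<integral>z. f z \<partial>conv2 s))"
proof -
  have contf: "continuous_on UNIV f"
    using d by (intro continuous_at_imp_continuous_on ballI DERIV_isCont)
  note [measurable] = borel_measurable_continuous_onI[OF contf] borel_measurable_continuous_onI[OF c]
  define k where "k y = f y + f' y * indicator {0<..} y" for y
  have [measurable]: "k \<in> borel_measurable borel" unfolding k_def by measurable
  have C: "0 \<le> C" using b(1)[of 0] by simp
  have k: "\<bar>k y\<bar> \<le> 2 * C" for y
    unfolding k_def using b(1)[of y] b(2)[of y] by (cases "0 < y") auto
  have exp_le: "\<bar>exp (- max 0 p) * y\<bar> \<le> 2 * C" if "\<bar>y\<bar> \<le> 2 * C" for p y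
  proof -
    have "exp (- max 0 p) * \<bar>y\<bar> \<le> 1 * (2 * C)" using that by (intro mult_mono) auto
    then show ?thesis by (simp add: abs_mult)
  qed
  have R: "real_distribution (conv2 (max 0 s))" for s
    by (rule real_distribution_conv2) simp
  define A where "A p = exp (- max 0 p) * (\<integral>y. k (max 0 (y - p)) \<partial>\<mu>\<^sub>0)" for p
  define H where "H s p = exp (- max 0 p) * (\<integral>z. k (max 0 (z - p)) \<partial>conv2 (max 0 s))" for s p
  define m where "m s = (\<integral>z. f z \<partial>conv2 (max 0 s))" for s
  define n where "n s = (\<integral>z. k z \<partial>painting_law \<mu>\<^sub>0 (max 0 s))" for s
  have [measurable]: "A \<in> borel_measurable borel" "m \<in> borel_measurable borel"
    unfolding A_def m_def by measurable
  note [measurable] = half_line_kernel_painting_law[unfolded half_line_kernel_def]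
  have [measurable]: "n \<in> borel_measurable borel"
    unfolding n_def by measurable
  have H_meas [measurable]: "case_prod H \<in> borel_measurable (borel \<Otimes>\<^sub>M borel)"
    unfolding H_def case_prod_beta' by measurable
  have A_le: "\<bar>A p\<bar> \<le> 2 * C" for p
    unfolding A_def by (intro exp_le abs_expectation_le k)
  have H_le: "\<bar>H s p\<bar> \<le> 2 * C" for s p
    unfolding H_def by (intro exp_le real_distribution.abs_expectation_le[OF R] k)
  have m_le: "\<bar>m s\<bar> \<le> C" for s
    unfolding m_def by (intro real_distribution.abs_expectation_le[OF R] b)
  have n_le: "\<bar>n s\<bar> \<le> 2 * C" for s
    unfolding n_def by (intro real_distribution.abs_expectation_le[OF real_distribution_painting_law] k) simp
  define T where "T s = (LBINT p:{0..t - s}. H s p)" for s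
  have [measurable]: "T \<in> borel_measurable borel"
    unfolding T_def by (rule measurable_set_integral_Icc) measurable
  have T_le: "\<bar>T s\<bar> \<le> 2 * C * t" if "s \<in> {0..t}" for s
  proof -
    have "\<bar>T s\<bar> \<le> 2 * C * (t - s - 0)"
      unfolding T_def using H_le C that by (intro abs_set_integral_Icc_le) auto
    also have "\<dots> \<le> 2 * C * t" using that C by (intro mult_left_mono) auto
    finally show ?thesis .
  qed
  have int: "set_integrable lborel {0..t} A" "set_integrable lborel {0..t} m" "set_integrable lborel {0..t} T"
      "set_integrable lborel {0..t} n"
    using set_integrable_bounded_Icc[of A 0 t, OF _ A_le] set_integrable_bounded_Icc[of m 0 t, OF _ m_le]
      set_integrable_bounded_Icc[of T 0 t, OF _ T_le] set_integrable_bounded_Icc[of n 0 t, OF _ n_le]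
    by simp_all

  have "(\<integral>x. f x \<partial>painting_law \<mu>\<^sub>0 t) = exp (- t) * (\<integral>y. f (max 0 (y - t)) \<partial>\<mu>\<^sub>0) +
    (LBINT x:{0..t}. exp (- x) * (\<integral>z. f (max 0 (z - x)) \<partial>conv2 (max 0 (t - x))))"
    by (rule integral_painting_law[OF _ b(1) t]) measurable
  also have "exp (- t) * (\<integral>y. f (max 0 (y - t)) \<partial>\<mu>\<^sub>0) = (\<integral>x. f x \<partial>\<mu>\<^sub>0) - (LBINT p:{0..t}. A p)"
    unfolding decay_integral[OF d c b t AE_nonneg] A_def k_def
    by (simp add: max_absorb2 cong: set_integral_cong_Icc)
  also have "(LBINT x:{0..t}. exp (- x) * (\<integral>z. f (max 0 (z - x)) \<partial>conv2 (max 0 (t - x)))) =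
      (LBINT x:{0..t}. m (t - x) - (LBINT p:{0..x}. H (t - x) p))"
  proof (rule set_integral_cong_Icc)
    fix x assume x: "0 \<le> x" "x \<le> t"
    interpret R: real_distribution "conv2 (max 0 (t - x))" by (rule R)
    show "exp (- x) * (\<integral>z. f (max 0 (z - x)) \<partial>conv2 (max 0 (t - x))) = m (t - x) - (LBINT p:{0..x}. H (t - x) p)"
      unfolding R.decay_integral[OF d c b x(1) AE_nonneg_conv2[OF max.cobounded1]] m_def H_def k_def
      by (simp add: max_absorb2 cong: set_integral_cong_Icc)
  qed
  also have "\<dots> = (LBINT s:{0..t}. m s - T s)"
    unfolding T_def by (subst set_integral_reflect) simp
  also have "\<dots> = (LBINT s:{0..t}. m s) - (LBINT s:{0..t}. T s)"
    using int by (intro set_integral_diff)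
  finally have 1: "(\<integral>x. f x \<partial>painting_law \<mu>\<^sub>0 t) =
      (\<integral>x. f x \<partial>\<mu>\<^sub>0) - (LBINT p:{0..t}. A p) + ((LBINT s:{0..t}. m s) - (LBINT s:{0..t}. T s))" .

  \<comment> \<open>The function \<open>k\<close> may jump at 0, so here the Duhamel formula is used
    for a test function that is merely measurable and bounded.\<close>
  have n_eq: "n s = A s + (LBINT x:{0..s}. H x (s - x))" if "0 \<le> s" for s
  proof -
    have "n s = exp (- s) * (\<integral>y. k (max 0 (y - s)) \<partial>\<mu>\<^sub>0) +
      (LBINT x:{0..s}. exp (- x) * (\<integral>z. k (max 0 (z - x)) \<partial>conv2 (max 0 (s - x))))"
      unfolding n_def using integral_painting_law[OF _ k that] that by simp
    also have "(LBINT x:{0..s}. exp (- x) * (\<integral>z. k (max 0 (z - x)) \<partial>conv2 (max 0 (s - x)))) =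
        (LBINT x:{0..s}. H (s - x) x)"
      by (rule set_integral_cong_Icc) (simp add: H_def max_absorb2)
    also have "\<dots> = (LBINT x:{0..s}. H x (s - x))"
      by (subst set_integral_reflect) simp
    finally show ?thesis using that by (simp add: A_def max_absorb2)
  qed
  have "(LBINT s:{0..t}. T s) = (LBINT s:{0..t}. LBINT x:{0..s}. H x (s - x))"
    unfolding T_def by (rule set_integral_triangle_diff[symmetric, OF H_meas H_le])
  also have "\<dots> = (LBINT s:{0..t}. n s - A s)"
    by (rule set_integral_cong_Icc) (simp add: n_eq)
  also have "\<dots> = (LBINT s:{0..t}. n s) - (LBINT s:{0..t}. A s)"
    using int by (intro set_integral_diff)
  finally have "(\<integral>x. f x \<partial>painting_law \<mu>\<^sub>0 t) - (\<integral>x. f x \<partial>\<mu>\<^sub>0) = (LBINT s:{0..t}. m s) - (LBINT s:{0..t}. n s)"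
    using 1 by simp
  also have "\<dots> = (LBINT s:{0..t}. m s - n s)"
    using int by (intro set_integral_diff(2)[symmetric])
  also have "\<dots> = (LBINT s:{0..t}. - (\<integral>x. f' x * indicator {0<..} x + f x \<partial>painting_law \<mu>\<^sub>0 s) +
       (\<integral>z. f z \<partial>conv2 s))"
    by (rule set_integral_cong_Icc) (simp add: m_def n_def k_def max_absorb2 add.commute)
  finally show ?thesis .
qed

text \<open>After time reversal the Duhamel integrand contains the law at time \<open>s\<close>
  alone; the end time enters only through the shift of the test function, the exponential and the
  interval. Continuity of \<open>f\<close> and dominated convergence then suffice, without any prior
  continuity of the convolved laws in \<open>s\<close>.\<close>

lemma weakly_continuous_painting_law: "weakly_continuous (painting_law \<mu>\<^sub>0)"
  unfolding weakly_continuous_def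
proof (intro allI impI)
  fix f :: "real \<Rightarrow> real" assume c: "continuous_on UNIV f" and "bounded (range f)"
  from this(2) obtain C where "\<forall>x. \<bar>f x\<bar> \<le> C" using bounded_range_abs_le by blast
  then have f: "\<bar>f x\<bar> \<le> C" for x by blast
  have C: "0 \<le> C" using f[of 0] by simp
  note [measurable] = borel_measurable_continuous_onI[OF c]
  have f_tendsto: "(\<lambda>n. f (max 0 (z - u n))) \<longlonglongrightarrow> f (max 0 (z - v))" if "u \<longlonglongrightarrow> v" for u v z
  proof -
    have "isCont f (max 0 (z - v))" using c by (simp add: continuous_on_eq_continuous_at)
    then show ?thesis by (rule isCont_tendsto_compose) (intro tendsto_intros that)
  qed
  have lim: "(\<lambda>n. \<integral>z. f (max 0 (z - u n)) \<partial>N) \<longlonglongrightarrow> (\<integral>z. f (max 0 (z - v)) \<partial>N)"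
    if "u \<longlonglongrightarrow> v" "real_distribution N" for u v N
  proof -
    interpret N: real_distribution N by fact
    show ?thesis
      by (rule integral_dominated_convergence[where w = "\<lambda>_. C"])
         (use f f_tendsto[OF that(1)] in \<open>auto intro!: AE_I2\<close>)
  qed
  define Q where "Q r s = (\<integral>z. f (max 0 (z - r)) \<partial>conv2 (max 0 s))" for r s
  have [measurable]: "case_prod Q \<in> borel_measurable (borel \<Otimes>\<^sub>M borel)"
    unfolding Q_def case_prod_beta' by measurable
  have R: "real_distribution (conv2 (max 0 s))" for s
    by (rule real_distribution_conv2) simp
  have Q_le: "\<bar>Q r s\<bar> \<le> C" for r s
    unfolding Q_def using f by (intro real_distribution.abs_expectation_le[OF R])
  show "continuous_on {0..} (\<lambda>t. \<integral>x. f x \<partial>painting_law \<mu>\<^sub>0 t)"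
  proof (rule continuous_on_sequentiallyI)
    fix u :: "nat \<Rightarrow> real" and v assume u: "\<forall>n. u n \<in> {0..}" "v \<in> {0..}" "u \<longlonglongrightarrow> v"
    have eq: "(\<integral>x. f x \<partial>painting_law \<mu>\<^sub>0 t) = exp (- t) * (\<integral>y. f (max 0 (y - t)) \<partial>\<mu>\<^sub>0) +
        (LBINT s:{0..t}. exp (- (t - s)) * Q (t - s) s)" if "t \<in> {0..}" for t
    proof -
      from that have "0 \<le> t" by simp
      from integral_painting_law[OF _ f this] show ?thesis
        by (subst (asm) set_integral_reflect) (simp add: Q_def)
    qed
    from convergent_imp_Bseq[OF convergentI[OF u(3)]] obtain B where B: "\<bar>u n\<bar> \<le> B" for n
      by (auto simp: Bseq_def)
    have "(\<lambda>n. LBINT s:{0..u n}. exp (- (u n - s)) * Q (u n - s) s) \<longlonglongrightarrow>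
        (LBINT s:{0..v}. exp (- (v - s)) * Q (v - s) s)"
      unfolding set_lebesgue_integral_def
    proof (rule integral_dominated_convergence[where w = "\<lambda>s. indicator {0..B} s * C"])
      show "integrable lborel (\<lambda>s. indicator {0..B} s * C)"
        by (intro integrable_mult_left) (simp add: emeasure_lborel_Icc_eq)
      show "AE s in lborel. norm (indicator {0..u n} s *\<^sub>R (exp (- (u n - s)) * Q (u n - s) s)) \<le>
          indicator {0..B} s * C" for n
      proof (rule AE_I2)
        fix s
        have "exp (- (u n - s)) * \<bar>Q (u n - s) s\<bar> \<le> 1 * C" if "s \<in> {0..u n}"
          using Q_le that by (intro mult_mono) auto
        moreover have "s \<in> {0..B}" if "s \<in> {0..u n}" using that B[of n] by auto
        ultimately show "norm (indicator {0..u n} s *\<^sub>R (exp (- (u n - s)) * Q (u n - s) s)) \<le>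
          indicator {0..B} s * C" using C by (auto simp: abs_mult indicator_def)
      qed
      \<comment> \<open>At \<open>s = v\<close> the indicators of the intervals up to
        \<open>u n\<close> may oscillate; at every other \<open>s\<close> they are eventually
        constant.\<close>
      have "AE s in lborel. s \<noteq> v" by (rule AE_lborel_singleton)
      then show "AE s in lborel. (\<lambda>n. indicator {0..u n} s *\<^sub>R (exp (- (u n - s)) * Q (u n - s) s)) \<longlonglongrightarrow>
          indicator {0..v} s *\<^sub>R (exp (- (v - s)) * Q (v - s) s)"
      proof eventually_elim
        case (elim s)
        have "(\<lambda>n. indicator {0..u n} s :: real) \<longlonglongrightarrow> indicator {0..v} s"
        proof (cases "s < v")
          case True
          then have "\<forall>\<^sub>F n in sequentially. s < u n" using u(3) by (rule order_tendstoD(1)[rotated])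
          then have "\<forall>\<^sub>F n in sequentially. indicator {0..u n} s = (indicator {0..v} s :: real)"
            by eventually_elim (use True in \<open>auto simp: indicator_def\<close>)
          then show ?thesis by (rule tendsto_eventually)
        next
          case False
          with elim have "v < s" by simp
          then have "\<forall>\<^sub>F n in sequentially. u n < s" using u(3) by (rule order_tendstoD(2)[rotated])
          then have "\<forall>\<^sub>F n in sequentially. indicator {0..u n} s = (indicator {0..v} s :: real)"
            by eventually_elim (use \<open>v < s\<close> in \<open>auto simp: indicator_def\<close>)
          then show ?thesis by (rule tendsto_eventually)
        qed
        moreover have "(\<lambda>n. Q (u n - s) s) \<longlonglongrightarrow> Q (v - s) s"
          unfolding Q_def by (intro lim R tendsto_intros u(3))
        ultimately show ?case by (intro tendsto_intros u(3))
      qed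
    qed measurable
    moreover have "(\<lambda>n. exp (- u n) * (\<integral>y. f (max 0 (y - u n)) \<partial>\<mu>\<^sub>0)) \<longlonglongrightarrow> exp (- v) * (\<integral>y. f (max 0 (y - v)) \<partial>\<mu>\<^sub>0)"
      by (intro tendsto_intros u(3) lim real_distribution)
    ultimately show "(\<lambda>n. \<integral>x. f x \<partial>painting_law \<mu>\<^sub>0 (u n)) \<longlonglongrightarrow> (\<integral>x. f x \<partial>painting_law \<mu>\<^sub>0 v)"
      using u by (simp add: eq tendsto_add)
  qed
qed

theorem weak_solution_painting_law: "weak_solution (painting_law \<mu>\<^sub>0)"
  unfolding weak_solution_def
proof (intro conjI allI impI)
  show "real_distribution (painting_law \<mu>\<^sub>0 t)" if "0 \<le> t" for t
    using that by (rule real_distribution_painting_law)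
  show "weakly_continuous (painting_law \<mu>\<^sub>0)" by (rule weakly_continuous_painting_law)
  fix f f' :: "real \<Rightarrow> real" and t :: real
  assume d: "\<forall>x. (f has_real_derivative f' x) (at x)" and c: "continuous_on UNIV f'"
    and b: "bounded (range f)" "bounded (range f')" and t: "0 < t"
  obtain C1 where "\<forall>x. \<bar>f x\<bar> \<le> C1" using bounded_range_abs_le[OF b(1)] by blast
  moreover obtain C2 where "\<forall>x. \<bar>f' x\<bar> \<le> C2" using bounded_range_abs_le[OF b(2)] by blast
  ultimately have C: "\<bar>f x\<bar> \<le> max C1 C2" "\<bar>f' x\<bar> \<le> max C1 C2" for x by (simp_all add: le_max_iff_disj)
  have m: "f \<in> borel_measurable borel"
    using d by (intro borel_measurable_continuous_onI continuous_at_imp_continuous_on ballI DERIV_isCont) auto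
  have "(\<integral>x. f x \<partial>painting_law \<mu>\<^sub>0 t) - (\<integral>x. f x \<partial>painting_law \<mu>\<^sub>0 0) =
    (LBINT s:{0..t}. - (\<integral>x. f' x * indicator {0<..} x + f x \<partial>painting_law \<mu>\<^sub>0 s) + (\<integral>z. f z \<partial>conv2 s))"
    using weak_equation_painting_law[of f f' "max C1 C2" t] d c C t by (simp add: painting_law_def)
  also have "\<dots> = (LBINT s:{0..t}. - (\<integral>x. f' x * indicator {0<..} x + f x \<partial>painting_law \<mu>\<^sub>0 s) +
      (\<integral>(x, y). f (x + y) \<partial>(painting_law \<mu>\<^sub>0 s \<Otimes>\<^sub>M painting_law \<mu>\<^sub>0 s)))"
    by (rule set_integral_cong_Icc) (simp add: integral_convolution real_distribution_painting_law m)
  finally show "(\<integral>x. f x \<partial>painting_law \<mu>\<^sub>0 t) - (\<integral>x. f x \<partial>painting_law \<mu>\<^sub>0 0) =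
    (LBINT s:{0..t}. - (\<integral>x. f' x * indicator {0<..} x + f x \<partial>painting_law \<mu>\<^sub>0 s) +
      (\<integral>(x, y). f (x + y) \<partial>(painting_law \<mu>\<^sub>0 s \<Otimes>\<^sub>M painting_law \<mu>\<^sub>0 s)))" .
qed

end

section \<open>The mild equation\<close>

text \<open>Mass at or below \<open>a\<close> was at or below \<open>level a r\<close> a time \<open>r\<close> earlier: the drift has unit speed on
  the positive half-line and vanishes elsewhere.\<close>

definition level :: "real \<Rightarrow> real \<Rightarrow> real" where
  "level a r = (if 0 \<le> a then a + r else a)"

text \<open>The two families \<open>\<nu>\<close> and \<open>\<mu>\<close> allow for a process of law \<open>\<nu>\<close> whose jumps are sampled from \<open>\<mu>\<close>,
  before the two are known to agree.\<close>

definition mild :: "real measure \<Rightarrow> (real \<Rightarrow> real measure) \<Rightarrow> (real \<Rightarrow> real measure) \<Rightarrow> bool" where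
  "mild \<mu>\<^sub>0 \<nu> \<mu> \<longleftrightarrow> half_line_kernel \<nu> \<and> half_line_kernel \<mu> \<and>
    (\<forall>t\<ge>0. \<forall>a. cdf (\<nu> t) a = cdf \<mu>\<^sub>0 (level a t) +
      (LBINT s:{0..t}. cdf (\<nu> s \<star> \<mu> s) (level a (t - s)) - cdf (\<nu> s) (level a (t - s))))"

lemma measurable_cdf_kernel [measurable (raw)]:
  assumes [measurable]: "K \<in> N \<rightarrow>\<^sub>M prob_algebra (borel :: real measure)" "x \<in> borel_measurable N"
  shows "(\<lambda>n. cdf (K n) (x n)) \<in> borel_measurable N"
proof -
  have "(\<lambda>n. \<integral>y. (if y \<le> x n then 1 else 0 :: real) \<partial>K n) \<in> borel_measurable N"
    by measurable
  moreover have "(\<integral>y. (if y \<le> x n then 1 else 0 :: real) \<partial>K n) = cdf (K n) (x n)" if "n \<in> space N" for n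
  proof -
    have "K n \<in> space (prob_algebra borel)" using assms(1) that by (rule measurable_space)
    then interpret real_distribution "K n"
      by (auto simp: space_prob_algebra real_distribution_def real_distribution_axioms_def)
    have "(\<lambda>y. if y \<le> x n then 1 else 0 :: real) = indicator {..x n}"
      by (auto simp: indicator_def)
    then show ?thesis by (simp add: cdf_def)
  qed
  ultimately show ?thesis by (simp cong: measurable_cong)
qed

lemma (in real_distribution) cdf_bounds: "0 \<le> cdf M x" "cdf M x \<le> 1" "\<bar>cdf M x\<bar> \<le> 1"
  using cdf_nonneg[of x] cdf_bounded_prob[of x] by auto

lemma (in real_distribution) measurable_cdf [measurable]: "cdf M \<in> borel_measurable borel"
  by (rule borel_measurable_mono) (auto intro: monoI cdf_nondecreasing)

lemma cdf_convolution:
  assumes "real_distribution N" "real_distribution M"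
  shows "cdf (N \<star> M) c = (\<integral>x. cdf M (c - x) \<partial>N)"
proof -
  interpret N: real_distribution N by fact
  interpret M: real_distribution M by fact
  interpret NM: real_distribution "N \<star> M" by (rule real_distribution_convolution) fact+
  have "ennreal (cdf (N \<star> M) c) = emeasure (N \<star> M) {..c}"
    by (simp add: cdf_def NM.emeasure_eq_measure)
  also have "\<dots> = (\<integral>\<^sup>+x. emeasure M {y. y + x \<in> {..c}} \<partial>N)"
    by (rule convolution_emeasure) (auto intro: N.finite_measure_axioms M.finite_measure_axioms)
  also have "\<dots> = (\<integral>\<^sup>+x. ennreal (cdf M (c - x)) \<partial>N)"
  proof (rule nn_integral_cong)
    fix x
    have "{y. y + x \<in> {..c}} = {..c - x}" by auto
    then show "emeasure M {y. y + x \<in> {..c}} = ennreal (cdf M (c - x))"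
      by (simp add: cdf_def M.emeasure_eq_measure)
  qed
  also have "\<dots> = ennreal (\<integral>x. cdf M (c - x) \<partial>N)"
    using M.cdf_bounds by (intro nn_integral_eq_integral N.integrable_bounded[where C = 1]) auto
  finally show ?thesis
    using M.cdf_bounds NM.cdf_bounds by (subst (asm) ennreal_inj) (auto intro!: Bochner_Integration.integral_nonneg)
qed

text \<open>Conditioning on the summand of law \<open>N\<close> exhibits the difference as an
  average of differences of the two distribution functions at shifted points.\<close>

lemma abs_cdf_convolution_diff_le:
  assumes N: "real_distribution N" and M: "real_distribution M" "real_distribution M'"
    and K: "\<And>a. \<bar>cdf M a - cdf M' a\<bar> \<le> K"
  shows "\<bar>cdf (N \<star> M) c - cdf (N \<star> M') c\<bar> \<le> K"
proof -
  interpret N: real_distribution N by fact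
  interpret M: real_distribution M by fact
  interpret M': real_distribution M' by fact
  have "cdf (N \<star> M) c - cdf (N \<star> M') c = (\<integral>x. cdf M (c - x) \<partial>N) - (\<integral>x. cdf M' (c - x) \<partial>N)"
    by (simp add: cdf_convolution assms)
  also have "\<dots> = (\<integral>x. cdf M (c - x) - cdf M' (c - x) \<partial>N)"
    using M.cdf_bounds M'.cdf_bounds
    by (intro Bochner_Integration.integral_diff[symmetric] N.integrable_bounded[where C = 1]) auto
  also have "\<bar>\<dots>\<bar> \<le> K"
    by (rule N.abs_expectation_le) (rule K)
  finally show ?thesis .
qed

lemma abs_set_integral_le:
  fixes g h :: "real \<Rightarrow> real"
  assumes "set_integrable lborel {a..b} h" "set_integrable lborel {a..b} g"
    and "\<And>x. x \<in> {a..b} \<Longrightarrow> \<bar>h x\<bar> \<le> g x"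
  shows "\<bar>LBINT x:{a..b}. h x\<bar> \<le> (LBINT x:{a..b}. g x)"
proof -
  have "\<bar>LBINT x:{a..b}. h x\<bar> \<le> (LBINT x. \<bar>indicator {a..b} x *\<^sub>R h x\<bar>)"
    unfolding set_lebesgue_integral_def by (rule integral_abs_bound)
  also have "\<dots> \<le> (LBINT x:{a..b}. g x)"
    unfolding set_lebesgue_integral_def
  proof (rule integral_mono)
    show "integrable lborel (\<lambda>x. \<bar>indicator {a..b} x *\<^sub>R h x\<bar>)"
      using assms(1) by (intro integrable_abs) (simp add: set_integrable_def)
    show "integrable lborel (\<lambda>x. indicator {a..b} x *\<^sub>R g x)"
      using assms(2) by (simp add: set_integrable_def)
    show "\<bar>indicator {a..b} x *\<^sub>R h x\<bar> \<le> indicator {a..b} x *\<^sub>R g x" for x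
      using assms(3)[of x] by (simp add: indicator_def)
  qed
  finally show ?thesis .
qed

lemma set_integral_power:
  fixes c t :: real
  assumes "0 \<le> c" "0 \<le> t"
  shows "(LBINT x:{0..t}. c * ((c * x) ^ n / fact n)) = (c * t) ^ Suc n / fact (Suc n)"
proof -
  have "(\<integral>x. c * ((c * x) ^ n / fact n) * indicator {0..t} x \<partial>lborel) =
      (c * t) ^ Suc n / fact (Suc n) - (c * 0) ^ Suc n / fact (Suc n)"
  proof (rule integral_FTC_Icc_nonneg)
    fix x :: real
    have "((\<lambda>x. (c * x) ^ Suc n / fact (Suc n)) has_real_derivative
        real (Suc n) * (c * x) ^ n * c / fact (Suc n)) (at x)"
      by (auto intro!: derivative_eq_intros simp del: power_Suc fact_Suc)
    moreover have "real (Suc n) * y * c / fact (Suc n) = c * (y / fact n)" for y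
      by (simp add: divide_simps)
    ultimately show "((\<lambda>x. (c * x) ^ Suc n / fact (Suc n)) has_real_derivative
        c * ((c * x) ^ n / fact n)) (at x)" by (simp only:)
  qed (use assms in auto)
  moreover have "(LBINT x:{0..t}. c * ((c * x) ^ n / fact n)) =
      (\<integral>x. c * ((c * x) ^ n / fact n) * indicator {0..t} x \<partial>lborel)"
    unfolding set_lebesgue_integral_def by (intro Bochner_Integration.integral_cong) auto
  ultimately show ?thesis by (simp del: fact_Suc)
qed

text \<open>The integrand has Lipschitz constant 3 in the uniform distance: the factors of the
  convolution are changed one at a time, and the loss term contributes once. Iteration from the
  trivial bound 1 gives (3t)^n / n!, which tends to 0. The hypothesis \<open>lip\<close> covers two
  situations at once: jump laws equal to the unknown laws themselves, and two equations with the
  same prescribed jump laws.\<close>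

theorem mild_unique:
  assumes m: "mild \<mu>\<^sub>0 \<nu> \<mu>" and m': "mild \<mu>\<^sub>0 \<nu>' \<mu>'" and t: "0 \<le> t"
    and lip: "\<And>s K. 0 \<le> s \<Longrightarrow> (\<And>a. \<bar>cdf (\<nu> s) a - cdf (\<nu>' s) a\<bar> \<le> K) \<Longrightarrow>
        (\<And>a. \<bar>cdf (\<mu> s) a - cdf (\<mu>' s) a\<bar> \<le> K)"
  shows "\<nu> t = \<nu>' t"
proof -
  have R: "real_distribution (\<nu> s)" "real_distribution (\<nu>' s)" "real_distribution (\<mu> s)" "real_distribution (\<mu>' s)"
    if "0 \<le> s" for s
    using m m' that by (auto simp: mild_def intro: half_line_kernel_real_distribution)
  have k: "half_line_kernel \<nu>" "half_line_kernel \<nu>'" "half_line_kernel \<mu>" "half_line_kernel \<mu>'"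
    using m m' by (auto simp: mild_def)
  define I where "I \<nu> \<mu> a t s = cdf (\<nu> (max 0 s) \<star> \<mu> (max 0 s)) (level a (t - s)) - cdf (\<nu> (max 0 s)) (level a (t - s))"
    for \<nu> \<mu> :: "real \<Rightarrow> real measure" and a t s :: real
  have lv: "level a \<in> borel_measurable borel" for a
    unfolding level_def[abs_def] by (cases "0 \<le> a") simp_all
  have lv': "(\<lambda>s. level a (t - s)) \<in> borel_measurable borel" for a t
    by (rule measurable_compose[OF _ lv]) simp
  have meas: "I \<nu> \<mu> a t \<in> borel_measurable borel" if "half_line_kernel \<nu>" "half_line_kernel \<mu>"
    for \<nu> \<mu> :: "real \<Rightarrow> real measure" and a t
  proof -
    note K = that[unfolded half_line_kernel_def]
    have "(\<lambda>s. cdf (\<nu> (max 0 s) \<star> \<mu> (max 0 s)) (level a (t - s)) - cdf (\<nu> (max 0 s)) (level a (t - s)))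
        \<in> borel_measurable borel"
      by (rule borel_measurable_diff[OF
            measurable_cdf_kernel[OF measurable_convolution[OF K] lv'] measurable_cdf_kernel[OF K(1) lv']])
    then show ?thesis unfolding I_def[abs_def] .
  qed
  have I_le: "\<bar>I \<nu> \<mu> a t s\<bar> \<le> 1" if "half_line_kernel \<nu>" "half_line_kernel \<mu>"
    for \<nu> \<mu> and a t s
  proof -
    interpret A: real_distribution "\<nu> (max 0 s)" using that by (auto intro: half_line_kernel_real_distribution)
    interpret B: real_distribution "\<nu> (max 0 s) \<star> \<mu> (max 0 s)"
      by (intro real_distribution_convolution half_line_kernel_real_distribution that) auto
    show ?thesis unfolding I_def abs_le_iff
      using A.cdf_bounds[of "level a (t - s)"] B.cdf_bounds[of "level a (t - s)"] by linarith
  qed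
  have int: "set_integrable lborel {0..t} (I \<nu> \<mu> a t)" "set_integrable lborel {0..t} (I \<nu>' \<mu>' a t)" for a t
    by (rule set_integrable_bounded_Icc[OF meas[OF k(1,3)] I_le[OF k(1,3)]])
       (rule set_integrable_bounded_Icc[OF meas[OF k(2,4)] I_le[OF k(2,4)]])
  have eq: "cdf (\<nu> t) a = cdf \<mu>\<^sub>0 (level a t) + (LBINT s:{0..t}. I \<nu> \<mu> a t s)"
    "cdf (\<nu>' t) a = cdf \<mu>\<^sub>0 (level a t) + (LBINT s:{0..t}. I \<nu>' \<mu>' a t s)" if "0 \<le> t" for t a
    using m m' that by (simp_all add: mild_def I_def cong: set_integral_cong_Icc)
  have bound: "\<bar>cdf (\<nu> t) a - cdf (\<nu>' t) a\<bar> \<le> (3 * t) ^ n / fact n" if "0 \<le> t" for n t a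
    using that
  proof (induction n arbitrary: t a)
    case 0
    with R(1,2)[OF 0] show ?case
      using real_distribution.cdf_bounds[OF R(1)[OF 0], of a] real_distribution.cdf_bounds[OF R(2)[OF 0], of a]
      by simp
  next
    case (Suc n)
    have "cdf (\<nu> t) a - cdf (\<nu>' t) a = (LBINT s:{0..t}. I \<nu> \<mu> a t s - I \<nu>' \<mu>' a t s)"
      using int by (simp add: eq[OF Suc.prems])
    also have "\<bar>\<dots>\<bar> \<le> (LBINT s:{0..t}. 3 * ((3 * s) ^ n / fact n))"
    proof (rule abs_set_integral_le)
      show "set_integrable lborel {0..t} (\<lambda>s. I \<nu> \<mu> a t s - I \<nu>' \<mu>' a t s)"
        using int by (rule set_integral_diff)
      show "set_integrable lborel {0..t} (\<lambda>s. 3 * ((3 * s) ^ n / fact n))"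
        by (rule borel_integrable_atLeastAtMost') (intro continuous_intros, simp)
      fix s assume s: "s \<in> {0..t}"
      then have s0: "0 \<le> s" by simp
      define K where "K = (3 * s) ^ n / fact n"
      have d: "\<bar>cdf (\<nu> s) a - cdf (\<nu>' s) a\<bar> \<le> K" for a
        unfolding K_def by (rule Suc.IH) fact
      have d': "\<bar>cdf (\<mu> s) a - cdf (\<mu>' s) a\<bar> \<le> K" for a
        by (rule lip[OF s0 d])
      let ?c = "level a (t - s)"
      have "\<bar>cdf (\<nu> s \<star> \<mu> s) ?c - cdf (\<nu> s \<star> \<mu>' s) ?c\<bar> \<le> K"
        by (rule abs_cdf_convolution_diff_le[OF R(1,3,4)[OF s0 ] d']) 
      \<comment> \<open>The estimate varies the second factor only; commutativity of convolution
        turns it into one for the first.\<close>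
      moreover have "\<bar>cdf (\<mu>' s \<star> \<nu> s) ?c - cdf (\<mu>' s \<star> \<nu>' s) ?c\<bar> \<le> K"
        by (rule abs_cdf_convolution_diff_le[OF R(4,1,2)[OF s0] d])
      moreover have "(\<mu>' s \<star> \<nu> s) = (\<nu> s \<star> \<mu>' s)" "(\<mu>' s \<star> \<nu>' s) = (\<nu>' s \<star> \<mu>' s)"
        using R[OF s0] by (auto intro!: convolution_commutative
          simp: real_distribution_def real_distribution_axioms_def prob_space.finite_measure)
      ultimately show "\<bar>I \<nu> \<mu> a t s - I \<nu>' \<mu>' a t s\<bar> \<le> 3 * ((3 * s) ^ n / fact n)"
        using d[of ?c] s0 unfolding I_def K_def[symmetric] by (simp add: max_absorb2 abs_le_iff)
    qed
    also have "\<dots> = (3 * t) ^ Suc n / fact (Suc n)"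
      by (rule set_integral_power) (use Suc.prems in auto)
    finally show ?case .
  qed
  have "cdf (\<nu> t) a = cdf (\<nu>' t) a" for a
  proof -
    have "\<bar>cdf (\<nu> t) a - cdf (\<nu>' t) a\<bar> \<le> 0"
      by (rule LIMSEQ_le_const[OF power_over_fact_tendsto_0]) (use bound[OF t] in blast)
    then show ?thesis by simp
  qed
  with R[OF t] show ?thesis by (intro cdf_unique) auto
qed

section \<open>Weak solutions are mild\<close>

lemma set_integral_singleton: "(LBINT x:{a..a::real}. f x :: real) = 0"
proof -
  have "AE x in lborel. x \<noteq> a" by (rule AE_lborel_singleton)
  then have "(LBINT x. indicator {a..a} x *\<^sub>R f x) = 0"
    by (intro integral_eq_zero_AE) (auto elim!: eventually_mono)
  then show ?thesis by (simp add: set_lebesgue_integral_def)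
qed

text \<open>A \<open>C\<^sup>2\<close> step from 1 on \<open>y \<le> 0\<close> to 0 on \<open>y \<ge> 1\<close>, built from the \<open>C\<^sup>2\<close> function \<open>(y\<^sup>+)\<^sup>3\<close>.\<close>

definition ramp :: "nat \<Rightarrow> real \<Rightarrow> real" where "ramp n y = max 0 y ^ n"

definition smooth_step :: "real \<Rightarrow> real" where
  "smooth_step y = ramp 3 (1 - ramp 3 y)"

definition smooth_step' :: "real \<Rightarrow> real" where
  "smooth_step' y = - (3 * ramp 2 (1 - ramp 3 y)) * (3 * ramp 2 y)"

definition smooth_step'' :: "real \<Rightarrow> real" where
  "smooth_step'' y = 6 * ramp 1 (1 - ramp 3 y) * (3 * ramp 2 y)\<^sup>2 - 3 * ramp 2 (1 - ramp 3 y) * (6 * ramp 1 y)"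

lemma DERIV_ramp: "(ramp (Suc (Suc n)) has_real_derivative (real (Suc (Suc n)) * ramp (Suc n) y)) (at y)"
proof -
  consider "y < 0" | "y = 0" | "0 < y" by linarith
  then show ?thesis
  proof cases
    case 1
    have "((\<lambda>_. 0) has_real_derivative 0) (at y)" by simp
    then have "(ramp (Suc (Suc n)) has_real_derivative 0) (at y)"
      by (rule has_field_derivative_transform_within_open[of _ _ _ "{..<0}"])
         (use 1 in \<open>auto simp: ramp_def max_def\<close>)
    with 1 show ?thesis by (simp add: ramp_def max_def)
  next
    case 3
    have "((\<lambda>y. y ^ Suc (Suc n)) has_real_derivative real (Suc (Suc n)) * y ^ Suc n) (at y)"
      by (auto intro!: derivative_eq_intros simp del: power_Suc)
    then have "(ramp (Suc (Suc n)) has_real_derivative real (Suc (Suc n)) * y ^ Suc n) (at y)"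
      by (rule has_field_derivative_transform_within_open[of _ _ _ "{0<..}"])
         (use 3 in \<open>auto simp: ramp_def max_def\<close>)
    with 3 show ?thesis by (simp add: ramp_def max_def)
  next
    case 2
    have "((\<lambda>h. ramp (Suc n) h) \<longlongrightarrow> ramp (Suc n) 0) (at 0)"
      unfolding ramp_def by (intro tendsto_intros)
    then have "((\<lambda>h. ramp (Suc n) h) \<longlongrightarrow> 0) (at 0)" by (simp add: ramp_def)
    moreover have "(ramp (Suc (Suc n)) (0 + h) - ramp (Suc (Suc n)) 0) / h = ramp (Suc n) h" if "h \<noteq> 0" for h
      using that by (auto simp: ramp_def max_def)
    ultimately have "((\<lambda>h. (ramp (Suc (Suc n)) (0 + h) - ramp (Suc (Suc n)) 0) / h) \<longlongrightarrow> 0) (at 0)"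
      by (subst tendsto_cong[of _ "ramp (Suc n)"]) (auto simp: eventually_at_filter)
    with 2 show ?thesis by (simp add: DERIV_def ramp_def)
  qed
qed

lemma continuous_on_ramp [continuous_intros]:
  "continuous_on A f \<Longrightarrow> continuous_on A (\<lambda>x. ramp n (f x))"
  unfolding ramp_def by (intro continuous_intros)

lemma DERIV_smooth_step: "(smooth_step has_real_derivative smooth_step' y) (at y)"
proof -
  note D3 = DERIV_ramp[of 1, simplified, folded numeral_2_eq_2 numeral_3_eq_3]
  have "((\<lambda>y. 1 - ramp 3 y) has_real_derivative - (3 * ramp 2 y)) (at y)"
    using DERIV_diff[OF DERIV_const DERIV_ramp[of 1 y], of 1]
    by (simp add: numeral_2_eq_2 numeral_3_eq_3)
  from DERIV_chain2[OF DERIV_ramp[of 1 "1 - ramp 3 y"] this]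
  show ?thesis
    unfolding smooth_step_def[abs_def] smooth_step'_def by (simp add: numeral_2_eq_2 numeral_3_eq_3)
qed

lemma DERIV_smooth_step': "(smooth_step' has_real_derivative smooth_step'' y) (at y)"
proof -
  have 3: "((\<lambda>y. 1 - ramp 3 y) has_real_derivative - (3 * ramp 2 y)) (at y)"
    using DERIV_diff[OF DERIV_const DERIV_ramp[of 1 y], of 1]
    by (simp add: numeral_2_eq_2 numeral_3_eq_3)
  have 2: "(ramp 2 has_real_derivative 2 * ramp 1 y) (at y)" for y
    using DERIV_ramp[of 0 y] by (simp add: numeral_2_eq_2)
  from DERIV_chain2[OF 2 3]
  have "((\<lambda>y. ramp 2 (1 - ramp 3 y)) has_real_derivative 2 * ramp 1 (1 - ramp 3 y) * - (3 * ramp 2 y)) (at y)" .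
  from DERIV_mult[OF DERIV_cmult[OF this, of "-3"] DERIV_cmult[OF 2, of 3 y]]
  show ?thesis
    unfolding smooth_step'_def[abs_def] smooth_step''_def
    by (simp add: algebra_simps power2_eq_square)
qed

lemma smooth_step_le_0 [simp]:
  "y \<le> 0 \<Longrightarrow> smooth_step y = 1" "y \<le> 0 \<Longrightarrow> smooth_step' y = 0" "y \<le> 0 \<Longrightarrow> smooth_step'' y = 0"
  by (simp_all add: smooth_step_def smooth_step'_def smooth_step''_def ramp_def max_def)

lemma smooth_step_ge_1 [simp]:
  assumes "1 \<le> y" shows "smooth_step y = 0" "smooth_step' y = 0" "smooth_step'' y = 0"
proof -
  have "1 \<le> y ^ 3" using assms by (rule one_le_power)
  then have "max 0 (1 - ramp 3 y) = 0"
    using assms by (simp add: ramp_def max_absorb2)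
  then have "ramp n (1 - ramp 3 y) = 0" if "0 < n" for n
    using that unfolding ramp_def[of n] by simp
  then show "smooth_step y = 0" "smooth_step' y = 0" "smooth_step'' y = 0"
    by (simp_all add: smooth_step_def smooth_step'_def smooth_step''_def)
qed

text \<open>In the transition zone all ramps lie in [0, 1], and 72 = 54 + 18 is the sum of the
  coefficients of the second derivative; it also dominates the coefficient 9 of the first.\<close>

lemma smooth_step_bounds:
  "0 \<le> smooth_step y" "smooth_step y \<le> 1" "\<bar>smooth_step' y\<bar> \<le> 72" "\<bar>smooth_step'' y\<bar> \<le> 72"
proof -
  have *: "0 \<le> smooth_step y \<and> smooth_step y \<le> 1 \<and> \<bar>smooth_step' y\<bar> \<le> 72 \<and> \<bar>smooth_step'' y\<bar> \<le> 72"
  proof (cases "y \<le> 0 \<or> 1 \<le> y")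
    case False
    have r: "0 \<le> ramp n z \<and> ramp n z \<le> 1" if "z \<le> 1" for n z
      using that by (auto simp: ramp_def intro!: power_le_one)
    have a: "0 \<le> ramp n y \<and> ramp n y \<le> 1" "0 \<le> ramp n (1 - ramp 3 y) \<and> ramp n (1 - ramp 3 y) \<le> 1" for n
      using False r[of y] r[of "1 - ramp 3 y"] by auto
    have b: "0 \<le> u * v \<and> u * v \<le> 1" if "0 \<le> u \<and> u \<le> 1" "0 \<le> v \<and> v \<le> 1" for u v :: real
      using that mult_mono[of u 1 v 1] by auto
    have "smooth_step' y = - 9 * (ramp 2 (1 - ramp 3 y) * ramp 2 y)"
      by (simp add: smooth_step'_def)
    moreover have "smooth_step'' y = 54 * (ramp 1 (1 - ramp 3 y) * (ramp 2 y * ramp 2 y)) -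
        18 * (ramp 2 (1 - ramp 3 y) * ramp 1 y)"
      by (simp add: smooth_step''_def power2_eq_square)
    moreover note b[OF a(2)[of 2] a(1)[of 2]] b[OF a(2)[of 1] b[OF a(1)[of 2] a(1)[of 2]]]
      b[OF a(2)[of 2] a(1)[of 1]] a(2)[of 3]
    ultimately show ?thesis unfolding smooth_step_def abs_le_iff by linarith
  qed auto
  then show "0 \<le> smooth_step y" "smooth_step y \<le> 1" "\<bar>smooth_step' y\<bar> \<le> 72" "\<bar>smooth_step'' y\<bar> \<le> 72" by auto
qed

text \<open>The transition from 1 to 0 lies in [b, b + 1/(n+1)], to the right of \<open>b\<close>,
  so the limit is the indicator of the closed half-line and expectations converge to the
  distribution function at every point, atoms included.\<close>

definition approx_step :: "nat \<Rightarrow> real \<Rightarrow> real \<Rightarrow> real" where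
  "approx_step n b x = smooth_step (real (Suc n) * (x - b))"

lemma continuous_on_smooth_step [continuous_intros]:
  "continuous_on A f \<Longrightarrow> continuous_on A (\<lambda>x. smooth_step (f x))"
  "continuous_on A f \<Longrightarrow> continuous_on A (\<lambda>x. smooth_step' (f x))"
  "continuous_on A f \<Longrightarrow> continuous_on A (\<lambda>x. smooth_step'' (f x))"
  unfolding smooth_step_def smooth_step'_def smooth_step''_def by (intro continuous_intros; assumption)+

lemma measurable_smooth_step [measurable]:
  "smooth_step \<in> borel_measurable borel" "smooth_step' \<in> borel_measurable borel" "smooth_step'' \<in> borel_measurable borel"
  by (intro borel_measurable_continuous_onI continuous_intros)+

lemma approx_step_bounds: "0 \<le> approx_step n b x" "approx_step n b x \<le> 1" "\<bar>approx_step n b x\<bar> \<le> 1"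
  using smooth_step_bounds by (auto simp: approx_step_def)

lemma measurable_approx_step [measurable (raw)]:
  assumes [measurable]: "f \<in> borel_measurable M" "g \<in> borel_measurable M"
  shows "(\<lambda>x. approx_step n (f x) (g x)) \<in> borel_measurable M"
  unfolding approx_step_def by measurable

lemma approx_step_tendsto: "(\<lambda>n. approx_step n b x) \<longlonglongrightarrow> indicator {..b} x"
proof (cases "x \<le> b")
  case True
  then have "approx_step n b x = 1" for n
    unfolding approx_step_def by (intro smooth_step_le_0) (simp add: mult_nonneg_nonpos)
  with True show ?thesis by simp
next
  case False
  then have "\<forall>\<^sub>F n in sequentially. inverse (real (Suc n)) < x - b"
    by (intro order_tendstoD(2)[OF LIMSEQ_inverse_real_of_nat]) simp
  then have "\<forall>\<^sub>F n in sequentially. approx_step n b x = 0"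
  proof eventually_elim
    case (elim n)
    then have "1 \<le> real (Suc n) * (x - b)"
      by (simp add: inverse_eq_divide divide_less_eq mult.commute del: of_nat_Suc)
    then show ?case unfolding approx_step_def by (rule smooth_step_ge_1)
  qed
  with False show ?thesis by (simp add: tendsto_eventually)
qed

lemma (in real_distribution) approx_step_expectation_tendsto:
  "(\<lambda>n. expectation (approx_step n b)) \<longlonglongrightarrow> cdf M b"
proof -
  have "(\<lambda>n. expectation (approx_step n b)) \<longlonglongrightarrow> expectation (indicator {..b})"
  proof (rule integral_dominated_convergence[where w = "\<lambda>_. 1"])
    show "AE x in M. (\<lambda>n. approx_step n b x) \<longlonglongrightarrow> indicator {..b} x"
      using approx_step_tendsto by (intro AE_I2)
    show "AE x in M. norm (approx_step n b x) \<le> 1" for n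
      using approx_step_bounds by (intro AE_I2) simp
    show "approx_step n b \<in> borel_measurable M" for n
      unfolding approx_step_def[abs_def] by (rule measurable_finite_borel) measurable
  qed simp_all
  then show ?thesis by (simp add: cdf_def)
qed

section \<open>Duhamel formula for weak solutions\<close>

context
  fixes \<nu> :: "real \<Rightarrow> real measure"
  assumes weak: "weak_solution \<nu>"
begin

lemma weak_solution_real_distribution: "0 \<le> t \<Longrightarrow> real_distribution (\<nu> t)"
  using weak by (auto simp: weak_solution_def)

lemma weak_solution_half_line_kernel: "half_line_kernel \<nu>"
  using weak by (auto simp: weak_solution_def intro: weakly_continuous_half_line_kernel)

text \<open>The effect of the jumps on \<open>f\<close>: gain by convolution minus loss at rate
  1.\<close>

definition source :: "real \<Rightarrow> (real \<Rightarrow> real) \<Rightarrow> real" where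
  "source s f = (\<integral>z. f z \<partial>(\<nu> (max 0 s) \<star> \<nu> (max 0 s))) - (\<integral>z. f z \<partial>\<nu> (max 0 s))"

lemma weak_equation:
  fixes f f' :: "real \<Rightarrow> real"
  assumes d: "\<And>x. (f has_real_derivative f' x) (at x)" and c: "continuous_on UNIV f'"
    and b: "\<And>x. \<bar>f x\<bar> \<le> C" "\<And>x. \<bar>f' x\<bar> \<le> C" and t: "0 \<le> t"
  shows "(\<integral>x. f x \<partial>\<nu> t) = (\<integral>x. f x \<partial>\<nu> 0) +
    (LBINT s:{0..t}. source s f - (\<integral>x. f' x * indicator {0<..} x \<partial>\<nu> (max 0 s)))"
proof (cases "t = 0")
  case False
  have contf: "continuous_on UNIV f"
    using d by (intro continuous_at_imp_continuous_on ballI DERIV_isCont)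
  note [measurable] = borel_measurable_continuous_onI[OF contf] borel_measurable_continuous_onI[OF c]
  have bd: "bounded (range f)" "bounded (range f')"
    using b by (intro boundedI[of _ C]; clarsimp)+
  have "0 < t" using False t by simp
  note weak[unfolded weak_solution_def, THEN conjunct2, THEN conjunct2, rule_format, OF d c bd this]
  also have "(LBINT s:{0..t}. - (\<integral>x. f' x * indicator {0<..} x + f x \<partial>\<nu> s)
              + (\<integral>(x, y). f (x + y) \<partial>(\<nu> s \<Otimes>\<^sub>M \<nu> s))) = (LBINT s:{0..t}. source s f - (\<integral>x. f' x * indicator {0<..} x \<partial>\<nu> (max 0 s)))"
  proof (rule set_integral_cong_Icc)
    fix s assume s: "0 \<le> s" "s \<le> t"
    interpret R: real_distribution "\<nu> s" using s(1) by (rule weak_solution_real_distribution)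
    have "\<bar>f' x * indicator {0<..} x\<bar> \<le> C" for x
      using b(2)[of x] by (auto simp: indicator_def)
    then have "(\<integral>x. f' x * indicator {0<..} x + f x \<partial>\<nu> s) =
        (\<integral>x. f' x * indicator {0<..} x \<partial>\<nu> s) + (\<integral>x. f x \<partial>\<nu> s)"
      by (intro Bochner_Integration.integral_add R.integrable_bounded[where C = C] b) auto
    moreover have "(\<integral>(x, y). f (x + y) \<partial>(\<nu> s \<Otimes>\<^sub>M \<nu> s)) = (\<integral>z. f z \<partial>(\<nu> s \<star> \<nu> s))"
      by (subst integral_convolution) (auto intro: R.real_distribution_axioms)
    ultimately show "- (\<integral>x. f' x * indicator {0<..} x + f x \<partial>\<nu> s) + (\<integral>(x, y). f (x + y) \<partial>(\<nu> s \<Otimes>\<^sub>M \<nu> s)) =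
       source s f - (\<integral>x. f' x * indicator {0<..} x \<partial>\<nu> (max 0 s))"
      using s by (simp add: source_def max_absorb2)
  qed
  finally show ?thesis by simp
next
  case True
  show ?thesis unfolding True set_integral_singleton by simp
qed

lemma abs_source_le:
  assumes "\<And>x. \<bar>f x\<bar> \<le> C" shows "\<bar>source s f\<bar> \<le> 2 * C"
proof -
  have R: "real_distribution (\<nu> (max 0 s))" by (rule weak_solution_real_distribution) simp
  have "\<bar>\<integral>z. f z \<partial>(\<nu> (max 0 s) \<star> \<nu> (max 0 s))\<bar> \<le> C" "\<bar>\<integral>z. f z \<partial>\<nu> (max 0 s)\<bar> \<le> C"
    by (intro real_distribution.abs_expectation_le real_distribution_convolution R assms)+
  then show ?thesis by (simp add: source_def abs_le_iff)
qed

lemma measurable_source: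
  assumes [measurable]: "case_prod f \<in> borel_measurable (M \<Otimes>\<^sub>M borel)" "s \<in> borel_measurable M"
  shows "(\<lambda>x. source (s x) (f x)) \<in> borel_measurable M"
proof -
  have [measurable]: "(\<lambda>x. \<nu> (max 0 (s x))) \<in> M \<rightarrow>\<^sub>M prob_algebra borel"
    using measurable_compose[OF assms(2) weak_solution_half_line_kernel[unfolded half_line_kernel_def]] .
  show ?thesis unfolding source_def by measurable
qed

text \<open>A test function moving along the characteristics would require a weak form with
  time-dependent test functions. Instead the weak equation is applied to the fixed translates g'(x -
  r), which is why a second derivative appears, and is integrated over \<open>r\<close> and time
  along a triangle; integration in \<open>r\<close> undoes the derivative. Since g' and g'' vanish
  on the nonpositive half-line, the indicator in the drift is invisible.\<close>

lemma duhamel: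
  fixes g g' g'' :: "real \<Rightarrow> real"
  assumes d: "\<And>x. (g has_real_derivative g' x) (at x)" "\<And>x. (g' has_real_derivative g'' x) (at x)"
    and c: "continuous_on UNIV g''"
    and b: "\<And>x. \<bar>g x\<bar> \<le> C" "\<And>x. \<bar>g' x\<bar> \<le> C" "\<And>x. \<bar>g'' x\<bar> \<le> C"
    and z: "\<And>x. x \<le> 0 \<Longrightarrow> g' x = 0" "\<And>x. x \<le> 0 \<Longrightarrow> g'' x = 0" and t: "0 \<le> t"
  shows "(\<integral>x. g x \<partial>\<nu> t) = (\<integral>x. g (x - t) \<partial>\<nu> 0) +
    (LBINT s:{0..t}. source s (\<lambda>x. g (x - (t - s))))"
proof -
  have cg: "continuous_on UNIV g" "continuous_on UNIV g'"
    using d by (auto intro!: continuous_at_imp_continuous_on DERIV_isCont)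
  note meas [measurable] = cg[THEN borel_measurable_continuous_onI] borel_measurable_continuous_onI[OF c]
  note k = weak_solution_half_line_kernel[unfolded half_line_kernel_def]
  have k2 [measurable]: "(\<lambda>p. \<nu> (max 0 (fst p))) \<in> borel \<Otimes>\<^sub>M borel \<rightarrow>\<^sub>M prob_algebra borel"
    by (rule measurable_compose[OF measurable_fst k])
  note k [measurable]
  have R: "real_distribution (\<nu> (max 0 s))" for s by (rule weak_solution_real_distribution) simp
  have RR: "real_distribution (\<nu> (max 0 s) \<star> \<nu> (max 0 s))" for s
    by (intro real_distribution_convolution R)
  define N where "N s r = (\<integral>x. g' (x - r) \<partial>\<nu> (max 0 s))" for s r
  define N2 where "N2 s r = (\<integral>x. g'' (x - r) \<partial>\<nu> (max 0 s))" for s r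
  define G where "G s r = source s (\<lambda>x. g (x - r))" for s r
  define K where "K s r = source s (\<lambda>x. g' (x - r)) - N2 s r" for s r
  have K_meas: "case_prod K \<in> borel_measurable (borel \<Otimes>\<^sub>M borel)"
    unfolding K_def N2_def source_def case_prod_beta' by measurable
  define V where "V s r = (\<integral>x. g' (x - r) \<partial>(\<nu> (max 0 s) \<star> \<nu> (max 0 s)))" for s r
  have N_meas: "case_prod N \<in> borel_measurable (borel \<Otimes>\<^sub>M borel)"
    unfolding N_def case_prod_beta' by measurable
  have N2_meas: "case_prod N2 \<in> borel_measurable (borel \<Otimes>\<^sub>M borel)"
    unfolding N2_def case_prod_beta' by measurable
  have V_meas: "case_prod V \<in> borel_measurable (borel \<Otimes>\<^sub>M borel)"
    unfolding V_def case_prod_beta' by measurable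
  have G_meas: "case_prod G \<in> borel_measurable (borel \<Otimes>\<^sub>M borel)"
    unfolding G_def source_def case_prod_beta' by measurable
  have comp: "(\<lambda>s. H (a s) (b s)) \<in> borel_measurable borel"
    if "case_prod H \<in> borel_measurable (borel \<Otimes>\<^sub>M borel)" "a \<in> borel_measurable borel" "b \<in> borel_measurable borel"
    for H :: "real \<Rightarrow> real \<Rightarrow> real" and a b :: "real \<Rightarrow> real"
    using measurable_compose[OF measurable_Pair[OF that(2,3)] that(1)] by simp
  have m: "(\<lambda>s. N s (t - s)) \<in> borel_measurable borel" "(\<lambda>s. N s 0) \<in> borel_measurable borel"
    "(\<lambda>s. G s (t - s)) \<in> borel_measurable borel" "(\<lambda>s. G s 0) \<in> borel_measurable borel"
    by (rule comp[OF N_meas] comp[OF G_meas]; simp)+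
  have N_le: "\<bar>N s r\<bar> \<le> C" "\<bar>N2 s r\<bar> \<le> C" for s r
    unfolding N_def N2_def by (intro real_distribution.abs_expectation_le[OF R] b)+
  have G_le: "\<bar>G s r\<bar> \<le> 2 * C" for s r
    unfolding G_def by (intro abs_source_le b)
  have K_le: "\<bar>K s r\<bar> \<le> 3 * C" for s r
  proof -
    have "\<bar>source s (\<lambda>x. g' (x - r))\<bar> \<le> 2 * C" by (intro abs_source_le b)
    with N_le(2)[of s r] show ?thesis unfolding K_def abs_le_iff by linarith
  qed
  have int: "set_integrable lborel {0..t} (\<lambda>s. N s (t - s))" "set_integrable lborel {0..t} (\<lambda>s. N s 0)"
     "set_integrable lborel {0..t} (\<lambda>s. G s (t - s))" "set_integrable lborel {0..t} (\<lambda>s. G s 0)"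
    by (rule set_integrable_bounded_Icc[OF m(1) N_le(1)] set_integrable_bounded_Icc[OF m(2) N_le(1)]
        set_integrable_bounded_Icc[OF m(3) G_le] set_integrable_bounded_Icc[OF m(4) G_le])+
  have ftc: "(LBINT r:{0..p}. (\<integral>x. h' (x - r) \<partial>M)) = (\<integral>x. h x \<partial>M) - (\<integral>x. h (x - p) \<partial>M)"
    if M: "real_distribution M" and h: "\<And>x. (h has_real_derivative h' x) (at x)" "continuous_on UNIV h'"
      "\<And>x. \<bar>h x\<bar> \<le> C" "\<And>x. \<bar>h' x\<bar> \<le> C" and p: "0 \<le> p" for M h h' p
  proof -
    interpret M: real_distribution M by fact
    have ch: "continuous_on UNIV h"
      using h(1) by (auto intro!: continuous_at_imp_continuous_on DERIV_isCont)
    note [measurable] = borel_measurable_continuous_onI[OF ch] borel_measurable_continuous_onI[OF h(2)]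
    have "(\<integral>x. h x \<partial>M) - (\<integral>x. h (x - p) \<partial>M) = (\<integral>x. h x - h (x - p) \<partial>M)"
      by (intro Bochner_Integration.integral_diff[symmetric] M.integrable_bounded[where C = C] h) measurable
    also have "\<dots> = (\<integral>x. (LBINT r:{0..p}. h' (x - r)) \<partial>M)"
    proof (rule Bochner_Integration.integral_cong[OF refl])
      fix x
      have "(LBINT r. indicator {0..p} r *\<^sub>R h' (x - r)) = - h (x - p) - - h (x - 0)"
      proof (rule integral_FTC_Icc[OF p])
        fix r
        have "((\<lambda>r. - h (x - r)) has_real_derivative h' (x - r)) (at r within {0..p})"
          by (auto intro!: derivative_eq_intros DERIV_chain2[OF h(1)])
        then show "((\<lambda>r. - h (x - r)) has_vector_derivative h' (x - r)) (at r within {0..p})"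
          by (simp add: has_real_derivative_iff_has_vector_derivative)
        show "continuous_on {0..p} (\<lambda>r. h' (x - r))"
          by (rule continuous_on_compose2[OF h(2)]) (auto intro!: continuous_intros)
      qed
      then show "h x - h (x - p) = (LBINT r:{0..p}. h' (x - r))"
        by (simp add: set_lebesgue_integral_def)
    qed
    also have "\<dots> = (LBINT r:{0..p}. (\<integral>x. h' (x - r) \<partial>M))"
    proof (rule M.integral_set_integral_swap[where K = C])
      show "(\<lambda>(x, r). h' (x - r)) \<in> borel_measurable (borel \<Otimes>\<^sub>M borel)" by measurable
    qed (rule h)
    finally show ?thesis by simp
  qed
  \<comment> \<open>Integration in the shift \<open>r\<close> recovers differences of
    \<open>g\<close> from g', and of g' from g''.\<close>
  have inner: "(LBINT r:{0..p}. K s r) = G s 0 - G s p - (N s 0 - N s p)" if p: "0 \<le> p" for s p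
  proof -
    have mm: "V s \<in> borel_measurable borel" "N s \<in> borel_measurable borel" "N2 s \<in> borel_measurable borel"
      by (rule comp[OF V_meas measurable_const[of s] measurable_ident, simplified id_def]
          comp[OF N_meas measurable_const[of s] measurable_ident, simplified id_def]
          comp[OF N2_meas measurable_const[of s] measurable_ident, simplified id_def]; simp)+
    have V_le: "\<bar>V s r\<bar> \<le> C" for r
      unfolding V_def by (intro real_distribution.abs_expectation_le[OF RR] b)
    have i: "set_integrable lborel {0..p} (V s)" "set_integrable lborel {0..p} (N s)" "set_integrable lborel {0..p} (N2 s)"
      by (rule set_integrable_bounded_Icc[OF mm(1) V_le] set_integrable_bounded_Icc[OF mm(2) N_le(1)]
          set_integrable_bounded_Icc[OF mm(3) N_le(2)])+
    have "(LBINT r:{0..p}. K s r) = (LBINT r:{0..p}. V s r - N s r - N2 s r)"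
      by (simp add: K_def source_def V_def N_def)
    also have "\<dots> = (LBINT r:{0..p}. V s r) - (LBINT r:{0..p}. N s r) - (LBINT r:{0..p}. N2 s r)"
      using i by simp
    also have "(LBINT r:{0..p}. V s r) = (\<integral>x. g x \<partial>(\<nu> (max 0 s) \<star> \<nu> (max 0 s))) - (\<integral>x. g (x - p) \<partial>(\<nu> (max 0 s) \<star> \<nu> (max 0 s)))"
      unfolding V_def by (rule ftc[OF RR d(1) cg(2) b(1,2) p])
    also have "(LBINT r:{0..p}. N s r) = (\<integral>x. g x \<partial>\<nu> (max 0 s)) - (\<integral>x. g (x - p) \<partial>\<nu> (max 0 s))"
      unfolding N_def by (rule ftc[OF R d(1) cg(2) b(1,2) p])
    also have "(LBINT r:{0..p}. N2 s r) = N s 0 - N s p"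
      unfolding N_def N2_def using ftc[OF R d(2) c b(2,3) p] by simp
    finally show ?thesis by (simp add: G_def source_def)
  qed
  \<comment> \<open>The weak equation for g' translated by \<open>r\<close>. For
    \<open>x \<le> 0\<close> and \<open>r \<ge> 0\<close> the translate of g'' is evaluated at a
    nonpositive point and vanishes, so the indicator may be dropped.\<close>
  have N_eq: "N s r = N 0 r + (LBINT x:{0..s}. K x r)" if s: "0 \<le> s" and r: "0 \<le> r" for s r
  proof -
    have "(\<integral>x. g' (x - r) \<partial>\<nu> s) = (\<integral>x. g' (x - r) \<partial>\<nu> 0) +
      (LBINT s:{0..s}. source s (\<lambda>x. g' (x - r)) - (\<integral>x. g'' (x - r) * indicator {0<..} x \<partial>\<nu> (max 0 s)))"
    proof (rule weak_equation[OF _ _ b(2) b(3) s])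
      show "((\<lambda>x. g' (x - r)) has_real_derivative g'' (x - r)) (at x)" for x
        using DERIV_chain2[OF d(2) DERIV_diff[OF DERIV_ident DERIV_const], of r x UNIV] by simp
      show "continuous_on UNIV (\<lambda>x. g'' (x - r))"
        by (rule continuous_on_compose2[OF c]) (auto intro!: continuous_intros)
    qed
    moreover have "g'' (x - r) * indicator {0<..} x = g'' (x - r)" for x
      using z(2)[of "x - r"] r by (auto simp: indicator_def)
    ultimately show ?thesis using s by (simp add: N_def K_def N2_def max_absorb2)
  qed
  have "(LBINT s:{0..t}. N s (t - s) - N 0 (t - s)) = (LBINT s:{0..t}. LBINT x:{0..s}. K x (t - s))"
  proof (rule set_integral_cong_Icc)
    fix s assume "0 \<le> s" "s \<le> t"
    then show "N s (t - s) - N 0 (t - s) = (LBINT x:{0..s}. K x (t - s))"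
      using N_eq[of s "t - s"] by simp
  qed
  also have "\<dots> = (LBINT s:{0..t}. LBINT r:{0..t - s}. K s r)"
    by (rule set_integral_triangle_rev[OF K_meas K_le])
  also have "\<dots> = (LBINT s:{0..t}. G s 0 - G s (t - s) - (N s 0 - N s (t - s)))"
    by (rule set_integral_cong_Icc) (simp add: inner)
  also have "\<dots> = (LBINT s:{0..t}. G s 0) - (LBINT s:{0..t}. G s (t - s)) -
      ((LBINT s:{0..t}. N s 0) - (LBINT s:{0..t}. N s (t - s)))"
    using int by simp
  also have "(LBINT s:{0..t}. N s (t - s) - N 0 (t - s)) = (LBINT s:{0..t}. N s (t - s)) - (LBINT s:{0..t}. N 0 (t - s))"
  proof (rule set_integral_diff(2))
    have "(\<lambda>s. N 0 (t - s)) \<in> borel_measurable borel"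
      by (rule comp[OF N_meas]; simp)
    then show "set_integrable lborel {0..t} (\<lambda>s. N 0 (t - s))"
      by (rule set_integrable_bounded_Icc[OF _ N_le(1)])
  qed (rule int)
  also have "(LBINT s:{0..t}. N 0 (t - s)) = (LBINT r:{0..t}. N 0 r)"
    by (subst (2) set_integral_reflect) simp
  also have "\<dots> = (\<integral>x. g x \<partial>\<nu> 0) - (\<integral>x. g (x - t) \<partial>\<nu> 0)"
    unfolding N_def using ftc[OF R[of 0] d(1) cg(2) b(1,2) t] by simp
  \<comment> \<open>The integrals of \<open>N s (t - s)\<close> arise on both sides, from the weak
    equation and from the shift, and cancel.\<close>
  finally have 1: "(LBINT s:{0..t}. G s 0) - (LBINT s:{0..t}. N s 0) =
      (LBINT s:{0..t}. G s (t - s)) - ((\<integral>x. g x \<partial>\<nu> 0) - (\<integral>x. g (x - t) \<partial>\<nu> 0))"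
    by simp
  have "(\<lambda>x. g' x * indicator {0<..} x) = g'"
  proof
    show "g' x * indicator {0<..} x = g' x" for x
      using z(1)[of x] by (cases "0 < x") auto
  qed
  then have "(\<integral>x. g x \<partial>\<nu> t) = (\<integral>x. g x \<partial>\<nu> 0) + (LBINT s:{0..t}. G s 0 - N s 0)"
    using weak_equation[OF d(1) cg(2) b(1,2) t] by (simp add: G_def N_def)
  also have "(LBINT s:{0..t}. G s 0 - N s 0) = (LBINT s:{0..t}. G s 0) - (LBINT s:{0..t}. N s 0)"
    using int by simp
  finally show ?thesis using 1 by (simp add: G_def)
qed

text \<open>For \<open>a \<ge> 0\<close> the smooth step at \<open>a\<close> has derivatives
  vanishing on the nonpositive half-line, and its translate by \<open>r\<close> is the step at
  \<open>level a r\<close>: the Duhamel formula applies for every \<open>n\<close>. For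
  \<open>a < 0\<close> the step eventually lives where there is no drift and stays put. In both
  cases dominated convergence passes from steps to distribution functions.\<close>

theorem weak_solution_mild: "mild (\<nu> 0) \<nu> \<nu>"
  unfolding mild_def
proof (intro conjI allI impI weak_solution_half_line_kernel)
  fix t a :: real assume t: "0 \<le> t"
  have R: "real_distribution (\<nu> (max 0 s))" for s by (rule weak_solution_real_distribution) simp
  have RR: "real_distribution (\<nu> (max 0 s) \<star> \<nu> (max 0 s))" for s
    by (intro real_distribution_convolution R)
  have deriv: "(approx_step n a has_real_derivative real (Suc n) * smooth_step' (real (Suc n) * (x - a))) (at x)"
    "((\<lambda>x. real (Suc n) * smooth_step' (real (Suc n) * (x - a))) has_real_derivative
      real (Suc n) * (real (Suc n) * smooth_step'' (real (Suc n) * (x - a)))) (at x)" for n x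
  proof -
    have 1: "((\<lambda>x. real (Suc n) * (x - a)) has_real_derivative real (Suc n)) (at x)"
      by (auto intro!: derivative_eq_intros)
    show "(approx_step n a has_real_derivative real (Suc n) * smooth_step' (real (Suc n) * (x - a))) (at x)"
      using DERIV_chain2[OF DERIV_smooth_step 1] unfolding approx_step_def[abs_def] by (simp add: mult.commute)
    show "((\<lambda>x. real (Suc n) * smooth_step' (real (Suc n) * (x - a))) has_real_derivative
      real (Suc n) * (real (Suc n) * smooth_step'' (real (Suc n) * (x - a)))) (at x)"
      using DERIV_cmult[OF DERIV_chain2[OF DERIV_smooth_step' 1], of "real (Suc n)"] by (simp add: mult.commute)
  qed
  \<comment> \<open>Two differentiations produce the factor (n+1)^2; one common bound for the step
    and both derivatives is what the Duhamel formula asks for.\<close>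
  have bounds: "\<bar>approx_step n a x\<bar> \<le> 72 * (real (Suc n))\<^sup>2"
    "\<bar>real (Suc n) * smooth_step' (real (Suc n) * (x - a))\<bar> \<le> 72 * (real (Suc n))\<^sup>2"
    "\<bar>real (Suc n) * (real (Suc n) * smooth_step'' (real (Suc n) * (x - a)))\<bar> \<le> 72 * (real (Suc n))\<^sup>2" for n x
  proof -
    define m where "m = real (Suc n)"
    have m: "1 \<le> m" by (simp add: m_def)
    then have m2: "m * 1 \<le> m * m" by (intro mult_left_mono) auto
    show "\<bar>approx_step n a x\<bar> \<le> 72 * (real (Suc n))\<^sup>2"
      using approx_step_bounds(3)[of n a x] m m2 unfolding m_def[symmetric] power2_eq_square by linarith
    have "m * \<bar>smooth_step' (m * (x - a))\<bar> \<le> (m * m) * 72"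
      using m m2 smooth_step_bounds by (intro mult_mono) auto
    then show "\<bar>real (Suc n) * smooth_step' (real (Suc n) * (x - a))\<bar> \<le> 72 * (real (Suc n))\<^sup>2"
      using m unfolding m_def[symmetric] power2_eq_square by (simp add: abs_mult mult.commute)
    have "(m * m) * \<bar>smooth_step'' (m * (x - a))\<bar> \<le> (m * m) * 72"
      using smooth_step_bounds by (intro mult_left_mono) auto
    then show "\<bar>real (Suc n) * (real (Suc n) * smooth_step'' (real (Suc n) * (x - a)))\<bar> \<le> 72 * (real (Suc n))\<^sup>2"
      using m unfolding m_def[symmetric] power2_eq_square by (simp add: abs_mult mult_ac)
  qed
  have cont: "continuous_on UNIV (\<lambda>x. real (Suc n) * smooth_step' (real (Suc n) * (x - a)))"
    "continuous_on UNIV (\<lambda>x. real (Suc n) * (real (Suc n) * smooth_step'' (real (Suc n) * (x - a))))" for n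
    by (intro continuous_intros)+
  have E: "\<forall>\<^sub>F n in sequentially. (\<integral>x. approx_step n a x \<partial>\<nu> t) = (\<integral>x. approx_step n (level a t) x \<partial>\<nu> 0) +
    (LBINT s:{0..t}. source s (approx_step n (level a (t - s))))"
  proof (cases "0 \<le> a")
    case True
    have lev: "approx_step n a (x - r) = approx_step n (level a r) x" for n x r
      using True by (simp add: approx_step_def level_def algebra_simps)
    have "real (Suc n) * (x - a) \<le> 0" if "x \<le> 0" for n x
      using that True by (intro mult_nonneg_nonpos) auto
    then have "(\<integral>x. approx_step n a x \<partial>\<nu> t) = (\<integral>x. approx_step n (level a t) x \<partial>\<nu> 0) +
      (LBINT s:{0..t}. source s (approx_step n (level a (t - s))))" for n
      using duhamel[OF deriv cont(2) bounds _ _ t, of n] unfolding lev by simp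
    then show ?thesis by simp
  next
    case False
    then have "\<forall>\<^sub>F n in sequentially. inverse (real (Suc n)) < - a"
      by (intro order_tendstoD(2)[OF LIMSEQ_inverse_real_of_nat]) simp
    then show ?thesis
    proof eventually_elim
      case (elim n)
      \<comment> \<open>Now a + 1/(n+1) < 0: the whole transition zone is to the left of 0, so the
        derivative vanishes wherever the drift acts.\<close>
      then have n: "1 \<le> real (Suc n) * (- a)"
        by (simp add: inverse_eq_divide divide_less_eq mult.commute del: of_nat_Suc)
      have "(\<lambda>x. real (Suc n) * smooth_step' (real (Suc n) * (x - a)) * indicator {0<..} x) = (\<lambda>_. 0)"
      proof
        fix x :: real
        show "real (Suc n) * smooth_step' (real (Suc n) * (x - a)) * indicator {0<..} x = 0"
        proof (cases "0 < x")
          case True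
          then have "real (Suc n) * (- a) \<le> real (Suc n) * (x - a)" by (intro mult_left_mono) auto
          with n have "1 \<le> real (Suc n) * (x - a)" by (rule order_trans)
          then have "smooth_step' (real (Suc n) * (x - a)) = 0" by (rule smooth_step_ge_1)
          then show ?thesis by (simp only: mult_zero_right mult_zero_left)
        next
          case False
          then have "indicator {0<..} x = (0 :: real)" by (intro indicator_simps) simp
          then show ?thesis by (simp only: mult_zero_right)
        qed
      qed
      then have "(\<integral>x. approx_step n a x \<partial>\<nu> t) = (\<integral>x. approx_step n a x \<partial>\<nu> 0) +
          (LBINT s:{0..t}. source s (approx_step n a))"
        unfolding weak_equation[OF deriv(1) cont(1) bounds(1,2) t, of n]
        by (simp only: Bochner_Integration.integral_zero diff_zero)
      moreover have "level a r = a" for r using False by (simp add: level_def)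
      ultimately show ?case by (simp only:)
    qed
  qed
  have lim1: "(\<lambda>n. \<integral>x. approx_step n b x \<partial>\<nu> s) \<longlonglongrightarrow> cdf (\<nu> s) b" if "0 \<le> s" for b s
    by (rule real_distribution.approx_step_expectation_tendsto) (rule weak_solution_real_distribution that)+
  have lim2: "(\<lambda>n. source s (approx_step n b)) \<longlonglongrightarrow> cdf (\<nu> s \<star> \<nu> s) b - cdf (\<nu> s) b" if "0 \<le> s" for b s
    using tendsto_diff[OF real_distribution.approx_step_expectation_tendsto[OF RR[of s]]
        real_distribution.approx_step_expectation_tendsto[OF R[of s]]] that
    by (simp add: source_def max_absorb2)
  have lev_meas [measurable]: "level a \<in> borel_measurable borel"
    unfolding level_def[abs_def] by (cases "0 \<le> a") simp_all
  have lim3: "(\<lambda>n. LBINT s:{0..t}. source s (approx_step n (level a (t - s)))) \<longlonglongrightarrow>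
     (LBINT s:{0..t}. cdf (\<nu> s \<star> \<nu> s) (level a (t - s)) - cdf (\<nu> s) (level a (t - s)))"
    unfolding set_lebesgue_integral_def
  proof (rule integral_dominated_convergence[where w = "\<lambda>s. indicator {0..t} s * 2"])
    show m: "(\<lambda>s. indicator {0..t} s *\<^sub>R source s (approx_step n (level a (t - s)))) \<in> borel_measurable lborel" for n
    proof -
      have "(\<lambda>s. source s (\<lambda>x. approx_step n (level a (t - s)) x)) \<in> borel_measurable borel"
        by (rule measurable_source) measurable
      then show ?thesis by simp
    qed
    show lim: "AE s in lborel. (\<lambda>n. indicator {0..t} s *\<^sub>R source s (approx_step n (level a (t - s)))) \<longlonglongrightarrow>
       indicator {0..t} s *\<^sub>R (cdf (\<nu> s \<star> \<nu> s) (level a (t - s)) - cdf (\<nu> s) (level a (t - s)))"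
    proof (rule AE_I2)
      fix s
      show "(\<lambda>n. indicator {0..t} s *\<^sub>R source s (approx_step n (level a (t - s)))) \<longlonglongrightarrow>
       indicator {0..t} s *\<^sub>R (cdf (\<nu> s \<star> \<nu> s) (level a (t - s)) - cdf (\<nu> s) (level a (t - s)))"
      proof (cases "s \<in> {0..t}")
        case True
        then have "0 \<le> s" by simp
        from lim2[OF this] True show ?thesis by (simp only: indicator_simps scaleR_one)
      next
        case False
        then have i: "indicator {0..t} s = (0 :: real)" by (rule indicator_simps)
        show ?thesis unfolding i by (simp only: scaleR_zero_left tendsto_const)
      qed
    qed
    show "integrable lborel (\<lambda>s. indicator {0..t} s * 2 :: real)"
      by (intro integrable_mult_left) (simp add: emeasure_lborel_Icc_eq)
    show "AE s in lborel. norm (indicator {0..t} s *\<^sub>R source s (approx_step n (level a (t - s)))) \<le> indicator {0..t} s * 2" for n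
    proof (rule AE_I2)
      fix s
      have "\<bar>source s (approx_step n (level a (t - s)))\<bar> \<le> 2 * 1"
        by (rule abs_source_le) (rule approx_step_bounds)
      then show "norm (indicator {0..t} s *\<^sub>R source s (approx_step n (level a (t - s)))) \<le> indicator {0..t} s * 2"
        by (simp add: indicator_def)
    qed
    have "(\<lambda>s. indicator {0..t} s *\<^sub>R (cdf (\<nu> (max 0 s) \<star> \<nu> (max 0 s)) (level a (t - s)) -
        cdf (\<nu> (max 0 s)) (level a (t - s)))) \<in> borel_measurable lborel"
    proof -
      note k = weak_solution_half_line_kernel[unfolded half_line_kernel_def]
      have lv: "(\<lambda>s. level a (t - s)) \<in> borel_measurable borel"
        by (rule measurable_compose[OF _ lev_meas]) simp
      have ind: "(\<lambda>s. indicator {0..t} s :: real) \<in> borel_measurable borel" by simp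
      have "(\<lambda>s. cdf (\<nu> (max 0 s) \<star> \<nu> (max 0 s)) (level a (t - s)) - cdf (\<nu> (max 0 s)) (level a (t - s)))
          \<in> borel_measurable borel"
        by (rule borel_measurable_diff[OF
              measurable_cdf_kernel[OF measurable_convolution[OF k k] lv] measurable_cdf_kernel[OF k lv]])
      from borel_measurable_scaleR[OF ind this] show ?thesis by simp
    qed
    moreover have "indicator {0..t} s *\<^sub>R (cdf (\<nu> (max 0 s) \<star> \<nu> (max 0 s)) (level a (t - s)) -
        cdf (\<nu> (max 0 s)) (level a (t - s))) =
      indicator {0..t} s *\<^sub>R (cdf (\<nu> s \<star> \<nu> s) (level a (t - s)) - cdf (\<nu> s) (level a (t - s)))" for s
      by (simp add: indicator_def max_absorb2)
    ultimately show "(\<lambda>s. indicator {0..t} s *\<^sub>R (cdf (\<nu> s \<star> \<nu> s) (level a (t - s)) -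
        cdf (\<nu> s) (level a (t - s)))) \<in> borel_measurable lborel" by (simp only:)
  qed
  have "(\<lambda>n. \<integral>x. approx_step n a x \<partial>\<nu> t) \<longlonglongrightarrow> cdf (\<nu> 0) (level a t) +
      (LBINT s:{0..t}. cdf (\<nu> s \<star> \<nu> s) (level a (t - s)) - cdf (\<nu> s) (level a (t - s)))"
    by (rule Lim_transform_eventually[OF tendsto_add[OF lim1[OF order_refl] lim3]])
       (rule eventually_mono[OF E], rule sym)
  with lim1[OF t] show "cdf (\<nu> t) a = cdf (\<nu> 0) (level a t) +
      (LBINT s:{0..t}. cdf (\<nu> s \<star> \<nu> s) (level a (t - s)) - cdf (\<nu> s) (level a (t - s)))"
    by (rule LIMSEQ_unique)
qed

end

section \<open>Reflected paths\<close>

text \<open>The floor plus one gives grid points strictly to the right of \<open>max 0 s\<close>,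
  where right continuity applies; along each grid the path is a countable step function of
  \<open>s\<close>.\<close>

lemma measurable_right_continuous:
  fixes x :: "real \<Rightarrow> real"
  assumes x: "\<And>t. 0 \<le> t \<Longrightarrow> (x \<longlongrightarrow> x t) (at_right t)"
  shows "(\<lambda>s. x (max 0 s)) \<in> borel_measurable borel"
proof (rule borel_measurable_LIMSEQ_real)
  define c where "c n s = (real_of_int \<lfloor>real (Suc n) * max 0 s\<rfloor> + 1) / real (Suc n)" for n s
  show "(\<lambda>s. x (c n s)) \<in> borel_measurable borel" for n
  proof -
    have "(\<lambda>s. \<lfloor>real (Suc n) * max 0 s\<rfloor>) \<in> borel \<rightarrow>\<^sub>M count_space UNIV"
      by (rule measurable_compose[OF _ measurable_real_floor]) simp
    from measurable_compose[OF this, of "\<lambda>k. x ((real_of_int k + 1) / real (Suc n))" borel]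
    show ?thesis by (simp add: c_def)
  qed
  fix s :: real
  have gt: "max 0 s < c n s" and le: "c n s \<le> max 0 s + inverse (real (Suc n))" for n
  proof -
    define m w where "m = real (Suc n)" and "w = max 0 s"
    have m: "0 < m" by (simp add: m_def)
    have "m * w < real_of_int \<lfloor>m * w\<rfloor> + 1" by linarith
    with m show "max 0 s < c n s" unfolding c_def m_def[symmetric] w_def[symmetric]
      by (simp add: pos_less_divide_eq mult.commute)
    have "real_of_int \<lfloor>m * w\<rfloor> + 1 \<le> m * w + 1" by linarith
    with m show "c n s \<le> max 0 s + inverse (real (Suc n))"
      unfolding c_def m_def[symmetric] w_def[symmetric]
      by (simp add: pos_divide_le_eq distrib_left mult.commute)
  qed
  have lim: "(\<lambda>n. max 0 s + inverse (real (Suc n))) \<longlonglongrightarrow> max 0 s + 0"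
    by (intro tendsto_add tendsto_const LIMSEQ_inverse_real_of_nat)
  have "(\<lambda>n. c n s) \<longlonglongrightarrow> max 0 s"
  proof (rule tendsto_sandwich[OF _ _ tendsto_const])
    show "\<forall>\<^sub>F n in sequentially. max 0 s \<le> c n s"
      by (intro always_eventually allI less_imp_le gt)
    show "\<forall>\<^sub>F n in sequentially. c n s \<le> max 0 s + inverse (real (Suc n))"
      by (intro always_eventually allI le)
    show "(\<lambda>n. max 0 s + inverse (real (Suc n))) \<longlonglongrightarrow> max 0 s"
      using lim by (simp only: add_0_right)
  qed
  then have "filterlim (\<lambda>n. c n s) (at_right (max 0 s)) sequentially"
    by (rule tendsto_imp_filterlim_at_right) (intro always_eventually allI gt)
  then show "(\<lambda>n. x (c n s)) \<longlonglongrightarrow> x (max 0 s)"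
    by (rule filterlim_compose[OF x, rotated]) simp
qed

text \<open>The drift accumulated over [a, b]; for a single-server queue with workload
  \<open>x\<close> it is the busy time.\<close>

definition busy :: "(real \<Rightarrow> real) \<Rightarrow> real \<Rightarrow> real \<Rightarrow> real" where
  "busy x a b = (LBINT s:{a..b}. indicator {0<..} (x s))"

lemma set_integrable_busy:
  fixes x :: "real \<Rightarrow> real"
  assumes x: "\<And>t. 0 \<le> t \<Longrightarrow> (x \<longlongrightarrow> x t) (at_right t)" and "0 \<le> a"
  shows "set_integrable lborel {a..b} (\<lambda>s. indicator {0<..} (x s) :: real)"
proof -
  have "set_integrable lborel {a..b} (\<lambda>s. indicator {0<..} (x (max 0 s)) :: real)"
  proof (rule set_integrable_bounded_Icc[where C = 1])
    show "(\<lambda>s. indicator {0<..} (x (max 0 s)) :: real) \<in> borel_measurable borel"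
      by (rule measurable_compose[OF measurable_right_continuous[OF x]]) simp_all
  qed (simp add: indicator_def)
  moreover have "(\<lambda>s. indicator {a..b} s *\<^sub>R (indicator {0<..} (x (max 0 s)) :: real)) =
      (\<lambda>s. indicator {a..b} s *\<^sub>R indicator {0<..} (x s))"
  proof
    show "indicator {a..b} s *\<^sub>R (indicator {0<..} (x (max 0 s)) :: real) =
        indicator {a..b} s *\<^sub>R indicator {0<..} (x s)" for s
      using assms(2) by (cases "s \<in> {a..b}") (simp_all add: max_absorb2)
  qed
  ultimately show ?thesis by (simp only: set_integrable_def)
qed

lemma busy_split:
  fixes x :: "real \<Rightarrow> real"
  assumes x: "\<And>t. 0 \<le> t \<Longrightarrow> (x \<longlongrightarrow> x t) (at_right t)" and "0 \<le> a" "a \<le> b" "b \<le> c"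
  shows "busy x a c = busy x a b + busy x b c"
proof -
  have "busy x a c = (LBINT s:{a..b} \<union> {b..c}. indicator {0<..} (x s))"
    using assms by (simp add: busy_def ivl_disj_un_two_touch)
  also have "\<dots> = busy x a b + busy x b c"
    unfolding busy_def
  proof (rule set_integral_Un_AE)
    have "AE s in lborel. s \<noteq> b" by (rule AE_lborel_singleton)
    then show "AE s in lborel. \<not> (s \<in> {a..b} \<and> s \<in> {b..c})"
      by eventually_elim auto
  qed (use assms in \<open>auto intro!: set_integrable_busy[OF x]\<close>)
  finally show ?thesis .
qed

lemma busy_refl [simp]: "busy x a a = 0"
  by (simp only: busy_def set_integral_singleton)

lemma busy_bounds:
  fixes x :: "real \<Rightarrow> real"
  assumes x: "\<And>t. 0 \<le> t \<Longrightarrow> (x \<longlongrightarrow> x t) (at_right t)" and "0 \<le> a" "a \<le> b"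
  shows "0 \<le> busy x a b" "busy x a b \<le> b - a"
proof -
  show "0 \<le> busy x a b"
    unfolding busy_def set_lebesgue_integral_def by (rule Bochner_Integration.integral_nonneg) (simp add: indicator_def)
  have "\<bar>busy x a b\<bar> \<le> 1 * (b - a)"
    unfolding busy_def by (rule abs_set_integral_Icc_le) (use assms in \<open>simp_all add: indicator_def\<close>)
  then show "busy x a b \<le> b - a" by simp
qed

text \<open>The drift is nonincreasing in the state and both paths have the same jumps, so their
  difference is continuous and can only decrease where it is positive.\<close>

lemma reflected_path_le:
  fixes x :: "real \<Rightarrow> real"
  assumes x: "\<And>t. 0 \<le> t \<Longrightarrow> (x \<longlongrightarrow> x t) (at_right t)" "\<And>t. 0 \<le> t \<Longrightarrow> x t = z - busy x 0 t + J t"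
    and y: "\<And>t. 0 \<le> t \<Longrightarrow> (y \<longlongrightarrow> y t) (at_right t)" "\<And>t. 0 \<le> t \<Longrightarrow> y t = z - busy y 0 t + J t"
    and t: "0 \<le> t"
  shows "x t \<le> y t"
proof (rule ccontr)
  assume "\<not> x t \<le> y t"
  define d where "d s = busy y 0 s - busy x 0 s" for s
  have d_eq: "d s = x s - y s" if "0 \<le> s" for s
    using x(2)[OF that] y(2)[OF that] by (simp add: d_def)
  have incr: "d u - d s = busy y s u - busy x s u" if "0 \<le> s" "s \<le> u" for s u
    using busy_split[OF x(1), of 0 s u] busy_split[OF y(1), of 0 s u] that by (simp add: d_def)
  have lip: "\<bar>d u - d s\<bar> \<le> u - s" if "0 \<le> s" "s \<le> u" for s u
    using incr[OF that] busy_bounds[OF x(1) that] busy_bounds[OF y(1) that] by (simp add: abs_le_iff)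
  have "continuous_on {0..t} d"
  proof (rule lipschitz_on_continuous_on[of 1])
    show "1-lipschitz_on {0..t} d"
    proof (rule lipschitz_onI)
      fix s u assume "s \<in> {0..t}" "u \<in> {0..t}"
      then show "dist (d s) (d u) \<le> 1 * dist s u"
        using lip[of s u] lip[of u s] by (cases "s \<le> u") (simp_all add: dist_real_def abs_minus_commute)
    qed simp
  qed
  then have "closed {s \<in> {0..t}. d s \<le> 0}"
    by (intro continuous_on_closed_Collect_le) auto
  then have "compact {s \<in> {0..t}. d s \<le> 0}"
    by (intro compact_eq_bounded_closed[THEN iffD2] conjI) (auto intro: bounded_subset[of "{0..t}"])
  moreover have "0 \<in> {s \<in> {0..t}. d s \<le> 0}"
    using t by (simp add: d_def)
  ultimately obtain s where s: "s \<in> {0..t}" "d s \<le> 0" and max: "\<And>r. r \<in> {0..t} \<Longrightarrow> d r \<le> 0 \<Longrightarrow> r \<le> s"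
    using compact_attains_sup[of "{s \<in> {0..t}. d s \<le> 0}"] by blast
  \<comment> \<open>Since \<open>s\<close> is the last time with \<open>d \<le> 0\<close>, the path
    \<open>y\<close> is strictly below \<open>x\<close> on (s, t]; where \<open>y\<close> is
    positive, so is \<open>x\<close>. The difference therefore cannot grow after
    \<open>s\<close>.\<close>
  have "busy y s t \<le> busy x s t"
    unfolding busy_def set_lebesgue_integral_def
  proof (rule integral_mono_AE)
    show "integrable lborel (\<lambda>r. indicator {s..t} r *\<^sub>R (indicator {0<..} (y r) :: real))"
      "integrable lborel (\<lambda>r. indicator {s..t} r *\<^sub>R (indicator {0<..} (x r) :: real))"
      using set_integrable_busy[OF x(1), of s t] set_integrable_busy[OF y(1), of s t] s
      by (simp_all add: set_integrable_def)
    have "AE r in lborel. r \<noteq> s" by (rule AE_lborel_singleton)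
    then show "AE r in lborel. indicator {s..t} r *\<^sub>R (indicator {0<..} (y r) :: real) \<le>
        indicator {s..t} r *\<^sub>R indicator {0<..} (x r)"
    proof eventually_elim
      case (elim r)
      show ?case
      proof (cases "r \<in> {s..t}")
        case True
        with elim s have "0 \<le> r" "r \<le> t" "\<not> r \<le> s" by auto
        then have "0 < d r" using max[of r] by force
        then have "y r < x r" using d_eq[OF \<open>0 \<le> r\<close>] by simp
        then show ?thesis by (simp add: indicator_def)
      qed simp
    qed
  qed
  with incr[of s t] s have "d t \<le> 0" by simp
  with \<open>\<not> x t \<le> y t\<close> d_eq[OF t] show False by simp
qed

lemma reflected_path_unique:
  fixes x :: "real \<Rightarrow> real"
  assumes "\<And>t. 0 \<le> t \<Longrightarrow> (x \<longlongrightarrow> x t) (at_right t)" "\<And>t. 0 \<le> t \<Longrightarrow> x t = z - busy x 0 t + J t"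
    and "\<And>t. 0 \<le> t \<Longrightarrow> (y \<longlongrightarrow> y t) (at_right t)" "\<And>t. 0 \<le> t \<Longrightarrow> y t = z - busy y 0 t + J t"
    and "0 \<le> t"
  shows "x t = y t"
  by (rule antisym) (rule reflected_path_le[where J = J and z = z]; fact)+

text \<open>Skorokhod's reflection formula for \<open>z + J t - t\<close>; rational times and the time \<open>t\<close> itself
  suffice for the supremum, which makes adaptedness evident.\<close>

definition reflected :: "real \<Rightarrow> (real \<Rightarrow> real) \<Rightarrow> real \<Rightarrow> real" where
  "reflected z J t = max (z + J t - t) (SUP q\<in>insert t ({0..<t} \<inter> \<rat>). J t - J q - (t - q))"

text \<open>Reduces a pathwise identity to a single gap without interior jumps, a jump being booked
  at the right end of its gap. The induction counts the jumps strictly before \<open>t\<close> and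
  cuts at the last of them, so a jump at \<open>t\<close> itself falls into the final gap.\<close>

lemma telescope:
  fixes D :: "real set" and V :: "real \<Rightarrow> real"
  assumes "finite (D \<inter> {..t})" "D \<subseteq> {0<..}" "0 \<le> t"
    and step: "\<And>s u. 0 \<le> s \<Longrightarrow> s < u \<Longrightarrow> u \<le> t \<Longrightarrow> D \<inter> {s<..<u} = {} \<Longrightarrow>
        V u - V s = (if u \<in> D then c u else 0)"
  shows "V t - V 0 = sum c (D \<inter> {..t})"
  using assms
proof (induction "card (D \<inter> {..<t})" arbitrary: t rule: less_induct)
  case (less t)
  have fin: "finite (D \<inter> {..<t})" by (rule finite_subset[OF _ less.prems(1)]) auto
  have D_t: "D \<inter> {..t} = D \<inter> {..<t} \<union> (if t \<in> D then {t} else {})"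
    by (auto simp: less_le)
  have sum_t: "sum c (D \<inter> {..t}) = sum c (D \<inter> {..<t}) + (if t \<in> D then c t else 0)"
    unfolding D_t using fin by (subst sum.union_disjoint) auto
  show ?case
  proof (cases "t = 0")
    case True
    with less.prems have "D \<inter> {..t} = {}" by auto
    then have "sum c (D \<inter> {..t}) = 0" by simp
    with True show ?thesis by simp
  next
    case False
    with less.prems have t: "0 < t" by simp
    show ?thesis
    proof (cases "D \<inter> {..<t} = {}")
      case True
      then have "D \<inter> {0<..<t} = {}" by auto
      with less.prems(4)[of 0 t] t True sum_t show ?thesis by simp
    next
      case False
      define s where "s = Max (D \<inter> {..<t})"
      have s: "s \<in> D \<inter> {..<t}" unfolding s_def using fin False by (rule Max_in)
      have s_max: "r \<le> s" if "r \<in> D \<inter> {..<t}" for r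
        unfolding s_def using fin that by (rule Max_ge)
      have s0: "0 < s" using s less.prems(2) by auto
      have eq: "D \<inter> {..s} = D \<inter> {..<t}" using s s_max by fastforce
      have "D \<inter> {..<s} \<subset> D \<inter> {..<t}" using s by auto
      then have "card (D \<inter> {..<s}) < card (D \<inter> {..<t})" using fin by (rule psubset_card_mono[rotated])
      moreover have "finite (D \<inter> {..s})" using eq fin by simp
      ultimately have "V s - V 0 = sum c (D \<inter> {..s})"
        using s s0 less.prems by (intro less.hyps) auto
      moreover have "D \<inter> {s<..<t} = {}" using s_max by fastforce
      then have "V t - V s = (if t \<in> D then c t else 0)"
        using s s0 less.prems by (intro less.prems(4)) auto
      ultimately show ?thesis using sum_t eq by simp
    qed
  qed
qed

section \<open>Paths driven by locally finitely many jumps\<close>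

locale jump_path =
  fixes D :: "real set" and j :: "real \<Rightarrow> real" and z :: real
  assumes D: "\<And>t. finite (D \<inter> {..t})" "D \<subseteq> {0<..}" and j: "\<And>s. 0 \<le> j s" and z: "0 \<le> z"
begin

definition J :: "real \<Rightarrow> real" where "J t = sum j (D \<inter> {..t})"

abbreviation X :: "real \<Rightarrow> real" where "X \<equiv> reflected z J"

lemma J_nonneg: "0 \<le> J t"
  unfolding J_def by (intro sum_nonneg j)

lemma J_mono: "s \<le> t \<Longrightarrow> J s \<le> J t"
  unfolding J_def by (intro sum_mono2 D j) auto

lemma J_0: "J 0 = 0"
proof -
  have "D \<inter> {..0} = {}" using D(2) by auto
  then show ?thesis by (simp add: J_def)
qed

lemma J_step:
  assumes "s < u" "D \<inter> {s<..<u} = {}"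
  shows "J u - J s = (if u \<in> D then j u else 0)"
proof -
  have eq: "D \<inter> {..u} = (if u \<in> D then insert u (D \<inter> {..s}) else D \<inter> {..s})"
  proof (rule set_eqI)
    fix r
    have "r \<notin> D" if "s < r" "r < u" using assms that by auto
    then show "r \<in> D \<inter> {..u} \<longleftrightarrow> r \<in> (if u \<in> D then insert u (D \<inter> {..s}) else D \<inter> {..s})"
      using assms(1) by (cases "r \<le> s"; cases "r = u"; cases "r < u") auto
  qed
  show ?thesis unfolding J_def eq using assms(1) D(1)[of s] by simp
qed

lemma J_const:
  assumes "s \<le> r" "r < u" "D \<inter> {s<..<u} = {}" shows "J r = J s"
proof -
  have "D \<inter> {..r} = D \<inter> {..s}" using assms by force
  then show ?thesis by (simp add: J_def)
qed

lemma bdd_above_reflected: "bdd_above ((\<lambda>q. J t - J q - (t - q)) ` insert t ({0..<t} \<inter> \<rat>))"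
proof (rule bdd_aboveI2)
  fix q assume "q \<in> insert t ({0..<t} \<inter> \<rat>)"
  then have "q \<le> t" by auto
  with J_nonneg[of q] show "J t - J q - (t - q) \<le> J t" by simp
qed

lemma reflected_ge:
  "z + J t - t \<le> X t" "q \<in> insert t ({0..<t} \<inter> \<rat>) \<Longrightarrow> J t - J q - (t - q) \<le> X t"
proof -
  show "z + J t - t \<le> X t" unfolding reflected_def by simp
  show "J t - J q - (t - q) \<le> X t" if "q \<in> insert t ({0..<t} \<inter> \<rat>)"
    unfolding reflected_def by (rule max.coboundedI2) (rule cSUP_upper[OF that bdd_above_reflected])
qed

lemma reflected_le:
  assumes "z + J t - t \<le> y" "\<And>q. q \<in> insert t ({0..<t} \<inter> \<rat>) \<Longrightarrow> J t - J q - (t - q) \<le> y"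
  shows "X t \<le> y"
  unfolding reflected_def by (intro max.boundedI assms(1) cSUP_least assms(2)) auto

lemma X_nonneg: "0 \<le> X t"
  using reflected_ge(2)[of t t] by simp

lemma X_0: "X 0 = z"
  by (rule antisym; (rule reflected_le)?) (use z reflected_ge(1)[of 0] in \<open>auto simp: J_0\<close>)

text \<open>On a gap the path drifts down at unit speed, is stopped at 0, and receives a possible
  jump at the right end. In the supremum, times before \<open>s\<close> reproduce
  \<open>X s\<close>, while a time inside the gap contributes at most the jump at
  \<open>u\<close>.\<close>

lemma X_step:
  assumes s: "0 \<le> s" "s < u" and no: "D \<inter> {s<..<u} = {}"
  shows "X u = max 0 (X s - (u - s)) + (J u - J s)"
proof (rule antisym)
  show "X u \<le> max 0 (X s - (u - s)) + (J u - J s)"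
  proof (rule reflected_le)
    show "z + J u - u \<le> max 0 (X s - (u - s)) + (J u - J s)"
      using reflected_ge(1)[of s] by simp
    fix q assume q: "q \<in> insert u ({0..<u} \<inter> \<rat>)"
    have m: "J s \<le> J u" using s by (intro J_mono) simp
    consider "q = u" | "s \<le> q" "q < u" | "q \<in> {0..<s} \<inter> \<rat>" using q by fastforce
    then show "J u - J q - (u - q) \<le> max 0 (X s - (u - s)) + (J u - J s)"
    proof cases
      case 1 with m show ?thesis by simp
    next
      case 2
      with J_const[OF 2 no] show ?thesis by simp
    next
      case 3
      then have "J s - J q - (s - q) \<le> X s" by (intro reflected_ge) simp
      then show ?thesis by simp
    qed
  qed
  have "X s - (u - s) + (J u - J s) \<le> X u"
  proof -
    have "X s \<le> X u + (u - s) - (J u - J s)"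
    proof (rule reflected_le)
      show "z + J s - s \<le> X u + (u - s) - (J u - J s)" using reflected_ge(1)[of u] by simp
      fix q assume q: "q \<in> insert s ({0..<s} \<inter> \<rat>)"
      show "J s - J q - (s - q) \<le> X u + (u - s) - (J u - J s)"
      proof (cases "q = s")
        case False
        with q s have "q \<in> insert u ({0..<u} \<inter> \<rat>)" by auto
        from reflected_ge(2)[OF this] show ?thesis by simp
      next
        case True
        \<comment> \<open>The time \<open>s\<close> itself need not be rational; rational times just
          after it serve instead, as \<open>J\<close> is constant on the gap. The same device works
          just before \<open>u\<close> further down.\<close>
        have "J u - J s - (u - s) \<le> X u"
        proof (rule field_le_epsilon)
          fix e :: real assume "0 < e"
          then obtain p where p: "p \<in> \<rat>" "s < p" "p < min u (s + e)"
            using Rats_dense_in_real[of s "min u (s + e)"] s by auto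
          then have "J u - J p - (u - p) \<le> X u" using s by (intro reflected_ge) auto
          moreover have "J p = J s" using p by (intro J_const[OF _ _ no]) auto
          ultimately show "J u - J s - (u - s) \<le> X u + e" using p by auto
        qed
        with True show ?thesis by simp
      qed
    qed
    then show ?thesis by simp
  qed
  moreover have "J u - J s \<le> X u"
  proof (rule field_le_epsilon)
    fix e :: real assume "0 < e"
    then obtain p where p: "p \<in> \<rat>" "max s (u - e) < p" "p < u"
      using Rats_dense_in_real[of "max s (u - e)" u] s by auto
    then have "J u - J p - (u - p) \<le> X u" using s by (intro reflected_ge) auto
    moreover have "J p = J s" using p by (intro J_const[OF _ _ no]) auto
    ultimately show "J u - J s \<le> X u + e" using p by auto
  qed
  ultimately show "max 0 (X s - (u - s)) + (J u - J s) \<le> X u" by (simp add: max_def)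
qed

lemma gap_right: obtains e where "0 < e" "D \<inter> {t<..<t + e} = {}"
proof (cases "D \<inter> {t<..t + 1} = {}")
  case True
  then have "D \<inter> {t<..<t + 1} = {}" by auto
  then show thesis by (intro that[of 1]) auto
next
  case False
  have fin: "finite (D \<inter> {t<..t + 1})" by (rule finite_subset[OF _ D(1)[of "t + 1"]]) auto
  define m where "m = Min (D \<inter> {t<..t + 1})"
  have "m \<in> D \<inter> {t<..t + 1}" unfolding m_def using fin False by (rule Min_in)
  moreover have "m \<le> r" if "r \<in> D \<inter> {t<..t + 1}" for r
    unfolding m_def using fin that by (rule Min_le)
  ultimately show thesis by (intro that[of "m - t"]) fastforce+
qed

lemma gap_left: assumes "0 < t" obtains s where "0 \<le> s" "s < t" "D \<inter> {s<..<t} = {}"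
proof (cases "D \<inter> {..<t} = {}")
  case True
  then have "D \<inter> {0<..<t} = {}" by auto
  with assms show thesis by (intro that[of 0]) auto
next
  case False
  have fin: "finite (D \<inter> {..<t})" by (rule finite_subset[OF _ D(1)[of t]]) auto
  define m where "m = Max (D \<inter> {..<t})"
  have "m \<in> D \<inter> {..<t}" unfolding m_def using fin False by (rule Max_in)
  moreover have "r \<le> m" if "r \<in> D \<inter> {..<t}" for r
    unfolding m_def using fin that by (rule Max_ge)
  ultimately show thesis using D(2) by (intro that[of m]) fastforce+
qed

lemma X_right_continuous: assumes "0 \<le> t" shows "(X \<longlongrightarrow> X t) (at_right t)"
proof -
  obtain e where e: "0 < e" "D \<inter> {t<..<t + e} = {}" by (rule gap_right)
  have "((\<lambda>r. max 0 (X t - (r - t))) \<longlongrightarrow> max 0 (X t - (t - t))) (at_right t)"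
    by (intro tendsto_intros)
  moreover have "\<forall>\<^sub>F r in at_right t. X r = max 0 (X t - (r - t))"
    unfolding eventually_at_right_field
  proof (intro exI conjI allI impI)
    show "t < t + e" using e by simp
    fix r assume r: "t < r" "r < t + e"
    then have "D \<inter> {t<..<r} = {}" "r \<notin> D" using e by auto
    with X_step[OF assms r(1)] J_step[OF r(1)] show "X r = max 0 (X t - (r - t))" by simp
  qed
  ultimately show ?thesis using X_nonneg[of t] by (simp add: tendsto_cong max_absorb2)
qed

lemma X_left_limit:
  assumes "0 < t" shows "(X \<longlongrightarrow> X t - (if t \<in> D then j t else 0)) (at_left t)"
proof -
  obtain s where s: "0 \<le> s" "s < t" "D \<inter> {s<..<t} = {}" by (rule gap_left[OF assms])
  have "((\<lambda>r. max 0 (X s - (r - s))) \<longlongrightarrow> max 0 (X s - (t - s))) (at_left t)"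
    by (intro tendsto_intros)
  moreover have "\<forall>\<^sub>F r in at_left t. X r = max 0 (X s - (r - s))"
    unfolding eventually_at_left_field
  proof (intro exI conjI allI impI)
    show "s < t" by fact
    fix r assume r: "s < r" "r < t"
    then have "D \<inter> {s<..<r} = {}" "r \<notin> D" using s by auto
    with X_step[OF s(1) r(1)] J_step[OF r(1)] show "X r = max 0 (X s - (r - s))" by simp
  qed
  moreover have "max 0 (X s - (t - s)) = X t - (if t \<in> D then j t else 0)"
    using X_step[OF s] J_step[OF s(2,3)] by simp
  ultimately show ?thesis by (simp add: tendsto_cong)
qed

lemma cadlag_X: "cadlag X"
  unfolding cadlag_def using X_right_continuous X_left_limit by blast

lemma busy_step:
  assumes s: "0 \<le> s" "s < u" and no: "D \<inter> {s<..<u} = {}"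
  shows "busy X s u = X s - max 0 (X s - (u - s))"
proof -
  \<comment> \<open>The time at which the path reaches 0, capped at the end of the gap; the path is
    positive strictly between \<open>s\<close> and \<open>v\<close> and vanishes between
    \<open>v\<close> and \<open>u\<close>.\<close>
  define v where "v = min u (s + X s)"
  have v: "s \<le> v" using s X_nonneg[of s] by (simp add: v_def)
  have "busy X s u = (LBINT r. indicator {s..v} r)"
    unfolding busy_def set_lebesgue_integral_def
  proof (rule integral_cong_AE)
    show "(\<lambda>r. indicator {s..u} r *\<^sub>R (indicator {0<..} (X r) :: real)) \<in> borel_measurable lborel"
      using set_integrable_busy[OF X_right_continuous s(1)]
      by (auto simp: set_integrable_def dest: borel_measurable_integrable)
    have "AE r in lborel. r \<noteq> u" "AE r in lborel. r \<noteq> v" "AE r in lborel. r \<noteq> s" by (rule AE_lborel_singleton)+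
    then show "AE r in lborel. indicator {s..u} r *\<^sub>R (indicator {0<..} (X r) :: real) = indicator {s..v} r"
    proof eventually_elim
      case (elim r)
      show ?case
      proof (cases "s < r \<and> r < u")
        case True
        then have "D \<inter> {s<..<r} = {}" "r \<notin> D" using no by auto
        with X_step[OF s(1), of r] J_step[of s r] True have "X r = max 0 (X s - (r - s))" by simp
        with True elim show ?thesis by (auto simp: indicator_def v_def)
      qed (use elim v in \<open>auto simp: indicator_def v_def\<close>)
    qed
  qed simp
  also have "\<dots> = v - s" using v by simp
  finally show ?thesis by (auto simp: v_def)
qed

text \<open>On each gap the decrease of the path equals its busy time, so path plus busy time
  changes only by the jumps and telescopes.\<close>

lemma X_equation: assumes "0 \<le> t" shows "X t = z - busy X 0 t + J t"
proof -
  have "(X t + busy X 0 t) - (X 0 + busy X 0 0) = sum j (D \<inter> {..t})"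
  proof (rule telescope[OF D assms])
    fix s u assume s: "0 \<le> s" "s < u" "u \<le> t" "D \<inter> {s<..<u} = {}"
    have "busy X 0 u = busy X 0 s + busy X s u"
      by (rule busy_split[OF X_right_continuous]) (use s in auto)
    with busy_step[of s u] X_step[of s u] J_step[of s u] s
    show "X u + busy X 0 u - (X s + busy X 0 s) = (if u \<in> D then j u else 0)" by simp
  qed
  moreover have "busy X 0 0 = 0" by simp
  ultimately show ?thesis by (simp add: X_0 J_def)
qed

text \<open>Between jumps \<open>X r \<le> a + t - r\<close> does not depend on \<open>r\<close>, since the barrier moves along a
  characteristic of the drift.\<close>

lemma indicator_telescope:
  assumes "0 \<le> a" "0 \<le> t"
  shows "indicator {..a} (X t) - indicator {..a + t} z =
    (\<Sum>s\<in>D \<inter> {..t}. indicator {..a + t - s} (X s) - indicator {..a + t - s} (X s - j s) :: real)"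
proof -
  have "indicator {..a + t - t} (X t) - indicator {..a + t - 0} (X 0) =
    (\<Sum>s\<in>D \<inter> {..t}. indicator {..a + t - s} (X s) - indicator {..a + t - s} (X s - j s) :: real)"
  proof (rule telescope[OF D assms(2), where V = "\<lambda>r. indicator {..a + t - r} (X r)"])
    fix s u assume s: "0 \<le> s" "s < u" "u \<le> t" "D \<inter> {s<..<u} = {}"
    have "X u - (if u \<in> D then j u else 0) = max 0 (X s - (u - s))"
      using X_step[of s u] J_step[of s u] s by simp
    then have "X u - (if u \<in> D then j u else 0) \<le> a + t - u \<longleftrightarrow> X s \<le> a + t - s"
      using s assms by auto
    then show "indicator {..a + t - u} (X u) - indicator {..a + t - s} (X s) =
        (if u \<in> D then indicator {..a + t - u} (X u) - indicator {..a + t - u} (X u - j u) else 0 :: real)"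
      by (auto simp: indicator_def)
  qed
  then show ?thesis by (simp add: X_0)
qed

end

section \<open>Atoms of the driving point process\<close>

text \<open>Integer values below 1 are 0. Hence each atom weighs at least 1 and there are at most as
  many atoms as the total mass. Around any other point the masses of shrinking balls tend to 0, so
  some ball has mass 0 off the atoms; by the Lindelof property countably many such balls cover the
  remainder.\<close>

lemma integer_valued_finite_atoms:
  fixes m :: "'a::{second_countable_topology, metric_space} measure"
  assumes s: "sets m = sets (restrict_space borel S)" and A: "A \<in> sets m" and fin: "emeasure m A < \<infinity>"
    and int: "\<And>B. B \<in> sets m \<Longrightarrow> emeasure m B \<in> insert \<infinity> (range of_nat)"
  shows "finite {p\<in>A. emeasure m {p} \<noteq> 0}" "emeasure m (A - {p\<in>A. emeasure m {p} \<noteq> 0}) = 0"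
proof -
  define F where "F = {p\<in>A. emeasure m {p} \<noteq> 0}"
  have sp: "space m = S" using sets_eq_imp_space_eq[OF s] by (simp add: space_restrict_space)
  have A_S: "A \<subseteq> S" using sets.sets_into_space[OF A] sp by simp
  have single: "{p} \<in> sets m" if "p \<in> A" for p
    unfolding s using that A_S by (auto simp: sets_restrict_space intro!: image_eqI[of _ _ "{p}"])
  have less1: "emeasure m B = 0" if "B \<in> sets m" "emeasure m B < 1" for B
  proof -
    from int[OF that(1)] that(2) obtain k :: nat where "emeasure m B = of_nat k" by auto
    with that(2) show ?thesis by (cases k) (auto simp: of_nat_less_1_iff[symmetric] less_le_not_le)
  qed
  obtain n :: nat where n: "emeasure m A = of_nat n" using int[OF A] fin by auto
  have "card G \<le> n" if G: "G \<subseteq> F" "finite G" for G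
  proof -
    have "of_nat (card G) = (\<Sum>p\<in>G. 1 :: ennreal)" by simp
    also have "\<dots> \<le> (\<Sum>p\<in>G. emeasure m {p})"
      using G single less1 by (intro sum_mono) (fastforce simp: F_def not_less[symmetric])
    also have "\<dots> = emeasure m G"
      using G single by (intro emeasure_eq_sum_singleton[symmetric]) (auto simp: F_def)
    also have "\<dots> \<le> emeasure m A"
      using G A by (intro emeasure_mono) (auto simp: F_def)
    finally show ?thesis by (simp add: n)
  qed
  then have finF: "finite F" using finite_if_finite_subsets_card_bdd[of F n] by blast
  then show "finite {p\<in>A. emeasure m {p} \<noteq> 0}" by (simp add: F_def)
  have F_sets: "F \<in> sets m"
  proof -
    have "(\<Union>p\<in>F. {p}) \<in> sets m" by (rule sets.finite_UN[OF finF]) (rule single, simp add: F_def)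
    then show ?thesis by simp
  qed
  define B where "B = A - F"
  have B: "B \<in> sets m" using A F_sets by (simp add: B_def)
  have Bb: "B \<inter> ball p r \<in> sets m" for p r
  proof -
    have "S \<inter> ball p r \<in> sets m" unfolding s sets_restrict_space by (rule imageI) simp
    with B have "B \<inter> (S \<inter> ball p r) \<in> sets m" by (rule sets.Int)
    moreover have "B \<inter> (S \<inter> ball p r) = B \<inter> ball p r" using A_S by (auto simp: B_def)
    ultimately show ?thesis by simp
  qed
  have "\<exists>r>0. emeasure m (B \<inter> ball p r) = 0" if p: "p \<in> B" for p
  proof -
    let ?U = "\<lambda>n. B \<inter> ball p (inverse (real (Suc n)))"
    have "(\<lambda>n. emeasure m (?U n)) \<longlonglongrightarrow> emeasure m (\<Inter>n. ?U n)"
    proof (rule Lim_emeasure_decseq)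
      show "decseq ?U"
      proof (rule decseq_SucI)
        fix n
        have "inverse (real (Suc (Suc n))) \<le> inverse (real (Suc n))"
          by (rule le_imp_inverse_le) auto
        then show "?U (Suc n) \<subseteq> ?U n" by (intro Int_mono subset_refl subset_ball)
      qed
      show "emeasure m (?U n) \<noteq> \<infinity>" for n
      proof -
        have "emeasure m (?U n) \<le> emeasure m A" using A by (intro emeasure_mono) (auto simp: B_def)
        with fin show ?thesis by (auto simp: top_unique)
      qed
    qed (use Bb in auto)
    moreover have "(\<Inter>n. ?U n) = {p}"
    proof (intro equalityI subsetI)
      fix q assume q: "q \<in> (\<Inter>n. ?U n)"
      then have "dist p q < inverse (real (Suc n))" for n by auto
      with LIMSEQ_inverse_real_of_nat have "dist p q \<le> 0"
        by (intro LIMSEQ_le_const[of "\<lambda>n. inverse (real (Suc n))"]) (auto intro: less_imp_le simp del: of_nat_Suc)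
      then show "q \<in> {p}" by simp
    qed (use p in auto)
    moreover have "emeasure m {p} = 0" using p by (auto simp: B_def F_def)
    ultimately have "(\<lambda>n. emeasure m (?U n)) \<longlonglongrightarrow> 0" by simp
    then have "\<forall>\<^sub>F n in sequentially. emeasure m (?U n) < 1" by (rule order_tendstoD) simp
    then obtain n where "emeasure m (?U n) < 1" by (auto simp: eventually_sequentially)
    with less1[OF Bb] show ?thesis by (intro exI[of _ "inverse (real (Suc n))"]) simp
  qed
  then obtain r where r: "\<And>p. p \<in> B \<Longrightarrow> 0 < r p \<and> emeasure m (B \<inter> ball p (r p)) = 0" by metis
  obtain U where U: "U \<subseteq> (\<lambda>p. ball p (r p)) ` B" "countable U" "\<Union>U = \<Union>((\<lambda>p. ball p (r p)) ` B)"
    by (rule Lindelof[of "(\<lambda>p. ball p (r p)) ` B"]) auto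
  have "(\<Union>u\<in>U. B \<inter> u) \<in> null_sets m"
    using U r Bb by (intro null_sets_UN' U(2)) (auto simp: null_sets_def)
  moreover have "B \<subseteq> \<Union>U" unfolding U(3) using r by force
  then have "(\<Union>u\<in>U. B \<inter> u) = B" by auto
  ultimately show "emeasure m (A - {p\<in>A. emeasure m {p} \<noteq> 0}) = 0"
    by (simp add: null_sets_def B_def F_def)
qed

lemma nn_integral_finite_atoms:
  assumes A: "A \<in> sets m" and F: "finite F" "F \<subseteq> A" "\<And>p. p \<in> F \<Longrightarrow> {p} \<in> sets m"
    and null: "emeasure m (A - F) = 0"
  shows "(\<integral>\<^sup>+p. f p * indicator A p \<partial>m) = (\<Sum>p\<in>F. f p * emeasure m {p})"
proof -
  have "(\<Union>p\<in>F. {p}) \<in> sets m" by (rule sets.finite_UN[OF F(1)]) (rule F(3))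
  then have F_sets: "F \<in> sets m" by simp
  have "A - F \<in> null_sets m" using null A F_sets by (auto simp: null_sets_def)
  then have "AE p in m. p \<notin> A - F" by (rule AE_not_in)
  then have "(\<integral>\<^sup>+p. f p * indicator A p \<partial>m) = (\<integral>\<^sup>+p. (\<Sum>q\<in>F. f q * indicator {q} p) \<partial>m)"
  proof (intro nn_integral_cong_AE, eventually_elim)
    case (elim p)
    show ?case
    proof (cases "p \<in> F")
      case True
      then have "(\<Sum>q\<in>F. f q * indicator {q} p) = (\<Sum>q\<in>F. if q = p then f p else 0)"
        by (intro sum.cong) (auto simp: indicator_def)
      with True F show ?thesis by (auto simp: sum.delta indicator_def)
    next
      case False
      then have "(\<Sum>q\<in>F. f q * indicator {q} p) = 0" by (intro sum.neutral) (auto simp: indicator_def)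
      with False elim show ?thesis by (auto simp: indicator_def)
    qed
  qed
  also have "\<dots> = (\<Sum>q\<in>F. f q * emeasure m {q})"
    using F by (subst nn_integral_sum) (auto simp: nn_integral_cmult_indicator)
  finally show ?thesis .
qed

section \<open>Counts of the driving Poisson process\<close>

abbreviation strip :: "real \<Rightarrow> (real \<times> real) set" where
  "strip t \<equiv> {0..t} \<times> {0..1}"

lemma sets_strip_iff: "A \<in> sets strip_intensity \<longleftrightarrow> A \<in> sets borel \<and> A \<subseteq> {0..} \<times> {0..1}"
proof -
  have "{0..} \<times> {0..1} \<in> sets (lborel :: (real \<times> real) measure)"
    by (simp add: borel_prod[symmetric])
  then show ?thesis by (simp add: strip_intensity_def sets_restrict_space_iff conj_commute)
qed

lemma emeasure_strip: "A \<in> sets strip_intensity \<Longrightarrow> emeasure strip_intensity A = emeasure lborel A"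
  unfolding strip_intensity_def sets_strip_iff[unfolded strip_intensity_def]
  by (subst emeasure_restrict_space) (auto simp: borel_prod[symmetric])

lemma Times_in_strip:
  assumes "A \<in> sets borel" "B \<in> sets borel" "A \<subseteq> {0..}" "B \<subseteq> {0..1}"
  shows "A \<times> B \<in> sets strip_intensity"
  using assms by (auto simp: sets_strip_iff borel_prod[symmetric])

lemma emeasure_lborel_Times:
  "A \<in> sets borel \<Longrightarrow> B \<in> sets borel \<Longrightarrow>
    emeasure (lborel :: (real \<times> real) measure) (A \<times> B) = emeasure lborel A * emeasure lborel B"
  unfolding lborel_prod[symmetric] by (rule lborel.emeasure_pair_measure_Times) auto

lemma poisson_mean_sums: "(\<lambda>k. real k * (exp (- l) * l ^ k / fact k)) sums l"
proof -
  have "(\<lambda>k. l * exp (- l) * (l ^ k /\<^sub>R fact k)) sums (l * exp (- l) * exp l)"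
    by (intro sums_mult exp_converges)
  moreover have "l * exp (- l) * exp l = l" by (simp add: exp_minus)
  moreover have "l * exp (- l) * (l ^ k /\<^sub>R fact k) = real (Suc k) * (exp (- l) * l ^ Suc k / fact (Suc k))" for k
    by (simp add: divide_simps)
  ultimately have "(\<lambda>k. real (Suc k) * (exp (- l) * l ^ Suc k / fact (Suc k))) sums l" by (simp only:)
  from sums_Suc[OF this] show ?thesis by simp
qed

lemma poisson_total_sums: "(\<lambda>k. exp (- l) * l ^ k / fact k) sums (1 :: real)"
proof -
  have "(\<lambda>k. exp (- l) * (l ^ k /\<^sub>R fact k)) sums (exp (- l) * exp l)"
    by (intro sums_mult exp_converges)
  then show ?thesis by (simp add: exp_minus divide_inverse mult_ac)
qed

locale driven =
  fixes \<mu>\<^sub>0 :: "real measure" and M :: "'a measure" and X\<^sub>0 :: "'a \<Rightarrow> real"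
    and N :: "'a \<Rightarrow> (real \<times> real) measure"
  assumes driving: "driving_data \<mu>\<^sub>0 M X\<^sub>0 N"
begin

sublocale prob_space M
  using driving by (simp add: driving_data_def)

lemma X0_measurable [measurable]: "X\<^sub>0 \<in> borel_measurable M"
  and distr_X0: "distr M borel X\<^sub>0 = \<mu>\<^sub>0"
  using driving by (simp_all add: driving_data_def)

lemma poisson: "poisson_point_process M strip_intensity N"
  using driving by (simp add: driving_data_def)

lemma sets_N: "\<omega> \<in> space M \<Longrightarrow> sets (N \<omega>) = sets strip_intensity"
  using poisson by (simp add: poisson_point_process_def point_process_def)

lemma N_integer: "\<omega> \<in> space M \<Longrightarrow> A \<in> sets strip_intensity \<Longrightarrow> emeasure (N \<omega>) A \<in> insert \<infinity> (range of_nat)"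
  using poisson by (simp add: poisson_point_process_def point_process_def)

lemma N_measurable: "A \<in> sets strip_intensity \<Longrightarrow> (\<lambda>\<omega>. emeasure (N \<omega>) A) \<in> borel_measurable M"
  using poisson by (simp add: poisson_point_process_def point_process_def)

lemma prob_N:
  assumes "A \<in> sets strip_intensity" "emeasure lborel A < \<infinity>"
  shows "prob {\<omega>\<in>space M. emeasure (N \<omega>) A = of_nat k} =
    exp (- measure lborel A) * measure lborel A ^ k / fact k"
proof -
  have "measure strip_intensity A = measure lborel A"
    using emeasure_strip[OF assms(1)] by (simp add: measure_def)
  with poisson assms emeasure_strip[OF assms(1)] show ?thesis
    by (simp add: poisson_point_process_def)
qed

lemma indep_N:
  fixes A :: "nat \<Rightarrow> (real \<times> real) set"
  shows "A ` {..<n} \<subseteq> sets strip_intensity \<Longrightarrow> disjoint_family_on A {..<n} \<Longrightarrow>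
    indep_vars (\<lambda>_. borel) (\<lambda>i \<omega>. emeasure (N \<omega>) (A i)) {..<n}"
  using poisson by (simp add: poisson_point_process_def)

lemma indep_X0_N:
  "indep_set {X\<^sub>0 -` B \<inter> space M | B. B \<in> sets borel}
     (sigma_sets (space M) (counting_events M strip_intensity N UNIV))"
  using driving by (simp add: driving_data_def)

text \<open>The Poisson weights sum to 1, which leaves no probability for an infinite count.\<close>

lemma AE_N_finite:
  assumes A: "A \<in> sets strip_intensity" "emeasure lborel A < \<infinity>"
  shows "AE \<omega> in M. \<exists>k::nat. emeasure (N \<omega>) A = of_nat k"
proof -
  let ?E = "\<lambda>k::nat. {\<omega>\<in>space M. emeasure (N \<omega>) A = of_nat k}"
  have E: "range ?E \<subseteq> events" using N_measurable[OF A(1)] by auto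
  have "disjoint_family ?E" by (auto simp: disjoint_family_on_def)
  from finite_measure_UNION[OF E this]
  have "(\<lambda>k. prob (?E k)) sums prob (\<Union>k. ?E k)" .
  moreover have "(\<lambda>k. prob (?E k)) sums 1"
    unfolding prob_N[OF A] by (rule poisson_total_sums)
  ultimately have "prob (\<Union>k. ?E k) = 1" by (rule sums_unique2)
  then have "AE \<omega> in M. \<omega> \<in> (\<Union>k. ?E k)"
    using E by (subst (asm) prob_eq_1) auto
  then show ?thesis by eventually_elim auto
qed

text \<open>The count is decomposed by its value; independence of \<open>E\<close> from each value
  factors the sum, and the mean of the Poisson law remains. This is the base case of the
  compensation formula.\<close>

lemma nn_integral_indicator_N:
  assumes A: "A \<in> sets strip_intensity" "emeasure lborel A < \<infinity>" and E: "E \<in> events"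
    and ind: "\<And>k::nat. prob (E \<inter> {\<omega>\<in>space M. emeasure (N \<omega>) A = of_nat k}) =
        prob E * prob {\<omega>\<in>space M. emeasure (N \<omega>) A = of_nat k}"
  shows "(\<integral>\<^sup>+\<omega>. indicator E \<omega> * emeasure (N \<omega>) A \<partial>M) = emeasure M E * emeasure lborel A"
proof -
  let ?E = "\<lambda>k::nat. {\<omega>\<in>space M. emeasure (N \<omega>) A = of_nat k}"
  have Ek: "?E k \<in> events" for k using N_measurable[OF A(1)] by auto
  have "(\<integral>\<^sup>+\<omega>. indicator E \<omega> * emeasure (N \<omega>) A \<partial>M) =
      (\<integral>\<^sup>+\<omega>. (\<Sum>k. of_nat k * indicator (E \<inter> ?E k) \<omega>) \<partial>M)"
  proof (rule nn_integral_cong_AE)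
    show "AE \<omega> in M. indicator E \<omega> * emeasure (N \<omega>) A = (\<Sum>k. of_nat k * indicator (E \<inter> ?E k) \<omega>)"
      using AE_N_finite[OF A] AE_space
    proof eventually_elim
      case (elim \<omega>)
      then obtain k :: nat where k: "emeasure (N \<omega>) A = of_nat k" by blast
      have "(\<Sum>i. of_nat i * indicator (E \<inter> ?E i) \<omega> :: ennreal) = (\<Sum>i\<in>{k}. of_nat i * indicator (E \<inter> ?E i) \<omega>)"
        by (rule suminf_finite) (auto simp: indicator_def k)
      also have "\<dots> = indicator E \<omega> * emeasure (N \<omega>) A" using elim k by (auto simp: indicator_def)
      finally show ?case by simp
    qed
  qed
  also have "\<dots> = (\<Sum>k. \<integral>\<^sup>+\<omega>. of_nat k * indicator (E \<inter> ?E k) \<omega> \<partial>M)"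
    using Ek E by (intro nn_integral_suminf) auto
  also have "\<dots> = (\<Sum>k. ennreal (prob E * (real k * (exp (- measure lborel A) * measure lborel A ^ k / fact k))))"
  proof (rule suminf_cong)
    fix k :: nat
    have "(\<integral>\<^sup>+\<omega>. of_nat k * indicator (E \<inter> ?E k) \<omega> \<partial>M) = of_nat k * emeasure M (E \<inter> ?E k)"
      using Ek E by (intro nn_integral_cmult_indicator) auto
    also have "\<dots> = ennreal (real k * (prob E * prob (?E k)))"
      unfolding emeasure_eq_measure ind by (simp add: ennreal_of_nat_eq_real_of_nat ennreal_mult)
    finally show "(\<integral>\<^sup>+\<omega>. of_nat k * indicator (E \<inter> ?E k) \<omega> \<partial>M) =
        ennreal (prob E * (real k * (exp (- measure lborel A) * measure lborel A ^ k / fact k)))"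
      by (simp add: prob_N[OF A] mult_ac)
  qed
  also have "\<dots> = ennreal (prob E * measure lborel A)"
  proof -
    have s: "(\<lambda>k. prob E * (real k * (exp (- measure lborel A) * measure lborel A ^ k / fact k))) sums
        (prob E * measure lborel A)"
      by (intro sums_mult poisson_mean_sums)
    show ?thesis
      by (rule suminf_ennreal_eq[OF _ s]) simp
  qed
  also have "\<dots> = emeasure M E * emeasure lborel A"
    using A(2) by (simp add: emeasure_eq_measure ennreal_mult emeasure_eq_ennreal_measure less_top)
  finally show ?thesis .
qed

lemma nn_integral_N:
  assumes A: "A \<in> sets strip_intensity" "emeasure lborel A < \<infinity>"
  shows "(\<integral>\<^sup>+\<omega>. emeasure (N \<omega>) A \<partial>M) = emeasure lborel A"
proof -
  have "space M \<inter> {\<omega>\<in>space M. emeasure (N \<omega>) A = of_nat k} = {\<omega>\<in>space M. emeasure (N \<omega>) A = of_nat k}" for k :: nat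
    by auto
  then have "(\<integral>\<^sup>+\<omega>. indicator (space M) \<omega> * emeasure (N \<omega>) A \<partial>M) = emeasure M (space M) * emeasure lborel A"
    by (intro nn_integral_indicator_N A) (auto simp: prob_space)
  moreover have "(\<integral>\<^sup>+\<omega>. indicator (space M) \<omega> * emeasure (N \<omega>) A \<partial>M) = (\<integral>\<^sup>+\<omega>. emeasure (N \<omega>) A \<partial>M)"
    by (intro nn_integral_cong) simp
  ultimately show ?thesis by (simp add: emeasure_space_1)
qed

lemma AE_N_null:
  assumes A: "A \<in> sets strip_intensity" "emeasure lborel A = 0"
  shows "AE \<omega> in M. emeasure (N \<omega>) A = 0"
proof -
  have "emeasure lborel A < \<infinity>" using A(2) by simp
  from nn_integral_N[OF A(1) this] have "(\<integral>\<^sup>+\<omega>. emeasure (N \<omega>) A \<partial>M) = 0" by (simp only: A(2))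
  then show ?thesis by (subst (asm) nn_integral_0_iff_AE[OF N_measurable[OF A(1)]])
qed

text \<open>From exp(-l) \<open>\<ge>\<close> 1 - l follows exp(-l)(1 + l) \<open>\<ge>\<close> 1 -
  l^2. The quadratic order is what makes the sum over the cells of a fine grid small, so that two
  points never share a time.\<close>

lemma prob_N_ge_2:
  assumes A: "A \<in> sets strip_intensity" "emeasure lborel A < \<infinity>"
  shows "prob {\<omega>\<in>space M. 2 \<le> emeasure (N \<omega>) A} \<le> (measure lborel A)\<^sup>2"
proof -
  define l where "l = measure lborel A"
  have l: "0 \<le> l" by (simp add: l_def)
  let ?E = "\<lambda>k::nat. {\<omega>\<in>space M. emeasure (N \<omega>) A = of_nat k}"
  have Ek: "?E k \<in> events" for k using N_measurable[OF A(1)] by auto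
  have "{\<omega>\<in>space M. 2 \<le> emeasure (N \<omega>) A} \<inter> (?E 0 \<union> ?E 1) = {}" by auto
  then have "prob {\<omega>\<in>space M. 2 \<le> emeasure (N \<omega>) A} + prob (?E 0 \<union> ?E 1) =
      prob ({\<omega>\<in>space M. 2 \<le> emeasure (N \<omega>) A} \<union> (?E 0 \<union> ?E 1))"
    using N_measurable[OF A(1)] Ek[of 0] Ek[of 1] by (intro finite_measure_Union[symmetric] sets.Un) simp_all
  also have "\<dots> \<le> 1" by (rule prob_le_1)
  finally have "prob {\<omega>\<in>space M. 2 \<le> emeasure (N \<omega>) A} + prob (?E 0 \<union> ?E 1) \<le> 1" .
  moreover have "prob (?E 0 \<union> ?E 1) = prob (?E 0) + prob (?E 1)"
    by (rule finite_measure_Union[OF Ek Ek]) auto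
  moreover have "\<dots> = exp (- l) * (1 + l)"
    unfolding prob_N[OF A] l_def by (simp add: algebra_simps)
  moreover have "(1 - l) * (1 + l) \<le> exp (- l) * (1 + l)"
    using l exp_ge_add_one_self[of "- l"] by (intro mult_right_mono) auto
  moreover have "(1 - l) * (1 + l) = 1 - l\<^sup>2" by (simp add: algebra_simps power2_eq_square)
  ultimately show ?thesis by (simp add: l_def)
qed

end

section \<open>Independence of the past\<close>

context driven
begin

lemma counting_events_subset: "counting_events M strip_intensity N S \<subseteq> events"
proof
  fix H assume "H \<in> counting_events M strip_intensity N S"
  then obtain A B where H: "H = {\<omega>\<in>space M. emeasure (N \<omega>) A \<in> B}" and A: "A \<in> sets strip_intensity" "B \<in> sets borel"
    by (auto simp: counting_events_def)
  have "(\<lambda>\<omega>. emeasure (N \<omega>) A) -` B \<inter> space M \<in> events"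
    by (rule measurable_sets[OF N_measurable[OF A(1)] A(2)])
  moreover have "(\<lambda>\<omega>. emeasure (N \<omega>) A) -` B \<inter> space M = H" by (auto simp: H)
  ultimately show "H \<in> events" by simp
qed

lemma counting_events_mono:
  assumes "S \<subseteq> S'"
  shows "counting_events M strip_intensity N S \<subseteq> counting_events M strip_intensity N S'"
proof
  fix H assume "H \<in> counting_events M strip_intensity N S"
  then obtain A B where AB: "H = {\<omega>\<in>space M. emeasure (N \<omega>) A \<in> B}" "A \<in> sets strip_intensity" "A \<subseteq> S" "B \<in> sets borel"
    unfolding counting_events_def mem_Collect_eq by (elim exE conjE) (rule that)
  have "A \<subseteq> S'" by (rule order_trans[OF AB(3) assms])
  with AB show "H \<in> counting_events M strip_intensity N S'"
    unfolding counting_events_def mem_Collect_eq by (intro exI conjI)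
qed

text \<open>Finite intersections of counting events: the intersection-stable generator on which
  independence is checked before it extends to the generated sigma-algebra.\<close>

definition joint_counting_events :: "(real \<times> real) set \<Rightarrow> 'a set set" where
  "joint_counting_events S = {{\<omega>\<in>space M. \<forall>i<n. emeasure (N \<omega>) (A i) \<in> B i} | (n :: nat) A B.
     \<forall>i<n. A i \<in> sets strip_intensity \<and> A i \<subseteq> S \<and> B i \<in> sets borel}"

lemma joint_counting_eventsE:
  assumes "G \<in> joint_counting_events S"
  obtains n :: nat and A B where "G = {\<omega>\<in>space M. \<forall>i<n. emeasure (N \<omega>) (A i) \<in> B i}"
    "\<forall>i<n. A i \<in> sets strip_intensity \<and> A i \<subseteq> S \<and> B i \<in> sets borel"
  using assms unfolding joint_counting_events_def mem_Collect_eq by (elim exE conjE) (rule that)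

lemma joint_counting_eventsI:
  assumes "\<forall>i<n. A i \<in> sets strip_intensity \<and> A i \<subseteq> S \<and> B i \<in> sets borel"
  shows "{\<omega>\<in>space M. \<forall>i<(n :: nat). emeasure (N \<omega>) (A i) \<in> B i} \<in> joint_counting_events S"
  unfolding joint_counting_events_def mem_Collect_eq
  by (rule exI[of _ n], rule exI[of _ A], rule exI[of _ B], rule conjI[OF refl assms])

lemma counting_events_joint: "counting_events M strip_intensity N S \<subseteq> joint_counting_events S"
proof
  fix H assume "H \<in> counting_events M strip_intensity N S"
  then obtain A B where "H = {\<omega>\<in>space M. emeasure (N \<omega>) A \<in> B}" "A \<in> sets strip_intensity" "A \<subseteq> S" "B \<in> sets borel"
    by (auto simp: counting_events_def)
  then show "H \<in> joint_counting_events S"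
    using joint_counting_eventsI[of "Suc 0" "\<lambda>_. A" S "\<lambda>_. B"] by simp
qed

lemma Int_stable_joint_counting_events: "Int_stable (joint_counting_events S)"
proof (rule Int_stableI)
  fix G H assume GH: "G \<in> joint_counting_events S" "H \<in> joint_counting_events S"
  from GH(1) obtain n :: nat and A B where
    G: "G = {\<omega>\<in>space M. \<forall>i<n. emeasure (N \<omega>) (A i) \<in> B i}"
      "\<forall>i<n. A i \<in> sets strip_intensity \<and> A i \<subseteq> S \<and> B i \<in> sets borel"
    by (rule joint_counting_eventsE)
  from GH(2) obtain n' :: nat and A' B' where
    H: "H = {\<omega>\<in>space M. \<forall>i<n'. emeasure (N \<omega>) (A' i) \<in> B' i}"
      "\<forall>i<n'. A' i \<in> sets strip_intensity \<and> A' i \<subseteq> S \<and> B' i \<in> sets borel"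
    by (rule joint_counting_eventsE)
  define A'' where "A'' i = (if i < n then A i else A' (i - n))" for i
  define B'' where "B'' i = (if i < n then B i else B' (i - n))" for i
  have split: "(\<forall>i<n + n'. P i) \<longleftrightarrow> (\<forall>i<n. P i) \<and> (\<forall>i<n'. P (n + i))" for P
  proof (intro iffI conjI allI impI)
    fix i assume P: "(\<forall>i<n. P i) \<and> (\<forall>i<n'. P (n + i))" "i < n + n'"
    show "P i"
    proof (cases "i < n")
      case False
      then have "i - n < n'" "n + (i - n) = i" using P(2) by auto
      with P(1) show ?thesis by metis
    qed (use P in auto)
  qed auto
  have "G \<inter> H = {\<omega>\<in>space M. \<forall>i<n + n'. emeasure (N \<omega>) (A'' i) \<in> B'' i}"
    unfolding split G(1) H(1) A''_def B''_def by auto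
  moreover have "\<forall>i<n + n'. A'' i \<in> sets strip_intensity \<and> A'' i \<subseteq> S \<and> B'' i \<in> sets borel"
    unfolding split A''_def B''_def using G(2) H(2) by auto
  ultimately show "G \<inter> H \<in> joint_counting_events S"
    using joint_counting_eventsI[of "n + n'" A'' S B''] by (simp only:)
qed

text \<open>Independence is only given for disjoint sets; overlapping sets are cut into their atoms.\<close>

lemma indep_joint_counting:
  assumes G: "G \<in> joint_counting_events S" and C: "C \<in> sets strip_intensity" "C \<inter> S = {}"
    and S: "S \<in> sets strip_intensity" and K: "K \<in> sets borel"
  shows "prob (G \<inter> {\<omega>\<in>space M. emeasure (N \<omega>) C \<in> K}) = prob G * prob {\<omega>\<in>space M. emeasure (N \<omega>) C \<in> K}"
    and "G \<in> events"
proof -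
  from G obtain n :: nat and A B where
    G_eq: "G = {\<omega>\<in>space M. \<forall>i<n. emeasure (N \<omega>) (A i) \<in> B i}" and
    AB': "\<forall>i<n. A i \<in> sets strip_intensity \<and> A i \<subseteq> S \<and> B i \<in> sets borel"
    by (rule joint_counting_eventsE)
  have AB: "\<And>i. i < n \<Longrightarrow> A i \<in> sets strip_intensity" "\<And>i. i < n \<Longrightarrow> A i \<subseteq> S" "\<And>i. i < n \<Longrightarrow> B i \<in> sets borel"
    using AB' by simp_all
  obtain h where h: "bij_betw h {0..<card (Pow {..<n})} (Pow {..<n})"
    using ex_bij_betw_nat_finite[of "Pow {..<n}"] by auto
  define m where "m = card (Pow {..<n})"
  have h_sub: "h k \<subseteq> {..<n}" if "k < m" for k
    using bij_betwE[OF h] that by (auto simp: m_def)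
  have h_inj: "h k \<noteq> h l" if "k < m" "l < m" "k \<noteq> l" for k l
    using h that by (auto simp: m_def bij_betw_def inj_on_def)
  have h_surj: "\<exists>k<m. h k = T" if "T \<subseteq> {..<n}" for T
  proof -
    have "T \<in> h ` {0..<card (Pow {..<n})}" using h that by (simp add: bij_betw_def)
    then show ?thesis by (auto simp: m_def)
  qed
  \<comment> \<open>Below \<open>m\<close> the sets are the atoms of the family \<open>A\<close>
    inside \<open>S\<close>, one for each subset of indices; index \<open>m\<close> carries
    \<open>C\<close>. All are disjoint because \<open>C\<close> does not meet
    \<open>S\<close>.\<close>
  define D where "D k = (if k < m then {p\<in>S. \<forall>i<n. p \<in> A i \<longleftrightarrow> i \<in> h k} else C)" for k
  have D_sets: "D k \<in> sets strip_intensity" for k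
  proof (cases "k < m")
    case True
    have "{p\<in>space strip_intensity. p \<in> S \<and> (\<forall>i\<in>{..<n}. p \<in> A i \<longleftrightarrow> i \<in> h k)} \<in> sets strip_intensity"
      using S AB(1) by (intro sets.sets_Collect_conj sets.sets_Collect_finite_All sets.sets_Collect_imp)
        (auto simp: Collect_conj_eq sets.Int_space_eq1 sets.sets_Collect_neg Int_commute)
    moreover have "{p\<in>space strip_intensity. p \<in> S \<and> (\<forall>i\<in>{..<n}. p \<in> A i \<longleftrightarrow> i \<in> h k)} = D k"
      using True sets.sets_into_space[OF S] by (auto simp: D_def)
    ultimately show ?thesis by simp
  qed (simp add: D_def C)
  have D_disj: "disjoint_family_on D {..<Suc m}"
    unfolding disjoint_family_on_def
  proof (intro ballI impI)
    fix k l assume kl: "k \<in> {..<Suc m}" "l \<in> {..<Suc m}" "k \<noteq> l"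
    show "D k \<inter> D l = {}"
    proof (cases "k < m \<and> l < m")
      case True
      then have "h k \<noteq> h l" using h_inj kl by blast
      then obtain i where i: "i < n" "i \<in> h k \<longleftrightarrow> i \<notin> h l"
        using h_sub[of k] h_sub[of l] True by blast
      with True show ?thesis by (auto simp: D_def)
    next
      case False
      with kl C(2) show ?thesis by (auto simp: D_def)
    qed
  qed
  \<comment> \<open>Counts of overlapping sets are sums of counts of atoms, so \<open>G\<close>
    becomes an event of the atom counts alone.\<close>
  have A_eq: "emeasure (N \<omega>) (A i) = (\<Sum>k | k < m \<and> i \<in> h k. emeasure (N \<omega>) (D k))"
    if \<omega>: "\<omega> \<in> space M" and i: "i < n" for \<omega> i
  proof -
    have "(\<Union>k\<in>{k. k < m \<and> i \<in> h k}. D k) = A i"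
    proof (intro equalityI subsetI)
      fix p assume p: "p \<in> A i"
      obtain k where k: "k < m" "h k = {l. l < n \<and> p \<in> A l}"
        using h_surj[of "{l. l < n \<and> p \<in> A l}"] by auto
      then have "p \<in> D k" "i \<in> h k" using p i AB(2)[OF i] by (auto simp: D_def)
      with k show "p \<in> (\<Union>k\<in>{k. k < m \<and> i \<in> h k}. D k)" by auto
    qed (use i in \<open>auto simp: D_def\<close>)
    moreover have "(\<Sum>k | k < m \<and> i \<in> h k. emeasure (N \<omega>) (D k)) = emeasure (N \<omega>) (\<Union>k\<in>{k. k < m \<and> i \<in> h k}. D k)"
      using D_sets sets_N[OF \<omega>] by (intro sum_emeasure disjoint_family_on_mono[OF _ D_disj]) auto
    ultimately show ?thesis by simp
  qed
  have iv: "indep_vars (\<lambda>_. borel) (\<lambda>k \<omega>. emeasure (N \<omega>) (D k)) {..<Suc m}"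
    using D_sets D_disj by (intro indep_N) auto
  define Q where "Q = {y\<in>space (PiM {..<m} (\<lambda>_. borel :: ennreal measure)). \<forall>i<n. (\<Sum>k | k < m \<and> i \<in> h k. y k) \<in> B i}"
  define R where "R = {y\<in>space (PiM {m} (\<lambda>_. borel :: ennreal measure)). y m \<in> K}"
  have Q: "Q \<in> sets (PiM {..<m} (\<lambda>_. borel))"
  proof -
    have Qi: "{y\<in>space (PiM {..<m} (\<lambda>_. borel :: ennreal measure)). (\<Sum>k | k < m \<and> i \<in> h k. y k) \<in> B i}
        \<in> sets (PiM {..<m} (\<lambda>_. borel))" if "i < n" for i
    proof -
      have "(\<lambda>y. \<Sum>k | k < m \<and> i \<in> h k. y k) \<in> borel_measurable (PiM {..<m} (\<lambda>_. borel :: ennreal measure))"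
        by (intro borel_measurable_sum measurable_component_singleton) auto
      from measurable_sets[OF this AB(3)[OF that]] show ?thesis
        by (simp add: vimage_def Int_def conj_commute)
    qed
    have "{y\<in>space (PiM {..<m} (\<lambda>_. borel :: ennreal measure)). \<forall>i\<in>{..<n}. (\<Sum>k | k < m \<and> i \<in> h k. y k) \<in> B i}
        \<in> sets (PiM {..<m} (\<lambda>_. borel))"
      by (rule sets.sets_Collect_finite_All[OF Qi]) simp_all
    then show ?thesis unfolding Q_def by (simp only: Ball_def lessThan_iff)
  qed
  have R: "R \<in> sets (PiM {m} (\<lambda>_. borel))"
  proof -
    have "(\<lambda>y. y m) \<in> borel_measurable (PiM {m} (\<lambda>_. borel :: ennreal measure))"
      by (rule measurable_component_singleton) simp
    from measurable_sets[OF this K] show ?thesis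
      by (simp add: R_def vimage_def Int_def conj_commute)
  qed
  let ?Y = "\<lambda>\<omega>. \<lambda>k\<in>{..<m}. emeasure (N \<omega>) (D k)" and ?Z = "\<lambda>\<omega>. \<lambda>k\<in>{m}. emeasure (N \<omega>) (D k)"
  have "indep_var (PiM {..<m} (\<lambda>_. borel)) ?Y (PiM {m} (\<lambda>_. borel)) ?Z"
    by (rule indep_var_restrict[OF iv]) auto
  from indep_varD[OF this Q R]
  have "prob ((\<lambda>\<omega>. (?Y \<omega>, ?Z \<omega>)) -` (Q \<times> R) \<inter> space M) = prob (?Y -` Q \<inter> space M) * prob (?Z -` R \<inter> space M)" .
  moreover have YQ: "?Y -` Q \<inter> space M = G"
    unfolding G_eq Q_def using A_eq by (auto simp: space_PiM)
  moreover have ZR: "?Z -` R \<inter> space M = {\<omega>\<in>space M. emeasure (N \<omega>) C \<in> K}"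
    unfolding R_def by (auto simp: space_PiM D_def)
  moreover have "(\<lambda>\<omega>. (?Y \<omega>, ?Z \<omega>)) -` (Q \<times> R) \<inter> space M = (?Y -` Q \<inter> space M) \<inter> (?Z -` R \<inter> space M)"
    by auto
  ultimately show "prob (G \<inter> {\<omega>\<in>space M. emeasure (N \<omega>) C \<in> K}) = prob G * prob {\<omega>\<in>space M. emeasure (N \<omega>) C \<in> K}"
    by simp
  have "?Y \<in> M \<rightarrow>\<^sub>M PiM {..<m} (\<lambda>_. borel)"
    using D_sets by (intro measurable_restrict N_measurable)
  from measurable_sets[OF this Q] show "G \<in> events" by (simp add: YQ)
qed

abbreviation filtration :: "real \<Rightarrow> 'a measure" where
  "filtration \<equiv> driving_filtration M X\<^sub>0 N"

lemma strip_sets: "strip t \<in> sets strip_intensity"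
  by (rule Times_in_strip) auto

lemma filtration_generators:
  "{X\<^sub>0 -` B \<inter> space M | B. B \<in> sets borel} \<union> counting_events M strip_intensity N (strip t) \<union> null_sets M \<subseteq> events"
  using counting_events_subset measurable_sets[OF X0_measurable] by (auto simp: null_sets_def)

lemma space_filtration [simp]: "space (filtration t) = space M"
  unfolding driving_filtration_def
  using filtration_generators[of t] sets.sets_into_space[of _ M]
  by (subst space_measure_of) auto

lemma sets_filtration:
  "sets (filtration t) = sigma_sets (space M) ({X\<^sub>0 -` B \<inter> space M | B. B \<in> sets borel} \<union>
     counting_events M strip_intensity N (strip t) \<union> null_sets M)"
  unfolding driving_filtration_def
  using filtration_generators[of t] sets.sets_into_space[of _ M]
  by (subst sets_measure_of) auto

lemma filtration_subset: "sets (filtration t) \<subseteq> events"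
  unfolding sets_filtration by (rule sets.sigma_sets_subset[OF filtration_generators])

lemma filtration_mono: "s \<le> t \<Longrightarrow> sets (filtration s) \<subseteq> sets (filtration t)"
  unfolding sets_filtration
  by (rule sigma_sets_mono', intro Un_mono subset_refl counting_events_mono) auto

lemma measurable_filtration_mono:
  "f \<in> filtration s \<rightarrow>\<^sub>M L \<Longrightarrow> s \<le> t \<Longrightarrow> f \<in> filtration t \<rightarrow>\<^sub>M L"
  using filtration_mono[of s t] by (auto simp: measurable_def)

lemma measurable_filtration: "f \<in> filtration s \<rightarrow>\<^sub>M L \<Longrightarrow> f \<in> M \<rightarrow>\<^sub>M L"
  using filtration_subset[of s] by (auto simp: measurable_def)

lemma X0_filtration: "X\<^sub>0 \<in> borel_measurable (filtration t)"
  by (rule measurableI) (auto simp: sets_filtration)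

lemma N_filtration:
  assumes "A \<in> sets strip_intensity" "A \<subseteq> strip t"
  shows "(\<lambda>\<omega>. emeasure (N \<omega>) A) \<in> borel_measurable (filtration t)"
proof (rule measurableI)
  fix B :: "ennreal set" assume "B \<in> sets borel"
  with assms have "{\<omega>\<in>space M. emeasure (N \<omega>) A \<in> B} \<in> counting_events M strip_intensity N (strip t)"
    unfolding counting_events_def by blast
  then have "{\<omega>\<in>space M. emeasure (N \<omega>) A \<in> B} \<in> sets (filtration t)"
    unfolding sets_filtration by blast
  moreover have "(\<lambda>\<omega>. emeasure (N \<omega>) A) -` B \<inter> space (filtration t) = {\<omega>\<in>space M. emeasure (N \<omega>) A \<in> B}" by auto
  ultimately show "(\<lambda>\<omega>. emeasure (N \<omega>) A) -` B \<inter> space (filtration t) \<in> sets (filtration t)" by simp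
qed simp

text \<open>On a generating event, an event of the initial value intersected with a counting event
  \<open>H\<close> of the strip, two independences combine: the initial value is independent of all
  counts, in particular of \<open>H\<close> together with the later count, and \<open>H\<close> is
  independent of that count because the regions are disjoint.\<close>

lemma indep_filtration:
  assumes E: "E \<in> sets (filtration a)" and C: "C \<in> sets strip_intensity" "C \<inter> strip a = {}" and K: "K \<in> sets borel"
  shows "prob (E \<inter> {\<omega>\<in>space M. emeasure (N \<omega>) C \<in> K}) = prob E * prob {\<omega>\<in>space M. emeasure (N \<omega>) C \<in> K}"
proof -
  define L where "L K = {\<omega>\<in>space M. emeasure (N \<omega>) C \<in> K}" for K
  define \<K> where "\<K> = L ` sets borel"
  have L_count: "L K \<in> counting_events M strip_intensity N UNIV" if "K \<in> sets borel" for K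
    unfolding counting_events_def L_def mem_Collect_eq
    by (rule exI[of _ C], rule exI[of _ K]) (use C(1) that in simp)
  have K_count: "\<K> \<subseteq> counting_events M strip_intensity N UNIV"
    unfolding \<K>_def by (rule image_subsetI) (rule L_count)
  have K_ev: "\<K> \<subseteq> events" by (rule order_trans[OF K_count counting_events_subset])
  have K_Int: "Int_stable \<K>"
  proof (rule Int_stableI)
    fix a b assume "a \<in> \<K>" "b \<in> \<K>"
    then obtain K K' where K: "a = L K" "K \<in> sets borel" "b = L K'" "K' \<in> sets borel"
      unfolding \<K>_def by (elim imageE) (rule that)
    have "a \<inter> b = L (K \<inter> K')" unfolding K L_def by auto
    with K show "a \<inter> b \<in> \<K>" unfolding \<K>_def by (simp add: sets.Int)
  qed
  have 1: "indep_set (sigma_sets (space M) (joint_counting_events (strip a))) (sigma_sets (space M) \<K>)"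
  proof (rule indep_set_sigma_sets[OF _ Int_stable_joint_counting_events K_Int], rule indep_setI)
    show "joint_counting_events (strip a) \<subseteq> events"
      by (rule subsetI) (rule indep_joint_counting(2)[OF _ C strip_sets, of _ UNIV], simp_all)
    show "\<K> \<subseteq> events" by (rule K_ev)
    show "prob (G \<inter> L') = prob G * prob L'" if "G \<in> joint_counting_events (strip a)" "L' \<in> \<K>" for G L'
    proof -
      from that(2) obtain K where "L' = L K" "K \<in> sets borel"
        unfolding \<K>_def by (elim imageE) (rule that)
      with indep_joint_counting(1)[OF that(1) C strip_sets, of K] show ?thesis by (simp add: L_def)
    qed
  qed
  let ?H = "sigma_sets (space M) (counting_events M strip_intensity N (strip a))"
  have H_sub: "?H \<subseteq> sigma_sets (space M) (joint_counting_events (strip a))"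
    by (rule sigma_sets_mono'[OF counting_events_joint])
  have H_UNIV: "?H \<subseteq> sigma_sets (space M) (counting_events M strip_intensity N UNIV)"
    by (rule sigma_sets_mono') (auto simp: counting_events_def)
  have H_ev: "?H \<subseteq> events" by (rule sets.sigma_sets_subset[OF counting_events_subset])
  have H_alg: "sigma_algebra (space M) ?H"
    by (rule sigma_algebra_sigma_sets[OF order_trans[OF counting_events_subset sets.space_closed]])
  have U_alg: "sigma_algebra (space M) (sigma_sets (space M) (counting_events M strip_intensity N UNIV))"
    by (rule sigma_algebra_sigma_sets[OF order_trans[OF counting_events_subset sets.space_closed]])
  interpret HA: sigma_algebra "space M" ?H by (rule H_alg)
  interpret UA: sigma_algebra "space M" "sigma_sets (space M) (counting_events M strip_intensity N UNIV)"
    by (rule U_alg)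
  define X where "X B = X\<^sub>0 -` B \<inter> space M" for B
  \<comment> \<open>The null sets are adjoined to the generator itself: the product rule is trivial
    for them, and intersections with them remain null.\<close>
  define Q where "Q = (\<lambda>(B, H). X B \<inter> H) ` (sets borel \<times> ?H) \<union> null_sets M"
  have X_ev: "X B \<in> events" if "B \<in> sets borel" for B
    unfolding X_def by (rule measurable_sets[OF X0_measurable that])
  have Q_cases: "G \<in> null_sets M \<or> (\<exists>B H. B \<in> sets borel \<and> H \<in> ?H \<and> G = X B \<inter> H)" if "G \<in> Q" for G
  proof (cases "G \<in> null_sets M")
    case False
    with that have "G \<in> (\<lambda>(B, H). X B \<inter> H) ` (sets borel \<times> ?H)" unfolding Q_def by (simp only: Un_iff simp_thms)
    then obtain p where p: "p \<in> sets borel \<times> ?H" "G = (\<lambda>(B, H). X B \<inter> H) p" by (rule imageE)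
    then have "fst p \<in> sets borel \<and> snd p \<in> ?H \<and> G = X (fst p) \<inter> snd p"
      by (simp only: mem_Times_iff case_prod_beta simp_thms)
    then show ?thesis by (intro disjI2 exI)
  qed (rule disjI1)
  have QI: "X B \<inter> H \<in> Q" if "B \<in> sets borel" "H \<in> ?H" for B H
    unfolding Q_def by (rule UnI1, rule image_eqI[of _ _ "(B, H)"]) (use that in simp_all)
  have Q_ev: "Q \<subseteq> events"
  proof
    fix G assume "G \<in> Q"
    from Q_cases[OF this] show "G \<in> events"
    proof (elim disjE exE conjE)
      fix B H assume BH: "B \<in> sets borel" "H \<in> ?H" "G = X B \<inter> H"
      show ?thesis unfolding BH(3) by (rule sets.Int[OF X_ev[OF BH(1)] subsetD[OF H_ev BH(2)]])
    qed (rule null_setsD2)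
  qed
  have Q_Int: "Int_stable Q"
  proof (rule Int_stableI)
    fix G G' assume GL: "G \<in> Q" "G' \<in> Q"
    have ev: "G \<in> events" "G' \<in> events" by (rule subsetD[OF Q_ev GL(1)], rule subsetD[OF Q_ev GL(2)])
    show "G \<inter> G' \<in> Q"
    proof (cases "G \<in> null_sets M \<or> G' \<in> null_sets M")
      case True
      then have "G \<inter> G' \<in> null_sets M"
      proof
        assume "G \<in> null_sets M" then show ?thesis using ev(2) by (rule null_set_Int2)
      next
        assume "G' \<in> null_sets M"
        then have "G' \<inter> G \<in> null_sets M" using ev(1) by (rule null_set_Int2)
        then show ?thesis by (simp only: Int_commute)
      qed
      then show ?thesis by (simp add: Q_def)
    next
      case False
      then have "\<exists>B H. B \<in> sets borel \<and> H \<in> ?H \<and> G = X B \<inter> H" "\<exists>B H. B \<in> sets borel \<and> H \<in> ?H \<and> G' = X B \<inter> H"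
        using Q_cases[OF GL(1)] Q_cases[OF GL(2)] by (simp_all only: de_Morgan_disj simp_thms)
      then obtain B H B' H'
        where BH: "B \<in> sets borel" "H \<in> ?H" "G = X B \<inter> H" "B' \<in> sets borel" "H' \<in> ?H" "G' = X B' \<inter> H'"
        by (elim exE conjE) (rule that)
      have "G \<inter> G' = X (B \<inter> B') \<inter> (H \<inter> H')" unfolding BH X_def by auto
      moreover have "H \<inter> H' \<in> ?H" by (rule HA.Int[OF BH(2,5)])
      ultimately show ?thesis using QI[of "B \<inter> B'" "H \<inter> H'"] BH(1,4) by (simp add: sets.Int)
    qed
  qed
  have 2: "indep_set (sigma_sets (space M) Q) (sigma_sets (space M) \<K>)"
  proof (rule indep_set_sigma_sets[OF _ Q_Int K_Int], rule indep_setI[OF Q_ev K_ev])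
    fix G L' assume G: "G \<in> Q" and L': "L' \<in> \<K>"
    have L_ev: "L' \<in> events" using K_ev L' by (rule subsetD)
    show "prob (G \<inter> L') = prob G * prob L'"
    proof (cases "G \<in> null_sets M")
      case True
      then have "G \<inter> L' \<in> null_sets M" using L_ev by (rule null_set_Int2)
      with True show ?thesis by (simp add: measure_eq_0_null_sets)
    next
      case False
      then have "\<exists>B H. B \<in> sets borel \<and> H \<in> ?H \<and> G = X B \<inter> H"
        using Q_cases[OF G] by (simp only: simp_thms)
      then obtain B H where BH: "B \<in> sets borel" "H \<in> ?H" "G = X B \<inter> H"
        by (elim exE conjE) (rule that)
      have LU: "L' \<in> sigma_sets (space M) (counting_events M strip_intensity N UNIV)"
        using subsetD[OF K_count L'] by (rule sigma_sets.Basic)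
      have HU: "H \<in> sigma_sets (space M) (counting_events M strip_intensity N UNIV)"
        using H_UNIV BH(2) by (rule subsetD)
      have HL: "H \<inter> L' \<in> sigma_sets (space M) (counting_events M strip_intensity N UNIV)"
        by (rule UA.Int[OF HU LU])
      have XB: "X B \<in> {X\<^sub>0 -` B \<inter> space M | B. B \<in> sets borel}"
        unfolding X_def mem_Collect_eq by (rule exI[of _ B], rule conjI[OF refl BH(1)])
      have "prob (G \<inter> L') = prob (X B \<inter> (H \<inter> L'))" by (simp add: BH Int_assoc)
      also have "\<dots> = prob (X B) * prob (H \<inter> L')" by (rule indep_setD[OF indep_X0_N XB HL])
      also have "prob (H \<inter> L') = prob H * prob L'"
        by (rule indep_setD[OF 1 subsetD[OF H_sub BH(2)] sigma_sets.Basic[OF L']])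
      also have "prob (X B) * (prob H * prob L') = prob G * prob L'"
        unfolding BH(3) indep_setD[OF indep_X0_N XB HU] by simp
      finally show ?thesis .
    qed
  qed
  have sp_H: "space M \<in> ?H" by (rule sigma_sets_top)
  have "{X\<^sub>0 -` B \<inter> space M | B. B \<in> sets borel} \<subseteq> Q"
  proof
    fix G assume "G \<in> {X\<^sub>0 -` B \<inter> space M | B. B \<in> sets borel}"
    then obtain B where B: "G = X\<^sub>0 -` B \<inter> space M" "B \<in> sets borel"
      unfolding mem_Collect_eq by (elim exE conjE) (rule that)
    then have "G = X B \<inter> space M" by (auto simp: X_def)
    with QI[OF B(2) sp_H] show "G \<in> Q" by (simp only:)
  qed
  moreover have "counting_events M strip_intensity N (strip a) \<subseteq> Q"
  proof
    fix G assume G: "G \<in> counting_events M strip_intensity N (strip a)"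
    have "G \<subseteq> space M" by (rule sets.sets_into_space[OF subsetD[OF counting_events_subset G]])
    then have "G = X UNIV \<inter> G" by (auto simp: X_def)
    moreover have "X UNIV \<inter> G \<in> Q" by (rule QI[OF _ sigma_sets.Basic[OF G]]) simp
    ultimately show "G \<in> Q" by (simp only:)
  qed
  moreover have "null_sets M \<subseteq> Q" by (simp add: Q_def)
  ultimately have "sets (filtration a) \<subseteq> sigma_sets (space M) Q"
    unfolding sets_filtration by (intro sigma_sets_mono' Un_least)
  then have "E \<in> sigma_sets (space M) Q" using E by (rule subsetD)
  moreover have "L K \<in> sigma_sets (space M) \<K>"
    by (rule sigma_sets.Basic) (simp add: \<K>_def K)
  ultimately show ?thesis
    unfolding L_def[symmetric] by (rule indep_setD[OF 2])
qed

end

section \<open>The compensation formula\<close>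

context driven
begin

text \<open>Time intervals are open on the left and \<open>E\<close> is known at the left endpoint,
  so all points counted lie strictly after the past that determines \<open>E\<close>.\<close>

definition predictable_rectangles :: "real \<Rightarrow> ('a \<times> real \<times> real) set set" where
  "predictable_rectangles T = {E \<times> ({a<..b} \<times> B) | E a b B. 0 \<le> a \<and> a \<le> b \<and> b \<le> T \<and>
     E \<in> sets (filtration a) \<and> B \<in> sets borel \<and> B \<subseteq> {0..1}}"

lemma predictable_rectanglesE:
  assumes "R \<in> predictable_rectangles T"
  obtains E a b B where "R = E \<times> ({a<..b} \<times> B)" "0 \<le> a" "a \<le> b" "b \<le> T"
    "E \<in> sets (filtration a)" "B \<in> sets borel" "B \<subseteq> {0..1}"
  using assms unfolding predictable_rectangles_def mem_Collect_eq by (elim exE conjE) (rule that)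

lemma predictable_rectanglesI:
  assumes "0 \<le> a" "a \<le> b" "b \<le> T" "E \<in> sets (filtration a)" "B \<in> sets borel" "B \<subseteq> {0..1}"
  shows "E \<times> ({a<..b} \<times> B) \<in> predictable_rectangles T"
  unfolding predictable_rectangles_def mem_Collect_eq
  by (rule exI[of _ E], rule exI[of _ a], rule exI[of _ b], rule exI[of _ B]) (intro conjI refl assms)

definition predictable_space :: "real \<Rightarrow> ('a \<times> real \<times> real) set" where
  "predictable_space T = space M \<times> ({0<..T} \<times> {0..1})"

definition predictable :: "real \<Rightarrow> ('a \<times> real \<times> real) measure" where
  "predictable T = sigma (predictable_space T) (predictable_rectangles T)"

lemma predictable_rectangles_subset: "predictable_rectangles T \<subseteq> Pow (predictable_space T)"
proof
  fix R assume "R \<in> predictable_rectangles T"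
  then obtain E a b B where R: "R = E \<times> ({a<..b} \<times> B)" "0 \<le> a" "a \<le> b" "b \<le> T"
    "E \<in> sets (filtration a)" "B \<in> sets borel" "B \<subseteq> {0..1}" by (rule predictable_rectanglesE)
  have "E \<subseteq> space M" using sets.sets_into_space[OF R(5)] by simp
  with R(1,2,4,7) show "R \<in> Pow (predictable_space T)" by (auto simp: predictable_space_def)
qed

lemma space_predictable [simp]: "space (predictable T) = predictable_space T"
  unfolding predictable_def by (rule space_measure_of[OF predictable_rectangles_subset])

lemma sets_predictable: "sets (predictable T) = sigma_sets (predictable_space T) (predictable_rectangles T)"
  unfolding predictable_def by (rule sets_measure_of[OF predictable_rectangles_subset])

lemma Int_stable_predictable_rectangles: "Int_stable (predictable_rectangles T)"
proof (rule Int_stableI)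
  fix R R' assume RR: "R \<in> predictable_rectangles T" "R' \<in> predictable_rectangles T"
  obtain E a b B where
    R: "R = E \<times> ({a<..b} \<times> B)" "0 \<le> a" "a \<le> b" "b \<le> T" "E \<in> sets (filtration a)" "B \<in> sets borel" "B \<subseteq> {0..1}"
    using RR(1) by (rule predictable_rectanglesE)
  obtain E' a' b' B' where
    R': "R' = E' \<times> ({a'<..b'} \<times> B')" "0 \<le> a'" "a' \<le> b'" "b' \<le> T" "E' \<in> sets (filtration a')" "B' \<in> sets borel" "B' \<subseteq> {0..1}"
    using RR(2) by (rule predictable_rectanglesE)
  \<comment> \<open>The outer maximum keeps \<open>c \<le> d\<close> when the intervals are
    disjoint; the intersection is then an empty rectangle.\<close>
  define c d where "c = max a a'" and "d = max c (min b b')"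
  have eq: "R \<inter> R' = (E \<inter> E') \<times> ({c<..d} \<times> (B \<inter> B'))"
    unfolding R(1) R'(1) c_def d_def by auto
  have "E \<in> sets (filtration c)" "E' \<in> sets (filtration c)"
    by (rule subsetD[OF filtration_mono R(5)], simp add: c_def)
       (rule subsetD[OF filtration_mono R'(5)], simp add: c_def)
  then have "E \<inter> E' \<in> sets (filtration c)" by (rule sets.Int)
  moreover have "0 \<le> c" "c \<le> d" "d \<le> T" using R(2-4) R'(2-4) by (auto simp: c_def d_def)
  moreover have "B \<inter> B' \<in> sets borel" "B \<inter> B' \<subseteq> {0..1}"
    using R(6) R'(6) R(7) by (simp_all add: le_infI1)
  ultimately show "R \<inter> R' \<in> predictable_rectangles T"
    unfolding eq by (intro predictable_rectanglesI)
qed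

lemma emeasure_strip_box:
  fixes a b :: real and B :: "real set"
  assumes "a \<le> b" "B \<in> sets borel" "B \<subseteq> {0..1}"
  shows "emeasure lborel ({a<..b} \<times> B) = ennreal (b - a) * emeasure lborel B" "emeasure lborel ({a<..b} \<times> B) < \<infinity>"
proof -
  show eq: "emeasure lborel ({a<..b} \<times> B) = ennreal (b - a) * emeasure lborel B"
    using assms by (subst emeasure_lborel_Times) auto
  have "emeasure lborel B \<le> emeasure lborel {0..1::real}" using assms by (intro emeasure_mono) auto
  then have "emeasure lborel B < \<infinity>" by (auto simp: less_top[symmetric] top_unique)
  then show "emeasure lborel ({a<..b} \<times> B) < \<infinity>"
    unfolding eq by (simp add: ennreal_mult_less_top)
qed

lemma section_in_strip:
  assumes "A \<in> sets (M \<Otimes>\<^sub>M lborel)" "A \<subseteq> predictable_space T"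
  shows "Pair \<omega> -` A \<in> sets strip_intensity"
proof -
  have "Pair \<omega> -` A \<in> sets lborel" by (rule sets_Pair1[OF assms(1)])
  with assms(2) show ?thesis by (auto simp: sets_strip_iff predictable_space_def)
qed

text \<open>A pi-lambda argument starting from predictable rectangles, where the count over the
  rectangle is independent of \<open>E\<close>. The mass of a random section is matched with a
  measurable \<open>g\<close> only almost surely: passing to complements subtracts masses, which is
  legitimate where \<open>N\<close> has finite mass on the whole region, and this holds off a null
  set.\<close>

theorem compensation:
  assumes A: "A \<in> sets (predictable T)" and T: "0 \<le> T"
  shows "A \<in> sets (M \<Otimes>\<^sub>M lborel)"
    and "\<exists>g\<in>borel_measurable M. (AE \<omega> in M. emeasure (N \<omega>) (Pair \<omega> -` A) = g \<omega>) \<and>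
      (\<integral>\<^sup>+\<omega>. g \<omega> \<partial>M) = emeasure (M \<Otimes>\<^sub>M lborel) A"
proof -
  let ?P = "\<lambda>A. A \<in> sets (M \<Otimes>\<^sub>M lborel) \<and> A \<subseteq> predictable_space T \<and>
    (\<exists>g\<in>borel_measurable M. (AE \<omega> in M. emeasure (N \<omega>) (Pair \<omega> -` A) = g \<omega>) \<and>
      (\<integral>\<^sup>+\<omega>. g \<omega> \<partial>M) = emeasure (M \<Otimes>\<^sub>M lborel) A)"
  define R :: "(real \<times> real) set" where "R = {0<..T} \<times> {0..1}"
  have R: "R \<in> sets strip_intensity" unfolding R_def by (rule Times_in_strip) auto
  have R_fin: "emeasure lborel R < \<infinity>" and R_eq: "emeasure lborel R = ennreal T"
    using emeasure_strip_box[of 0 T "{0..1}"] T by (simp_all add: R_def)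
  have Om: "predictable_space T \<in> sets (M \<Otimes>\<^sub>M lborel)"
    using R unfolding predictable_space_def R_def[symmetric] by (intro pair_measureI) (auto simp: sets_strip_iff)
  have Om_eq: "emeasure (M \<Otimes>\<^sub>M lborel) (predictable_space T) = ennreal T"
    using R unfolding predictable_space_def R_def[symmetric]
    by (subst lborel.emeasure_pair_measure_Times) (auto simp: sets_strip_iff emeasure_space_1 R_eq)
  have "A \<in> sigma_sets (predictable_space T) (predictable_rectangles T)"
    using A by (simp add: sets_predictable)
  with Int_stable_predictable_rectangles predictable_rectangles_subset
  have "?P A"
  proof (induction rule: sigma_sets_induct_disjoint)
    case (basic A)
    then obtain E a b B where A_eq: "A = E \<times> ({a<..b} \<times> B)" and ab: "0 \<le> a" "a \<le> b" "b \<le> T"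
      and E: "E \<in> sets (filtration a)" and B: "B \<in> sets borel" "B \<subseteq> {0..1}"
      by (rule predictable_rectanglesE)
    have E_ev: "E \<in> events" by (rule subsetD[OF filtration_subset E])
    define C where "C = {a<..b} \<times> B"
    have C: "C \<in> sets strip_intensity" unfolding C_def by (rule Times_in_strip) (use ab B in auto)
    have C_fin: "emeasure lborel C < \<infinity>" unfolding C_def by (rule emeasure_strip_box[OF ab(2) B])
    have C_b: "C \<in> sets lborel" using C by (simp add: sets_strip_iff)
    have disj: "C \<inter> strip a = {}" by (auto simp: C_def)
    have AE: "A = E \<times> C" by (simp add: A_eq C_def)
    show ?case
    proof (intro conjI bexI)
      show "A \<in> sets (M \<Otimes>\<^sub>M lborel)" unfolding AE by (intro pair_measureI E_ev C_b)
      show "A \<subseteq> predictable_space T" using subsetD[OF predictable_rectangles_subset basic] by simp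
      show "AE \<omega> in M. emeasure (N \<omega>) (Pair \<omega> -` A) = indicator E \<omega> * emeasure (N \<omega>) C"
        by (intro AE_I2) (auto simp: AE indicator_def)
      have ind: "prob (E \<inter> {\<omega>\<in>space M. emeasure (N \<omega>) C = of_nat k}) =
          prob E * prob {\<omega>\<in>space M. emeasure (N \<omega>) C = of_nat k}" for k :: nat
        using indep_filtration[OF E C disj, of "{of_nat k}"] by simp
      show "(\<integral>\<^sup>+\<omega>. indicator E \<omega> * emeasure (N \<omega>) C \<partial>M) = emeasure (M \<Otimes>\<^sub>M lborel) A"
        unfolding AE by (subst lborel.emeasure_pair_measure_Times[OF E_ev C_b])
          (rule nn_integral_indicator_N[OF C C_fin E_ev ind])
      show "(\<lambda>\<omega>. indicator E \<omega> * emeasure (N \<omega>) C) \<in> borel_measurable M"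
        using E_ev N_measurable[OF C] by (intro borel_measurable_times_ennreal borel_measurable_indicator)
    qed
  next
    case empty
    show ?case
    proof (intro conjI bexI[of _ "\<lambda>_. 0"])
      show "AE \<omega> in M. emeasure (N \<omega>) (Pair \<omega> -` {}) = 0" by (intro AE_I2) (simp only: vimage_empty emeasure_empty)
    qed simp_all
  next
    case (compl A)
    then obtain g where A: "A \<in> sets (M \<Otimes>\<^sub>M lborel)" "A \<subseteq> predictable_space T" and
      g: "g \<in> borel_measurable M" "AE \<omega> in M. emeasure (N \<omega>) (Pair \<omega> -` A) = g \<omega>"
      "(\<integral>\<^sup>+\<omega>. g \<omega> \<partial>M) = emeasure (M \<Otimes>\<^sub>M lborel) A"
      by (elim conjE bexE) (rule that)
    have g_fin: "emeasure (M \<Otimes>\<^sub>M lborel) A < \<infinity>"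
      using emeasure_mono[OF A(2) Om] Om_eq by (auto simp: less_top[symmetric] top_unique)
    have sub: "Pair \<omega> -` A \<subseteq> R" for \<omega> using A(2) by (auto simp: predictable_space_def R_def)
    have le: "AE \<omega> in M. g \<omega> \<le> emeasure (N \<omega>) R"
      using g(2) AE_space
    proof eventually_elim
      case (elim \<omega>)
      have "emeasure (N \<omega>) (Pair \<omega> -` A) \<le> emeasure (N \<omega>) R"
        by (rule emeasure_mono[OF sub]) (simp only: sets_N[OF elim(2)] R)
      with elim show ?case by simp
    qed
    show ?case
    proof (intro conjI bexI)
      show "predictable_space T - A \<in> sets (M \<Otimes>\<^sub>M lborel)" using Om A(1) by (rule sets.Diff)
      show "(\<lambda>\<omega>. emeasure (N \<omega>) R - g \<omega>) \<in> borel_measurable M"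
        using N_measurable[OF R] g(1) by (rule borel_measurable_minus_ennreal)
      show "AE \<omega> in M. emeasure (N \<omega>) (Pair \<omega> -` (predictable_space T - A)) = emeasure (N \<omega>) R - g \<omega>"
        using g(2) AE_space AE_N_finite[OF R R_fin]
      proof eventually_elim
        case (elim \<omega>)
        have "Pair \<omega> -` (predictable_space T - A) = R - Pair \<omega> -` A"
        proof (rule set_eqI)
          fix p show "p \<in> Pair \<omega> -` (predictable_space T - A) \<longleftrightarrow> p \<in> R - Pair \<omega> -` A"
            by (simp only: vimage_eq Diff_iff predictable_space_def R_def mem_Sigma_iff elim(2) simp_thms)
        qed
        moreover have "emeasure (N \<omega>) (R - Pair \<omega> -` A) = emeasure (N \<omega>) R - emeasure (N \<omega>) (Pair \<omega> -` A)"
        proof (rule emeasure_Diff)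
          have "emeasure (N \<omega>) (Pair \<omega> -` A) \<le> emeasure (N \<omega>) R"
            by (rule emeasure_mono[OF sub]) (simp only: sets_N[OF elim(2)] R)
          moreover obtain k :: nat where "emeasure (N \<omega>) R = of_nat k" using elim(3) by (rule exE)
          ultimately have "emeasure (N \<omega>) (Pair \<omega> -` A) < \<infinity>" by (simp add: le_less_trans[OF _ of_nat_less_top])
          then show "emeasure (N \<omega>) (Pair \<omega> -` A) \<noteq> \<infinity>" by simp
          show "R \<in> sets (N \<omega>)" "Pair \<omega> -` A \<in> sets (N \<omega>)"
            unfolding sets_N[OF elim(2)] by (rule R, rule section_in_strip[OF A])
        qed (rule sub)
        ultimately show ?case using elim(1) by simp
      qed
      have "(\<integral>\<^sup>+\<omega>. emeasure (N \<omega>) R - g \<omega> \<partial>M) = (\<integral>\<^sup>+\<omega>. emeasure (N \<omega>) R \<partial>M) - (\<integral>\<^sup>+\<omega>. g \<omega> \<partial>M)"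
        using g_fin g(3) by (intro nn_integral_diff N_measurable R g(1) le) auto
      also have "\<dots> = emeasure (M \<Otimes>\<^sub>M lborel) (predictable_space T) - emeasure (M \<Otimes>\<^sub>M lborel) A"
        by (simp add: nn_integral_N[OF R R_fin] R_eq Om_eq g(3))
      also have "\<dots> = emeasure (M \<Otimes>\<^sub>M lborel) (predictable_space T - A)"
        using g_fin A Om by (intro emeasure_Diff[symmetric]) auto
      finally show "(\<integral>\<^sup>+\<omega>. emeasure (N \<omega>) R - g \<omega> \<partial>M) = emeasure (M \<Otimes>\<^sub>M lborel) (predictable_space T - A)" .
    qed (rule Diff_subset)
  next
    case (union A)
    then have A: "\<And>i. A i \<in> sets (M \<Otimes>\<^sub>M lborel)" "\<And>i. A i \<subseteq> predictable_space T" by simp_all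
    have "\<forall>i. \<exists>g. g \<in> borel_measurable M \<and> (AE \<omega> in M. emeasure (N \<omega>) (Pair \<omega> -` A i) = g \<omega>) \<and>
      (\<integral>\<^sup>+\<omega>. g \<omega> \<partial>M) = emeasure (M \<Otimes>\<^sub>M lborel) (A i)"
      using union.IH by (simp add: Bex_def)
    from choice[OF this] obtain g where g': "\<forall>i. g i \<in> borel_measurable M \<and> (AE \<omega> in M. emeasure (N \<omega>) (Pair \<omega> -` A i) = g i \<omega>) \<and>
      (\<integral>\<^sup>+\<omega>. g i \<omega> \<partial>M) = emeasure (M \<Otimes>\<^sub>M lborel) (A i)" by (rule exE)
    have g: "\<And>i. g i \<in> borel_measurable M"
      "\<And>i. AE \<omega> in M. emeasure (N \<omega>) (Pair \<omega> -` A i) = g i \<omega>"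
      "\<And>i. (\<integral>\<^sup>+\<omega>. g i \<omega> \<partial>M) = emeasure (M \<Otimes>\<^sub>M lborel) (A i)"
      using g' by (simp_all only: simp_thms)
    show ?case
    proof (intro conjI bexI)
      show "(\<Union>i. A i) \<in> sets (M \<Otimes>\<^sub>M lborel)" by (rule sets.countable_UN) (rule image_subsetI, rule A(1))
      show "(\<Union>i. A i) \<subseteq> predictable_space T" by (rule UN_least) (rule A(2))
      show "(\<lambda>\<omega>. \<Sum>i. g i \<omega>) \<in> borel_measurable M" by (intro borel_measurable_suminf_order g(1))
      have "AE \<omega> in M. \<forall>i. emeasure (N \<omega>) (Pair \<omega> -` A i) = g i \<omega>"
        unfolding AE_all_countable by (intro allI g(2))
      then show "AE \<omega> in M. emeasure (N \<omega>) (Pair \<omega> -` (\<Union>i. A i)) = (\<Sum>i. g i \<omega>)"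
        using AE_space
      proof eventually_elim
        case (elim \<omega>)
        have "(\<Sum>i. emeasure (N \<omega>) (Pair \<omega> -` A i)) = emeasure (N \<omega>) (\<Union>i. Pair \<omega> -` A i)"
        proof (rule suminf_emeasure)
          show "range (\<lambda>i. Pair \<omega> -` A i) \<subseteq> sets (N \<omega>)"
            unfolding sets_N[OF elim(2)] by (rule image_subsetI) (rule section_in_strip[OF A])
          show "disjoint_family (\<lambda>i. Pair \<omega> -` A i)"
            using union.hyps(1) by (auto simp: disjoint_family_on_def)
        qed
        with elim(1) show ?case by (simp add: vimage_UN)
      qed
      have "(\<integral>\<^sup>+\<omega>. (\<Sum>i. g i \<omega>) \<partial>M) = (\<Sum>i. emeasure (M \<Otimes>\<^sub>M lborel) (A i))"
        by (subst nn_integral_suminf[OF g(1)]) (simp only: g(3))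
      also have "\<dots> = emeasure (M \<Otimes>\<^sub>M lborel) (\<Union>i. A i)"
        using union.hyps(1) by (intro suminf_emeasure image_subsetI A(1))
      finally show "(\<integral>\<^sup>+\<omega>. (\<Sum>i. g i \<omega>) \<partial>M) = emeasure (M \<Otimes>\<^sub>M lborel) (\<Union>i. A i)" .
    qed
  qed
  then show "A \<in> sets (M \<Otimes>\<^sub>M lborel)"
    and "\<exists>g\<in>borel_measurable M. (AE \<omega> in M. emeasure (N \<omega>) (Pair \<omega> -` A) = g \<omega>) \<and>
      (\<integral>\<^sup>+\<omega>. g \<omega> \<partial>M) = emeasure (M \<Otimes>\<^sub>M lborel) A" by simp_all
qed

lemma predictable_rectangle:
  "0 \<le> a \<Longrightarrow> a \<le> b \<Longrightarrow> b \<le> T \<Longrightarrow> E \<in> sets (filtration a) \<Longrightarrow> B \<in> sets borel \<Longrightarrow> B \<subseteq> {0..1} \<Longrightarrow>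
    E \<times> ({a<..b} \<times> B) \<in> sets (predictable T)"
  unfolding sets_predictable by (rule sigma_sets.Basic) (rule predictable_rectanglesI)

lemma predictable_time: assumes "0 \<le> T" shows "(\<lambda>z. fst (snd z)) \<in> borel_measurable (predictable T)"
  unfolding borel_measurable_iff_le
proof
  fix c :: real
  have "{z \<in> space (predictable T). fst (snd z) \<le> c} = space M \<times> ({0<..max 0 (min T c)} \<times> {0..1})"
    by (auto simp: predictable_space_def)
  also have "\<dots> \<in> sets (predictable T)"
    using assms sets.top[of "filtration 0"] by (intro predictable_rectangle) auto
  finally show "{z \<in> space (predictable T). fst (snd z) \<le> c} \<in> sets (predictable T)" .
qed

lemma predictable_mark: assumes "0 \<le> T" shows "(\<lambda>z. snd (snd z)) \<in> borel_measurable (predictable T)"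
  unfolding borel_measurable_iff_le
proof
  fix c :: real
  have "{z \<in> space (predictable T). snd (snd z) \<le> c} = space M \<times> ({0<..T} \<times> ({0..1} \<inter> {..c}))"
    by (auto simp: predictable_space_def)
  also have "\<dots> \<in> sets (predictable T)"
    using assms sets.top[of "filtration 0"] by (intro predictable_rectangle) auto
  finally show "{z \<in> space (predictable T). snd (snd z) \<le> c} \<in> sets (predictable T)" .
qed

text \<open>Left limits are taken along grid points strictly before \<open>s\<close>, where the process depends on the
  past only; this makes them predictable.\<close>

definition grid_before :: "nat \<Rightarrow> real \<Rightarrow> real" where
  "grid_before n s = real (nat (\<lceil>real (Suc n) * s\<rceil> - 1)) / real (Suc n)"

lemma grid_before:
  assumes "0 < s"
  shows "0 \<le> grid_before n s" "grid_before n s < s" "s - inverse (real (Suc n)) \<le> grid_before n s"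
proof -
  define m where "m = real (Suc n)"
  have m: "0 < m" by (simp add: m_def)
  have "0 < m * s" using assms m by simp
  then have "1 \<le> \<lceil>m * s\<rceil>" by (simp add: one_le_ceiling)
  then have eq: "grid_before n s = (real_of_int \<lceil>m * s\<rceil> - 1) / m"
    unfolding grid_before_def m_def[symmetric] by simp
  show "0 \<le> grid_before n s" by (simp add: grid_before_def)
  have "real_of_int \<lceil>m * s\<rceil> - 1 < m * s" by linarith
  then show "grid_before n s < s" unfolding eq using m by (simp add: pos_divide_less_eq mult.commute)
  have "m * s - 1 \<le> real_of_int \<lceil>m * s\<rceil> - 1" by linarith
  then show "s - inverse (real (Suc n)) \<le> grid_before n s"
    unfolding eq m_def[symmetric] using m by (simp add: pos_le_divide_eq right_diff_distrib mult.commute)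
qed

lemma grid_before_tendsto:
  assumes "0 < s" shows "filterlim (\<lambda>n. grid_before n s) (at_left s) sequentially"
proof (rule tendsto_imp_filterlim_at_left)
  show "(\<lambda>n. grid_before n s) \<longlonglongrightarrow> s"
  proof (rule tendsto_sandwich[OF _ _ _ tendsto_const])
    show "\<forall>\<^sub>F n in sequentially. s - inverse (real (Suc n)) \<le> grid_before n s"
      by (intro always_eventually allI grid_before(3) assms)
    show "\<forall>\<^sub>F n in sequentially. grid_before n s \<le> s"
      by (intro always_eventually allI less_imp_le grid_before(2) assms)
    have "(\<lambda>n. s - inverse (real (Suc n))) \<longlonglongrightarrow> s - 0"
      by (intro tendsto_diff tendsto_const LIMSEQ_inverse_real_of_nat)
    then show "(\<lambda>n. s - inverse (real (Suc n))) \<longlonglongrightarrow> s" by (simp only: diff_zero)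
  qed
  show "\<forall>\<^sub>F n in sequentially. grid_before n s < s"
    by (intro always_eventually allI grid_before(2) assms)
qed

text \<open>A limit along a sequence, defined for all \<open>\<omega>\<close> with an unspecified
  value where there is no convergence; measurability thus holds without exceptional sets.\<close>

definition left_lim :: "(real \<Rightarrow> 'a \<Rightarrow> real) \<Rightarrow> 'a \<Rightarrow> real \<Rightarrow> real" where
  "left_lim X \<omega> s = lim (\<lambda>n. X (grid_before n s) \<omega>)"

text \<open>At grid level \<open>n\<close> the sampled value is constant for \<open>s\<close> in a
  cell (k/m, (k+1)/m] and equals the process at the left endpoint, hence is known there. Preimages
  are countable unions of predictable rectangles, the last cell being cut off at
  \<open>T\<close>.\<close>

lemma predictable_left_lim:
  fixes X :: "real \<Rightarrow> 'a \<Rightarrow> real"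
  assumes X: "\<And>t. 0 \<le> t \<Longrightarrow> X t \<in> borel_measurable (filtration t)"
  shows "(\<lambda>z. left_lim X (fst z) (fst (snd z))) \<in> borel_measurable (predictable T)"
  unfolding left_lim_def
proof (rule borel_measurable_lim_metric)
  fix n
  define m where "m = real (Suc n)"
  have m: "0 < m" by (simp add: m_def)
  show "(\<lambda>z. X (grid_before n (fst (snd z))) (fst z)) \<in> borel_measurable (predictable T)"
  proof (rule measurableI)
    fix B :: "real set" assume B: "B \<in> sets borel"
    define E where "E k = {\<omega>\<in>space M. X (real k / m) \<omega> \<in> B}" for k
    have E: "E k \<in> sets (filtration (real k / m))" for k
    proof -
      have "X (real k / m) \<in> borel_measurable (filtration (real k / m))" using m by (intro X) auto
      from measurable_sets[OF this B] show ?thesis by (simp add: E_def vimage_def Int_def conj_commute)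
    qed
    have "(\<lambda>z. X (grid_before n (fst (snd z))) (fst z)) -` B \<inter> space (predictable T) =
        (\<Union>k\<in>{k. real k / m \<le> T}. E k \<times> ({real k / m<..min T ((real k + 1) / m)} \<times> {0..1}))"
      (is "?L = ?R")
    proof (intro equalityI subsetI)
      fix z assume z: "z \<in> ?L"
      obtain \<omega> s u where z_eq: "z = (\<omega>, s, u)" by (cases z)
      from z have s: "\<omega> \<in> space M" "0 < s" "s \<le> T" "u \<in> {0..1}" "X (grid_before n s) \<omega> \<in> B"
        by (auto simp: z_eq predictable_space_def)
      define k where "k = nat (\<lceil>m * s\<rceil> - 1)"
      have k: "grid_before n s = real k / m" by (simp add: grid_before_def k_def m_def)
      have "s - inverse m \<le> real k / m" "real k / m < s"
        using grid_before(3)[OF s(2), of n] grid_before(2)[OF s(2), of n]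
        unfolding k m_def[symmetric] by (simp_all only:)
      then have "s \<le> (real k + 1) / m" by (simp add: add_divide_distrib inverse_eq_divide)
      with s \<open>real k / m < s\<close> show "z \<in> ?R"
        by (intro UN_I[of k]) (auto simp: z_eq E_def k)
    next
      fix z assume "z \<in> ?R"
      then obtain k \<omega> s u where z: "z = (\<omega>, s, u)" "\<omega> \<in> E k" "real k / m < s" "s \<le> T" "s \<le> (real k + 1) / m" "u \<in> {0..1}"
        by auto
      have "0 \<le> real k / m" using m by simp
      then have s0: "0 < s" using z(3) by linarith
      have "real k < m * s" "m * s \<le> real k + 1"
        using z(3,5) m by (simp_all add: pos_divide_less_eq pos_le_divide_eq mult.commute)
      then have "\<lceil>m * s\<rceil> = int k + 1" by (intro ceiling_unique) auto
      then have "grid_before n s = real k / m" by (simp add: grid_before_def m_def)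
      with z s0 show "z \<in> ?L" by (auto simp: predictable_space_def E_def)
    qed
    also have "\<dots> \<in> sets (predictable T)"
    proof (rule sets.countable_UN'')
      fix k assume k: "k \<in> {k. real k / m \<le> T}"
      have "real k / m \<le> (real k + 1) / m" using m by (simp add: divide_right_mono)
      with k show "E k \<times> ({real k / m<..min T ((real k + 1) / m)} \<times> {0..1}) \<in> sets (predictable T)"
        using m by (intro predictable_rectangle E) auto
    qed simp
    finally show "(\<lambda>z. X (grid_before n (fst (snd z))) (fst z)) -` B \<inter> space (predictable T) \<in> sets (predictable T)" .
  qed simp
qed

end

section \<open>Jump times and marks\<close>

context driven
begin

lemma strip_segment:
  assumes "0 \<le> s" shows "{s} \<times> {0..1} \<in> sets strip_intensity" "emeasure lborel ({s} \<times> {0..1::real}) = 0"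
  using assms by (auto intro: Times_in_strip simp: emeasure_lborel_Times)

lemma emeasure_lborel_strip: "0 \<le> t \<Longrightarrow> emeasure lborel (strip t) = ennreal t"
  by (simp add: emeasure_lborel_Times)

text \<open>Cut (0, T] into (n+1) T cells of length 1/(n+1). By the quadratic bound some cell holds
  two points with probability at most T/(n+1), which tends to 0; but a time carrying two points
  spoils a cell for every \<open>n\<close>.\<close>

lemma AE_simple_upto:
  "AE \<omega> in M. \<forall>s\<in>{0<..real T}. emeasure (N \<omega>) ({s} \<times> {0..1}) < 2"
proof -
  define I where "I n k = {real k / real (Suc n)<..(real k + 1) / real (Suc n)} \<times> {0..1::real}" for n k
  define Z where "Z n = (\<Union>k<Suc n * T. {\<omega>\<in>space M. 2 \<le> emeasure (N \<omega>) (I n k)})" for n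
  have I: "I n k \<in> sets strip_intensity" for n k
  proof -
    have "{real k / real (Suc n)<..(real k + 1) / real (Suc n)} \<subseteq> {0..}"
    proof
      fix x assume "x \<in> {real k / real (Suc n)<..(real k + 1) / real (Suc n)}"
      then have "real k / real (Suc n) < x" by (simp only: greaterThanAtMost_iff)
      moreover have "0 \<le> real k / real (Suc n)" by simp
      ultimately have "0 \<le> x" by linarith
      then show "x \<in> {0..}" by simp
    qed
    then show ?thesis unfolding I_def by (intro Times_in_strip) simp_all
  qed
  have I_eq: "emeasure lborel (I n k) = ennreal (1 / real (Suc n))" for n k
  proof -
    have "real k / real (Suc n) \<le> (real k + 1) / real (Suc n)" by (intro divide_right_mono) auto
    moreover have "(real k + 1) / real (Suc n) - real k / real (Suc n) = 1 / real (Suc n)"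
      by (simp add: diff_divide_distrib[symmetric])
    ultimately show ?thesis
      unfolding I_def by (subst emeasure_strip_box(1)) (simp_all del: of_nat_Suc)
  qed
  have Zk: "{\<omega>\<in>space M. 2 \<le> emeasure (N \<omega>) (I n k)} \<in> events" for n k
    using N_measurable[OF I] by (rule borel_measurable_le[OF borel_measurable_const])
  have Z: "Z n \<in> events" for n unfolding Z_def by (intro sets.finite_UN Zk) auto
  have Z_le: "prob (Z n) \<le> real T / real (Suc n)" for n
  proof -
    have "prob (Z n) \<le> (\<Sum>k<Suc n * T. prob {\<omega>\<in>space M. 2 \<le> emeasure (N \<omega>) (I n k)})"
      unfolding Z_def by (intro finite_measure_subadditive_finite) (use Zk in auto)
    also have "\<dots> \<le> (\<Sum>k<Suc n * T. (1 / real (Suc n))\<^sup>2)"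
    proof (rule sum_mono)
      fix k
      have "measure lborel (I n k) = 1 / real (Suc n)" unfolding measure_def I_eq by simp
      with prob_N_ge_2[OF I, of n k] I_eq[of n k]
      show "prob {\<omega>\<in>space M. 2 \<le> emeasure (N \<omega>) (I n k)} \<le> (1 / real (Suc n))\<^sup>2" by simp
    qed
    also have "\<dots> = real (Suc n) * real T * (1 / real (Suc n))\<^sup>2"
      by (simp only: sum_constant card_lessThan of_nat_mult)
    also have "\<dots> = real T / real (Suc n)" by (simp add: power2_eq_square del: of_nat_Suc)
    finally show ?thesis .
  qed
  have "prob (\<Inter>n. Z n) \<le> real T / real (Suc n)" for n
    by (rule order_trans[OF finite_measure_mono Z_le[of n]]) (use Z in auto)
  moreover have "(\<lambda>n. real T / real (Suc n)) \<longlonglongrightarrow> 0"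
    using tendsto_mult_right_zero[OF LIMSEQ_inverse_real_of_nat, of "real T"] by (simp add: divide_inverse)
  ultimately have "prob (\<Inter>n. Z n) \<le> 0" by (intro LIMSEQ_le_const[of _ 0]) auto
  then have "prob (\<Inter>n. Z n) = 0" by (simp add: measure_le_0_iff)
  then have "(\<Inter>n. Z n) \<in> null_sets M" using Z by (auto simp: null_sets_def emeasure_eq_measure)
  then have "AE \<omega> in M. \<omega> \<notin> (\<Inter>n. Z n)" by (rule AE_not_in)
  then show ?thesis
    using AE_space
  proof eventually_elim
    case (elim \<omega>)
    show ?case
    proof (rule ballI, rule ccontr)
      fix s assume s: "s \<in> {0<..real T}" and "\<not> emeasure (N \<omega>) ({s} \<times> {0..1}) < 2"
      then have 2: "2 \<le> emeasure (N \<omega>) ({s} \<times> {0..1})" by simp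
      have "\<omega> \<in> Z n" for n
      proof -
        define m where "m = real (Suc n)"
        have m: "0 < m" by (simp add: m_def)
        define k where "k = nat (\<lceil>m * s\<rceil> - 1)"
        have k: "grid_before n s = real k / m" by (simp add: grid_before_def k_def m_def)
        have "s - inverse m \<le> real k / m" and lt: "real k / m < s"
          using grid_before(3)[of s n] grid_before(2)[of s n] s
          unfolding k m_def[symmetric] by (simp_all only: greaterThanAtMost_iff)
        then have le: "s \<le> (real k + 1) / m" by (simp add: add_divide_distrib inverse_eq_divide)
        have "real k < m * s" using lt m by (simp add: pos_divide_less_eq mult.commute)
        also have "m * s \<le> m * real T" using s m by simp
        also have "\<dots> = real (Suc n * T)" by (simp only: m_def of_nat_mult)
        finally have "k < Suc n * T" by (simp only: of_nat_less_iff)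
        moreover have "{s} \<times> {0..1} \<subseteq> I n k" using lt le by (auto simp: I_def m_def)
        then have "2 \<le> emeasure (N \<omega>) (I n k)"
          using I sets_N[OF elim(2)] by (intro order_trans[OF 2] emeasure_mono) auto
        ultimately show ?thesis using elim(2) by (auto simp: Z_def)
      qed
      with elim(1) show False by blast
    qed
  qed
qed

text \<open>The almost sure properties under which paths can be treated one by one: finitely many
  points up to each time, none at time 0, no two at once. Points of mark 1 are excluded because the
  inverse of a distribution function is infinite there.\<close>

definition good :: "'a \<Rightarrow> bool" where
  "good \<omega> \<longleftrightarrow> \<omega> \<in> space M \<and> (\<forall>n::nat. emeasure (N \<omega>) (strip (real n)) < \<infinity>) \<and>
     emeasure (N \<omega>) ({0} \<times> {0..1}) = 0 \<and> emeasure (N \<omega>) ({0..} \<times> {1}) = 0 \<and>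
     (\<forall>s>0. emeasure (N \<omega>) ({s} \<times> {0..1}) < 2)"

lemma AE_good: "AE \<omega> in M. good \<omega>"
proof -
  have "AE \<omega> in M. \<exists>k::nat. emeasure (N \<omega>) (strip (real n)) = of_nat k" for n
    by (rule AE_N_finite[OF strip_sets]) (simp add: emeasure_lborel_strip)
  then have 1: "AE \<omega> in M. \<forall>n. \<exists>k::nat. emeasure (N \<omega>) (strip (real n)) = of_nat k"
    by (simp add: AE_all_countable)
  have 2: "AE \<omega> in M. emeasure (N \<omega>) ({0} \<times> {0..1}) = 0"
    by (rule AE_N_null) (rule strip_segment, simp)+
  have "emeasure lborel ({0::real..} \<times> {1::real}) = 0"
    by (subst emeasure_lborel_Times) auto
  then have 3: "AE \<omega> in M. emeasure (N \<omega>) ({0..} \<times> {1}) = 0"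
    by (intro AE_N_null Times_in_strip) auto
  have 4: "AE \<omega> in M. \<forall>T. \<forall>s\<in>{0<..real T}. emeasure (N \<omega>) ({s} \<times> {0..1}) < 2"
    using AE_simple_upto by (simp add: AE_all_countable)
  show ?thesis
    using 1 2 3 4 AE_space
  proof eventually_elim
    case (elim \<omega>)
    have "emeasure (N \<omega>) (strip (real n)) < \<infinity>" for n
    proof -
      from elim(1) obtain k :: nat where "emeasure (N \<omega>) (strip (real n)) = of_nat k" by blast
      then show ?thesis by (simp add: of_nat_less_top)
    qed
    moreover have "emeasure (N \<omega>) ({s} \<times> {0..1}) < 2" if "0 < s" for s
    proof -
      obtain T :: nat where "s \<le> real T" using real_arch_simple by blast
      with elim(4) that show ?thesis by auto
    qed
    ultimately show ?case using elim by (simp add: good_def)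
  qed
qed

section \<open>Jump times and marks of a good realisation\<close>

definition jumps :: "'a \<Rightarrow> real set" where
  "jumps \<omega> = {s. 0 \<le> s \<and> emeasure (N \<omega>) ({s} \<times> {0..1}) \<noteq> 0}"

definition mark :: "'a \<Rightarrow> real \<Rightarrow> real" where
  "mark \<omega> s = (SOME u. u \<in> {0..1} \<and> emeasure (N \<omega>) {(s, u)} \<noteq> 0)"

context
  fixes \<omega> assumes good: "good \<omega>"
begin

lemma good_space: "\<omega> \<in> space M" using good by (simp add: good_def)

lemma point_sets: "0 \<le> s \<Longrightarrow> u \<in> {0..1} \<Longrightarrow> {(s, u)} \<in> sets (N \<omega>)"
  using Times_in_strip[of "{s}" "{u}"] sets_N[OF good_space] by auto

lemma segment_sets: "0 \<le> s \<Longrightarrow> {s} \<times> {0..1} \<in> sets (N \<omega>)"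
  using strip_segment sets_N[OF good_space] by auto

lemma strip_finite: "emeasure (N \<omega>) (strip t) < \<infinity>"
proof -
  obtain n :: nat where n: "t \<le> real n" using real_arch_simple by blast
  have "emeasure (N \<omega>) (strip t) \<le> emeasure (N \<omega>) (strip (real n))"
    using n strip_sets sets_N[OF good_space] by (intro emeasure_mono) auto
  also have "\<dots> < \<infinity>" using good by (simp add: good_def)
  finally show ?thesis .
qed

lemma strip_atoms:
  "finite {p\<in>strip t. emeasure (N \<omega>) {p} \<noteq> 0}"
  "emeasure (N \<omega>) (strip t - {p\<in>strip t. emeasure (N \<omega>) {p} \<noteq> 0}) = 0"
proof -
  have s: "sets (N \<omega>) = sets (restrict_space borel ({0..} \<times> {0..1}))"
    using sets_N[OF good_space] by (simp add: strip_intensity_def sets_restrict_space)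
  have A: "strip t \<in> sets (N \<omega>)" using strip_sets sets_N[OF good_space] by simp
  have int: "emeasure (N \<omega>) B \<in> insert \<infinity> (range of_nat)" if "B \<in> sets (N \<omega>)" for B
    using N_integer[OF good_space] that sets_N[OF good_space] by simp
  show "finite {p\<in>strip t. emeasure (N \<omega>) {p} \<noteq> 0}"
    by (rule integer_valued_finite_atoms(1)[OF s A strip_finite int])
  show "emeasure (N \<omega>) (strip t - {p\<in>strip t. emeasure (N \<omega>) {p} \<noteq> 0}) = 0"
    by (rule integer_valued_finite_atoms(2)[OF s A strip_finite int])
qed

lemma atom_mass:
  assumes "0 < s" "u \<in> {0..1}" "emeasure (N \<omega>) {(s, u)} \<noteq> 0" shows "emeasure (N \<omega>) {(s, u)} = 1"
proof -
  have "emeasure (N \<omega>) {(s, u)} \<le> emeasure (N \<omega>) ({s} \<times> {0..1})"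
    using assms segment_sets[of s] by (intro emeasure_mono) auto
  also have "\<dots> < 2" using good assms by (simp add: good_def)
  finally have lt: "emeasure (N \<omega>) {(s, u)} < 2" .
  have "{(s, u)} \<in> sets strip_intensity" using point_sets[of s u] assms sets_N[OF good_space] by auto
  from N_integer[OF good_space this] lt obtain k :: nat where k: "emeasure (N \<omega>) {(s, u)} = of_nat k" by auto
  have "of_nat k < (of_nat 2 :: ennreal)" using lt k by simp
  then have "k < 2" by (simp only: of_nat_less_iff)
  moreover have "k \<noteq> 0" using assms(3) k by auto
  ultimately have "k = 1" by simp
  with k show ?thesis by simp
qed

lemma segment_null: "emeasure (N \<omega>) ({0} \<times> {0..1}) = 0"
  using good by (simp add: good_def)

lemma jumps_pos: "jumps \<omega> \<subseteq> {0<..}"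
  using segment_null by (auto simp: jumps_def less_le)

lemma atom_jump:
  assumes "0 \<le> s" "u \<in> {0..1}" "emeasure (N \<omega>) {(s, u)} \<noteq> 0" shows "s \<in> jumps \<omega>"
proof -
  have "emeasure (N \<omega>) {(s, u)} \<le> emeasure (N \<omega>) ({s} \<times> {0..1})"
    using assms segment_sets[of s] by (intro emeasure_mono) auto
  with assms show ?thesis by (auto simp: jumps_def)
qed

text \<open>A segment without atoms would lie in the atom-free part of the strip, which has mass
  0.\<close>

lemma mark_atom:
  assumes s: "s \<in> jumps \<omega>" shows "mark \<omega> s \<in> {0..1}" "emeasure (N \<omega>) {(s, mark \<omega> s)} \<noteq> 0"
proof -
  have "\<exists>u. u \<in> {0..1} \<and> emeasure (N \<omega>) {(s, u)} \<noteq> 0"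
  proof (rule ccontr)
    assume no: "\<nexists>u. u \<in> {0..1} \<and> emeasure (N \<omega>) {(s, u)} \<noteq> 0"
    let ?F = "{p\<in>strip s. emeasure (N \<omega>) {p} \<noteq> 0}"
    have s0: "0 \<le> s" using s by (simp add: jumps_def)
    have "{s} \<times> {0..1} \<subseteq> strip s - ?F" using no s0 by auto
    moreover have "strip s - ?F \<in> sets (N \<omega>)"
    proof -
      have "(\<Union>p\<in>?F. {p}) \<in> sets (N \<omega>)"
        using strip_atoms(1)[of s] by (rule sets.finite_UN) (auto intro!: point_sets)
      then have "?F \<in> sets (N \<omega>)" by simp
      moreover have "strip s \<in> sets (N \<omega>)" using strip_sets sets_N[OF good_space] by simp
      ultimately show ?thesis by (intro sets.Diff)
    qed
    ultimately have "emeasure (N \<omega>) ({s} \<times> {0..1}) \<le> emeasure (N \<omega>) (strip s - ?F)"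
      by (rule emeasure_mono)
    with strip_atoms(2)[of s] s show False by (simp add: jumps_def)
  qed
  from someI_ex[OF this] show "mark \<omega> s \<in> {0..1}" "emeasure (N \<omega>) {(s, mark \<omega> s)} \<noteq> 0"
    unfolding mark_def by auto
qed

lemma mark_unique:
  assumes "0 < s" "u \<in> {0..1}" "emeasure (N \<omega>) {(s, u)} \<noteq> 0" shows "u = mark \<omega> s"
proof (rule ccontr)
  assume ne: "u \<noteq> mark \<omega> s"
  have j: "s \<in> jumps \<omega>" by (rule atom_jump) (use assms in auto)
  note m = mark_atom[OF j]
  have "emeasure (N \<omega>) {(s, u)} + emeasure (N \<omega>) {(s, mark \<omega> s)} = emeasure (N \<omega>) ({(s, u)} \<union> {(s, mark \<omega> s)})"
    using assms m ne by (intro plus_emeasure point_sets) auto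
  also have "\<dots> \<le> emeasure (N \<omega>) ({s} \<times> {0..1})"
    using assms m segment_sets[of s] by (intro emeasure_mono) auto
  also have "\<dots> < 2" using good assms by (simp add: good_def)
  finally show False
    using atom_mass[OF assms] atom_mass[OF assms(1) m] by (simp add: one_add_one)
qed

lemma mark_less_1: assumes s: "s \<in> jumps \<omega>" shows "mark \<omega> s < 1"
proof -
  have "mark \<omega> s \<noteq> 1"
  proof
    assume 1: "mark \<omega> s = 1"
    have "{0..} \<times> {1} \<in> sets (N \<omega>)"
      unfolding sets_N[OF good_space] by (rule Times_in_strip) auto
    then have "emeasure (N \<omega>) {(s, 1)} \<le> emeasure (N \<omega>) ({0..} \<times> {1})"
      using s by (intro emeasure_mono) (auto simp: jumps_def)
    with mark_atom(2)[OF s] 1 good show False by (simp add: good_def)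
  qed
  with mark_atom(1)[OF s] show ?thesis by auto
qed

lemma strip_atoms_eq:
  "{p\<in>strip t. emeasure (N \<omega>) {p} \<noteq> 0} = (\<lambda>s. (s, mark \<omega> s)) ` (jumps \<omega> \<inter> {..t})"
proof (intro equalityI subsetI)
  fix p assume p: "p \<in> {p\<in>strip t. emeasure (N \<omega>) {p} \<noteq> 0}"
  obtain s u where su: "p = (s, u)" by (cases p)
  with p have 1: "0 \<le> s" "s \<le> t" "u \<in> {0..1}" "emeasure (N \<omega>) {(s, u)} \<noteq> 0" by auto
  then have j: "s \<in> jumps \<omega>" by (intro atom_jump)
  with jumps_pos 1 mark_unique[of s u] show "p \<in> (\<lambda>s. (s, mark \<omega> s)) ` (jumps \<omega> \<inter> {..t})"
    unfolding su by (intro image_eqI[of _ _ s]) auto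
next
  fix p assume "p \<in> (\<lambda>s. (s, mark \<omega> s)) ` (jumps \<omega> \<inter> {..t})"
  then obtain s where "p = (s, mark \<omega> s)" "s \<in> jumps \<omega>" "s \<le> t" by auto
  with mark_atom[of s] jumps_pos show "p \<in> {p\<in>strip t. emeasure (N \<omega>) {p} \<noteq> 0}" by fastforce
qed

lemma finite_jumps: "finite (jumps \<omega> \<inter> {..t})"
  using strip_atoms(1)[of t] unfolding strip_atoms_eq by (rule finite_imageD) (auto simp: inj_on_def)

text \<open>The bridge from \<open>N\<close> to paths: each atom up to time \<open>t\<close> has
  mass 1 and sits above exactly one jump time, so integrals become finite sums over jump
  times.\<close>

lemma nn_integral_jumps:
  "(\<integral>\<^sup>+p. f p * indicator (strip t) p \<partial>N \<omega>) = (\<Sum>s\<in>jumps \<omega> \<inter> {..t}. f (s, mark \<omega> s))"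
proof -
  have "(\<integral>\<^sup>+p. f p * indicator (strip t) p \<partial>N \<omega>) =
      (\<Sum>p\<in>{p\<in>strip t. emeasure (N \<omega>) {p} \<noteq> 0}. f p * emeasure (N \<omega>) {p})"
  proof (rule nn_integral_finite_atoms)
    show "strip t \<in> sets (N \<omega>)" using strip_sets sets_N[OF good_space] by simp
    show "{p} \<in> sets (N \<omega>)" if "p \<in> {p\<in>strip t. emeasure (N \<omega>) {p} \<noteq> 0}" for p
      using that point_sets by (cases p) auto
  qed (use strip_atoms[of t] in auto)
  also have "\<dots> = (\<Sum>s\<in>jumps \<omega> \<inter> {..t}. f (s, mark \<omega> s) * emeasure (N \<omega>) {(s, mark \<omega> s)})"
    unfolding strip_atoms_eq by (subst sum.reindex) (auto simp: inj_on_def)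
  also have "\<dots> = (\<Sum>s\<in>jumps \<omega> \<inter> {..t}. f (s, mark \<omega> s))"
  proof (rule sum.cong[OF refl])
    fix s assume s: "s \<in> jumps \<omega> \<inter> {..t}"
    then have "emeasure (N \<omega>) {(s, mark \<omega> s)} = 1"
      using jumps_pos mark_atom[of s] by (intro atom_mass) auto
    then show "f (s, mark \<omega> s) * emeasure (N \<omega>) {(s, mark \<omega> s)} = f (s, mark \<omega> s)" by simp
  qed
  finally show ?thesis .
qed

lemma emeasure_jumps:
  assumes "A \<in> sets strip_intensity" "A \<subseteq> strip t"
  shows "emeasure (N \<omega>) A = (\<Sum>s\<in>jumps \<omega> \<inter> {..t}. indicator A (s, mark \<omega> s))"
proof -
  have "emeasure (N \<omega>) A = (\<integral>\<^sup>+p. indicator A p \<partial>N \<omega>)"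
    using assms sets_N[OF good_space] by simp
  also have "\<dots> = (\<integral>\<^sup>+p. indicator A p * indicator (strip t) p \<partial>N \<omega>)"
    using assms(2) by (intro nn_integral_cong) (auto simp: indicator_def)
  finally show ?thesis by (simp add: nn_integral_jumps)
qed

end

end

section \<open>Solutions with prescribed jump laws\<close>

text \<open>Monotonicity lets a rational slightly larger than any competitor take its place; a
  countable infimum yields joint measurability in time and mark.\<close>

lemma right_inverse_rational:
  assumes F: "mono F"
  shows "right_inverse F u = (INF q\<in>\<rat> \<inter> {0..}. if u < F q then ennreal q else top)"
proof (rule antisym)
  show "right_inverse F u \<le> (INF q\<in>\<rat> \<inter> {0..}. if u < F q then ennreal q else top)"
  proof (rule INF_greatest)
    fix q :: real assume q: "q \<in> \<rat> \<inter> {0..}"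
    show "right_inverse F u \<le> (if u < F q then ennreal q else top)"
      unfolding right_inverse_def using q by (auto intro!: INF_lower)
  qed
  show "(INF q\<in>\<rat> \<inter> {0..}. if u < F q then ennreal q else top) \<le> right_inverse F u"
    unfolding right_inverse_def
  proof (rule INF_greatest)
    fix x assume "x \<in> {x. 0 \<le> x \<and> u < F x}"
    then have x: "0 \<le> x" "u < F x" by auto
    show "(INF q\<in>\<rat> \<inter> {0..}. if u < F q then ennreal q else top) \<le> ennreal x"
    proof (rule ennreal_le_epsilon)
      fix e :: real assume e: "0 < e"
      then obtain q where q: "q \<in> \<rat>" "x < q" "q < x + e" using Rats_dense_in_real[of x "x + e"] by auto
      have "F x \<le> F q" by (rule monoD[OF F less_imp_le[OF q(2)]])
      with x have "u < F q" by simp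
      have "(INF q\<in>\<rat> \<inter> {0..}. if u < F q then ennreal q else top) \<le> (if u < F q then ennreal q else top)"
        using q x by (intro INF_lower) auto
      also have "\<dots> = ennreal q" using \<open>u < F q\<close> by simp
      also have "\<dots> \<le> ennreal (x + e)" using q by (intro ennreal_leI) simp
      finally show "(INF q\<in>\<rat> \<inter> {0..}. if u < F q then ennreal q else top) \<le> ennreal x + ennreal e"
        using x e by simp
    qed
  qed
qed

definition quantile :: "(real \<Rightarrow> real measure) \<Rightarrow> real \<Rightarrow> real \<Rightarrow> ennreal" where
  "quantile \<mu> s u = right_inverse (cdf (\<mu> (max 0 s))) u"

lemma (in real_distribution) mono_cdf: "mono (cdf M)"
  by (rule monoI) (rule cdf_nondecreasing)

lemma measurable_quantile:
  assumes k: "half_line_kernel \<mu>"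
  shows "case_prod (quantile \<mu>) \<in> borel_measurable (borel \<Otimes>\<^sub>M borel)"
proof -
  have mono: "mono (cdf (\<mu> (max 0 s)))" for s
    by (rule real_distribution.mono_cdf[OF half_line_kernel_real_distribution[OF k]]) simp
  have "(\<lambda>s. cdf (\<mu> (max 0 s)) q) \<in> borel_measurable borel" for q
    by (rule measurable_cdf_kernel[OF k[unfolded half_line_kernel_def] measurable_const]) simp
  note m = measurable_compose[OF measurable_fst this]
  have "(\<lambda>p. INF q\<in>\<rat> \<inter> {0..}. if snd p < cdf (\<mu> (max 0 (fst p))) q then ennreal q else top)
      \<in> borel_measurable (borel \<Otimes>\<^sub>M borel)"
  proof (rule borel_measurable_INF)
    show "countable (\<rat> \<inter> {0::real..})" by (rule countable_Int1[OF countable_rat])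
    show "(\<lambda>p. if snd p < cdf (\<mu> (max 0 (fst p))) q then ennreal q else top) \<in> borel_measurable (borel \<Otimes>\<^sub>M borel)" for q
      by (rule measurable_If[OF measurable_const measurable_const borel_measurable_less[OF measurable_snd m]]) simp_all
  qed
  moreover have "case_prod (quantile \<mu>) = (\<lambda>p. INF q\<in>\<rat> \<inter> {0..}. if snd p < cdf (\<mu> (max 0 (fst p))) q then ennreal q else top)"
    by (rule ext) (simp only: case_prod_beta quantile_def right_inverse_rational[OF mono])
  ultimately show ?thesis by (simp only:)
qed

lemma quantile_finite:
  assumes "half_line_kernel \<mu>" "u < 1" shows "quantile \<mu> s u < top"
proof -
  interpret R: real_distribution "\<mu> (max 0 s)" by (rule half_line_kernel_real_distribution[OF assms(1)]) simp
  have "\<forall>\<^sub>F x in at_top. u < cdf (\<mu> (max 0 s)) x"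
    using R.cdf_lim_at_top_prob assms(2) by (rule order_tendstoD)
  then have "\<forall>\<^sub>F x in at_top. u < cdf (\<mu> (max 0 s)) x \<and> 0 \<le> x"
    using eventually_ge_at_top[of "0::real"] by eventually_elim simp
  from eventually_happens'[OF _ this] obtain x where x: "u < cdf (\<mu> (max 0 s)) x" "0 \<le> x"
    by auto
  then have "quantile \<mu> s u \<le> ennreal x"
    unfolding quantile_def right_inverse_def by (intro INF_lower) simp
  then show ?thesis by (rule le_less_trans) simp
qed

text \<open>If the distribution function at \<open>y\<close> were below \<open>u\<close>, right
  continuity would keep it below \<open>u\<close> at some \<open>z > y\<close>, and the infimum
  would be at least \<open>z\<close>.\<close>

lemma (in real_distribution) right_inverse_le_imp:
  assumes "right_inverse (cdf M) u \<le> ennreal y" "0 \<le> y" shows "u \<le> cdf M y"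
proof (rule ccontr)
  assume "\<not> u \<le> cdf M y"
  then have lt: "cdf M y < u" by simp
  have "(cdf M \<longlongrightarrow> cdf M y) (at_right y)"
    using cdf_is_right_cont[of y] by (simp add: continuous_within)
  then have "\<forall>\<^sub>F x in at_right y. cdf M x < u" using lt by (rule order_tendstoD)
  then obtain b where b: "y < b" "\<And>x. y < x \<Longrightarrow> x < b \<Longrightarrow> cdf M x < u"
    unfolding eventually_at_right_field by auto
  define z where "z = (y + b) / 2"
  have z: "y < z" "cdf M z < u" using b by (auto simp: z_def)
  have "ennreal z \<le> right_inverse (cdf M) u"
    unfolding right_inverse_def
  proof (rule INF_greatest)
    fix x assume x: "x \<in> {x. 0 \<le> x \<and> u < cdf M x}"
    have "z \<le> x"
    proof (rule ccontr)
      assume "\<not> z \<le> x"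
      then have "cdf M x \<le> cdf M z" by (intro cdf_nondecreasing) simp
      with x z show False by simp
    qed
    then show "ennreal z \<le> ennreal x" by (rule ennreal_leI)
  qed
  with assms(1) have "ennreal z \<le> ennreal y" by (rule order_trans[rotated])
  with z assms(2) show False by (simp add: ennreal_le_iff)
qed

lemma AE_nonneg_cdf:
  assumes "real_distribution \<mu>" "AE x in \<mu>. 0 \<le> x" "y < 0" shows "cdf \<mu> y = 0"
proof -
  interpret real_distribution \<mu> by fact
  have "AE x in \<mu>. x \<notin> {..y}" using assms(2) by eventually_elim (use assms(3) in simp)
  then have "prob {..y} = 0" by (subst prob_eq_0) simp_all
  then show ?thesis by (simp add: cdf_def)
qed

text \<open>Inverse transform sampling: a uniform mark produces a jump of law \<open>\<mu>\<close>.
  For \<open>y \<ge> 0\<close> the set of marks lies between the half-open interval below the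
  distribution function at \<open>y\<close> and its closure with the point 1 added; these differ by
  a null set.\<close>

lemma emeasure_quantile_le:
  assumes k: "half_line_kernel \<mu>" and n: "AE x in \<mu> (max 0 s). 0 \<le> x"
  shows "emeasure lborel {u\<in>{0..1}. enn2real (quantile \<mu> s u) \<le> y} = ennreal (cdf (\<mu> (max 0 s)) y)"
proof -
  interpret R: real_distribution "\<mu> (max 0 s)" by (rule half_line_kernel_real_distribution[OF k]) simp
  let ?S = "{u\<in>{0..1}. enn2real (quantile \<mu> s u) \<le> y}" and ?F = "cdf (\<mu> (max 0 s)) y"
  have Fb: "0 \<le> ?F" "?F \<le> 1" by (rule R.cdf_bounds)+
  show ?thesis
  proof (cases "0 \<le> y")
    case False
    have "\<not> enn2real (quantile \<mu> s u) \<le> y" for u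
      using False enn2real_nonneg[of "quantile \<mu> s u"] by linarith
    then have "?S = {}" by simp
    then have "emeasure lborel ?S = 0" by (simp only: emeasure_empty)
    moreover have "?F = 0" by (rule AE_nonneg_cdf[OF R.real_distribution_axioms n]) (use False in simp)
    ultimately show ?thesis by simp
  next
    case True
    have "quantile \<mu> s \<in> borel_measurable borel"
      using measurable_compose[OF measurable_Pair1' measurable_quantile[OF k], of s] by simp
    then have "(\<lambda>u. enn2real (quantile \<mu> s u)) \<in> borel_measurable borel"
      by (rule measurable_compose) simp
    then have "{u \<in> space borel. enn2real (quantile \<mu> s u) \<le> y} \<in> sets borel"
      by (rule borel_measurable_le[OF _ borel_measurable_const])
    then have "{0..1} \<inter> {u \<in> space borel. enn2real (quantile \<mu> s u) \<le> y} \<in> sets lborel"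
      unfolding sets_lborel by (rule sets.Int[OF borel_closed[OF closed_atLeastAtMost]])
    moreover have "{0..1} \<inter> {u \<in> space borel. enn2real (quantile \<mu> s u) \<le> y} = ?S"
      by (rule set_eqI) (simp only: mem_Collect_eq Int_iff space_borel UNIV_I simp_thms)
    ultimately have S: "?S \<in> sets lborel" by (simp only:)
    have "{0..<?F} \<subseteq> ?S"
    proof
      fix u assume u: "u \<in> {0..<?F}"
      then have "quantile \<mu> s u \<le> ennreal y"
        unfolding quantile_def right_inverse_def using True by (intro INF_lower) simp
      then have "enn2real (quantile \<mu> s u) \<le> enn2real (ennreal y)" by (intro enn2real_mono) simp_all
      with u Fb True show "u \<in> ?S" by simp
    qed
    then have "emeasure lborel {0..<?F} \<le> emeasure lborel ?S" using S by (rule emeasure_mono)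
    then have 1: "ennreal ?F \<le> emeasure lborel ?S" using Fb by simp
    have "?S \<subseteq> {0..?F} \<union> {1}"
    proof
      fix u assume u: "u \<in> ?S"
      show "u \<in> {0..?F} \<union> {1}"
      proof (cases "u = 1")
        case False
        with u have "quantile \<mu> s u < top" by (intro quantile_finite[OF k]) simp
        then have "quantile \<mu> s u = ennreal (enn2real (quantile \<mu> s u))" by simp
        also have "\<dots> \<le> ennreal y" using u by (intro ennreal_leI) simp
        finally have "u \<le> ?F" unfolding quantile_def using True by (rule R.right_inverse_le_imp)
        with u show ?thesis by simp
      qed simp
    qed
    then have "emeasure lborel ?S \<le> emeasure lborel ({0..?F} \<union> {1})" by (rule emeasure_mono) simp
    also have "\<dots> \<le> emeasure lborel {0..?F} + emeasure lborel {1::real}" by (rule emeasure_subadditive) simp_all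
    also have "\<dots> = ennreal ?F" using Fb by simp
    finally show ?thesis using 1 by (rule antisym)
  qed
qed

text \<open>Right-continuous paths and dominated convergence make the expectation of every bounded
  continuous function right-continuous in time, hence measurable.\<close>

lemma (in prob_space) half_line_kernel_process:
  fixes X :: "real \<Rightarrow> 'a \<Rightarrow> real"
  assumes X: "\<And>t. 0 \<le> t \<Longrightarrow> X t \<in> borel_measurable M"
    and rc: "AE \<omega> in M. \<forall>t\<ge>0. ((\<lambda>s. X s \<omega>) \<longlongrightarrow> X t \<omega>) (at_right t)"
  shows "half_line_kernel (\<lambda>t. distr M borel (X t))"
proof (rule half_line_kernelI)
  show "real_distribution (distr M borel (X t))" if "0 \<le> t" for t
    by (rule real_distribution_distr[OF X[OF that]])
  fix f :: "real \<Rightarrow> real" assume f: "continuous_on UNIV f" "bounded (range f)"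
  obtain C where "\<forall>x. \<bar>f x\<bar> \<le> C" using bounded_range_abs_le[OF f(2)] by (rule exE)
  then have C: "\<bar>f x\<bar> \<le> C" for x by (rule spec)
  have fm: "f \<in> borel_measurable borel" by (rule borel_measurable_continuous_onI[OF f(1)])
  define \<phi> where "\<phi> s = (\<integral>\<omega>. f (X s \<omega>) \<partial>M)" for s
  have "(\<phi> \<longlongrightarrow> \<phi> t) (at_right t)" if t: "0 \<le> t" for t
  proof (rule tendsto_at_right_sequentially[of t "t + 1"])
    fix S :: "nat \<Rightarrow> real" assume S: "\<And>n. t < S n" "\<And>n. S n < t + 1" "decseq S" "S \<longlonglongrightarrow> t"
    have S0: "0 \<le> S n" for n using S(1)[of n] t by simp
    show "(\<lambda>n. \<phi> (S n)) \<longlonglongrightarrow> \<phi> t"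
      unfolding \<phi>_def
    proof (rule integral_dominated_convergence[where w = "\<lambda>_. C"])
      show "(\<lambda>\<omega>. f (X t \<omega>)) \<in> borel_measurable M" by (rule measurable_compose[OF X[OF t] fm])
      show "(\<lambda>\<omega>. f (X (S n) \<omega>)) \<in> borel_measurable M" for n by (rule measurable_compose[OF X[OF S0] fm])
      show "AE \<omega> in M. (\<lambda>n. f (X (S n) \<omega>)) \<longlonglongrightarrow> f (X t \<omega>)"
        using rc
      proof eventually_elim
        case (elim \<omega>)
        have "filterlim S (at_right t) sequentially"
          by (rule tendsto_imp_filterlim_at_right[OF S(4)]) (intro always_eventually allI S(1))
        moreover have "((\<lambda>s. X s \<omega>) \<longlongrightarrow> X t \<omega>) (at_right t)" using elim t by simp
        ultimately have "(\<lambda>n. X (S n) \<omega>) \<longlonglongrightarrow> X t \<omega>" by (rule filterlim_compose[rotated])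
        moreover have "isCont f (X t \<omega>)" using f(1) by (simp add: continuous_on_eq_continuous_at)
        ultimately show ?case by (rule isCont_tendsto_compose[rotated])
      qed
      show "AE \<omega> in M. norm (f (X (S n) \<omega>)) \<le> C" for n
        unfolding real_norm_def by (intro AE_I2 C)
    qed simp
  qed simp
  then have "(\<lambda>s. \<phi> (max 0 s)) \<in> borel_measurable borel" by (rule measurable_right_continuous)
  moreover have "\<phi> (max 0 s) = (\<integral>x. f x \<partial>distr M borel (X (max 0 s)))" for s
    unfolding \<phi>_def by (rule integral_distr[symmetric, OF X fm]) simp
  ultimately show "(\<lambda>s. \<integral>x. f x \<partial>distr M borel (X (max 0 s))) \<in> borel_measurable borel" by (simp only:)
qed

context driven
begin

definition input :: "(real \<Rightarrow> real measure) \<Rightarrow> real \<Rightarrow> 'a \<Rightarrow> real" where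
  "input \<mu> t \<omega> = enn2real (\<integral>\<^sup>+p. quantile \<mu> (fst p) (snd p) * indicator (strip t) p \<partial>N \<omega>)"

definition solution :: "(real \<Rightarrow> real measure) \<Rightarrow> real \<Rightarrow> 'a \<Rightarrow> real" where
  "solution \<mu> t \<omega> = reflected (X\<^sub>0 \<omega>) (\<lambda>s. input \<mu> s \<omega>) t"

abbreviation jump_size :: "(real \<Rightarrow> real measure) \<Rightarrow> 'a \<Rightarrow> real \<Rightarrow> real" where
  "jump_size \<mu> \<omega> s \<equiv> enn2real (quantile \<mu> s (mark \<omega> s))"

lemma borel_measurable_filtration_cong:
  assumes "\<And>\<omega>. \<omega> \<in> space M \<Longrightarrow> f \<omega> = g \<omega>" "g \<in> borel_measurable (filtration t)"
  shows "f \<in> borel_measurable (filtration t)"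
  using measurable_cong[of "filtration t" f g borel] assms by simp

text \<open>Induction from indicators, whose integrals are counts inside the strip up to time
  \<open>t\<close> and hence known at time \<open>t\<close>, through sums and monotone
  limits.\<close>

lemma measurable_nn_integral_N:
  assumes h: "h \<in> borel_measurable strip_intensity"
  shows "(\<lambda>\<omega>. \<integral>\<^sup>+p. h p * indicator (strip t) p \<partial>N \<omega>) \<in> borel_measurable (filtration t)"
  using h
proof (induction rule: borel_measurable_induct)
  case (cong f g)
  have "(\<integral>\<^sup>+p. f p * indicator (strip t) p \<partial>N \<omega>) = (\<integral>\<^sup>+p. g p * indicator (strip t) p \<partial>N \<omega>)" if "\<omega> \<in> space M" for \<omega>
    by (rule nn_integral_cong) (simp add: cong(3) sets_eq_imp_space_eq[OF sets_N[OF that]])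
  from this cong(4) show ?case by (rule borel_measurable_filtration_cong)
next
  case (set A)
  have "(\<integral>\<^sup>+p. indicator A p * indicator (strip t) p \<partial>N \<omega>) = emeasure (N \<omega>) (A \<inter> strip t)" if "\<omega> \<in> space M" for \<omega>
  proof -
    have "A \<inter> strip t \<in> sets (N \<omega>)" unfolding sets_N[OF that] using set strip_sets by (rule sets.Int)
    then have "(\<integral>\<^sup>+p. indicator (A \<inter> strip t) p \<partial>N \<omega>) = emeasure (N \<omega>) (A \<inter> strip t)" by (rule nn_integral_indicator)
    then show ?thesis by (simp only: indicator_inter_arith)
  qed
  moreover have "(\<lambda>\<omega>. emeasure (N \<omega>) (A \<inter> strip t)) \<in> borel_measurable (filtration t)"
    by (rule N_filtration[OF sets.Int[OF set strip_sets]]) simp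
  ultimately show ?case by (rule borel_measurable_filtration_cong)
next
  case (mult u c)
  have "(\<integral>\<^sup>+p. c * u p * indicator (strip t) p \<partial>N \<omega>) = c * (\<integral>\<^sup>+p. u p * indicator (strip t) p \<partial>N \<omega>)" if "\<omega> \<in> space M" for \<omega>
  proof -
    have "(\<lambda>p. u p * indicator (strip t) p) \<in> borel_measurable (N \<omega>)"
      unfolding measurable_cong_sets[OF sets_N[OF that] refl]
      by (intro borel_measurable_times_ennreal mult borel_measurable_indicator strip_sets)
    then show ?thesis by (subst nn_integral_cmult[symmetric]) (simp_all add: mult.assoc)
  qed
  moreover have "(\<lambda>\<omega>. c * (\<integral>\<^sup>+p. u p * indicator (strip t) p \<partial>N \<omega>)) \<in> borel_measurable (filtration t)"
    by (rule borel_measurable_times_ennreal[OF borel_measurable_const mult.IH])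
  ultimately show ?case by (rule borel_measurable_filtration_cong)
next
  case (add u v)
  have "(\<integral>\<^sup>+p. (v p + u p) * indicator (strip t) p \<partial>N \<omega>) =
      (\<integral>\<^sup>+p. v p * indicator (strip t) p \<partial>N \<omega>) + (\<integral>\<^sup>+p. u p * indicator (strip t) p \<partial>N \<omega>)" if "\<omega> \<in> space M" for \<omega>
  proof -
    have "(\<lambda>p. u p * indicator (strip t) p) \<in> borel_measurable (N \<omega>)" "(\<lambda>p. v p * indicator (strip t) p) \<in> borel_measurable (N \<omega>)"
      unfolding measurable_cong_sets[OF sets_N[OF that] refl]
      by (intro borel_measurable_times_ennreal add borel_measurable_indicator strip_sets)+
    then show ?thesis by (subst nn_integral_add[symmetric]) (simp_all add: distrib_right)
  qed
  moreover have "(\<lambda>\<omega>. (\<integral>\<^sup>+p. v p * indicator (strip t) p \<partial>N \<omega>) + (\<integral>\<^sup>+p. u p * indicator (strip t) p \<partial>N \<omega>))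
      \<in> borel_measurable (filtration t)"
    by (rule borel_measurable_add[OF add.IH(2) add.IH(1)])
  ultimately show ?case by (rule borel_measurable_filtration_cong)
next
  case (seq U)
  have "(\<integral>\<^sup>+p. (SUP i. U i) p * indicator (strip t) p \<partial>N \<omega>) = (SUP i. \<integral>\<^sup>+p. U i p * indicator (strip t) p \<partial>N \<omega>)"
    if "\<omega> \<in> space M" for \<omega>
  proof -
    have "(\<lambda>p. U i p * indicator (strip t) p) \<in> borel_measurable (N \<omega>)" for i
      unfolding measurable_cong_sets[OF sets_N[OF that] refl]
      by (intro borel_measurable_times_ennreal seq borel_measurable_indicator strip_sets)
    moreover have "incseq (\<lambda>i p. U i p * indicator (strip t) p)"
    proof (intro incseq_def[THEN iffD2] allI impI le_funI)
      fix m n :: nat and p assume "m \<le> n"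
      then have "U m p \<le> U n p" by (rule le_funD[OF incseqD[OF seq(3)]])
      then show "U m p * indicator (strip t) p \<le> U n p * indicator (strip t) p" by (rule mult_right_mono) simp
    qed
    ultimately show ?thesis
      by (subst nn_integral_monotone_convergence_SUP[symmetric]) (simp_all add: SUP_mult_right_ennreal image_comp)
  qed
  moreover have "(\<lambda>\<omega>. SUP i. \<integral>\<^sup>+p. U i p * indicator (strip t) p \<partial>N \<omega>) \<in> borel_measurable (filtration t)"
    by (rule borel_measurable_SUP) (simp_all add: seq)
  ultimately show ?case by (rule borel_measurable_filtration_cong)
qed

lemma input_adapted:
  assumes k: "half_line_kernel \<mu>" shows "input \<mu> t \<in> borel_measurable (filtration t)"
proof -
  have "(\<lambda>p. quantile \<mu> (fst p) (snd p)) \<in> borel_measurable borel"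
    using measurable_quantile[OF k] by (simp add: borel_prod case_prod_beta')
  then have "(\<lambda>p. quantile \<mu> (fst p) (snd p)) \<in> borel_measurable strip_intensity"
    unfolding strip_intensity_def by (intro measurable_restrict_space1) simp
  from measurable_nn_integral_N[OF this, of t]
  have "(\<lambda>\<omega>. \<integral>\<^sup>+p. quantile \<mu> (fst p) (snd p) * indicator (strip t) p \<partial>N \<omega>) \<in> borel_measurable (filtration t)" .
  from measurable_compose[OF this, of enn2real borel] show ?thesis
    unfolding input_def[abs_def] by simp
qed

lemma solution_adapted:
  assumes k: "half_line_kernel \<mu>" and t: "0 \<le> t"
  shows "solution \<mu> t \<in> borel_measurable (filtration t)"
  unfolding solution_def[abs_def] reflected_def
proof (intro borel_measurable_max borel_measurable_cSUP)
  have I: "input \<mu> s \<in> borel_measurable (filtration t)" if "s \<le> t" for s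
    by (rule measurable_filtration_mono[OF input_adapted[OF k] that])
  show "(\<lambda>\<omega>. X\<^sub>0 \<omega> + input \<mu> t \<omega> - t) \<in> borel_measurable (filtration t)"
    by (intro borel_measurable_diff borel_measurable_add X0_filtration I) simp_all
  show "countable (insert t ({0..<t} \<inter> \<rat>))"
    by (simp add: countable_Int2 countable_rat)
  show "(\<lambda>\<omega>. input \<mu> t \<omega> - input \<mu> q \<omega> - (t - q)) \<in> borel_measurable (filtration t)"
    if "q \<in> insert t ({0..<t} \<inter> \<rat>)" for q
    by (intro borel_measurable_diff I) (use that in auto)
  show "bdd_above ((\<lambda>q. input \<mu> t \<omega> - input \<mu> q \<omega> - (t - q)) ` insert t ({0..<t} \<inter> \<rat>))" for \<omega>
  proof (rule bdd_aboveI2)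
    fix q assume "q \<in> insert t ({0..<t} \<inter> \<rat>)"
    then have "q \<le> t" by auto
    moreover have "0 \<le> input \<mu> q \<omega>" by (simp add: input_def)
    ultimately show "input \<mu> t \<omega> - input \<mu> q \<omega> - (t - q) \<le> input \<mu> t \<omega>" by simp
  qed
qed

lemma good_jump_path:
  "good \<omega> \<Longrightarrow> 0 \<le> X\<^sub>0 \<omega> \<Longrightarrow> jump_path (jumps \<omega>) (jump_size \<mu> \<omega>) (X\<^sub>0 \<omega>)"
  by (simp add: jump_path_def finite_jumps jumps_pos)

lemma nn_integral_quantile:
  assumes g: "good \<omega>" and X0: "0 \<le> X\<^sub>0 \<omega>" and k: "half_line_kernel \<mu>"
  shows "(\<integral>\<^sup>+p. quantile \<mu> (fst p) (snd p) * indicator (strip t) p \<partial>N \<omega>) =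
    ennreal (jump_path.J (jumps \<omega>) (jump_size \<mu> \<omega>) t)"
proof -
  have "quantile \<mu> s (mark \<omega> s) = ennreal (jump_size \<mu> \<omega> s)" if "s \<in> jumps \<omega> \<inter> {..t}" for s
    using quantile_finite[OF k mark_less_1[OF g], of s s] that by simp
  then have "(\<Sum>s\<in>jumps \<omega> \<inter> {..t}. quantile \<mu> s (mark \<omega> s)) = (\<Sum>s\<in>jumps \<omega> \<inter> {..t}. ennreal (jump_size \<mu> \<omega> s))"
    by (rule sum.cong[OF refl])
  also have "\<dots> = ennreal (\<Sum>s\<in>jumps \<omega> \<inter> {..t}. jump_size \<mu> \<omega> s)" by (rule sum_ennreal) simp
  finally show ?thesis
    unfolding nn_integral_jumps[OF g] jump_path.J_def[OF good_jump_path[OF g X0]] fst_conv snd_conv .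
qed

lemma solution_path:
  assumes g: "good \<omega>" and X0: "0 \<le> X\<^sub>0 \<omega>" and k: "half_line_kernel \<mu>"
  shows "solution \<mu> t \<omega> = reflected (X\<^sub>0 \<omega>) (jump_path.J (jumps \<omega>) (jump_size \<mu> \<omega>)) t"
proof -
  have "input \<mu> s \<omega> = jump_path.J (jumps \<omega>) (jump_size \<mu> \<omega>) s" for s
    unfolding input_def nn_integral_quantile[OF assms]
    by (rule enn2real_ennreal) (rule jump_path.J_nonneg[OF good_jump_path[OF g X0]])
  then show ?thesis by (simp add: solution_def)
qed

lemma left_lim_path:
  assumes g: "good \<omega>" "0 \<le> X\<^sub>0 \<omega>" and k: "half_line_kernel \<mu>"
    and X: "\<And>t. 0 \<le> t \<Longrightarrow> X t \<omega> = solution \<mu> t \<omega>" and s: "0 < s"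
  shows "left_lim X \<omega> s = X s \<omega> - (if s \<in> jumps \<omega> then jump_size \<mu> \<omega> s else 0)"
proof -
  interpret P: jump_path "jumps \<omega>" "jump_size \<mu> \<omega>" "X\<^sub>0 \<omega>" by (rule good_jump_path[OF g])
  have eq: "X t \<omega> = P.X t" if "0 \<le> t" for t
    using X[OF that] solution_path[OF g k, of t] by simp
  have "(\<lambda>n. P.X (grid_before n s)) \<longlonglongrightarrow> P.X s - (if s \<in> jumps \<omega> then jump_size \<mu> \<omega> s else 0)"
    by (rule filterlim_compose[OF P.X_left_limit[OF s] grid_before_tendsto[OF s]])
  then have "(\<lambda>n. X (grid_before n s) \<omega>) \<longlonglongrightarrow> X s \<omega> - (if s \<in> jumps \<omega> then jump_size \<mu> \<omega> s else 0)"
    using s by (simp only: eq grid_before(1)[OF s] less_imp_le)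
  then show ?thesis unfolding left_lim_def by (rule limI)
qed

end

section \<open>The law of the solution\<close>

lemma nn_integral_interval:
  fixes h :: "real \<Rightarrow> real"
  assumes h: "h \<in> borel_measurable borel" and b: "\<And>s. 0 \<le> s \<Longrightarrow> s \<le> t \<Longrightarrow> 0 \<le> h s" "\<And>s. 0 \<le> s \<Longrightarrow> s \<le> t \<Longrightarrow> h s \<le> C"
  shows "(\<integral>\<^sup>+s. ennreal (h s) * indicator {0<..t} s \<partial>lborel) = ennreal (LBINT s:{0..t}. h s)"
proof -
  have "(\<integral>\<^sup>+s. ennreal (h s) * indicator {0<..t} s \<partial>lborel) = (\<integral>\<^sup>+s. ennreal (indicator {0..t} s *\<^sub>R h s) \<partial>lborel)"
  proof (rule nn_integral_cong_AE)
    show "AE s in lborel. ennreal (h s) * indicator {0<..t} s = ennreal (indicator {0..t} s *\<^sub>R h s)"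
      using AE_lborel_singleton[of 0] by eventually_elim (simp add: indicator_def)
  qed
  also have "\<dots> = ennreal (LBINT s:{0..t}. h s)"
    unfolding set_lebesgue_integral_def
  proof (rule nn_integral_eq_integral)
    have "\<bar>h s\<bar> \<le> C" if "s \<in> {0..t}" for s using b[of s] that by simp
    with h have "set_integrable lborel {0..t} h" by (rule set_integrable_bounded_Icc)
    then show "integrable lborel (\<lambda>s. indicator {0..t} s *\<^sub>R h s)" unfolding set_integrable_def .
    show "AE s in lborel. 0 \<le> indicator {0..t} s *\<^sub>R h s" using b(1) by (intro AE_I2) (simp add: indicator_def)
  qed
  finally show ?thesis .
qed

lemma (in real_distribution) nn_integral_cdf_diff:
  assumes "real_distribution N"
  shows "(\<integral>\<^sup>+x. ennreal (cdf N (c - x)) \<partial>M) = ennreal (cdf (M \<star> N) c)"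
proof -
  interpret N: real_distribution N by fact
  have m: "(\<lambda>x. cdf N (c - x)) \<in> borel_measurable M"
    by (rule measurable_compose[OF _ N.measurable_cdf]) simp
  have "(\<integral>\<^sup>+x. ennreal (cdf N (c - x)) \<partial>M) = ennreal (\<integral>x. cdf N (c - x) \<partial>M)"
  proof (rule nn_integral_eq_integral)
    show "integrable M (\<lambda>x. cdf N (c - x))"
      by (rule integrable_const_bound[OF _ m, where B = 1]) (intro AE_I2, simp add: N.cdf_bounds)
  qed (simp add: N.cdf_bounds)
  then show ?thesis by (simp only: cdf_convolution[OF real_distribution_axioms assms])
qed

lemma cdf_convolution_neg:
  assumes M: "real_distribution M" "AE x in M. 0 \<le> x" and N: "real_distribution N" "AE x in N. 0 \<le> x" and "c < 0"
  shows "cdf (M \<star> N) c = 0"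
proof -
  have "AE x in M. cdf N (c - x) = 0"
    using M(2) by eventually_elim (rule AE_nonneg_cdf[OF N], use \<open>c < 0\<close> in simp)
  then have "(\<integral>x. cdf N (c - x) \<partial>M) = 0" by (rule integral_eq_zero_AE)
  then show ?thesis by (simp only: cdf_convolution[OF M(1) N(1)])
qed

context driven
begin

text \<open>With time as the outermost variable, the inner integral at each fixed time involves only
  the law of the process at that time.\<close>

lemma emeasure_time_first:
  assumes A: "A \<in> sets (M \<Otimes>\<^sub>M (lborel :: (real \<times> real) measure))"
  shows "emeasure (M \<Otimes>\<^sub>M lborel) A = (\<integral>\<^sup>+s. \<integral>\<^sup>+\<omega>. emeasure lborel {u. (\<omega>, s, u) \<in> A} \<partial>M \<partial>lborel)"
proof -
  interpret P: pair_sigma_finite M "lborel :: real measure" ..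
  have A': "A \<in> sets (M \<Otimes>\<^sub>M ((lborel :: real measure) \<Otimes>\<^sub>M (lborel :: real measure)))" using A by (simp only: lborel_prod)
  have i: "(\<lambda>z. indicator A z :: ennreal) \<in> borel_measurable (M \<Otimes>\<^sub>M (lborel \<Otimes>\<^sub>M lborel))"
    using A' by (rule borel_measurable_indicator)
  have i1: "(\<lambda>p. indicator A (\<omega>, p) :: ennreal) \<in> borel_measurable (lborel \<Otimes>\<^sub>M lborel)" if "\<omega> \<in> space M" for \<omega>
    by (rule measurable_compose[OF measurable_Pair1'[OF that] i])
  have "(\<lambda>w. (fst (fst w), snd (fst w), snd w)) \<in>
      (M \<Otimes>\<^sub>M (lborel :: real measure)) \<Otimes>\<^sub>M (lborel :: real measure) \<rightarrow>\<^sub>M M \<Otimes>\<^sub>M (lborel \<Otimes>\<^sub>M lborel)"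
    by (intro measurable_Pair measurable_compose[OF measurable_fst measurable_fst]
        measurable_compose[OF measurable_fst measurable_snd] measurable_snd)
  from measurable_compose[OF this i]
  have i3: "(\<lambda>w. indicator A (fst (fst w), snd (fst w), snd w) :: ennreal) \<in> borel_measurable ((M \<Otimes>\<^sub>M lborel) \<Otimes>\<^sub>M lborel)" .
  from lborel.borel_measurable_nn_integral_fst[OF this]
  have i4: "(\<lambda>w. \<integral>\<^sup>+u. indicator A (fst w, snd w, u) \<partial>lborel) \<in> borel_measurable (M \<Otimes>\<^sub>M lborel)"
    by (simp only: fst_conv snd_conv)
  have "emeasure (M \<Otimes>\<^sub>M lborel) A = (\<integral>\<^sup>+\<omega>. \<integral>\<^sup>+p. indicator A (\<omega>, p) \<partial>(lborel \<Otimes>\<^sub>M lborel) \<partial>M)"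
    unfolding lborel_prod by (rule lborel.emeasure_pair_measure[OF A])
  also have "\<dots> = (\<integral>\<^sup>+\<omega>. \<integral>\<^sup>+s. \<integral>\<^sup>+u. indicator A (\<omega>, s, u) \<partial>lborel \<partial>lborel \<partial>M)"
    by (rule nn_integral_cong) (rule lborel.nn_integral_fst[symmetric, OF i1])
  also have "\<dots> = (\<integral>\<^sup>+s. \<integral>\<^sup>+\<omega>. \<integral>\<^sup>+u. indicator A (\<omega>, s, u) \<partial>lborel \<partial>M \<partial>lborel)"
    by (rule P.Fubini'[symmetric]) (use i4 in \<open>simp only: case_prod_beta'\<close>)
  also have "\<dots> = (\<integral>\<^sup>+s. \<integral>\<^sup>+\<omega>. emeasure lborel {u. (\<omega>, s, u) \<in> A} \<partial>M \<partial>lborel)"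
  proof (intro nn_integral_cong)
    fix s :: real and \<omega> assume "\<omega> \<in> space M"
    have eq: "{u. (\<omega>, s, u) \<in> A} = Pair s -` (Pair \<omega> -` A)" by (simp add: vimage_def)
    have S: "{u. (\<omega>, s, u) \<in> A} \<in> sets lborel" unfolding eq by (rule sets_Pair1[OF sets_Pair1[OF A']])
    have "(\<integral>\<^sup>+u. indicator A (\<omega>, s, u) \<partial>lborel) = (\<integral>\<^sup>+u. indicator {u. (\<omega>, s, u) \<in> A} u \<partial>lborel)"
      by (simp add: indicator_def)
    also have "\<dots> = emeasure lborel {u. (\<omega>, s, u) \<in> A}" by (rule nn_integral_indicator[OF S])
    finally show "(\<integral>\<^sup>+u. indicator A (\<omega>, s, u) \<partial>lborel) = emeasure lborel {u. (\<omega>, s, u) \<in> A}" .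
  qed
  finally show ?thesis .
qed

text \<open>The number of jumps at which the predictable quantity \<open>G\<close> lies below the
  moving barrier a + t - s is the \<open>N\<close>-mass of a predictable set; its expectation is the
  mass of the same set under the intensity, computed in \<open>h\<close> time by time.\<close>

lemma compensated_level:
  fixes h :: "real \<Rightarrow> real"
  assumes G: "G \<in> borel_measurable (predictable t)" and t: "0 \<le> t"
    and h: "h \<in> borel_measurable borel" "\<And>s. 0 \<le> s \<Longrightarrow> s \<le> t \<Longrightarrow> 0 \<le> h s" "\<And>s. 0 \<le> s \<Longrightarrow> s \<le> t \<Longrightarrow> h s \<le> 1"
    and H: "\<And>s. 0 < s \<Longrightarrow> s \<le> t \<Longrightarrow> (\<integral>\<^sup>+\<omega>. emeasure lborel {u\<in>{0..1}. G (\<omega>, s, u) \<le> a + t - s} \<partial>M) = ennreal (h s)"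
  shows "\<exists>g\<in>borel_measurable M.
    (AE \<omega> in M. g \<omega> = ennreal (\<Sum>s\<in>jumps \<omega> \<inter> {..t}. indicator {..a + t - s} (G (\<omega>, s, mark \<omega> s)))) \<and>
    (\<integral>\<^sup>+\<omega>. g \<omega> \<partial>M) = ennreal (LBINT s:{0..t}. h s)"
proof -
  define A where "A = {z \<in> space (predictable t). G z \<le> a + t - fst (snd z)}"
  have "A \<in> sets (predictable t)"
    unfolding A_def by (intro borel_measurable_le G borel_measurable_diff borel_measurable_const predictable_time t)
  note comp = compensation[OF this t]
  have sub: "A \<subseteq> predictable_space t" by (auto simp: A_def)
  have mem: "(\<omega>, s, u) \<in> A \<longleftrightarrow> \<omega> \<in> space M \<and> 0 < s \<and> s \<le> t \<and> u \<in> {0..1} \<and> G (\<omega>, s, u) \<le> a + t - s" for \<omega> s u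
    by (simp add: A_def predictable_space_def)
  obtain g where g: "g \<in> borel_measurable M" and
    g_eq: "AE \<omega> in M. emeasure (N \<omega>) (Pair \<omega> -` A) = g \<omega>" and
    g_int: "(\<integral>\<^sup>+\<omega>. g \<omega> \<partial>M) = emeasure (M \<Otimes>\<^sub>M lborel) A"
    using comp(2) by (elim bexE conjE) (rule that)
  have "AE \<omega> in M. g \<omega> = ennreal (\<Sum>s\<in>jumps \<omega> \<inter> {..t}. indicator {..a + t - s} (G (\<omega>, s, mark \<omega> s)))"
    using g_eq AE_good
  proof eventually_elim
    case (elim \<omega>)
    note good = elim(2)
    have "Pair \<omega> -` A \<subseteq> strip t" using sub by (auto simp: predictable_space_def)
    from emeasure_jumps[OF good section_in_strip[OF comp(1) sub] this]
    have "g \<omega> = (\<Sum>s\<in>jumps \<omega> \<inter> {..t}. indicator (Pair \<omega> -` A) (s, mark \<omega> s))"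
      using elim(1) by (simp only:)
    also have "\<dots> = (\<Sum>s\<in>jumps \<omega> \<inter> {..t}. ennreal (indicator {..a + t - s} (G (\<omega>, s, mark \<omega> s))))"
    proof (rule sum.cong[OF refl])
      fix s assume s: "s \<in> jumps \<omega> \<inter> {..t}"
      then have "0 < s" "s \<le> t" "mark \<omega> s \<in> {0..1}"
        using jumps_pos[OF good] mark_atom(1)[OF good, of s] by auto
      with good_space[OF good] have "(\<omega>, s, mark \<omega> s) \<in> A \<longleftrightarrow> G (\<omega>, s, mark \<omega> s) \<le> a + t - s"
        by (simp only: mem simp_thms)
      then show "indicator (Pair \<omega> -` A) (s, mark \<omega> s) = ennreal (indicator {..a + t - s} (G (\<omega>, s, mark \<omega> s)))"
        by (simp add: indicator_def)
    qed
    also have "\<dots> = ennreal (\<Sum>s\<in>jumps \<omega> \<inter> {..t}. indicator {..a + t - s} (G (\<omega>, s, mark \<omega> s)))"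
      by (rule sum_ennreal) simp
    finally show ?case .
  qed
  moreover have "(\<integral>\<^sup>+\<omega>. g \<omega> \<partial>M) = ennreal (LBINT s:{0..t}. h s)"
  proof -
    have "(\<integral>\<^sup>+\<omega>. g \<omega> \<partial>M) = (\<integral>\<^sup>+s. \<integral>\<^sup>+\<omega>. emeasure lborel {u. (\<omega>, s, u) \<in> A} \<partial>M \<partial>lborel)"
      unfolding g_int by (rule emeasure_time_first[OF comp(1)])
    also have "\<dots> = (\<integral>\<^sup>+s. ennreal (h s) * indicator {0<..t} s \<partial>lborel)"
    proof (rule nn_integral_cong)
      fix s :: real
      show "(\<integral>\<^sup>+\<omega>. emeasure lborel {u. (\<omega>, s, u) \<in> A} \<partial>M) = ennreal (h s) * indicator {0<..t} s"
      proof (cases "0 < s \<and> s \<le> t")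
        case True
        have "(\<integral>\<^sup>+\<omega>. emeasure lborel {u. (\<omega>, s, u) \<in> A} \<partial>M) =
            (\<integral>\<^sup>+\<omega>. emeasure lborel {u\<in>{0..1}. G (\<omega>, s, u) \<le> a + t - s} \<partial>M)"
        proof (rule nn_integral_cong)
          fix \<omega> assume "\<omega> \<in> space M"
          then have "{u. (\<omega>, s, u) \<in> A} = {u\<in>{0..1}. G (\<omega>, s, u) \<le> a + t - s}"
            using True by (simp only: mem simp_thms)
          then show "emeasure lborel {u. (\<omega>, s, u) \<in> A} = emeasure lborel {u\<in>{0..1}. G (\<omega>, s, u) \<le> a + t - s}"
            by (simp only:)
        qed
        then show ?thesis using H[of s] True by simp
      next
        case False
        have "{u. (\<omega>, s, u) \<in> A} = {}" for \<omega>
          using False by (simp only: mem) auto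
        with False show ?thesis by (simp add: indicator_def)
      qed
    qed
    also have "\<dots> = ennreal (LBINT s:{0..t}. h s)" by (rule nn_integral_interval[OF h])
    finally show ?thesis .
  qed
  ultimately show ?thesis using g by (intro bexI[of _ g] conjI)
qed

lemma AE_X0_nonneg: "AE x in \<mu>\<^sub>0. 0 \<le> x \<Longrightarrow> AE \<omega> in M. 0 \<le> X\<^sub>0 \<omega>"
  unfolding distr_X0[symmetric] by (rule AE_distrD[OF X0_measurable])

section \<open>The law of an adapted process that almost surely solves the equation with prescribed
  jump laws\<close>

context
  fixes \<mu> :: "real \<Rightarrow> real measure" and X :: "real \<Rightarrow> 'a \<Rightarrow> real"
  assumes k: "half_line_kernel \<mu>"
    and \<mu>\<^sub>0_nonneg: "AE x in \<mu>\<^sub>0. 0 \<le> x"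
    and adapted: "\<And>t. 0 \<le> t \<Longrightarrow> X t \<in> borel_measurable (filtration t)"
    and X_solution: "AE \<omega> in M. \<forall>t\<ge>0. X t \<omega> = solution \<mu> t \<omega>"
begin

lemma X_measurable: "0 \<le> t \<Longrightarrow> X t \<in> borel_measurable M"
  by (rule measurable_filtration[OF adapted])

lemma AE_path: "AE \<omega> in M. good \<omega> \<and> 0 \<le> X\<^sub>0 \<omega> \<and> (\<forall>t\<ge>0. X t \<omega> = solution \<mu> t \<omega>)"
  using AE_good AE_X0_nonneg[OF \<mu>\<^sub>0_nonneg] X_solution by eventually_elim (intro conjI)

lemma process_path:
  assumes "good \<omega> \<and> 0 \<le> X\<^sub>0 \<omega> \<and> (\<forall>t\<ge>0. X t \<omega> = solution \<mu> t \<omega>)" "0 \<le> t"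
  shows "X t \<omega> = reflected (X\<^sub>0 \<omega>) (jump_path.J (jumps \<omega>) (jump_size \<mu> \<omega>)) t"
  using assms(1)[THEN conjunct2, THEN conjunct2, rule_format, OF assms(2)]
    solution_path[OF assms(1)[THEN conjunct1] assms(1)[THEN conjunct2, THEN conjunct1] k, of t] by (simp only:)

lemma real_distribution_process: "0 \<le> t \<Longrightarrow> real_distribution (distr M borel (X t))"
  by (rule real_distribution_distr[OF X_measurable])

lemma AE_process_nonneg:
  assumes t: "0 \<le> t" shows "AE x in distr M borel (X t). 0 \<le> x"
proof -
  have "AE \<omega> in M. 0 \<le> X t \<omega>"
    using AE_path
  proof eventually_elim
    case (elim \<omega>)
    then have "jump_path (jumps \<omega>) (jump_size \<mu> \<omega>) (X\<^sub>0 \<omega>)" by (intro good_jump_path) simp_all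
    then show ?case unfolding process_path[OF elim t] by (rule jump_path.X_nonneg)
  qed
  then show ?thesis by (subst AE_distr_iff[OF X_measurable[OF t]]) simp_all
qed

lemma half_line_kernel_solution: "half_line_kernel (\<lambda>t. distr M borel (X t))"
proof (rule half_line_kernel_process[OF X_measurable])
  show "AE \<omega> in M. \<forall>t\<ge>0. ((\<lambda>s. X s \<omega>) \<longlongrightarrow> X t \<omega>) (at_right t)"
    using AE_path
  proof eventually_elim
    case (elim \<omega>)
    then interpret P: jump_path "jumps \<omega>" "jump_size \<mu> \<omega>" "X\<^sub>0 \<omega>" by (intro good_jump_path) simp_all
    show ?case
    proof (intro allI impI)
      fix t :: real assume t: "0 \<le> t"
      have "\<forall>\<^sub>F s in at_right t. P.X s = X s \<omega>"
        using eventually_at_right_less[of t] by eventually_elim (use t process_path[OF elim] in simp)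
      then show "((\<lambda>s. X s \<omega>) \<longlongrightarrow> X t \<omega>) (at_right t)"
        using P.X_right_continuous[OF t] unfolding process_path[OF elim t] by (rule Lim_transform_eventually[rotated])
    qed
  qed
qed

text \<open>The segment above a fixed time has zero intensity, so a fixed time is almost surely no
  jump time.\<close>

lemma AE_left_lim:
  assumes s: "0 < s" shows "AE \<omega> in M. left_lim X \<omega> s = X s \<omega>"
proof -
  have "AE \<omega> in M. emeasure (N \<omega>) ({s} \<times> {0..1}) = 0"
    by (rule AE_N_null; rule strip_segment) (use s in simp_all)
  with AE_path show ?thesis
  proof eventually_elim
    case (elim \<omega>)
    then have "s \<notin> jumps \<omega>" by (simp add: jumps_def)
    with left_lim_path[of \<omega> \<mu> X s] elim(1) k s show ?case by simp
  qed
qed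

context
  assumes \<mu>_nonneg: "\<And>s. 0 \<le> s \<Longrightarrow> AE x in \<mu> s. 0 \<le> x"
begin

text \<open>At a fixed time the left limit may be replaced by the state. Integrating over the mark
  adds a variable of law \<open>\<mu> s\<close> that is independent of the state, whence the
  convolution; without the jump, the mark merely contributes the length 1 of its interval.\<close>

lemma level_integral:
  assumes s: "0 < s"
  shows "(\<integral>\<^sup>+\<omega>. emeasure lborel {u\<in>{0..1}. left_lim X \<omega> s + enn2real (quantile \<mu> s u) \<le> c} \<partial>M) =
      ennreal (cdf (distr M borel (X s) \<star> \<mu> s) c)" (is ?jump)
    and "(\<integral>\<^sup>+\<omega>. emeasure lborel {u\<in>{0..1::real}. left_lim X \<omega> s \<le> c} \<partial>M) =
      ennreal (cdf (distr M borel (X s)) c)" (is ?nojump)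
proof -
  have s0: "0 \<le> s" using s by simp
  note m = X_measurable[OF s0]
  interpret R: real_distribution "distr M borel (X s)" by (rule real_distribution_process[OF s0])
  have rd: "real_distribution (\<mu> s)" by (rule half_line_kernel_real_distribution[OF k s0])
  interpret S: real_distribution "\<mu> s" by (rule rd)
  have max: "max 0 s = s" using s by simp
  have "(\<integral>\<^sup>+\<omega>. emeasure lborel {u\<in>{0..1}. left_lim X \<omega> s + enn2real (quantile \<mu> s u) \<le> c} \<partial>M) =
      (\<integral>\<^sup>+\<omega>. ennreal (cdf (\<mu> s) (c - X s \<omega>)) \<partial>M)"
  proof (rule nn_integral_cong_AE)
    show "AE \<omega> in M. emeasure lborel {u\<in>{0..1}. left_lim X \<omega> s + enn2real (quantile \<mu> s u) \<le> c} =
        ennreal (cdf (\<mu> s) (c - X s \<omega>))"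
      using AE_left_lim[OF s]
    proof eventually_elim
      case (elim \<omega>)
      have "{u\<in>{0..1}. left_lim X \<omega> s + enn2real (quantile \<mu> s u) \<le> c} =
          {u\<in>{0..1}. enn2real (quantile \<mu> s u) \<le> c - X s \<omega>}"
        unfolding elim by (rule Collect_cong) (simp only: le_diff_eq add.commute)
      with emeasure_quantile_le[OF k, of s "c - X s \<omega>"] \<mu>_nonneg[OF s0] show ?case by (simp only: max)
    qed
  qed
  also have "\<dots> = (\<integral>\<^sup>+x. ennreal (cdf (\<mu> s) (c - x)) \<partial>distr M borel (X s))"
    by (rule nn_integral_distr[symmetric, OF m])
       (intro measurable_compose[OF _ measurable_ennreal] measurable_compose[OF _ S.measurable_cdf], simp)
  also have "\<dots> = ennreal (cdf (distr M borel (X s) \<star> \<mu> s) c)" by (rule R.nn_integral_cdf_diff[OF rd])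
  finally show ?jump .
  have "(\<integral>\<^sup>+\<omega>. emeasure lborel {u\<in>{0..1::real}. left_lim X \<omega> s \<le> c} \<partial>M) = (\<integral>\<^sup>+\<omega>. indicator {..c} (X s \<omega>) \<partial>M)"
  proof (rule nn_integral_cong_AE)
    show "AE \<omega> in M. emeasure lborel {u\<in>{0..1::real}. left_lim X \<omega> s \<le> c} = indicator {..c} (X s \<omega>)"
      using AE_left_lim[OF s]
    proof eventually_elim
      case (elim \<omega>)
      have "{u\<in>{0..1::real}. X s \<omega> \<le> c} = (if X s \<omega> \<le> c then {0..1} else {})" by auto
      then show ?case unfolding elim by simp
    qed
  qed
  also have "\<dots> = (\<integral>\<^sup>+x. indicator {..c} x \<partial>distr M borel (X s))"
    by (rule nn_integral_distr[symmetric, OF m]) simp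
  also have "\<dots> = ennreal (cdf (distr M borel (X s)) c)"
    by (simp add: cdf_def R.emeasure_eq_measure)
  finally show ?nojump .
qed

text \<open>The expectation of \<open>indicator_telescope\<close>. Each jump contributes the barrier
  indicator after the jump minus the one before it; compensation turns the two sums into time
  integrals of the distribution functions of the convolution and of the law itself.\<close>

lemma law_level:
  assumes a: "0 \<le> a" and t: "0 \<le> t"
  shows "cdf (distr M borel (X t)) a = cdf \<mu>\<^sub>0 (a + t) +
    (LBINT s:{0..t}. cdf (distr M borel (X s) \<star> \<mu> s) (a + t - s) - cdf (distr M borel (X s)) (a + t - s))"
proof -
  define \<nu> where "\<nu> s = distr M borel (X s)" for s
  have rd: "real_distribution (\<nu> s)" if "0 \<le> s" for s unfolding \<nu>_def by (rule real_distribution_process[OF that])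
  have rd2: "real_distribution (\<nu> s \<star> \<mu> s)" if "0 \<le> s" for s
    by (rule real_distribution_convolution[OF rd half_line_kernel_real_distribution[OF k]]) (rule that)+
  have k\<nu>: "half_line_kernel \<nu>" unfolding \<nu>_def by (rule half_line_kernel_solution)
  have id: "(\<lambda>s. a + t - s) \<in> borel_measurable borel" by simp
  define h1 where "h1 s = cdf (\<nu> (max 0 s) \<star> \<mu> (max 0 s)) (a + t - s)" for s
  define h2 where "h2 s = cdf (\<nu> (max 0 s)) (a + t - s)" for s
  have h1m: "h1 \<in> borel_measurable borel"
    unfolding h1_def
    by (rule measurable_cdf_kernel[OF half_line_kernel_convolution[OF k\<nu> k, unfolded half_line_kernel_def] id])
  have h2m: "h2 \<in> borel_measurable borel"
    unfolding h2_def by (rule measurable_cdf_kernel[OF k\<nu>[unfolded half_line_kernel_def] id])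
  have h1b: "0 \<le> h1 s" "h1 s \<le> 1" for s
    unfolding h1_def by (rule real_distribution.cdf_bounds[OF rd2], simp)+
  have h2b: "0 \<le> h2 s" "h2 s \<le> 1" for s
    unfolding h2_def by (rule real_distribution.cdf_bounds[OF rd], simp)+
  \<comment> \<open>\<open>G2\<close> is the state before the jump. The state after it,
    \<open>G1\<close>, adds a deterministic function of time and mark, so it is predictable
    too.\<close>
  define G2 where "G2 z = left_lim X (fst z) (fst (snd z))" for z :: "'a \<times> real \<times> real"
  define G1 where "G1 z = G2 z + enn2real (quantile \<mu> (fst (snd z)) (snd (snd z)))" for z
  have G2m: "G2 \<in> borel_measurable (predictable t)"
    unfolding G2_def by (rule predictable_left_lim[OF adapted])
  have "(\<lambda>z. (fst (snd z), snd (snd z))) \<in> predictable t \<rightarrow>\<^sub>M borel \<Otimes>\<^sub>M borel"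
    by (rule measurable_Pair[OF predictable_time[OF t] predictable_mark[OF t]])
  from measurable_compose[OF measurable_compose[OF this measurable_quantile[OF k]] borel_measurable_enn2real[OF measurable_ident]]
  have "(\<lambda>z. enn2real (quantile \<mu> (fst (snd z)) (snd (snd z)))) \<in> borel_measurable (predictable t)"
    by (simp only: case_prod_conv id_apply)
  with G2m have G1m: "G1 \<in> borel_measurable (predictable t)"
    unfolding G1_def by (rule borel_measurable_add)
  have "\<exists>g\<in>borel_measurable M.
    (AE \<omega> in M. g \<omega> = ennreal (\<Sum>s\<in>jumps \<omega> \<inter> {..t}. indicator {..a + t - s} (G1 (\<omega>, s, mark \<omega> s)))) \<and>
    (\<integral>\<^sup>+\<omega>. g \<omega> \<partial>M) = ennreal (LBINT s:{0..t}. h1 s)"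
  proof (rule compensated_level[OF G1m t h1m h1b])
    fix s :: real assume s: "0 < s" "s \<le> t"
    then show "(\<integral>\<^sup>+\<omega>. emeasure lborel {u\<in>{0..1}. G1 (\<omega>, s, u) \<le> a + t - s} \<partial>M) = ennreal (h1 s)"
      using level_integral(1)[OF s(1), of "a + t - s"] by (simp add: G1_def G2_def h1_def \<nu>_def)
  qed
  then obtain g1 where g1: "g1 \<in> borel_measurable M"
    and g1_eq: "AE \<omega> in M. g1 \<omega> = ennreal (\<Sum>s\<in>jumps \<omega> \<inter> {..t}. indicator {..a + t - s} (G1 (\<omega>, s, mark \<omega> s)))"
    and g1_int: "(\<integral>\<^sup>+\<omega>. g1 \<omega> \<partial>M) = ennreal (LBINT s:{0..t}. h1 s)" by (elim bexE conjE) (rule that)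
  have "\<exists>g\<in>borel_measurable M.
    (AE \<omega> in M. g \<omega> = ennreal (\<Sum>s\<in>jumps \<omega> \<inter> {..t}. indicator {..a + t - s} (G2 (\<omega>, s, mark \<omega> s)))) \<and>
    (\<integral>\<^sup>+\<omega>. g \<omega> \<partial>M) = ennreal (LBINT s:{0..t}. h2 s)"
  proof (rule compensated_level[OF G2m t h2m h2b])
    fix s :: real assume s: "0 < s" "s \<le> t"
    then show "(\<integral>\<^sup>+\<omega>. emeasure lborel {u\<in>{0..1}. G2 (\<omega>, s, u) \<le> a + t - s} \<partial>M) = ennreal (h2 s)"
      using level_integral(2)[OF s(1), of "a + t - s"] by (simp add: G2_def h2_def \<nu>_def)
  qed
  then obtain g2 where g2: "g2 \<in> borel_measurable M"
    and g2_eq: "AE \<omega> in M. g2 \<omega> = ennreal (\<Sum>s\<in>jumps \<omega> \<inter> {..t}. indicator {..a + t - s} (G2 (\<omega>, s, mark \<omega> s)))"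
    and g2_int: "(\<integral>\<^sup>+\<omega>. g2 \<omega> \<partial>M) = ennreal (LBINT s:{0..t}. h2 s)" by (elim bexE conjE) (rule that)
  \<comment> \<open>The pathwise identity is arranged with sums only, since subtraction of extended
    nonnegative reals is truncated.\<close>
  have balance: "AE \<omega> in M. indicator {..a} (X t \<omega>) + g2 \<omega> = indicator {..a + t} (X\<^sub>0 \<omega>) + g1 \<omega>"
    using AE_path g1_eq g2_eq
  proof eventually_elim
    case (elim \<omega>)
    note good = elim(1)[THEN conjunct1] elim(1)[THEN conjunct2, THEN conjunct1]
    interpret P: jump_path "jumps \<omega>" "jump_size \<mu> \<omega>" "X\<^sub>0 \<omega>" by (rule good_jump_path[OF good])
    let ?S1 = "\<Sum>s\<in>jumps \<omega> \<inter> {..t}. indicator {..a + t - s} (P.X s) :: real"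
    let ?S2 = "\<Sum>s\<in>jumps \<omega> \<inter> {..t}. indicator {..a + t - s} (P.X s - jump_size \<mu> \<omega> s) :: real"
    have G: "G2 (\<omega>, s, mark \<omega> s) = P.X s - jump_size \<mu> \<omega> s" "G1 (\<omega>, s, mark \<omega> s) = P.X s"
      if "s \<in> jumps \<omega> \<inter> {..t}" for s
    proof -
      have s: "s \<in> jumps \<omega>" "0 < s" using that jumps_pos[OF good(1)] by auto
      have "left_lim X \<omega> s = X s \<omega> - (if s \<in> jumps \<omega> then jump_size \<mu> \<omega> s else 0)"
        by (rule left_lim_path[OF good k _ s(2)]) (rule elim(1)[THEN conjunct2, THEN conjunct2, rule_format])
      also have "\<dots> = P.X s - jump_size \<mu> \<omega> s" using s process_path[OF elim(1), of s] by simp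
      finally show "G2 (\<omega>, s, mark \<omega> s) = P.X s - jump_size \<mu> \<omega> s" by (simp add: G2_def)
      then show "G1 (\<omega>, s, mark \<omega> s) = P.X s" by (simp add: G1_def)
    qed
    have "indicator {..a} (P.X t) - indicator {..a + t} (X\<^sub>0 \<omega>) = ?S1 - ?S2"
      unfolding sum_subtractf[symmetric] by (rule P.indicator_telescope[OF a t])
    then have "indicator {..a} (P.X t) + ?S2 = indicator {..a + t} (X\<^sub>0 \<omega>) + ?S1" by simp
    then have "ennreal (indicator {..a} (P.X t) + ?S2) = ennreal (indicator {..a + t} (X\<^sub>0 \<omega>) + ?S1)" by (simp only:)
    moreover have "0 \<le> ?S1" "0 \<le> ?S2" by (intro sum_nonneg indicator_pos_le)+
    ultimately have "ennreal (indicator {..a} (P.X t)) + ennreal ?S2 = ennreal (indicator {..a + t} (X\<^sub>0 \<omega>)) + ennreal ?S1"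
      by (simp only: ennreal_plus indicator_pos_le)
    moreover have "g1 \<omega> = ennreal ?S1" unfolding elim(2) by (rule arg_cong[where f = ennreal]) (rule sum.cong[OF refl], simp only: G)
    moreover have "g2 \<omega> = ennreal ?S2" unfolding elim(3) by (rule arg_cong[where f = ennreal]) (rule sum.cong[OF refl], simp only: G)
    ultimately show ?case by (simp only: process_path[OF elim(1) t] ennreal_indicator)
  qed
  interpret R: real_distribution "\<nu> t" by (rule rd[OF t])
  interpret R0: real_distribution "\<mu>\<^sub>0" unfolding distr_X0[symmetric] by (rule real_distribution_distr[OF X0_measurable])
  have i1: "(\<integral>\<^sup>+\<omega>. indicator {..a} (X t \<omega>) \<partial>M) = ennreal (cdf (\<nu> t) a)"
  proof -
    have "(\<integral>\<^sup>+\<omega>. indicator {..a} (X t \<omega>) \<partial>M) = (\<integral>\<^sup>+x. indicator {..a} x \<partial>\<nu> t)"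
      unfolding \<nu>_def by (rule nn_integral_distr[symmetric, OF X_measurable[OF t]]) simp
    then show ?thesis by (simp add: cdf_def R.emeasure_eq_measure)
  qed
  have i0: "(\<integral>\<^sup>+\<omega>. indicator {..a + t} (X\<^sub>0 \<omega>) \<partial>M) = ennreal (cdf \<mu>\<^sub>0 (a + t))"
  proof -
    have "(\<integral>\<^sup>+\<omega>. indicator {..a + t} (X\<^sub>0 \<omega>) \<partial>M) = (\<integral>\<^sup>+x. indicator {..a + t} x \<partial>\<mu>\<^sub>0)"
      unfolding distr_X0[symmetric] by (rule nn_integral_distr[symmetric, OF X0_measurable]) simp
    then show ?thesis by (simp add: cdf_def R0.emeasure_eq_measure)
  qed
  have m1: "(\<lambda>\<omega>. indicator {..a} (X t \<omega>) :: ennreal) \<in> borel_measurable M"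
    by (rule measurable_compose[OF X_measurable[OF t]]) simp
  have m0: "(\<lambda>\<omega>. indicator {..a + t} (X\<^sub>0 \<omega>) :: ennreal) \<in> borel_measurable M"
    by (rule measurable_compose[OF X0_measurable]) simp
  have "(\<integral>\<^sup>+\<omega>. indicator {..a} (X t \<omega>) + g2 \<omega> \<partial>M) = (\<integral>\<^sup>+\<omega>. indicator {..a + t} (X\<^sub>0 \<omega>) + g1 \<omega> \<partial>M)"
    by (rule nn_integral_cong_AE[OF balance])
  then have eq: "ennreal (cdf (\<nu> t) a) + ennreal (LBINT s:{0..t}. h2 s) = ennreal (cdf \<mu>\<^sub>0 (a + t)) + ennreal (LBINT s:{0..t}. h1 s)"
    unfolding nn_integral_add[OF m1 g2] nn_integral_add[OF m0 g1] i1 i0 g1_int g2_int .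
  have nn: "0 \<le> (LBINT s:{0..t}. h1 s)" "0 \<le> (LBINT s:{0..t}. h2 s)"
    unfolding set_lebesgue_integral_def
    by (rule Bochner_Integration.integral_nonneg, simp add: h1b h2b)+
  from eq have "ennreal (cdf (\<nu> t) a + (LBINT s:{0..t}. h2 s)) = ennreal (cdf \<mu>\<^sub>0 (a + t) + (LBINT s:{0..t}. h1 s))"
    by (simp only: ennreal_plus nn R.cdf_bounds R0.cdf_bounds)
  then have "cdf (\<nu> t) a + (LBINT s:{0..t}. h2 s) = cdf \<mu>\<^sub>0 (a + t) + (LBINT s:{0..t}. h1 s)"
    by (subst (asm) ennreal_inj) (simp_all only: add_nonneg_nonneg nn R.cdf_bounds R0.cdf_bounds)
  moreover have "(LBINT s:{0..t}. h1 s) - (LBINT s:{0..t}. h2 s) = (LBINT s:{0..t}. h1 s - h2 s)"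
  proof (rule set_integral_diff(2)[symmetric])
    show "set_integrable lborel {0..t} h1" using h1m by (rule set_integrable_bounded_Icc[where C = 1]) (simp add: h1b)
    show "set_integrable lborel {0..t} h2" using h2m by (rule set_integrable_bounded_Icc[where C = 1]) (simp add: h2b)
  qed
  moreover have "(LBINT s:{0..t}. h1 s - h2 s) = (LBINT s:{0..t}. cdf (\<nu> s \<star> \<mu> s) (a + t - s) - cdf (\<nu> s) (a + t - s))"
    by (rule set_integral_cong_Icc) (simp add: h1_def h2_def)
  ultimately show ?thesis unfolding \<nu>_def by linarith
qed

theorem law_mild: "mild \<mu>\<^sub>0 (\<lambda>t. distr M borel (X t)) \<mu>"
  unfolding mild_def
proof (intro conjI allI impI half_line_kernel_solution k)
  fix t a :: real assume t: "0 \<le> t"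
  show "cdf (distr M borel (X t)) a = cdf \<mu>\<^sub>0 (level a t) +
    (LBINT s:{0..t}. cdf (distr M borel (X s) \<star> \<mu> s) (level a (t - s)) - cdf (distr M borel (X s)) (level a (t - s)))"
  proof (cases "0 \<le> a")
    case True
    then have "level a (t - s) = a + t - s" "level a t = a + t" for s by (simp_all add: level_def)
    with law_level[OF True t] show ?thesis by (simp only:)
  next
    case False
    \<comment> \<open>All laws involved live on the nonnegative half-line, so below 0 every term of
      the mild equation vanishes.\<close>
    then have a: "a < 0" "level a r = a" for r by (simp_all add: level_def)
    have z: "cdf (distr M borel (X s)) a = 0" if "0 \<le> s" for s
      by (rule AE_nonneg_cdf[OF real_distribution_process[OF that] AE_process_nonneg[OF that] a(1)])
    have z2: "cdf (distr M borel (X s) \<star> \<mu> s) a = 0" if "0 \<le> s" for s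
      by (rule cdf_convolution_neg[OF real_distribution_process[OF that] AE_process_nonneg[OF that]
          half_line_kernel_real_distribution[OF k that] \<mu>_nonneg[OF that] a(1)])
    have "real_distribution \<mu>\<^sub>0" unfolding distr_X0[symmetric] by (rule real_distribution_distr[OF X0_measurable])
    then have z0: "cdf \<mu>\<^sub>0 a = 0" using \<mu>\<^sub>0_nonneg a(1) by (rule AE_nonneg_cdf)
    have "(LBINT s:{0..t}. cdf (distr M borel (X s) \<star> \<mu> s) a - cdf (distr M borel (X s)) a) = (LBINT s:{0..t}. 0)"
      by (rule set_integral_cong_Icc) (simp only: z z2 diff_self)
    then show ?thesis by (simp only: a(2) z[OF t] z0) (simp add: set_lebesgue_integral_def)
  qed
qed

end

end

end

section \<open>The McKean--Vlasov equation\<close>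

context driven
begin

lemma nn_integral_strip_law:
  assumes "\<And>s. 0 \<le> s \<Longrightarrow> \<nu> s = \<mu> s"
  shows "(\<integral>\<^sup>+(s, u)\<in>strip t. right_inverse (cdf (\<nu> s)) u \<partial>N \<omega>) =
    (\<integral>\<^sup>+p. quantile \<mu> (fst p) (snd p) * indicator (strip t) p \<partial>N \<omega>)"
proof (rule nn_integral_cong)
  fix p :: "real \<times> real"
  show "(case p of (s, u) \<Rightarrow> right_inverse (cdf (\<nu> s)) u) * indicator (strip t) p =
      quantile \<mu> (fst p) (snd p) * indicator (strip t) p"
  proof (cases "p \<in> strip t")
    case True
    then have "0 \<le> fst p" by (simp add: mem_Times_iff)
    with assms[of "fst p"] show ?thesis by (simp add: quantile_def case_prod_beta)
  qed simp
qed

text \<open>By construction the process solves the equation with jump laws \<open>\<mu>\<close>; the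
  hypothesis \<open>law\<close> closes the loop by identifying these with its own laws. On good
  paths the jump integral is finite, so \<open>enn2real\<close> in \<open>input\<close> loses
  nothing.\<close>

lemma strong_solution_solution:
  assumes \<mu>\<^sub>0: "AE x in \<mu>\<^sub>0. 0 \<le> x" and k: "half_line_kernel \<mu>"
    and law: "\<And>t. 0 \<le> t \<Longrightarrow> distr M borel (solution \<mu> t) = \<mu> t"
  shows "strong_solution M X\<^sub>0 N (solution \<mu>)"
  unfolding strong_solution_def
proof (intro conjI)
  have strip: "(\<integral>\<^sup>+(s, u)\<in>strip t. right_inverse (cdf (distr M borel (solution \<mu> s))) u \<partial>N \<omega>) =
      (\<integral>\<^sup>+p. quantile \<mu> (fst p) (snd p) * indicator (strip t) p \<partial>N \<omega>)" for t \<omega>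
    by (rule nn_integral_strip_law[of "\<lambda>s. distr M borel (solution \<mu> s)"]) (erule law)
  show "\<forall>t\<ge>0. solution \<mu> t \<in> borel_measurable (filtration t)"
    by (intro allI impI solution_adapted[OF k])
  show "AE \<omega> in M. cadlag (\<lambda>t. solution \<mu> t \<omega>)"
    using AE_good AE_X0_nonneg[OF \<mu>\<^sub>0]
  proof eventually_elim
    case (elim \<omega>)
    interpret P: jump_path "jumps \<omega>" "jump_size \<mu> \<omega>" "X\<^sub>0 \<omega>" by (rule good_jump_path[OF elim])
    show ?case unfolding solution_path[OF elim k] by (rule P.cadlag_X)
  qed
  show "AE \<omega> in M. \<forall>t\<ge>0. ereal (solution \<mu> t \<omega>) =
      ereal (X\<^sub>0 \<omega> - (LBINT s:{0..t}. indicator {0<..} (solution \<mu> s \<omega>))) +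
      enn2ereal (\<integral>\<^sup>+(s, u)\<in>strip t. right_inverse (cdf (distr M borel (solution \<mu> s))) u \<partial>N \<omega>)"
    using AE_good AE_X0_nonneg[OF \<mu>\<^sub>0]
  proof eventually_elim
    case (elim \<omega>)
    interpret P: jump_path "jumps \<omega>" "jump_size \<mu> \<omega>" "X\<^sub>0 \<omega>" by (rule good_jump_path[OF elim])
    show ?case
      unfolding strip nn_integral_quantile[OF elim k] solution_path[OF elim k]
        enn2ereal_ennreal[OF P.J_nonneg] plus_ereal.simps(1) ereal.inject busy_def[symmetric]
      by (intro allI impI P.X_equation)
  qed
qed

text \<open>Regarded as prescribed jump laws, the laws of \<open>Y\<close> give an equation without
  feedback, to which uniqueness of reflected paths applies. The jump integral is finite on good
  paths, so the extended-real equation there is one of real numbers.\<close>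

lemma strong_solution_self:
  assumes \<mu>\<^sub>0: "AE x in \<mu>\<^sub>0. 0 \<le> x" and Y: "strong_solution M X\<^sub>0 N Y"
  shows "half_line_kernel (\<lambda>t. distr M borel (Y t))"
    and "AE \<omega> in M. \<forall>t\<ge>0. Y t \<omega> = solution (\<lambda>t. distr M borel (Y t)) t \<omega>"
proof -
  have ad: "Y t \<in> borel_measurable M" if "0 \<le> t" for t
    using Y that unfolding strong_solution_def by (intro measurable_filtration[of "Y t" t]) simp
  have cl: "AE \<omega> in M. cadlag (\<lambda>t. Y t \<omega>)" using Y by (simp add: strong_solution_def)
  show k: "half_line_kernel (\<lambda>t. distr M borel (Y t))"
  proof (rule half_line_kernel_process[OF ad])
    show "AE \<omega> in M. \<forall>t\<ge>0. ((\<lambda>s. Y s \<omega>) \<longlongrightarrow> Y t \<omega>) (at_right t)"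
      using cl by eventually_elim (simp add: cadlag_def)
  qed
  define \<nu> where "\<nu> t = distr M borel (Y t)" for t
  note k' = k[folded \<nu>_def]
  have eq: "AE \<omega> in M. \<forall>t\<ge>0. ereal (Y t \<omega>) =
      ereal (X\<^sub>0 \<omega> - (LBINT s:{0..t}. indicator {0<..} (Y s \<omega>))) +
      enn2ereal (\<integral>\<^sup>+(s, u)\<in>strip t. right_inverse (cdf (\<nu> s)) u \<partial>N \<omega>)"
    using Y unfolding strong_solution_def \<nu>_def by (elim conjE)
  have "AE \<omega> in M. \<forall>t\<ge>0. Y t \<omega> = solution \<nu> t \<omega>"
    using AE_good AE_X0_nonneg[OF \<mu>\<^sub>0] cl eq
  proof eventually_elim
    case (elim \<omega>)
    interpret P: jump_path "jumps \<omega>" "jump_size \<nu> \<omega>" "X\<^sub>0 \<omega>" by (rule good_jump_path[OF elim(1,2)])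
    have rc: "((\<lambda>s. Y s \<omega>) \<longlongrightarrow> Y t \<omega>) (at_right t)" if "0 \<le> t" for t
      using elim(3) that by (simp add: cadlag_def)
    have Yeq: "Y t \<omega> = X\<^sub>0 \<omega> - busy (\<lambda>s. Y s \<omega>) 0 t + P.J t" if "0 \<le> t" for t
      using elim(4)[rule_format, OF that]
      unfolding nn_integral_strip_law[of \<nu> \<nu>, OF refl] nn_integral_quantile[OF elim(1,2) k']
        enn2ereal_ennreal[OF P.J_nonneg] plus_ereal.simps(1) ereal.inject busy_def[symmetric] .
    show ?case
    proof (intro allI impI)
      fix t :: real assume t: "0 \<le> t"
      show "Y t \<omega> = solution \<nu> t \<omega>"
        unfolding solution_path[OF elim(1,2) k']
        by (rule reflected_path_unique[where x = "\<lambda>s. Y s \<omega>" and y = P.X and J = P.J and z = "X\<^sub>0 \<omega>"])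
           (rule rc Yeq P.X_right_continuous P.X_equation t, assumption?)+
    qed
  qed
  then show "AE \<omega> in M. \<forall>t\<ge>0. Y t \<omega> = solution (\<lambda>t. distr M borel (Y t)) t \<omega>"
    unfolding \<nu>_def .
qed

lemma solution_cong:
  assumes "\<And>s. 0 \<le> s \<Longrightarrow> \<nu> s = \<mu> s" shows "solution \<nu> = solution \<mu>"
proof -
  have "quantile \<nu> = quantile \<mu>"
    by (intro ext) (simp add: quantile_def assms)
  then have "input \<nu> = input \<mu>" by (intro ext) (simp only: input_def)
  then show ?thesis by (intro ext) (simp only: solution_def)
qed

end

lemma (in painting) mild_painting_law: "mild \<mu>\<^sub>0 (painting_law \<mu>\<^sub>0) (painting_law \<mu>\<^sub>0)"
  using weak_solution_mild[OF weak_solution_painting_law] by (simp add: painting_law_def)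

theorem theorem1p8:
  fixes \<mu>\<^sub>0 :: "real measure"
  assumes "real_distribution \<mu>\<^sub>0" and "AE x in \<mu>\<^sub>0. 0 \<le> x"
  shows
    "(\<forall>(M :: 'a measure) X\<^sub>0 N. driving_data \<mu>\<^sub>0 M X\<^sub>0 N \<longrightarrow>
        (\<exists>X. strong_solution M X\<^sub>0 N X \<and>
             (\<forall>Y. strong_solution M X\<^sub>0 N Y \<longrightarrow> indistinguishable M X Y) \<and>
             (\<forall>t\<ge>0. distr M borel (X t) = painting_law \<mu>\<^sub>0 t)))
     \<and> (weak_solution (painting_law \<mu>\<^sub>0) \<and> painting_law \<mu>\<^sub>0 0 = \<mu>\<^sub>0 \<and>
        (\<forall>\<nu>. weak_solution \<nu> \<and> \<nu> 0 = \<mu>\<^sub>0 \<longrightarrow> (\<forall>t\<ge>0. \<nu> t = painting_law \<mu>\<^sub>0 t)))"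
proof -
  interpret painting \<mu>\<^sub>0 by (rule painting.intro) (rule assms)+
  have self: "\<nu> t = painting_law \<mu>\<^sub>0 t" if "mild \<mu>\<^sub>0 \<nu> \<nu>" "0 \<le> t" for \<nu> t
    using that(1) mild_painting_law that(2) by (rule mild_unique)
  have strong: "\<exists>X. strong_solution M X\<^sub>0 N X \<and>
      (\<forall>Y. strong_solution M X\<^sub>0 N Y \<longrightarrow> indistinguishable M X Y) \<and>
      (\<forall>t\<ge>0. distr M borel (X t) = painting_law \<mu>\<^sub>0 t)"
    if data: "driving_data \<mu>\<^sub>0 M X\<^sub>0 N" for M :: "'a measure" and X\<^sub>0 N
  proof -
    interpret D: driven \<mu>\<^sub>0 M X\<^sub>0 N by (rule driven.intro) (rule data)
    note k = half_line_kernel_painting_law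
    define X where "X = D.solution (painting_law \<mu>\<^sub>0)"
    have "mild \<mu>\<^sub>0 (\<lambda>t. distr M borel (X t)) (painting_law \<mu>\<^sub>0)"
      unfolding X_def
    proof (rule D.law_mild[OF k assms(2)])
      show "D.solution (painting_law \<mu>\<^sub>0) t \<in> borel_measurable (driving_filtration M X\<^sub>0 N t)" if "0 \<le> t" for t
        by (rule D.solution_adapted[OF k that])
      show "AE x in painting_law \<mu>\<^sub>0 s. 0 \<le> x" if "0 \<le> s" for s by (rule AE_nonneg_painting_law[OF that])
    qed simp
    then have law: "distr M borel (X t) = painting_law \<mu>\<^sub>0 t" if "0 \<le> t" for t
      using mild_painting_law that
    proof (rule mild_unique)
      \<comment> \<open>Here both equations have the painting law as jump law, so the distance
        between the jump laws is 0 and only \<open>0 \<le> K\<close> is at stake.\<close>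
      fix s K a assume "\<And>b. \<bar>cdf (distr M borel (X s)) b - cdf (painting_law \<mu>\<^sub>0 s) b\<bar> \<le> (K :: real)"
      then have "0 \<le> K" by (rule order_trans[OF abs_ge_zero])
      then show "\<bar>cdf (painting_law \<mu>\<^sub>0 s) a - cdf (painting_law \<mu>\<^sub>0 s) a\<bar> \<le> K" by simp
    qed
    have "strong_solution M X\<^sub>0 N X"
      using law unfolding X_def by (rule D.strong_solution_solution[OF assms(2) k])
    moreover have "indistinguishable M X Y" if Y: "strong_solution M X\<^sub>0 N Y" for Y
    proof -
      define \<nu> where "\<nu> t = distr M borel (Y t)" for t
      note Y' = D.strong_solution_self[OF assms(2) Y, folded \<nu>_def]
      have ad: "Y t \<in> borel_measurable (driving_filtration M X\<^sub>0 N t)" if "0 \<le> t" for t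
        using Y that by (simp add: strong_solution_def)
      have "mild \<mu>\<^sub>0 \<nu> \<nu>"
        using D.law_mild[OF Y'(1) assms(2) ad Y'(2)]
          D.AE_process_nonneg[OF Y'(1) assms(2) ad Y'(2)] unfolding \<nu>_def by simp
      \<comment> \<open>The laws of \<open>Y\<close> are now known to be the painting laws, so
        \<open>Y\<close> and \<open>X\<close> are reflected paths with the same jumps.\<close>
      then have sol: "D.solution \<nu> = X"
        unfolding X_def by (intro D.solution_cong self)
      show ?thesis
        using Y'(2) unfolding indistinguishable_def sol by eventually_elim simp
    qed
    ultimately show ?thesis using law by (intro exI[of _ X]) simp
  qed
  have weak: "\<nu> t = painting_law \<mu>\<^sub>0 t" if "weak_solution \<nu> \<and> \<nu> 0 = \<mu>\<^sub>0" "0 \<le> t" for \<nu> t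
    using weak_solution_mild[OF conjunct1[OF that(1)]] that(2) unfolding conjunct2[OF that(1)] by (rule self)
  have zero: "painting_law \<mu>\<^sub>0 0 = \<mu>\<^sub>0" by (simp add: painting_law_def)
  show ?thesis
    by (intro conjI allI impI) (erule strong, rule weak_solution_painting_law, rule zero, erule (1) weak)
qed

end
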